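(* The function $\zeta_{\mathfrak{so}(5)}$ extends to a meromorphic function on $\mathbb C$ and is holomorphic at every point of $\mathbb N_0$. For $K\in\mathbb N$ and $0<\varepsilon<1$, on the half-plane $\{s:\mathrm{Re}(s)>\frac{1-K+\varepsilon}{3}\}$ one has \begin{multline*} \zeta_{\mathfrak{so}(5)}(s)=\frac{6^s}{\Gamma(s)}\sum_{k=0}^{K-1}\frac{(-1)^k\Gamma(s+k)}{k!}\zeta_{\mathrm{MT},2}(s,s-k,2s+k)\\ +\frac{6^s}{2\pi i\,\Gamma(s)}\int_{K-\varepsilon-i\infty}^{K-\varepsilon+i\infty}\Gamma(s+z)\Gamma(-z)\zeta_{\mathrm{MT},2}(s,s-z,2s+z)\,dz. \end{multline*} All poles of $\zeta_{\mathfrak{so}(5)}$ are simple and contained in $\{\frac12,\frac13,-\frac13,-\frac23,-\frac43,-\frac53,\dots\}=\{\frac12\}\cup\left((\frac13-\frac13\mathbb N_0)\setminus\mathbb Z\right)$. Furthermore, for all real $\sigma_0\le\sigma_1$ there is a polynomial $P_{\sigma_0,\sigma_1}$ such that $|\zeta_{\mathfrak{so}(5)}(s)|\le P_{\sigma_0,\sigma_1}(|\mathrm{Im}(s)|)$ for $\sigma_0\le\mathrm{Re}(s)\le\sigma_1$ as $|\mathrm{Im}(s)|\to\infty$.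
   Context: $\zeta_{\mathfrak{so}(5)}(s):=6^s\sum_{m,n\ge1}m^{-s}n^{-s}(m+n)^{-s}(m+2n)^{-s}$ for $\mathrm{Re}(s)$ large. The Mordell–Tornheim zeta function is $\zeta_{\mathrm{MT},2}(s_1,s_2,s_3):=\sum_{m,n\ge1}m^{-s_1}n^{-s_2}(m+n)^{-s_3}$ (where convergent); it is known to extend meromorphically to $\mathbb C^3$ with singularities contained in the hyperplanes $s_1+s_3=1-\ell$, $s_2+s_3=1-\ell$ ($\ell\in\mathbb N_0$), and $s_1+s_2+s_3=2$; $\zeta_{\mathrm{MT},2}$ denotes this continuation. *)

theory Defs
  imports "HOL-Complex_Analysis.Complex_Analysis"
begin

definition so5_term :: "complex \<Rightarrow> nat \<times> nat \<Rightarrow> complex" where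
  "so5_term s = (\<lambda>(m, n). of_nat m powr (-s) * of_nat n powr (-s) *
     of_nat (m + n) powr (-s) * of_nat (m + 2 * n) powr (-s))"

definition so5_series :: "complex \<Rightarrow> complex" where
  "so5_series s = 6 powr s * (\<Sum>\<^sub>\<infinity>p\<in>{1..} \<times> {1..}. so5_term s p)"

definition mt_term :: "complex \<Rightarrow> complex \<Rightarrow> complex \<Rightarrow> nat \<times> nat \<Rightarrow> complex" where
  "mt_term s1 s2 s3 = (\<lambda>(m, n). of_nat m powr (-s1) * of_nat n powr (-s2) *
     of_nat (m + n) powr (-s3))"

definition mt_singular_set :: "(complex \<times> complex \<times> complex) set" where
  "mt_singular_set = {(s1, s2, s3).
     (\<exists>l::nat. s1 + s3 = 1 - of_nat l) \<or> (\<exists>l::nat. s2 + s3 = 1 - of_nat l) \<or> s1 + s2 + s3 = 2}"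

(* Holomorphy in three complex variables on an open set: Frechet differentiability with a
   complex-linear derivative. *)
definition holomorphic3_on ::
  "(complex \<times> complex \<times> complex \<Rightarrow> complex) \<Rightarrow> (complex \<times> complex \<times> complex) set \<Rightarrow> bool" where
  "holomorphic3_on F U \<longleftrightarrow>
     (\<forall>p\<in>U. \<exists>a b c. (F has_derivative (\<lambda>(h1, h2, h3). a * h1 + b * h2 + c * h3)) (at p))"

(* Convergence of the double series is unconditional (equivalently absolute) convergence. *)
definition mt_continuation :: "(complex \<times> complex \<times> complex \<Rightarrow> complex) \<Rightarrow> bool" where
  "mt_continuation F \<longleftrightarrow>
     holomorphic3_on F (- mt_singular_set) \<and>
     (\<forall>s1 s2 s3. mt_term s1 s2 s3 summable_on {1..} \<times> {1..} \<longrightarrow>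
        F (s1, s2, s3) = (\<Sum>\<^sub>\<infinity>p\<in>{1..} \<times> {1..}. mt_term s1 s2 s3 p))"

(* The meromorphic continuation of the Mordell-Tornheim zeta function to C^3, whose
   singularities lie in mt_singular_set.  That set is a locally finite union of complex
   hyperplanes, so its complement is open and connected; by the identity theorem any function
   satisfying mt_continuation coincides there with the meromorphic continuation, and the choice
   is immaterial.  Values on the singular set carry no meaning and must not be relied upon. *)
definition mt_zeta :: "complex \<Rightarrow> complex \<Rightarrow> complex \<Rightarrow> complex" where
  "mt_zeta s1 s2 s3 = (SOME F. mt_continuation F) (s1, s2, s3)"

(* The integral of f along the upward vertical line Re z = c, where dz = i dt. *)
definition vertical_line_integral :: "real \<Rightarrow> (complex \<Rightarrow> complex) \<Rightarrow> complex" where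
  "vertical_line_integral c f = \<i> * (LINT t|lborel. f (Complex c t))"

definition vertical_line_integrable :: "real \<Rightarrow> (complex \<Rightarrow> complex) \<Rightarrow> bool" where
  "vertical_line_integrable c f \<longleftrightarrow> integrable lborel (\<lambda>t. f (Complex c t))"

(* The set 1/3 - (1/3) N_0. *)
definition third_points :: "complex set" where
  "third_points = {(1 - of_nat l) / 3 | l::nat. True}"

end

theory Submission
  imports Defs
begin

text \<open>The Mellin--Barnes formula, which writes \<open>(1 + x) powr (- s)\<close> as the integral of the kernel
  \<open>Beta (s + z) (- z) * x powr z\<close> over a vertical line, separates sums: with \<open>x = n / m\<close> it turns the
  Mordell--Tornheim series into an integral of products of Riemann zeta values, and with
  \<open>x = n / (m + n)\<close> it turns the so(5) series into an integral of Mordell--Tornheim values at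
  \<open>(s, s - z, 2 s + z)\<close>. Moving the line to the right past the poles of \<open>Gamma (- z)\<close> produces the
  finite sums and continues both functions. All integrals converge because
  \<open>norm (Beta a b) \<le> Beta (Re a) (Re b)\<close> and the recursion of Beta make the kernel decay faster than
  any power of \<open>Im z\<close>, at the cost of a power of \<open>1 + norm s\<close>, while the zeta functions grow polynomially.

  The formulas obtained for different lines agree by the identity theorem, which for the
  Mordell--Tornheim function is applied along complex lines in the direction of \<open>s3\<close>.
  At an exceptional point \<open>p\<close> every term of the so(5) formula, including the integrand for each fixed
  \<open>z\<close>, has at most a simple pole; the maximum principle on a small circle carries the polynomial
  bounds of \<open>(s - p) * mt_zeta s (s - z) (2 * s + z)\<close> over to \<open>s = p\<close>, so that the integral has at most a simple
  pole as well. At an integer \<open>p \<le> 0\<close> the factor \<open>1 / Gamma p = 0\<close> cancels it.\<close>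

section \<open>Integrals and holomorphic functions with parameters\<close>

text \<open>Three restrictions shape the development. The kernel is normalised as
  \<open>Beta (s + z) (- z)\<close>, that is \<open>Gamma (s + z) * Gamma (- z) / Gamma s\<close>:
  it can be bounded without Stirling's formula, and it makes sense where \<open>Gamma s\<close> has
  a pole, as the cancellation at nonpositive integers requires. The Barnes integral of the
  Mordell--Tornheim function is moved to the right only for \<open>Re s2 < 1\<close>, where the pole
  of \<open>zeta1 (s2 - z)\<close> stays apart from those of \<open>Gamma (- z)\<close>. For so(5)
  one has \<open>s2 = s - z\<close> with \<open>Re z \<ge> 0\<close>, so this suffices for
  \<open>Re s < 1\<close>; the recurring cap \<open>9/10\<close> is a convenient number between
  \<open>1/2\<close>, right of which the series converges, and \<open>1\<close>. A continuation to
  all of C^3 is nevertheless built, because \<open>mt_zeta\<close> is an unspecified choice and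
  nothing is known about it until some function satisfying \<open>mt_continuation\<close> exists.
  Since values of \<open>mt_zeta\<close> on the singular set carry no information, residues are
  always taken as limits from nonsingular points.\<close>

definition decay :: "real \<Rightarrow> real" where
  "decay t = 1 / (1 + \<bar>t\<bar>) ^ 2"

lemma decay_nonneg [simp]: "decay t \<ge> 0"
  by (simp add: decay_def)

lemma decay_measurable [measurable]: "decay \<in> borel_measurable borel"
  unfolding decay_def by measurable

lemma integrable_decay: "integrable lborel decay"
proof -
  have "(\<integral>\<^sup>+t. ennreal (1 / (1 + t) ^ 2) * indicator {0..} t \<partial>lborel) = ennreal (0 - (- 1 / (1 + 0)))"
  proof (rule nn_integral_FTC_atLeast)
    show "(\<lambda>t::real. 1 / (1 + t)\<^sup>2) \<in> borel_measurable borel" by measurable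
    show "DERIV (\<lambda>t::real. - 1 / (1 + t)) x :> 1 / (1 + x)\<^sup>2" if "0 \<le> x" for x
      using that by (auto intro!: derivative_eq_intros simp: power2_eq_square divide_simps)
    show "0 \<le> 1 / (1 + x)\<^sup>2" for x :: real by simp
    show "((\<lambda>t::real. - 1 / (1 + t)) \<longlongrightarrow> 0) at_top"
      by real_asymp
  qed
  also have "(\<integral>\<^sup>+t. ennreal (1 / (1 + t) ^ 2) * indicator {0..} t \<partial>lborel)
      = (\<integral>\<^sup>+t. ennreal (decay t) * indicator {0..} t \<partial>lborel)"
    by (intro nn_integral_cong) (auto simp: decay_def indicator_def)
  finally have 1: "(\<integral>\<^sup>+t. ennreal (decay t) * indicator {0..} t \<partial>lborel) = 1" by simp
  have "(\<integral>\<^sup>+t. ennreal (decay t) * indicator {..0} t \<partial>lborel)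
      = (\<integral>\<^sup>+t. ennreal (decay t) * indicator {0..} t \<partial>lborel)"
    by (subst nn_integral_real_affine[where c="-1" and t=0]) (auto simp: decay_def indicator_def cong: if_cong)
  with 1 have 2: "(\<integral>\<^sup>+t. ennreal (decay t) * indicator {..0} t \<partial>lborel) = 1" by simp
  have "(\<integral>\<^sup>+t. ennreal (decay t) \<partial>lborel) \<le>
     (\<integral>\<^sup>+t. ennreal (decay t) * indicator {0..} t + ennreal (decay t) * indicator {..0} t \<partial>lborel)"
    by (intro nn_integral_mono) (auto simp: indicator_def)
  also have "\<dots> = 1 + 1"
    by (subst nn_integral_add) (simp_all add: 1 2)
  finally show ?thesis
    by (intro integrableI_bounded) (auto simp: less_top[symmetric] top_unique intro: le_less_trans)
qed

text \<open>Continuity bounds \<open>f\<close> on the compact segment up to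
  \<open>\<bar>T\<bar>\<close>; there \<open>decay\<close> is at least
  \<open>1 / (1 + \<bar>T\<bar>)\<^sup>2\<close>, so a single multiple of \<open>decay\<close>
  dominates everywhere.\<close>

lemma integrable_decay_bound:
  fixes f :: "real \<Rightarrow> complex"
  assumes "continuous_on UNIV f" and "\<And>t. \<bar>t\<bar> \<ge> T \<Longrightarrow> norm (f t) \<le> C * decay t"
  shows "integrable lborel f"
proof -
  have "compact (f ` {-\<bar>T\<bar>..\<bar>T\<bar>})"
    by (intro compact_continuous_image continuous_on_subset[OF assms(1)]) auto
  then obtain B where B: "\<And>t. t \<in> {-\<bar>T\<bar>..\<bar>T\<bar>} \<Longrightarrow> norm (f t) \<le> B"
    by (meson bounded_iff compact_imp_bounded imageI)
  have B0: "0 \<le> B" using order_trans[OF norm_ge_zero B[of 0]] by auto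
  have "norm (f t) \<le> norm ((\<bar>C\<bar> + B * (1 + \<bar>T\<bar>)\<^sup>2) * decay t)" for t
  proof (cases "\<bar>t\<bar> \<ge> T")
    case True
    have "norm (f t) \<le> C * decay t" by (rule assms(2)[OF True])
    also have "\<dots> \<le> (\<bar>C\<bar> + B * (1 + \<bar>T\<bar>)\<^sup>2) * decay t"
      using B0 by (intro mult_right_mono) (auto intro: add_increasing2)
    finally show ?thesis by simp
  next
    case False
    then have "t \<in> {-\<bar>T\<bar>..\<bar>T\<bar>}" and tT: "\<bar>t\<bar> \<le> \<bar>T\<bar>" by auto
    then have "norm (f t) \<le> B * 1" using B by auto
    also have "1 \<le> (1 + \<bar>T\<bar>)\<^sup>2 * decay t"
      using tT by (simp add: decay_def power_mono)
    then have "B * 1 \<le> B * ((1 + \<bar>T\<bar>)\<^sup>2 * decay t)" using B0 by (intro mult_left_mono)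
    also have "\<dots> \<le> (\<bar>C\<bar> + B * (1 + \<bar>T\<bar>)\<^sup>2) * decay t" by (simp add: algebra_simps)
    finally show ?thesis by simp
  qed
  then show ?thesis
    using assms(1)
    by (intro Bochner_Integration.integrable_bound[OF integrable_mult_right[OF integrable_decay,
            of "\<bar>C\<bar> + B * (1 + \<bar>T\<bar>)\<^sup>2"]])
       (auto simp: borel_measurable_continuous_onI)
qed

lemma integrable_const_decay: "integrable lborel (\<lambda>t. C * decay t)"
  by (intro integrable_mult_right integrable_decay)

lemma integrable_if_le_decay:
  fixes f :: "real \<Rightarrow> complex"
  assumes "f \<in> borel_measurable lborel" and "\<And>t. norm (f t) \<le> C * decay t"
  shows "integrable lborel f" and "norm (LINT t|lborel. f t) \<le> C * (LINT t|lborel. decay t)"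
proof -
  show i: "integrable lborel f"
    using assms order_trans[OF assms(2) abs_ge_self]
    by (intro Bochner_Integration.integrable_bound[OF integrable_const_decay[of C]]) auto
  have "norm (LINT t|lborel. f t) \<le> (LINT t|lborel. C * decay t)"
    by (rule Bochner_Integration.integral_norm_bound_integral[OF i integrable_const_decay]) (use assms in auto)
  then show "norm (LINT t|lborel. f t) \<le> C * (LINT t|lborel. decay t)" by simp
qed

text \<open>Only \<open>f\<close> itself is dominated. Cauchy's inequality on discs of radius
  \<open>r / 2\<close> bounds the derivative on \<open>cball s0 (r / 2)\<close> by
  \<open>2 * g t / r\<close>, so this function dominates the difference quotients and the limit
  passes under the integral along every sequence.\<close>

lemma field_differentiable_LINT:
  fixes f :: "complex \<Rightarrow> 'b \<Rightarrow> complex"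
  assumes r: "r > 0"
    and hol: "\<And>t. t \<in> space M \<Longrightarrow> (\<lambda>s. f s t) holomorphic_on (cball s0 r)"
    and meas: "\<And>s. s \<in> cball s0 r \<Longrightarrow> f s \<in> borel_measurable M"
    and bd: "\<And>s t. s \<in> cball s0 r \<Longrightarrow> t \<in> space M \<Longrightarrow> norm (f s t) \<le> g t"
    and g: "integrable M g"
  shows "(\<lambda>s. LINT t|M. f s t) field_differentiable (at s0)"
proof -
  define D where "D t = deriv (\<lambda>s. f s t) s0" for t
  have int: "integrable M (f s)" if "s \<in> cball s0 r" for s
    using meas[OF that] bd[OF that]
    by (intro Bochner_Integration.integrable_bound[OF g]) (auto intro!: AE_I2 intro: order_trans[OF _ abs_ge_self])
  have lip: "norm (f s t - f s0 t) \<le> (2 * g t / r) * norm (s - s0)"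
    if "s \<in> cball s0 (r / 2)" "t \<in> space M" for s t
  proof (rule field_differentiable_bound[where f' = "deriv (\<lambda>s. f s t)" and S = "cball s0 (r/2)"])
    fix z assume z: "z \<in> cball s0 (r / 2)"
    then have sub: "cball z (r / 2) \<subseteq> cball s0 r" and "z \<in> ball s0 r"
      using r by (auto simp: subset_iff dist_commute) (smt (verit) dist_triangle_half_l dist_commute dist_triangle2 field_sum_of_halves)+
    show "((\<lambda>s. f s t) has_field_derivative deriv (\<lambda>s. f s t) z) (at z within cball s0 (r / 2))"
      using holomorphic_derivI[OF holomorphic_on_subset[OF hol[OF that(2)], of "ball s0 r"] _ \<open>z \<in> ball s0 r\<close>]
      by (auto intro: has_field_derivative_at_within)
    have "norm ((deriv ^^ 1) (\<lambda>s. f s t) z) \<le> fact 1 * g t / (r / 2) ^ 1"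
    proof (rule Cauchy_inequality)
      show "(\<lambda>s. f s t) holomorphic_on ball z (r / 2)"
        using sub by (intro holomorphic_on_subset[OF hol[OF that(2)]]) auto
      show "continuous_on (cball z (r / 2)) (\<lambda>s. f s t)"
        using sub by (intro holomorphic_on_imp_continuous_on holomorphic_on_subset[OF hol[OF that(2)]]) auto
      show "norm (f x t) \<le> g t" if "norm (z - x) = r / 2" for x
        using sub that \<open>t \<in> space M\<close> by (intro bd) (auto simp: dist_norm subset_iff)
    qed (use r in auto)
    then show "norm (deriv (\<lambda>s. f s t) z) \<le> 2 * g t / r" by (simp add: mult.commute)
  qed (use that r in auto)
  have tend: "((\<lambda>s. (f s t - f s0 t) / (s - s0)) \<longlongrightarrow> D t) (at s0)" if "t \<in> space M" for t
    using holomorphic_derivI[OF holomorphic_on_subset[OF hol[OF that], of "ball s0 r"], of s0] r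
    unfolding D_def has_field_derivative_iff by auto
  have "((\<lambda>s. ((LINT t|M. f s t) - (LINT t|M. f s0 t)) / (s - s0)) \<longlongrightarrow> (LINT t|M. D t)) (at s0 within ball s0 (r/2))"
    unfolding tendsto_at_iff_sequentially
  proof (intro allI impI)
    fix X assume X: "\<forall>i. X i \<in> ball s0 (r / 2) - {s0}" "X \<longlonglongrightarrow> s0"
    define q where "q i t = (f (X i) t - f s0 t) / (X i - s0)" for i t
    have Xr: "X i \<in> cball s0 r" "X i \<in> cball s0 (r/2)" "X i \<noteq> s0" for i
      using X(1)[rule_format, of i] r by auto
    have lim: "(\<lambda>i. q i t) \<longlonglongrightarrow> D t" if "t \<in> space M" for t
    proof -
      have "filterlim X (at s0) sequentially"
        using X Xr by (auto simp: filterlim_at)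
      from filterlim_compose[OF tend[OF that] this] show ?thesis by (simp add: q_def)
    qed
    have qm: "q i \<in> borel_measurable M" for i
      unfolding q_def using meas[OF Xr(1)[of i]] meas[of s0] r by auto
    have "(\<lambda>i. LINT t|M. q i t) \<longlonglongrightarrow> (LINT t|M. D t)"
    proof (rule integral_dominated_convergence[where w = "\<lambda>t. 2 * g t / r"])
      show "D \<in> borel_measurable M"
        by (rule borel_measurable_LIMSEQ_metric[OF qm lim])
      show "integrable M (\<lambda>t. 2 * g t / r)" using g by auto
      show "AE t in M. norm (q i t) \<le> 2 * g t / r" for i
      proof (rule AE_I2)
        fix t assume "t \<in> space M"
        then have "norm (f (X i) t - f s0 t) \<le> (2 * g t / r) * norm (X i - s0)"
          by (intro lip Xr)
        then show "norm (q i t) \<le> 2 * g t / r"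
          using Xr(3)[of i] unfolding q_def norm_divide by (subst pos_divide_le_eq) auto
      qed
    qed (use lim qm in auto)
    moreover have "(LINT t|M. q i t) = ((LINT t|M. f (X i) t) - (LINT t|M. f s0 t)) / (X i - s0)" for i
      unfolding q_def using int[OF Xr(1)[of i]] int[of s0] r by (simp add: Bochner_Integration.integral_diff)
    ultimately show "((\<lambda>s. ((LINT t|M. f s t) - (LINT t|M. f s0 t)) / (s - s0)) \<circ> X) \<longlonglongrightarrow> (LINT t|M. D t)"
      by (simp add: o_def)
  qed
  then have "((\<lambda>s. ((LINT t|M. f s t) - (LINT t|M. f s0 t)) / (s - s0)) \<longlongrightarrow> (LINT t|M. D t)) (at s0)"
    using r by (subst (asm) at_within_open) auto
  then show ?thesis
    unfolding field_differentiable_def has_field_derivative_iff by blast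
qed

text \<open>The measure is arbitrary: Lebesgue measure serves the Barnes integrals, counting measure
  the Dirichlet series.\<close>

lemma holomorphic_on_LINT:
  fixes f :: "complex \<Rightarrow> 'b \<Rightarrow> complex"
  assumes "open U"
    and "\<And>t. t \<in> space M \<Longrightarrow> (\<lambda>s. f s t) holomorphic_on U"
    and "\<And>s. s \<in> U \<Longrightarrow> f s \<in> borel_measurable M"
    and "\<And>s0. s0 \<in> U \<Longrightarrow> \<exists>r>0. \<exists>g. integrable M g \<and> (\<forall>s\<in>cball s0 r \<inter> U. \<forall>t\<in>space M. norm (f s t) \<le> g t)"
  shows "(\<lambda>s. LINT t|M. f s t) holomorphic_on U"
proof -
  have "(\<lambda>s. LINT t|M. f s t) field_differentiable (at s0)" if s0: "s0 \<in> U" for s0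
  proof -
    obtain r g where r: "r > 0" "integrable M g" "\<forall>s\<in>cball s0 r \<inter> U. \<forall>t\<in>space M. norm (f s t) \<le> g t"
      using assms(4)[OF s0] by auto
    obtain r' where r': "r' > 0" "cball s0 r' \<subseteq> U" using assms(1) s0 open_contains_cball by blast
    have sub: "cball s0 (min r r') \<subseteq> U" "cball s0 (min r r') \<subseteq> cball s0 r" using r' by auto
    show ?thesis
      by (rule field_differentiable_LINT[of "min r r'" M f s0 g])
         (use r r' sub in \<open>auto intro!: assms(3) holomorphic_on_subset[OF assms(2)]\<close>)
  qed
  then show ?thesis
    by (auto simp: holomorphic_on_def intro: field_differentiable_at_within)
qed

lemma continuous_on_LINT:
  fixes f :: "'a::first_countable_topology \<Rightarrow> 'b \<Rightarrow> complex"
  assumes "\<And>t. t \<in> space M \<Longrightarrow> continuous_on U (\<lambda>s. f s t)"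
    and "\<And>s. s \<in> U \<Longrightarrow> f s \<in> borel_measurable M"
    and "\<And>s t. s \<in> U \<Longrightarrow> t \<in> space M \<Longrightarrow> norm (f s t) \<le> g t"
    and "integrable M g"
  shows "continuous_on U (\<lambda>s. LINT t|M. f s t)"
  unfolding continuous_on_def tendsto_at_iff_sequentially
proof (intro ballI allI impI)
  fix s X assume s: "s \<in> U" and X: "\<forall>i. X i \<in> U - {s}" "X \<longlonglongrightarrow> s"
  have "(\<lambda>i. LINT t|M. f (X i) t) \<longlonglongrightarrow> (LINT t|M. f s t)"
  proof (rule integral_dominated_convergence[where w = g])
    show "AE t in M. (\<lambda>i. f (X i) t) \<longlonglongrightarrow> f s t"
    proof (rule AE_I2)
      fix t assume "t \<in> space M"
      then have "((\<lambda>s. f s t) \<longlongrightarrow> f s t) (at s within U)"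
        using assms(1) s by (auto simp: continuous_on_def)
      then show "(\<lambda>i. f (X i) t) \<longlonglongrightarrow> f s t"
        using X unfolding tendsto_at_iff_sequentially by (auto simp: o_def)
    qed
  qed (use X s assms in auto)
  then show "((\<lambda>s. LINT t|M. f s t) \<circ> X) \<longlonglongrightarrow> (LINT t|M. f s t)" by (simp add: o_def)
qed

text \<open>The majorant splits as \<open>a p * g t\<close>, so summability over \<open>p\<close>
  and integrability over \<open>t\<close> are checked separately. An enumeration of \<open>A\<close>
  reduces the exchange to a series of integrable functions.\<close>

lemma has_sum_LINT:
  fixes f :: "'i \<Rightarrow> 'b \<Rightarrow> complex"
  assumes A: "countable A" "infinite A"
    and a: "a summable_on A"
    and g: "integrable M g"
    and meas: "\<And>p. p \<in> A \<Longrightarrow> f p \<in> borel_measurable M"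
    and bd: "\<And>p t. p \<in> A \<Longrightarrow> t \<in> space M \<Longrightarrow> norm (f p t) \<le> a p * g t"
  shows "integrable M (\<lambda>t. \<Sum>\<^sub>\<infinity>p\<in>A. f p t)"
    and "((\<lambda>p. LINT t|M. f p t) has_sum (LINT t|M. (\<Sum>\<^sub>\<infinity>p\<in>A. f p t))) A"
proof -
  define e where "e = from_nat_into A"
  have e: "bij_betw e UNIV A" unfolding e_def using A by (rule bij_betw_from_nat_into)
  have eA: "e n \<in> A" for n using e by (auto simp: bij_betw_def)
  define a' where "a' n = a (e n)" for n
  have "a' summable_on UNIV"
    unfolding a'_def using a summable_on_reindex_bij_betw[OF e, of a] by simp
  then have a': "summable (\<lambda>n. norm (a' n))"
    using summable_on_imp_summable summable_on_iff_abs_summable_on_real by blast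
  have bd': "norm (f (e n) t) \<le> norm (a' n) * norm (g t)" if "t \<in> space M" for n t
    using order_trans[OF bd[OF eA that] abs_ge_self] by (simp add: a'_def abs_mult)
  have int: "integrable M (f (e n))" for n
    using g bd' by (intro Bochner_Integration.integrable_bound[OF _ meas[OF eA], of "\<lambda>t. norm (a' n) * norm (g t)"]) auto
  have sm: "summable (\<lambda>n. norm (f (e n) t))" if "t \<in> space M" for t
    by (rule summable_comparison_test'[OF summable_mult2[OF a', of "norm (g t)"], of 0]) (use bd' that in auto)
  have sm2: "summable (\<lambda>n. LINT t|M. norm (f (e n) t))"
  proof (rule summable_comparison_test'[OF summable_mult2[OF a', of "LINT t|M. norm (g t)"], of 0])
    fix n
    have "(LINT t|M. norm (f (e n) t)) \<le> (LINT t|M. norm (a' n) * norm (g t))"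
      using int g bd' by (intro integral_mono) auto
    then show "norm (LINT t|M. norm (f (e n) t)) \<le> norm (a' n) * (LINT t|M. norm (g t))"
      by simp
  qed
  have eq: "(\<Sum>\<^sub>\<infinity>p\<in>A. f p t) = (\<Sum>n. f (e n) t)" if "t \<in> space M" for t
  proof -
    have "((\<lambda>n. f (e n) t) has_sum (\<Sum>n. f (e n) t)) UNIV"
      using norm_summable_imp_has_sum[OF sm[OF that]] summable_norm_cancel[OF sm[OF that]] summable_sums by blast
    then have "((\<lambda>p. f p t) has_sum (\<Sum>n. f (e n) t)) A"
      using has_sum_reindex_bij_betw[OF e, of "\<lambda>p. f p t"] by simp
    then show ?thesis by (rule infsumI)
  qed
  have AEs: "AE t in M. summable (\<lambda>n. norm (f (e n) t))" using sm by auto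
  have "integrable M (\<lambda>t. \<Sum>n. f (e n) t)"
    by (rule integrable_suminf[OF int AEs sm2])
  then show "integrable M (\<lambda>t. \<Sum>\<^sub>\<infinity>p\<in>A. f p t)"
    using eq by (simp cong: Bochner_Integration.integrable_cong)
  have "(\<lambda>n. LINT t|M. f (e n) t) sums (LINT t|M. (\<Sum>n. f (e n) t))"
    by (rule sums_integral[OF int AEs sm2])
  moreover have "summable (\<lambda>n. norm (LINT t|M. f (e n) t))"
    by (rule summable_comparison_test'[OF sm2, of 0]) (auto intro: integral_norm_bound)
  ultimately have "((\<lambda>n. LINT t|M. f (e n) t) has_sum (LINT t|M. (\<Sum>n. f (e n) t))) UNIV"
    by (intro norm_summable_imp_has_sum)
  then show "((\<lambda>p. LINT t|M. f p t) has_sum (LINT t|M. (\<Sum>\<^sub>\<infinity>p\<in>A. f p t))) A"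
    using has_sum_reindex_bij_betw[OF e, of "\<lambda>p. LINT t|M. f p t"] eq
    by (simp cong: Bochner_Integration.integral_cong)
qed

section \<open>Holomorphic functions of three variables\<close>

lemma holomorphic3_onD_line:
  assumes F: "holomorphic3_on F U" and "(a1 + w * b1, a2 + w * b2, a3 + w * b3) \<in> U"
  shows "(\<lambda>w. F (a1 + w * b1, a2 + w * b2, a3 + w * b3)) field_differentiable (at w)"
proof -
  obtain a b c where "(F has_derivative (\<lambda>(h1, h2, h3). a * h1 + b * h2 + c * h3)) (at (a1 + w * b1, a2 + w * b2, a3 + w * b3))"
    using assms unfolding holomorphic3_on_def by blast
  then have "((\<lambda>w. F (a1 + w * b1, a2 + w * b2, a3 + w * b3)) has_derivative
     (\<lambda>h. (case (h * b1, h * b2, h * b3) of (h1, h2, h3) \<Rightarrow> a * h1 + b * h2 + c * h3))) (at w)"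
    by (rule has_derivative_compose[rotated]) (auto intro!: derivative_eq_intros)
  moreover have "(\<lambda>h. (case (h * b1, h * b2, h * b3) of (h1, h2, h3) \<Rightarrow> a * h1 + b * h2 + c * h3)) = (*) (a * b1 + b * b2 + c * b3)"
    by (auto simp: fun_eq_iff algebra_simps)
  ultimately show ?thesis
    unfolding field_differentiable_def has_field_derivative_def by metis
qed


text \<open>The bound is assumed on twice the radius, so that every point of
  \<open>cball x r\<close> is the centre of a disc of radius \<open>r\<close> on which
  \<open>B\<close> applies. The resulting constants depend on \<open>B\<close> and \<open>r\<close>
  alone, hence stay uniform while the other two variables move.\<close>

lemma holomorphic_bound_Taylor1:
  fixes \<phi> :: "complex \<Rightarrow> complex"
  assumes r: "r > 0" and hol: "\<phi> holomorphic_on (cball x (2 * r))"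
    and B: "\<And>z. z \<in> cball x (2 * r) \<Longrightarrow> norm (\<phi> z) \<le> B"
    and h: "norm h \<le> r"
  shows "norm (deriv \<phi> x) \<le> B / r"
    and "norm (\<phi> (x + h) - \<phi> x) \<le> B / r * norm h"
    and "norm (\<phi> (x + h) - \<phi> x - deriv \<phi> x * h) \<le> 2 * B / r\<^sup>2 * (norm h)\<^sup>2"
proof -
  have D: "norm ((deriv ^^ n) \<phi> z) \<le> fact n * B / r ^ n" if z: "z \<in> cball x r" for z n
  proof (rule Cauchy_inequality)
    have sub: "cball z r \<subseteq> cball x (2 * r)"
      using z by (auto simp: subset_iff) (smt (verit) dist_triangle)
    show "\<phi> holomorphic_on ball z r" using sub by (intro holomorphic_on_subset[OF hol]) auto
    show "continuous_on (cball z r) \<phi>"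
      using sub by (intro holomorphic_on_imp_continuous_on holomorphic_on_subset[OF hol]) auto
    show "norm (\<phi> w) \<le> B" if "norm (z - w) = r" for w
      using sub that by (intro B) (auto simp: dist_norm subset_iff)
  qed (use r in auto)
  have hol': "\<phi> holomorphic_on ball x (2 * r)" by (rule holomorphic_on_subset[OF hol]) auto
  have der: "((deriv ^^ n) \<phi> has_field_derivative (deriv ^^ Suc n) \<phi> z) (at z within cball x r)"
    if "z \<in> cball x r" for z n
  proof -
    have z: "z \<in> ball x (2 * r)" using that r by (auto simp: dist_norm intro: le_less_trans)
    have "(deriv ^^ n) \<phi> holomorphic_on ball x (2 * r)"
      by (intro holomorphic_higher_deriv hol') auto
    then show ?thesis using holomorphic_derivI[OF _ open_ball z] by (auto intro: has_field_derivative_at_within)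
  qed
  show "norm (deriv \<phi> x) \<le> B / r" using D[of x 1] r by auto
  have xh: "x + h \<in> cball x r" "x \<in> cball x r" using h r by (auto simp: dist_norm)
  show "norm (\<phi> (x + h) - \<phi> x) \<le> B / r * norm h"
    using field_differentiable_bound[of "cball x r" \<phi> "deriv \<phi>" "B / r" "x + h" x]
      der[of _ 0] D[of _ 1] xh by (auto simp: algebra_simps)
  have "norm ((deriv ^^ 0) \<phi> (x + h) - (\<Sum>i\<le>1. (deriv ^^ i) \<phi> x * ((x + h) - x) ^ i / fact i))
        \<le> (2 * B / r\<^sup>2) * norm ((x + h) - x) ^ Suc 1 / fact 1"
  proof (rule complex_Taylor[of "cball x r" 1 "\<lambda>i. (deriv ^^ i) \<phi>"])
    show "norm ((deriv ^^ Suc 1) \<phi> z) \<le> 2 * B / r\<^sup>2" if "z \<in> cball x r" for z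
      using D[OF that, of 2] by (simp add: numeral_2_eq_2)
    show "((deriv ^^ i) \<phi> has_field_derivative (deriv ^^ Suc i) \<phi> z) (at z within cball x r)"
      if "z \<in> cball x r" for i z by (rule der[OF that])
  qed (use xh in auto)
  then show "norm (\<phi> (x + h) - \<phi> x - deriv \<phi> x * h) \<le> 2 * B / r\<^sup>2 * (norm h)\<^sup>2"
    by (simp add: algebra_simps power2_eq_square)
qed

lemma bounded_linear_complex3:
  "bounded_linear (\<lambda>(h1, h2, h3). a * h1 + b * h2 + c * h3 :: complex)"
proof -
  have "bounded_linear (\<lambda>h. a * fst h + b * fst (snd h) + c * snd (snd h) :: complex)"
    by (intro bounded_linear_add bounded_linear_const_mult bounded_linear_fst
        bounded_linear_compose[OF bounded_linear_fst bounded_linear_snd]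
        bounded_linear_compose[OF bounded_linear_snd bounded_linear_snd])
  then show ?thesis by (simp add: case_prod_unfold)
qed

text \<open>A locally bounded, separately holomorphic function is Frechet differentiable: the mixed
  increments are of second order by Cauchy's estimates.\<close>

lemma holomorphic3_on_separately:
  assumes U: "open U"
    and s1: "\<And>a b c. (a, b, c) \<in> U \<Longrightarrow> (\<lambda>w. F (w, b, c)) field_differentiable (at a)"
    and s2: "\<And>a b c. (a, b, c) \<in> U \<Longrightarrow> (\<lambda>w. F (a, w, c)) field_differentiable (at b)"
    and s3: "\<And>a b c. (a, b, c) \<in> U \<Longrightarrow> (\<lambda>w. F (a, b, w)) field_differentiable (at c)"
    and bd: "\<And>p. p \<in> U \<Longrightarrow> \<exists>r>0. \<exists>B. \<forall>q\<in>ball p r \<inter> U. norm (F q) \<le> B"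
  shows "holomorphic3_on F U"
  unfolding holomorphic3_on_def
proof
  fix p assume p: "p \<in> U"
  obtain a b c where abc: "p = (a, b, c)" by (cases p) auto
  obtain r0 B where r0: "r0 > 0" "\<forall>q\<in>ball p r0 \<inter> U. norm (F q) \<le> B" using bd[OF p] by auto
  obtain r1 where r1: "r1 > 0" "ball p r1 \<subseteq> U" using U p open_contains_ball by blast
  \<comment> \<open>Each coordinate moves by at most \<open>2 * r\<close>; three such moves add up
    to \<open>6 * r\<close>, below \<open>min r0 r1\<close>.\<close>
  define r where "r = min r0 r1 / 8"
  have r: "r > 0" using r0 r1 by (auto simp: r_def)
  have near: "(x, y, z) \<in> U \<and> norm (F (x, y, z)) \<le> B"
    if "x \<in> cball a (2 * r)" "y \<in> cball b (2 * r)" "z \<in> cball c (2 * r)" for x y z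
  proof -
    have "dist p (x, y, z) \<le> dist a x + (dist b y + dist c z)"
      unfolding abc dist_Pair_Pair
      by (intro order_trans[OF sqrt_sum_squares_le_sum] add_left_mono) auto
    also have "\<dots> \<le> 6 * r" using that by auto
    also have "\<dots> < min r0 r1" using r by (auto simp: r_def)
    finally show ?thesis using r0 r1 by auto
  qed
  have B0: "B \<ge> 0" proof -
    have "norm (F (a, b, c)) \<le> B" using near[of a b c] r by auto
    then show ?thesis using norm_ge_zero order_trans by blast
  qed
  define D1 where "D1 y z = deriv (\<lambda>w. F (w, y, z)) a" for y z
  define D2 where "D2 z = deriv (\<lambda>w. F (a, w, z)) b" for z
  define D3 where "D3 = deriv (\<lambda>w. F (a, b, w)) c"
  let ?L = "\<lambda>(h1, h2, h3). D1 b c * h1 + D2 c * h2 + D3 * h3"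
  \<comment> \<open>The sum of the coefficients of the five second-order terms at the end: three
    Taylor remainders with \<open>2\<close> each and the mixed terms with \<open>2\<close> and
    \<open>1\<close>.\<close>
  define K where "K = 9 * B / r\<^sup>2"
  have K0: "K \<ge> 0" using B0 by (simp add: K_def)
  have h1: "(\<lambda>w. F (w, y, z)) holomorphic_on cball a (2 * r)"
    if "y \<in> cball b (2 * r)" "z \<in> cball c (2 * r)" for y z
    unfolding holomorphic_on_def
    by (rule ballI, rule field_differentiable_at_within, rule s1) (rule near[THEN conjunct1]; use that in simp)
  have h2: "(\<lambda>w. F (x, w, z)) holomorphic_on cball b (2 * r)"
    if "x \<in> cball a (2 * r)" "z \<in> cball c (2 * r)" for x z
    unfolding holomorphic_on_def
    by (rule ballI, rule field_differentiable_at_within, rule s2) (rule near[THEN conjunct1]; use that in simp)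
  have h3: "(\<lambda>w. F (x, y, w)) holomorphic_on cball c (2 * r)"
    if "x \<in> cball a (2 * r)" "y \<in> cball b (2 * r)" for x y
    unfolding holomorphic_on_def
    by (rule ballI, rule field_differentiable_at_within, rule s3) (rule near[THEN conjunct1]; use that in simp)
  have main: "norm (F (p + h) - F p - ?L h) \<le> K * (norm h)\<^sup>2" if h: "norm h \<le> r" for h
  proof -
    obtain x y z where hh: "h = (x, y, z)" by (cases h) auto
    have n: "norm x \<le> norm h" "norm y \<le> norm h" "norm z \<le> norm h"
      using norm_fst_le[of x "(y, z)"] norm_snd_le[of "(y, z)" x] norm_fst_le[of y z] norm_snd_le[of z y]
      unfolding hh by linarith+
    have nr: "norm x \<le> r" "norm y \<le> r" "norm z \<le> r" using n h by linarith+
    have mem: "a \<in> cball a (2*r)" "b \<in> cball b (2*r)" "c \<in> cball c (2*r)"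
      "b + y \<in> cball b (2*r)" "c + z \<in> cball c (2*r)"
      using nr r by (auto simp: dist_norm)
    have e1: "norm (F (a + x, b + y, c + z) - F (a, b + y, c + z) - D1 (b + y) (c + z) * x)
        \<le> 2 * B / r\<^sup>2 * (norm x)\<^sup>2"
      unfolding D1_def by (rule holomorphic_bound_Taylor1(3)[OF r h1]) (use near mem nr in auto)
    have e2: "norm (F (a, b + y, c + z) - F (a, b, c + z) - D2 (c + z) * y)
        \<le> 2 * B / r\<^sup>2 * (norm y)\<^sup>2"
      unfolding D2_def by (rule holomorphic_bound_Taylor1(3)[OF r h2]) (use near mem nr in auto)
    have e3: "norm (F (a, b, c + z) - F (a, b, c) - D3 * z) \<le> 2 * B / r\<^sup>2 * (norm z)\<^sup>2"
      unfolding D3_def by (rule holomorphic_bound_Taylor1(3)[OF r h3]) (use near mem nr in auto)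
    have f: "norm (F (w, b + y, c + z) - F (w, b, c)) \<le> B / r * norm y + B / r * norm z"
      if "w \<in> cball a (2 * r)" for w
    proof -
      have "norm (F (w, b + y, c + z) - F (w, b, c + z)) \<le> B / r * norm y"
        by (rule holomorphic_bound_Taylor1(2)[OF r h2]) (use near mem nr that in auto)
      moreover have "norm (F (w, b, c + z) - F (w, b, c)) \<le> B / r * norm z"
        by (rule holomorphic_bound_Taylor1(2)[OF r h3]) (use near mem nr that in auto)
      ultimately show ?thesis
        using norm_triangle_ineq[of "F (w, b + y, c + z) - F (w, b, c + z)" "F (w, b, c + z) - F (w, b, c)"] by simp
    qed
    \<comment> \<open>The difference of the two sections is of first order in \<open>y\<close> and
      \<open>z\<close> on a whole disc of the first variable, and Cauchy's estimate passes this on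
      to its derivative.\<close>
    have "norm (deriv (\<lambda>w. F (w, b + y, c + z) - F (w, b, c)) a) \<le> (B / r * norm y + B / r * norm z) / r"
      by (rule holomorphic_bound_Taylor1(1)[OF r, where h = 0])
         (use f mem r in \<open>auto intro!: holomorphic_intros h1\<close>)
    also have "deriv (\<lambda>w. F (w, b + y, c + z) - F (w, b, c)) a = D1 (b + y) (c + z) - D1 b c"
      unfolding D1_def by (rule deriv_diff) (use s1 near mem in auto)
    finally have e4: "norm (D1 (b + y) (c + z) - D1 b c) \<le> (B / r * norm y + B / r * norm z) / r" .
    have f: "norm (F (a, w, c + z) - F (a, w, c)) \<le> B / r * norm z" if "w \<in> cball b (2 * r)" for w
      by (rule holomorphic_bound_Taylor1(2)[OF r h3]) (use near mem nr that in auto)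
    have "norm (deriv (\<lambda>w. F (a, w, c + z) - F (a, w, c)) b) \<le> (B / r * norm z) / r"
      by (rule holomorphic_bound_Taylor1(1)[OF r, where h = 0])
         (use f mem r in \<open>auto intro!: holomorphic_intros h2\<close>)
    also have "deriv (\<lambda>w. F (a, w, c + z) - F (a, w, c)) b = D2 (c + z) - D2 c"
      unfolding D2_def by (rule deriv_diff) (use s2 near mem in auto)
    finally have e5: "norm (D2 (c + z) - D2 c) \<le> (B / r * norm z) / r" .
    let ?N = "norm h"
    have Br: "B / r\<^sup>2 \<ge> 0" using B0 by simp
    have g1: "2 * B / r\<^sup>2 * (norm u)\<^sup>2 \<le> 2 * B / r\<^sup>2 * ?N\<^sup>2" if "norm u \<le> ?N" for u :: complex
      using that B0 by (intro mult_left_mono power_mono) auto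
    have "norm (D1 (b + y) (c + z) - D1 b c) \<le> 2 * (B / r\<^sup>2) * ?N"
    proof -
      have "(B / r * norm y + B / r * norm z) / r = (B / r\<^sup>2) * (norm y + norm z)"
        using r by (simp add: field_simps power2_eq_square)
      also have "\<dots> \<le> (B / r\<^sup>2) * (2 * ?N)" using n Br by (intro mult_left_mono) auto
      also have "\<dots> = 2 * (B / r\<^sup>2) * ?N" by simp
      finally show ?thesis using e4 by (rule order_trans[rotated])
    qed
    then have g4: "norm ((D1 (b + y) (c + z) - D1 b c) * x) \<le> 2 * (B / r\<^sup>2) * ?N * ?N"
      unfolding norm_mult using n Br B0 by (intro mult_mono) auto
    have "norm (D2 (c + z) - D2 c) \<le> (B / r\<^sup>2) * ?N"
    proof -
      have "(B / r * norm z) / r = (B / r\<^sup>2) * norm z"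
        using r by (simp add: field_simps power2_eq_square)
      also have "\<dots> \<le> (B / r\<^sup>2) * ?N" using n Br by (intro mult_left_mono) auto
      finally show ?thesis using e5 by (rule order_trans[rotated])
    qed
    then have g5: "norm ((D2 (c + z) - D2 c) * y) \<le> (B / r\<^sup>2) * ?N * ?N"
      unfolding norm_mult using n Br B0 by (intro mult_mono) auto
    have "F (p + h) - F p - ?L h =
      (F (a + x, b + y, c + z) - F (a, b + y, c + z) - D1 (b + y) (c + z) * x)
     + (D1 (b + y) (c + z) - D1 b c) * x
     + (F (a, b + y, c + z) - F (a, b, c + z) - D2 (c + z) * y)
     + (D2 (c + z) - D2 c) * y + (F (a, b, c + z) - F (a, b, c) - D3 * z)"
      by (simp add: abc hh algebra_simps)
    also have "norm \<dots> \<le> 2 * B / r\<^sup>2 * ?N\<^sup>2 + 2 * (B / r\<^sup>2) * ?N * ?N + 2 * B / r\<^sup>2 * ?N\<^sup>2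
         + (B / r\<^sup>2) * ?N * ?N + 2 * B / r\<^sup>2 * ?N\<^sup>2"
      using e1 e2 e3 g1[OF n(1)] g1[OF n(2)] g1[OF n(3)] g4 g5
      by (intro norm_triangle_mono) auto
    also have "\<dots> = K * ?N\<^sup>2" by (simp add: K_def power2_eq_square field_simps)
    finally show ?thesis .
  qed
  have "(F has_derivative ?L) (at p)"
    unfolding has_derivative_at
  proof (intro conjI bounded_linear_complex3)
    have "\<forall>\<^sub>F h in at (0::complex \<times> complex \<times> complex). norm h < r"
      using r eventually_at_ball[of r "0::complex \<times> complex \<times> complex" UNIV] by simp
    then have "\<forall>\<^sub>F h in at (0::complex \<times> complex \<times> complex). norm h \<le> r"
      by (rule eventually_mono) simp
    then have ev: "\<forall>\<^sub>F h in at 0. norm (norm (F (p + h) - F p - ?L h) / norm h) \<le> K * norm h"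
    proof eventually_elim
      case (elim h)
      with main[of h] show ?case
        using K0 by (cases "h = 0") (auto simp: divide_simps power2_eq_square mult_ac)
    qed
    have "((\<lambda>h::complex \<times> complex \<times> complex. K * norm h) \<longlongrightarrow> 0) (at 0)"
      by (auto intro!: tendsto_eq_intros)
    from Lim_null_comparison[OF ev this]
    show "((\<lambda>h. norm (F (p + h) - F p - ?L h) / norm h) \<longlongrightarrow> 0) (at 0)" .
  qed
  then show "\<exists>a b c. (F has_derivative (\<lambda>(h1, h2, h3). a * h1 + b * h2 + c * h3)) (at p)"
    by blast
qed

lemma holomorphic3_on_add:
  assumes "holomorphic3_on F U" "holomorphic3_on G U"
  shows "holomorphic3_on (\<lambda>p. F p + G p) U"
  unfolding holomorphic3_on_def
proof
  fix p assume "p \<in> U"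
  with assms obtain a b c a' b' c' where
    "(F has_derivative (\<lambda>(h1, h2, h3). a * h1 + b * h2 + c * h3)) (at p)"
    "(G has_derivative (\<lambda>(h1, h2, h3). a' * h1 + b' * h2 + c' * h3)) (at p)"
    unfolding holomorphic3_on_def by metis
  from has_derivative_add[OF this]
  have "((\<lambda>p. F p + G p) has_derivative (\<lambda>(h1, h2, h3). (a + a') * h1 + (b + b') * h2 + (c + c') * h3)) (at p)"
    by (simp add: case_prod_unfold algebra_simps)
  then show "\<exists>a b c. ((\<lambda>p. F p + G p) has_derivative (\<lambda>(h1, h2, h3). a * h1 + b * h2 + c * h3)) (at p)"
    by blast
qed

lemma holomorphic3_on_mult:
  assumes "holomorphic3_on F U" "holomorphic3_on G U"
  shows "holomorphic3_on (\<lambda>p. F p * G p) U"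
  unfolding holomorphic3_on_def
proof
  fix p assume "p \<in> U"
  with assms obtain a b c a' b' c' where
    "(F has_derivative (\<lambda>(h1, h2, h3). a * h1 + b * h2 + c * h3)) (at p)"
    "(G has_derivative (\<lambda>(h1, h2, h3). a' * h1 + b' * h2 + c' * h3)) (at p)"
    unfolding holomorphic3_on_def by metis
  from has_derivative_mult[OF this]
  have "((\<lambda>p. F p * G p) has_derivative (\<lambda>(h1, h2, h3). (F p * a' + a * G p) * h1 + (F p * b' + b * G p) * h2
       + (F p * c' + c * G p) * h3)) (at p)"
    by (simp add: case_prod_unfold algebra_simps)
  then show "\<exists>a b c. ((\<lambda>p. F p * G p) has_derivative (\<lambda>(h1, h2, h3). a * h1 + b * h2 + c * h3)) (at p)"
    by blast
qed

lemma holomorphic3_on_sum: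
  assumes "\<And>i. i \<in> I \<Longrightarrow> holomorphic3_on (F i) U"
  shows "holomorphic3_on (\<lambda>p. \<Sum>i\<in>I. F i p) U"
  using assms
proof (induction I rule: infinite_finite_induct)
  case (insert x I)
  then show ?case by (simp add: holomorphic3_on_add)
qed (auto simp: holomorphic3_on_def intro!: exI[of _ 0] simp: case_prod_unfold)

lemma holomorphic3_on_affine:
  "holomorphic3_on (\<lambda>(s1, s2, s3). a * s1 + b * s2 + c * s3 + d) U"
  unfolding holomorphic3_on_def
proof
  fix p
  have "((\<lambda>p. a * fst p + b * fst (snd p) + c * snd (snd p) + d) has_derivative
      (\<lambda>h. a * fst h + b * fst (snd h) + c * snd (snd h))) (at p)"
    by (auto intro!: derivative_eq_intros)
  then show "\<exists>a' b' c'. ((\<lambda>(s1, s2, s3). a * s1 + b * s2 + c * s3 + d) has_derivative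
     (\<lambda>(h1, h2, h3). a' * h1 + b' * h2 + c' * h3)) (at p)"
    by (auto simp: case_prod_unfold)
qed

lemma holomorphic3_on_compose:
  assumes F: "holomorphic3_on F U" and f: "\<And>p. p \<in> U \<Longrightarrow> f field_differentiable (at (F p))"
  shows "holomorphic3_on (\<lambda>p. f (F p)) U"
  unfolding holomorphic3_on_def
proof
  fix p assume p: "p \<in> U"
  with F obtain a b c where *: "(F has_derivative (\<lambda>(h1, h2, h3). a * h1 + b * h2 + c * h3)) (at p)"
    unfolding holomorphic3_on_def by metis
  obtain f' where "(f has_field_derivative f') (at (F p))" using f[OF p] by (auto simp: field_differentiable_def)
  then have "(f has_derivative (*) f') (at (F p))" by (simp add: has_field_derivative_def)
  from has_derivative_compose[OF * this]
  have "((\<lambda>p. f (F p)) has_derivative (\<lambda>(h1, h2, h3). (f' * a) * h1 + (f' * b) * h2 + (f' * c) * h3)) (at p)"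
    by (simp add: case_prod_unfold algebra_simps)
  then show "\<exists>a b c. ((\<lambda>p. f (F p)) has_derivative (\<lambda>(h1, h2, h3). a * h1 + b * h2 + c * h3)) (at p)"
    by blast
qed

lemma holomorphic3_on_cong:
  assumes "open U" "\<And>p. p \<in> U \<Longrightarrow> F p = G p"
  shows "holomorphic3_on F U \<longleftrightarrow> holomorphic3_on G U"
proof -
  have "(F has_derivative D) (at p) \<longleftrightarrow> (G has_derivative D) (at p)" if "p \<in> U" for p D
    by (rule iffI; erule has_derivative_transform_within_open[OF _ assms(1) that]) (use assms(2) in auto)
  then show ?thesis by (simp add: holomorphic3_on_def)
qed

lemma holomorphic3_on_subset:
  "holomorphic3_on F U \<Longrightarrow> V \<subseteq> U \<Longrightarrow> holomorphic3_on F V"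
  by (auto simp: holomorphic3_on_def)

section \<open>Moving vertical lines of integration\<close>

text \<open>The pole is at most simple, so \<open>(z - z0) * f z\<close> extends holomorphically
  with value \<open>r\<close>, and Cauchy's integral formula for the extension on a tall rectangle
  yields the residue; the horizontal sides vanish in the limit by \<open>decay\<close>. With
  \<open>r = 0\<close> the lemma also moves a line across a regular point.\<close>

lemma vertical_line_shift:
  fixes f :: "complex \<Rightarrow> complex"
  assumes ab: "a < Re z0" "Re z0 < b" and \<delta>: "\<delta> > 0"
    and hol: "f holomorphic_on ({z. a - \<delta> < Re z \<and> Re z < b + \<delta>} - {z0})"
    and lim: "((\<lambda>z. (z - z0) * f z) \<longlongrightarrow> r) (at z0)"
    and bound: "\<And>z. a \<le> Re z \<Longrightarrow> Re z \<le> b \<Longrightarrow> \<bar>Im z\<bar> \<ge> T \<Longrightarrow> norm (f z) \<le> C * decay (Im z)"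
  shows "vertical_line_integrable a f" and "vertical_line_integrable b f"
    and "vertical_line_integral b f - vertical_line_integral a f = 2 * of_real pi * \<i> * r"
proof -
  define S where "S = {z. a - \<delta> < Re z \<and> Re z < b + \<delta>}"
  have oS: "open S" and cS: "convex S"
  proof -
    have "S = {z. Re z > a - \<delta>} \<inter> {z. Re z < b + \<delta>}" by (auto simp: S_def)
    then show "open S" "convex S"
      by (auto intro!: convex_Int convex_halfspace_Re_gt convex_halfspace_Re_lt open_Int
          open_halfspace_Re_gt open_halfspace_Re_lt)
  qed
  define g where "g z = (if z = z0 then r else (z - z0) * f z)" for z
  have gS: "g holomorphic_on S"
    unfolding g_def
    by (rule removable_singularity[OF _ oS lim]) (use hol in \<open>auto intro!: holomorphic_intros simp: S_def\<close>)
  have z0S: "z0 \<in> S" using ab \<delta> by (auto simp: S_def)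
  have cont: "continuous_on UNIV (\<lambda>t. f (Complex c t))" if "c = a \<or> c = b" for c
    by (rule continuous_on_compose2[OF holomorphic_on_imp_continuous_on[OF hol], of _ "\<lambda>t. Complex c t"])
       (use that ab \<delta> in \<open>auto simp: Complex_eq intro!: continuous_intros\<close>)
  have i: "integrable lborel (\<lambda>t. f (Complex c t))" if "c = a \<or> c = b" for c
  proof (rule integrable_decay_bound[OF cont[OF that], of T C])
    show "norm (f (Complex c t)) \<le> C * decay t" if "\<bar>t\<bar> \<ge> T" for t
      using bound[of "Complex c t"] that ab \<open>c = a \<or> c = b\<close> by auto
  qed
  show "vertical_line_integrable a f" "vertical_line_integrable b f"
    using i by (auto simp: vertical_line_integrable_def)
  \<comment> \<open>Rectangles see only symmetric truncations of the line integrals; these converge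
    because the integrand is absolutely integrable.\<close>
  have tend: "(\<lambda>n. integral {-real n..real n} (\<lambda>t. f (Complex c t))) \<longlonglongrightarrow> (LINT t|lborel. f (Complex c t))"
    if c: "c = a \<or> c = b" for c
  proof -
    have "(\<lambda>n. LINT t|lborel. indicator {-real n..real n} t *\<^sub>R f (Complex c t)) \<longlonglongrightarrow> (LINT t|lborel. f (Complex c t))"
    proof (rule integral_dominated_convergence[where w = "\<lambda>t. norm (f (Complex c t))"])
      show "AE t in lborel. (\<lambda>n. indicator {-real n..real n} t *\<^sub>R f (Complex c t)) \<longlonglongrightarrow> f (Complex c t)"
      proof (rule AE_I2)
        fix t :: real
        obtain N where N: "\<bar>t\<bar> \<le> real N" using real_arch_simple by blast
        have "\<forall>\<^sub>F n in sequentially. indicator {-real n..real n} t *\<^sub>R f (Complex c t) = f (Complex c t)"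
          using eventually_ge_at_top[of N]
        proof eventually_elim
          case (elim n)
          then have "t \<in> {-real n..real n}" using N by auto
          then show ?case by simp
        qed
        then show "(\<lambda>n. indicator {-real n..real n} t *\<^sub>R f (Complex c t)) \<longlonglongrightarrow> f (Complex c t)"
          by (rule tendsto_eventually)
      qed
    qed (use i[OF c] in \<open>auto simp: indicator_def\<close>)
    moreover have "(LINT t|lborel. indicator {-real n..real n} t *\<^sub>R f (Complex c t)) =
        integral {-real n..real n} (\<lambda>t. f (Complex c t))" for n
    proof -
      have "set_integrable lborel {-real n..real n} (\<lambda>t. f (Complex c t))"
        by (rule set_integrable_subset[of _ UNIV]) (use i[OF c] in \<open>auto simp: set_integrable_def\<close>)
      from set_borel_integral_eq_integral(2)[OF this] show ?thesis
        by (simp add: set_lebesgue_integral_def)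
    qed
    ultimately show ?thesis by simp
  qed
  define H where "H n = contour_integral (linepath (Complex a (-real n)) (Complex b (-real n))) f
       + contour_integral (linepath (Complex b (real n)) (Complex a (real n))) f" for n
  define V where "V c n = \<i> * integral {-real n..real n} (\<lambda>t. f (Complex c t))" for c n
  have ev: "\<forall>\<^sub>F n in sequentially. n \<ge> 1 \<and> real n > \<bar>Im z0\<bar> \<and> real n \<ge> T"
  proof -
    obtain N where N: "real N > max \<bar>Im z0\<bar> (max T 1)" using reals_Archimedean2 by blast
    show ?thesis
    proof (rule eventually_sequentiallyI[of N])
      fix n assume "N \<le> n"
      then have "real n > max \<bar>Im z0\<bar> (max T 1)" using N by simp
      then show "n \<ge> 1 \<and> real n > \<bar>Im z0\<bar> \<and> real n \<ge> T" by auto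
    qed
  qed
  have hb: "norm (contour_integral (linepath u v) f) \<le> \<bar>C\<bar> * decay (real n) * (b - a)"
    if "real n \<ge> T" "real n > \<bar>Im z0\<bar>" "Im u = Im v" "\<bar>Im u\<bar> = real n" "Re u = a \<and> Re v = b \<or> Re u = b \<and> Re v = a" for u v n
  proof -
    have seg: "a \<le> Re w \<and> Re w \<le> b \<and> Im w = Im u" if "w \<in> closed_segment u v" for w
    proof -
      have uv: "closed_segment u v \<subseteq> {w. a \<le> Re w} \<inter> {w. Re w \<le> b} \<inter> {w. Im w \<le> Im u} \<inter> {w. Im w \<ge> Im u}"
        by (rule closed_segment_subset)
           (use \<open>Re u = a \<and> Re v = b \<or> Re u = b \<and> Re v = a\<close> \<open>Im u = Im v\<close> ab in 
             \<open>auto intro!: convex_Int convex_halfspace_Re_ge convex_halfspace_Re_le convex_halfspace_Im_ge convex_halfspace_Im_le\<close>)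
      with that have "w \<in> {w. a \<le> Re w} \<inter> {w. Re w \<le> b} \<inter> {w. Im w \<le> Im u} \<inter> {w. Im w \<ge> Im u}"
        by blast
      then show ?thesis by auto
    qed
    have ci: "f contour_integrable_on (linepath u v)"
    proof (rule contour_integrable_continuous_linepath)
      show "continuous_on (closed_segment u v) f"
      proof (rule continuous_on_subset[OF holomorphic_on_imp_continuous_on[OF hol]], rule subsetI)
        fix w assume "w \<in> closed_segment u v"
        note w = seg[OF this]
        have "w \<noteq> z0" using w \<open>\<bar>Im u\<bar> = real n\<close> \<open>real n > \<bar>Im z0\<bar>\<close> by auto
        with w \<delta> show "w \<in> {z. a - \<delta> < Re z \<and> Re z < b + \<delta>} - {z0}" by simp
      qed
    qed
    have "norm (contour_integral (linepath u v) f) \<le> (\<bar>C\<bar> * decay (real n)) * norm (v - u)"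
    proof (rule has_contour_integral_bound_linepath[OF has_contour_integral_integral[OF ci]])
      fix w assume w: "w \<in> closed_segment u v"
      have "norm (f w) \<le> C * decay (Im w)" using seg[OF w] that by (intro bound) auto
      also have "decay (Im w) = decay (real n)" using seg[OF w] that by (auto simp: decay_def)
      also have "C * decay (real n) \<le> \<bar>C\<bar> * decay (real n)" by (intro mult_right_mono) auto
      finally show "norm (f w) \<le> \<bar>C\<bar> * decay (real n)" .
    qed auto
    also have "norm (v - u) = b - a"
      using that ab by (auto simp: cmod_def)
    finally show ?thesis .
  qed
  have eq: "\<forall>\<^sub>F n in sequentially. H n + V b n - V a n = 2 * of_real pi * \<i> * r"
    using ev
  proof eventually_elim
    case (elim n)
    let ?A = "Complex a (-real n)" and ?C = "Complex b (real n)"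
    let ?B = "Complex b (-real n)" and ?D = "Complex a (real n)"
    have box: "z0 \<in> box ?A ?C" using elim ab by (auto simp: in_box_complex_iff)
    have sub: "path_image (rectpath ?A ?C) \<subseteq> S - {z0}"
    proof -
      have "path_image (rectpath ?A ?C) \<subseteq> cbox ?A ?C - box ?A ?C"
        using path_image_rectpath_cbox_minus_box[of ?A ?C] ab elim by auto
      moreover have "cbox ?A ?C \<subseteq> S" using \<delta> by (auto simp: in_cbox_complex_iff S_def)
      ultimately show ?thesis using box by blast
    qed
    have 1: "((\<lambda>w. g w / (w - z0)) has_contour_integral (2 * pi * \<i> * winding_number (rectpath ?A ?C) z0 * g z0)) (rectpath ?A ?C)"
      by (rule Cauchy_integral_formula_convex_simple[OF cS gS]) (use sub z0S oS in \<open>auto simp: interior_open\<close>)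
    have 2: "(f has_contour_integral (2 * pi * \<i> * r)) (rectpath ?A ?C)"
    proof (rule has_contour_integral_eq)
      show "((\<lambda>w. g w / (w - z0)) has_contour_integral 2 * pi * \<i> * r) (rectpath ?A ?C)"
        using 1 unfolding winding_number_rectpath[OF box] by (simp add: g_def)
      show "g w / (w - z0) = f w" if "w \<in> path_image (rectpath ?A ?C)" for w
      proof -
        have "w \<noteq> z0" using sub that by auto
        then show ?thesis by (simp add: g_def)
      qed
    qed
    have cont': "continuous_on (path_image (rectpath ?A ?C)) f"
      by (rule continuous_on_subset[OF holomorphic_on_imp_continuous_on[OF hol]]) (use sub in \<open>auto simp: S_def\<close>)
    have pi: "path_image (rectpath ?A ?C) = closed_segment ?A ?B \<union> closed_segment ?B ?C \<union> closed_segment ?C ?D \<union> closed_segment ?D ?A"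
      by (simp add: rectpath_def Let_def path_image_join Un_assoc)
    have ci: "f contour_integrable_on (linepath ?A ?B)" "f contour_integrable_on (linepath ?B ?C)"
      "f contour_integrable_on (linepath ?C ?D)" "f contour_integrable_on (linepath ?D ?A)"
      by (intro contour_integrable_continuous_linepath continuous_on_subset[OF cont']; use pi in blast)+
    have "2 * pi * \<i> * r = contour_integral (rectpath ?A ?C) f" using contour_integral_unique[OF 2] by simp
    also have "\<dots> = contour_integral (linepath ?A ?B) f + (contour_integral (linepath ?B ?C) f
       + (contour_integral (linepath ?C ?D) f + contour_integral (linepath ?D ?A) f))"
      using ci by (simp add: rectpath_def Let_def)
    also have "contour_integral (linepath ?B ?C) f = V b n"
      unfolding V_def by (rule contour_integral_linepath_same_Re) (use elim in auto)
    also have "contour_integral (linepath ?D ?A) f = - contour_integral (linepath ?A ?D) f"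
      using contour_integral_reversepath[of "linepath ?A ?D" f] by simp
    also have "contour_integral (linepath ?A ?D) f = V a n"
      unfolding V_def by (rule contour_integral_linepath_same_Re) (use elim in auto)
    finally show ?case by (simp add: H_def algebra_simps)
  qed
  have dec: "(\<lambda>n. 2 * (\<bar>C\<bar> * decay (real n) * (b - a))) \<longlonglongrightarrow> 0"
    unfolding decay_def by real_asymp
  have "H \<longlonglongrightarrow> 0"
  proof (rule Lim_null_comparison[OF _ dec])
    show "\<forall>\<^sub>F n in sequentially. norm (H n) \<le> 2 * (\<bar>C\<bar> * decay (real n) * (b - a))"
      using ev
    proof eventually_elim
      case (elim n)
      show ?case unfolding H_def
        by (rule order_trans[OF norm_triangle_ineq]) (use elim in \<open>auto intro!: order_trans[OF add_mono[OF hb[where n=n] hb[where n=n]]]\<close>)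
    qed
  qed
  then have "(\<lambda>n. H n + V b n - V a n) \<longlonglongrightarrow> 0 + vertical_line_integral b f - vertical_line_integral a f"
    unfolding V_def vertical_line_integral_def by (intro tendsto_intros tend) auto
  with tendsto_eventually[OF eq] show
    "vertical_line_integral b f - vertical_line_integral a f = 2 * of_real pi * \<i> * r"
    using LIMSEQ_unique by fastforce
qed

section \<open>The Mellin--Barnes formula\<close>

lemma norm_of_real_powr: "x > 0 \<Longrightarrow> norm (of_real x powr z :: complex) = x powr Re z"
  by (simp add: norm_powr_real_powr)

lemma not_nonpos_Int_if_Re_pos: "Re z > 0 \<Longrightarrow> z \<notin> \<int>\<^sub>\<le>\<^sub>0"
  by (metis Re_complex_of_real nonpos_Ints_cases of_int_0_less_iff of_real_of_int_eq not_less)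

lemma continuous_on_imp_lborel_measurable:
  "continuous_on UNIV (f :: real \<Rightarrow> complex) \<Longrightarrow> f \<in> borel_measurable lborel"
  by (simp add: borel_measurable_continuous_onI)

section \<open>The Beta kernel at complex arguments\<close>

text \<open>Both sides are holomorphic in each argument and agree for positive reals. The identity
  theorem extends this one argument at a time; the substitution of \<open>1 - t\<close> for
  \<open>t\<close> exchanges the arguments, so one continuation step serves for both.\<close>

lemma Beta_complex_integral:
  fixes a b :: complex
  defines "f \<equiv> \<lambda>a b t. indicator {0<..<1} t *\<^sub>R ((of_real t :: complex) powr (a - 1) * of_real (1 - t) powr (b - 1))"
  assumes ab: "Re a > 0" "Re b > 0"
  shows "(LINT t|lborel. f a b t) = Beta a b"
proof -
  have meas: "f a b \<in> borel_measurable lborel" for a b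
    unfolding f_def by measurable
  define g where "g a b t = indicator {0<..<1} t * (t powr (a - 1) * (1 - t) powr (b - 1))" for a b t :: real
  have g: "integrable lborel (g a b)" if "a > 0" "b > 0" for a b
  proof -
    have "set_integrable lborel {0<..<1} (\<lambda>t. t powr (a - 1) * (1 - t) powr (b - 1))"
      by (rule set_integrable_subset[OF integrable_Beta[OF that]]) auto
    then show ?thesis unfolding set_integrable_def g_def by simp
  qed
  have nf: "norm (f a b t) \<le> g a0 b0 t" if "Re a \<ge> a0" "Re b \<ge> b0" for a b t a0 b0
  proof (cases "t \<in> {0<..<1}")
    case True
    then have "norm (f a b t) = t powr (Re a - 1) * (1 - t) powr (Re b - 1)"
      by (simp add: f_def norm_mult norm_of_real_powr del: of_real_diff)
    also have "\<dots> \<le> t powr (a0 - 1) * (1 - t) powr (b0 - 1)"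
      using True that by (intro mult_mono powr_mono') auto
    finally show ?thesis using True by (simp add: g_def)
  qed (simp add: f_def g_def)
  have hol1: "(\<lambda>a. LINT t|lborel. f a b t) holomorphic_on {a. Re a > 0}" if "Re b > 0" for b
  proof (rule holomorphic_on_LINT)
    show "(\<lambda>a. f a b t) holomorphic_on {a. Re a > 0}" for t
      by (cases "t \<in> {0<..<1}") (auto simp: f_def intro!: holomorphic_intros)
    fix s0 assume "s0 \<in> {a. 0 < Re a}"
    then have s0: "Re s0 > 0" by simp
    have "Re s \<ge> Re s0 / 2" if "s \<in> cball s0 (Re s0 / 2)" for s
      using that complex_Re_le_cmod[of "s0 - s"] by (auto simp: dist_norm)
    then show "\<exists>r>0. \<exists>g. integrable lborel g \<and> (\<forall>s\<in>cball s0 r \<inter> {a. 0 < Re a}. \<forall>t\<in>space lborel. norm (f s b t) \<le> g t)"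
      using s0 that by (intro exI[of _ "Re s0 / 2"] exI[of _ "g (Re s0 / 2) (Re b)"] conjI g) (auto intro!: nf)
  qed (use meas in \<open>auto simp: open_halfspace_Re_gt\<close>)
  have sym: "(LINT t|lborel. f a b t) = (LINT t|lborel. f b a t)" for a b
  proof -
    have "(LINT t|lborel. f a b t) = \<bar>-1\<bar> *\<^sub>R (LINT t|lborel. f a b (1 + (-1) * t))"
      by (rule lborel_integral_real_affine) simp
    also have "(\<lambda>t. f a b (1 + (-1) * t)) = f b a"
      by (auto simp: f_def fun_eq_iff indicator_def)
    finally show ?thesis by simp
  qed
  have real: "(LINT t|lborel. f (of_real x) (of_real y) t) = Beta (of_real x) (of_real y)" if "x > 0" "y > 0" for x y :: real
  proof -
    have "(g x y has_integral Beta x y) UNIV"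
    proof -
      have "((\<lambda>t. t powr (x - 1) * (1 - t) powr (y - 1)) has_integral Beta x y) {0<..<1}"
        using has_integral_Beta_real[OF that] by (simp add: has_integral_Icc_iff_Ioo)
      then have "((\<lambda>t. if t \<in> {0<..<1} then t powr (x - 1) * (1 - t) powr (y - 1) else 0) has_integral Beta x y) UNIV"
        by (simp only: has_integral_restrict_UNIV)
      then show ?thesis by (rule has_integral_eq_rhs[OF has_integral_eq[rotated]]) (auto simp: g_def)
    qed
    then have "(LINT t|lborel. g x y t) = Beta x y"
      using integral_lborel[OF g[OF that]] by (simp add: integral_unique)
    moreover have "f (of_real x) (of_real y) t = of_real (g x y t)" for t
    proof (cases "t \<in> {0<..<1}")
      case True
      then show ?thesis
        using powr_of_real[of t "x - 1"] powr_of_real[of "1 - t" "y - 1"] by (simp add: f_def g_def)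
    qed (simp add: f_def g_def)
    ultimately show ?thesis by (simp add: Beta_complex_of_real)
  qed
  have lim: "(1::complex) islimpt {of_real x | x::real. x > 0}"
  proof (rule islimptI)
    fix T :: "complex set" assume T: "1 \<in> T" "open T"
    then obtain e where e: "e > 0" "ball 1 e \<subseteq> T" using open_contains_ball by blast
    have "complex_of_real (1 + e / 2) \<in> ball 1 e" using e by (simp add: dist_norm)
    with e show "\<exists>y\<in>{of_real x | x::real. x > 0}. y \<in> T \<and> y \<noteq> 1"
      by (intro bexI[of _ "of_real (1 + e / 2)"]) (auto simp del: of_real_add of_real_divide)
  qed
  note npi = not_nonpos_Int_if_Re_pos
  have step: "(LINT t|lborel. f a b t) = Beta a b"
    if b: "Re b > 0" and eq: "\<And>x::real. x > 0 \<Longrightarrow> (LINT t|lborel. f (of_real x) b t) = Beta (of_real x) b" and a: "Re a > 0" for a b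
  proof -
    have "(LINT t|lborel. f a b t) - Beta a b = 0"
    proof (rule analytic_continuation[of "\<lambda>a. (LINT t|lborel. f a b t) - Beta a b" "{a. Re a > 0}"
          "{of_real x | x::real. x > 0}" 1])
      show "(\<lambda>a. (LINT t|lborel. f a b t) - Beta a b) holomorphic_on {a. 0 < Re a}"
        using b by (intro holomorphic_intros hol1) (auto simp: npi)
      show "connected {a::complex. 0 < Re a}" by (intro convex_connected convex_halfspace_Re_gt)
    qed (use eq a lim in \<open>auto simp: open_halfspace_Re_gt\<close>)
    then show ?thesis by simp
  qed
  have "(LINT t|lborel. f (of_real x) b t) = Beta (of_real x) b" if x: "x > 0" for x :: real
  proof -
    have "(LINT t|lborel. f b (of_real x) t) = Beta b (of_real x)"
    proof (rule step)
      show "(LINT t|lborel. f (of_real y) (of_real x) t) = Beta (of_real y) (of_real x)" if "y > 0" for y :: real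
        by (rule real[OF that x])
    qed (use x ab in auto)
    then show ?thesis by (subst sym) (simp add: Beta_commute)
  qed
  then show ?thesis using step ab by blast
qed

text \<open>On the unit interval a smaller exponent gives a larger power, so lower bounds of the
  real parts control the Beta integral uniformly in the imaginary parts.\<close>

lemma norm_Beta_le:
  fixes a b :: complex
  assumes "0 < a0" "a0 \<le> Re a" "0 < b0" "b0 \<le> Re b"
  shows "norm (Beta a b) \<le> Beta a0 b0"
proof -
  let ?g = "\<lambda>t. indicator {0<..<1} t *\<^sub>R (t powr (a0 - 1) * (1 - t) powr (b0 - 1))"
  have gi: "integrable lborel ?g"
  proof -
    have "set_integrable lborel {0<..<1} (\<lambda>t. t powr (a0 - 1) * (1 - t) powr (b0 - 1))"
      by (rule set_integrable_subset[OF integrable_Beta]) (use assms in auto)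
    then show ?thesis unfolding set_integrable_def .
  qed
  have "norm (Beta a b) = norm (LINT t|lborel. indicator {0<..<1} t *\<^sub>R ((of_real t :: complex) powr (a - 1) * of_real (1 - t) powr (b - 1)))"
    using Beta_complex_integral[of a b] assms by simp
  also have "\<dots> \<le> (LINT t|lborel. ?g t)"
  proof (rule Bochner_Integration.integral_norm_bound_integral[OF _ gi])
    have le: "norm (indicator {0<..<1} t *\<^sub>R ((of_real t :: complex) powr (a - 1) * of_real (1 - t) powr (b - 1))) \<le> ?g t" for t
    proof (cases "t \<in> {0<..<1}")
      case True
      then have "t powr (Re a - 1) * (1 - t) powr (Re b - 1) \<le> t powr (a0 - 1) * (1 - t) powr (b0 - 1)"
        using assms by (intro mult_mono powr_mono') auto
      then show ?thesis using True by (simp add: norm_mult norm_of_real_powr del: of_real_diff)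
    qed simp
    then show "norm (indicator {0<..<1} t *\<^sub>R ((of_real t :: complex) powr (a - 1) * of_real (1 - t) powr (b - 1))) \<le> ?g t" for t .
    show "integrable lborel (\<lambda>t. indicator {0<..<1} t *\<^sub>R ((of_real t :: complex) powr (a - 1) * of_real (1 - t) powr (b - 1)))"
      by (rule Bochner_Integration.integrable_bound[OF gi])
         (use le in \<open>auto intro!: AE_I2 intro: order_trans[OF _ abs_ge_self]\<close>)
  qed
  also have "(LINT t|lborel. ?g t) = Beta a0 b0"
  proof -
    have "((\<lambda>t. t powr (a0 - 1) * (1 - t) powr (b0 - 1)) has_integral Beta a0 b0) {0<..<1}"
      using has_integral_Beta_real[of a0 b0] assms by (simp add: has_integral_Icc_iff_Ioo)
    then have "integral {0<..<1} (\<lambda>t. t powr (a0 - 1) * (1 - t) powr (b0 - 1)) = Beta a0 b0"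
      by (rule integral_unique)
    moreover have "set_integrable lborel {0<..<1} (\<lambda>t. t powr (a0 - 1) * (1 - t) powr (b0 - 1))"
      using gi unfolding set_integrable_def .
    ultimately show ?thesis
      using set_borel_integral_eq_integral(2)[of "{0<..<1}" "\<lambda>t. t powr (a0 - 1) * (1 - t) powr (b0 - 1)"]
      by (simp add: set_lebesgue_integral_def)
  qed
  finally show ?thesis .
qed

text \<open>Used with \<open>a = s + z\<close> and \<open>b = - z\<close>: the Pochhammer symbol on
  the left grows like the \<open>M\<close>-th power of the height of \<open>z\<close>, the one on
  the right is that of \<open>a + b = s\<close> and independent of \<open>z\<close>. Each step of
  the recursion thus buys a power of decay in \<open>z\<close> for a power of the size of
  \<open>s\<close>.\<close>

lemma Beta_pochhammer_right:
  fixes a b :: complex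
  assumes "b \<notin> \<int>\<^sub>\<le>\<^sub>0"
  shows "Beta a b * pochhammer b M = Beta a (b + of_nat M) * pochhammer (a + b) M"
proof -
  have "Gamma b \<noteq> 0" using assms by (simp add: Gamma_eq_zero_iff)
  then have "Gamma b * pochhammer b M = Gamma (b + of_nat M)"
    using pochhammer_Gamma[OF assms, of M] by simp
  then have "Beta a b * pochhammer b M = Gamma a * Gamma (b + of_nat M) * rGamma (a + b)"
    by (simp add: Beta_altdef mult_ac)
  also have "rGamma (a + b) = pochhammer (a + b) M * rGamma (a + b + of_nat M)" by (rule pochhammer_rGamma)
  finally show ?thesis by (simp add: Beta_altdef mult_ac add_ac)
qed

lemma norm_pochhammer_le: "norm (pochhammer (z::complex) n) \<le> (norm z + real n) ^ n"
proof -
  have "norm (pochhammer z n) = (\<Prod>i<n. norm (z + of_nat i))"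
    by (simp add: pochhammer_prod prod_norm atLeast0LessThan)
  also have "\<dots> \<le> (\<Prod>i<n. norm z + real n)"
    by (intro prod_mono conjI norm_ge_zero order_trans[OF norm_triangle_ineq]) auto
  finally show ?thesis by simp
qed

lemma norm_pochhammer_ge:
  assumes "\<And>j. j < M \<Longrightarrow> norm (of_nat j - z :: complex) \<ge> d" "d \<ge> 0"
  shows "norm (pochhammer (- z) M) \<ge> d ^ M"
proof -
  have "d ^ M = (\<Prod>i<M. d)" by simp
  also have "\<dots> \<le> (\<Prod>i<M. norm (- z + of_nat i))"
    using assms by (intro prod_mono) (auto simp: algebra_simps)
  finally show ?thesis by (simp add: pochhammer_prod prod_norm atLeast0LessThan)
qed

text \<open>The distance from \<open>z\<close> to the naturals is required to be proportional to
  \<open>1 + \<bar>Im z\<bar>\<close>. This single hypothesis keeps \<open>z\<close> off the poles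
  of \<open>Gamma (- z)\<close> and makes the Pochhammer symbol to be divided by large.
  \<open>C\<close> and \<open>N\<close> do not depend on \<open>s\<close>, as holomorphy in
  \<open>s\<close> and the growth bounds need.\<close>

lemma MB_kernel_bound:
  fixes A :: nat and a0 \<eta> R :: real
  assumes "a0 > 0" "\<eta> > 0"
  obtains C N where "C > 0"
    "\<And>s z. Re (s + z) \<ge> a0 \<Longrightarrow> Re z \<le> R \<Longrightarrow> (\<And>j::nat. norm (of_nat j - z) \<ge> \<eta> * (1 + \<bar>Im z\<bar>)) \<Longrightarrow>
      norm (Beta (s + z) (- z)) * (1 + \<bar>Im z\<bar>) ^ A \<le> C * (1 + norm s) ^ N * decay (Im z)"
proof -
  obtain n0 :: nat where n0: "R + 1 \<le> real n0" using real_arch_simple by blast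
  \<comment> \<open>Adding \<open>M\<close> brings the real part of \<open>- z\<close> to at least
    \<open>1\<close> because \<open>M \<ge> n0\<close>; of the powers gained, \<open>A\<close> pay
    for the polynomial factor and two for \<open>decay\<close>.\<close>
  define M where "M = n0 + A + 2"
  define C where "C = Beta a0 1 * (1 + real M) ^ M / \<eta> ^ M"
  have B0: "Beta a0 1 > (0::real)" using assms by (simp add: Beta_def Gamma_real_pos)
  show ?thesis
  proof (rule that[of C M])
    show "C > 0" using B0 assms by (auto simp: C_def)
    fix s z :: complex
    assume sz: "Re (s + z) \<ge> a0" "Re z \<le> R" and d: "\<And>j::nat. norm (of_nat j - z) \<ge> \<eta> * (1 + \<bar>Im z\<bar>)"
    define T where "T = 1 + \<bar>Im z\<bar>"
    have T: "T \<ge> 1" by (simp add: T_def)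
    have nz: "- z \<notin> \<int>\<^sub>\<le>\<^sub>0"
    proof
      assume "- z \<in> \<int>\<^sub>\<le>\<^sub>0"
      then obtain n where "z = of_nat n" by (auto elim!: nonpos_Ints_cases' simp: minus_equation_iff)
      then show False using d[of n] assms by simp
    qed
    have p: "norm (pochhammer (- z) M) \<ge> (\<eta> * T) ^ M"
      by (rule norm_pochhammer_ge) (use d assms T in \<open>auto simp: T_def\<close>)
    have pos: "(\<eta> * T) ^ M > 0" using assms T by auto
    have "norm (Beta (s + z) (- z)) * (\<eta> * T) ^ M \<le> norm (Beta (s + z) (- z)) * norm (pochhammer (- z) M)"
      using p by (intro mult_left_mono) auto
    also have "\<dots> = norm (Beta (s + z) (- z + of_nat M)) * norm (pochhammer s M)"
      using Beta_pochhammer_right[OF nz, of "s + z" M] by (simp flip: norm_mult)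
    also have "\<dots> \<le> Beta a0 1 * (norm s + real M) ^ M"
      by (intro mult_mono norm_Beta_le norm_pochhammer_le) (use assms sz n0 B0 in \<open>auto simp: M_def\<close>)
    also have "\<dots> \<le> Beta a0 1 * ((1 + real M) * (1 + norm s)) ^ M"
      using B0 by (intro mult_left_mono power_mono) (auto simp: algebra_simps)
    finally have 1: "norm (Beta (s + z) (- z)) * (\<eta> * T) ^ M \<le> Beta a0 1 * ((1 + real M) * (1 + norm s)) ^ M" .
    have "T ^ A * T ^ 2 \<le> T ^ M" unfolding power_add[symmetric] M_def
      using T by (intro power_increasing) auto
    then have "norm (Beta (s + z) (- z)) * \<eta> ^ M * (T ^ A * T ^ 2) \<le> norm (Beta (s + z) (- z)) * \<eta> ^ M * T ^ M"
      using assms by (intro mult_left_mono) auto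
    also have "\<dots> \<le> Beta a0 1 * ((1 + real M) * (1 + norm s)) ^ M"
      using 1 by (simp add: power_mult_distrib mult_ac)
    finally have "norm (Beta (s + z) (- z)) * T ^ A \<le> Beta a0 1 * ((1 + real M) * (1 + norm s)) ^ M / \<eta> ^ M / T ^ 2"
      using assms T by (simp add: field_simps)
    then show "norm (Beta (s + z) (- z)) * (1 + \<bar>Im z\<bar>) ^ A \<le> C * (1 + norm s) ^ M * decay (Im z)"
      by (simp add: C_def decay_def T_def power_mult_distrib mult_ac)
  qed
qed

lemma norm_nat_diff_ge_Im:
  assumes "\<bar>Im z\<bar> \<ge> 1" shows "norm (of_nat j - z) \<ge> 1 / 2 * (1 + \<bar>Im z\<bar>)"
  using abs_Im_le_cmod[of "of_nat j - z"] assms by simp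

text \<open>The halved constant is the average of two lower bounds: \<open>\<eta>\<close> from the
  real part and, by \<open>\<eta> \<le> 1\<close>, \<open>\<eta> * \<bar>Im z\<bar>\<close> from the
  imaginary part.\<close>

lemma norm_nat_diff_ge_Re:
  assumes "\<bar>real j - Re z\<bar> \<ge> \<eta>" "\<eta> \<le> 1" "\<eta> \<ge> 0"
  shows "norm (of_nat j - z) \<ge> \<eta> / 2 * (1 + \<bar>Im z\<bar>)"
proof -
  have "norm (of_nat j - z) \<ge> \<eta>" "norm (of_nat j - z) \<ge> \<bar>Im z\<bar>"
    using abs_Im_le_cmod[of "of_nat j - z"] abs_Re_le_cmod[of "of_nat j - z"] assms by auto
  moreover have "\<eta> * \<bar>Im z\<bar> \<le> 1 * \<bar>Im z\<bar>" using assms by (intro mult_right_mono) auto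
  ultimately show ?thesis by (simp add: algebra_simps)
qed

text \<open>\<open>Gamma (- z)\<close> has residue \<open>- (-1) ^ K / fact K\<close> at
  \<open>K\<close>, and \<open>Gamma (s + of_nat K) * rGamma s\<close> is a Pochhammer symbol;
  together they form the binomial coefficient. Using \<open>rGamma s\<close> keeps this correct when
  \<open>s\<close> itself is a pole of Gamma.\<close>

lemma MB_kernel_residue:
  fixes K :: nat and s :: complex
  assumes "s + of_nat K \<notin> \<int>\<^sub>\<le>\<^sub>0"
  shows "((\<lambda>z. (z - of_nat K) * Beta (s + z) (- z)) \<longlongrightarrow> - ((- s) gchoose K)) (at (of_nat K))"
proof -
  have f: "filterlim (\<lambda>z::complex. - z) (at (- of_nat K)) (at (of_nat K))"
    by (rule filterlim_atI) (auto intro!: tendsto_intros simp: eventually_at_filter)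
  have 1: "((\<lambda>z. Gamma (- z) * (- z + of_nat K)) \<longlongrightarrow> (-1) ^ K / fact K) (at (of_nat K :: complex))"
    using filterlim_compose[OF Gamma_residues[of K] f] by simp
  have 2: "((\<lambda>z. Gamma (s + z) * rGamma s) \<longlongrightarrow> Gamma (s + of_nat K) * rGamma s) (at (of_nat K))"
    using assms by (intro tendsto_intros) auto
  have "((\<lambda>z. - ((Gamma (- z) * (- z + of_nat K)) * (Gamma (s + z) * rGamma s))) \<longlongrightarrow>
      - ((-1) ^ K / fact K * (Gamma (s + of_nat K) * rGamma s))) (at (of_nat K))"
    by (intro tendsto_intros 1 2)
  also have "(\<lambda>z. - ((Gamma (- z) * (- z + of_nat K)) * (Gamma (s + z) * rGamma s)))
      = (\<lambda>z. (z - of_nat K) * Beta (s + z) (- z))"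
    by (auto simp: fun_eq_iff Beta_altdef algebra_simps)
  also have "Gamma (s + of_nat K) * rGamma s = pochhammer s K"
    using assms by (subst pochhammer_rGamma[of s K]) (simp add: rGamma_inverse_Gamma Gamma_eq_zero_iff)
  also have "- ((-1) ^ K / fact K * pochhammer s K) = - ((- s) gchoose K)"
    by (simp add: gbinomial_pochhammer)
  finally show ?thesis .
qed

text \<open>Exactly one pole is crossed. \<open>Re s + a > 0\<close> leaves the poles of
  \<open>Gamma (s + z)\<close> to the left of both lines; the last condition in \<open>ab\<close>
  excludes the pole at \<open>K - 1\<close>, and for \<open>K = 0\<close> there is no earlier pole
  to exclude.\<close>

lemma MB_shift:
  fixes K :: nat and s :: complex and a b :: real
  assumes ab: "a < real K" "real K < b" "b < real K + 1" "K = 0 \<or> real K - 1 < a"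
    and s: "Re s + a > 0" and \<delta>: "\<delta> > 0"
    and h: "h holomorphic_on {z. a - \<delta> < Re z \<and> Re z < b + \<delta>}"
    and hb: "\<And>z. a \<le> Re z \<Longrightarrow> Re z \<le> b \<Longrightarrow> \<bar>Im z\<bar> \<ge> T \<Longrightarrow> norm (h z) \<le> C * (1 + \<bar>Im z\<bar>) ^ A"
  shows "vertical_line_integrable a (\<lambda>z. Beta (s + z) (- z) * h z)"
    and "vertical_line_integrable b (\<lambda>z. Beta (s + z) (- z) * h z)"
    and "vertical_line_integral a (\<lambda>z. Beta (s + z) (- z) * h z) =
      vertical_line_integral b (\<lambda>z. Beta (s + z) (- z) * h z) + 2 * of_real pi * \<i> * (((- s) gchoose K) * h (of_nat K))"
proof -
  let ?f = "\<lambda>z. Beta (s + z) (- z) * h z"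
  \<comment> \<open>Narrows the strip until \<open>of_nat K\<close> is the only pole of the kernel
    in it.\<close>
  define \<delta>' where "\<delta>' = min (min \<delta> (Re s + a)) (min (real K + 1 - b) (if K = 0 then 1 else a - (real K - 1)))"
  have \<delta>': "\<delta>' > 0" "\<delta>' \<le> \<delta>" "\<delta>' \<le> Re s + a" "b + \<delta>' \<le> real K + 1" "K \<noteq> 0 \<Longrightarrow> real K - 1 \<le> a - \<delta>'"
    using assms by (auto simp: \<delta>'_def)
  have nz: "- z \<notin> \<int>\<^sub>\<le>\<^sub>0" if "a - \<delta>' < Re z" "Re z < b + \<delta>'" "z \<noteq> of_nat K" for z :: complex
  proof
    assume "- z \<in> \<int>\<^sub>\<le>\<^sub>0"
    then obtain n where n: "z = of_nat n" by (auto elim!: nonpos_Ints_cases' simp: minus_equation_iff)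
    then have "real n < real K + 1" "K \<noteq> 0 \<Longrightarrow> real K - 1 < real n" using that \<delta>' by auto
    then have "n = K" by (cases "K = 0") auto
    with n that show False by simp
  qed
  have hol: "?f holomorphic_on ({z. a - \<delta>' < Re z \<and> Re z < b + \<delta>'} - {of_nat K})"
  proof (intro holomorphic_on_mult holomorphic_Beta)
    show "h holomorphic_on ({z. a - \<delta>' < Re z \<and> Re z < b + \<delta>'} - {of_nat K})"
      by (rule holomorphic_on_subset[OF h]) (use \<delta>' in auto)
    show "s + z \<notin> \<int>\<^sub>\<le>\<^sub>0" if "z \<in> {z. a - \<delta>' < Re z \<and> Re z < b + \<delta>'} - {of_nat K}" for z
    proof -
      have "Re (s + z) > 0" using that \<delta>' by auto
      then show ?thesis by (rule not_nonpos_Int_if_Re_pos)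
    qed
  qed (use nz in \<open>auto intro!: holomorphic_intros\<close>)
  have "Re (s + of_nat K) > 0" using s ab by simp
  then have "s + of_nat K \<notin> \<int>\<^sub>\<le>\<^sub>0" by (rule not_nonpos_Int_if_Re_pos)
  from MB_kernel_residue[OF this]
  have "((\<lambda>z. (z - of_nat K) * Beta (s + z) (- z) * h z) \<longlongrightarrow> - ((- s) gchoose K) * h (of_nat K)) (at (of_nat K))"
  proof (rule tendsto_mult)
    have "isCont h (of_nat K)"
    proof -
      have "open {z. a - \<delta> < Re z \<and> Re z < b + \<delta>}"
        by (simp add: open_Collect_conj open_halfspace_Re_gt open_halfspace_Re_lt)
      moreover have "of_nat K \<in> {z. a - \<delta> < Re z \<and> Re z < b + \<delta>}" using ab \<delta> by auto
      ultimately show ?thesis using holomorphic_on_imp_continuous_on[OF h] continuous_on_eq_continuous_at by blast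
    qed
    then show "(h \<longlongrightarrow> h (of_nat K)) (at (of_nat K))" by (simp add: isCont_def)
  qed
  then have lim: "((\<lambda>z. (z - of_nat K) * ?f z) \<longlongrightarrow> - ((- s) gchoose K) * h (of_nat K)) (at (of_nat K))"
    by (simp add: mult.assoc)
  obtain D N where D: "D > 0" "\<And>s' z. Re (s' + z) \<ge> Re s + a \<Longrightarrow> Re z \<le> b \<Longrightarrow> (\<And>j::nat. norm (of_nat j - z) \<ge> 1/2 * (1 + \<bar>Im z\<bar>)) \<Longrightarrow>
      norm (Beta (s' + z) (- z)) * (1 + \<bar>Im z\<bar>) ^ A \<le> D * (1 + norm s') ^ N * decay (Im z)"
    using MB_kernel_bound[of "Re s + a" "1/2" b A] s by auto
  have C0: "norm (h z) \<le> \<bar>C\<bar> * (1 + \<bar>Im z\<bar>) ^ A" if "a \<le> Re z" "Re z \<le> b" "\<bar>Im z\<bar> \<ge> T" for z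
    using hb[OF that] by (rule order_trans) (intro mult_right_mono, auto)
  have bd: "norm (?f z) \<le> (\<bar>C\<bar> * (D * (1 + norm s) ^ N)) * decay (Im z)"
    if "a \<le> Re z" "Re z \<le> b" "\<bar>Im z\<bar> \<ge> max 1 T" for z
  proof -
    have "norm (?f z) \<le> norm (Beta (s + z) (- z)) * (\<bar>C\<bar> * (1 + \<bar>Im z\<bar>) ^ A)"
      unfolding norm_mult using C0 that by (intro mult_left_mono) auto
    also have "\<dots> = \<bar>C\<bar> * (norm (Beta (s + z) (- z)) * (1 + \<bar>Im z\<bar>) ^ A)" by simp
    also have "\<dots> \<le> \<bar>C\<bar> * (D * (1 + norm s) ^ N * decay (Im z))"
      by (intro mult_left_mono D norm_nat_diff_ge_Im) (use that in auto)
    finally show ?thesis by (simp add: mult_ac)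
  qed
  note sh = vertical_line_shift[where ?z0.0 = "of_nat K" and T = "max 1 T", OF _ _ \<delta>'(1) hol lim bd]
  show "vertical_line_integrable a ?f" "vertical_line_integrable b ?f"
    using sh(1,2) ab by auto
  have "vertical_line_integral b ?f - vertical_line_integral a ?f = 2 * of_real pi * \<i> * (- ((- s) gchoose K) * h (of_nat K))"
    using ab by (intro sh(3)) auto
  then show "vertical_line_integral a ?f = vertical_line_integral b ?f + 2 * of_real pi * \<i> * (((- s) gchoose K) * h (of_nat K))"
    by (simp add: algebra_simps)
qed

lemma has_vector_derivative_quadratic:
  fixes f :: "real \<Rightarrow> complex"
  assumes "\<And>h. \<bar>h\<bar> \<le> 1 \<Longrightarrow> norm (f (u + h) - f u - h *\<^sub>R d) \<le> K * h\<^sup>2"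
  shows "(f has_vector_derivative d) (at u)"
  unfolding has_vector_derivative_def has_derivative_at
proof (intro conjI bounded_linear_scaleR_left)
  have "\<forall>\<^sub>F h in at (0::real). \<bar>h\<bar> < 1"
    using eventually_at_ball[of 1 "0::real" UNIV] by simp
  then have "\<forall>\<^sub>F h in at (0::real). norm (norm (f (u + h) - f u - h *\<^sub>R d) / norm h) \<le> K * \<bar>h\<bar>"
  proof eventually_elim
    case (elim h)
    show ?case
    proof (cases "h = 0")
      case False
      have "norm (f (u + h) - f u - h *\<^sub>R d) \<le> (K * \<bar>h\<bar>) * \<bar>h\<bar>"
        using assms[of h] elim by (simp add: power2_eq_square abs_mult_self_eq mult.assoc)
      then show ?thesis using False by (simp add: pos_divide_le_eq)
    qed simp
  qed
  moreover have "((\<lambda>h. K * \<bar>h\<bar>) \<longlongrightarrow> 0) (at (0::real))"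
    by (auto intro!: tendsto_eq_intros)
  ultimately show "((\<lambda>h. norm (f (u + h) - f u - h *\<^sub>R d) / norm h) \<longlongrightarrow> 0) (at 0)"
    by (rule Lim_null_comparison)
qed

text \<open>The Barnes integral satisfies \<open>(1 + x) I'(x) = - s I(x)\<close>, written below in the variable \<open>x = exp u\<close>;
  the constant is found by moving the line across \<open>z = 0\<close> and letting \<open>x\<close> tend to \<open>0\<close>.\<close>

lemma Mellin_Barnes_exp:
  fixes s :: complex and c u :: real
  assumes c: "c < 0" "Re s + c > 0"
  shows "vertical_line_integrable c (\<lambda>z. Beta (s + z) (- z) * exp (z * of_real u))"
    and "vertical_line_integral c (\<lambda>z. Beta (s + z) (- z) * exp (z * of_real u)) =
      2 * of_real pi * \<i> * (1 + exp (of_real u)) powr (- s)"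
proof -
  define z where "z t = Complex c t" for t
  define b where "b t = Beta (s + z t) (- z t)" for t
  have z [simp]: "Re (z t) = c" "Im (z t) = t" for t by (simp_all add: z_def)
  have contz: "continuous_on UNIV z"
    unfolding z_def by (simp add: Complex_eq continuous_intros)
  have contb: "continuous_on UNIV b"
  proof -
    have "(\<lambda>z. Beta (s + z) (- z)) holomorphic_on {z. -Re s < Re z \<and> Re z < 0}"
      by (intro holomorphic_intros; rule not_nonpos_Int_if_Re_pos) auto
    then show ?thesis unfolding b_def
      by (intro continuous_on_compose2[OF holomorphic_on_imp_continuous_on contz]) (use c in auto)
  qed
  have zlin: "norm (z t) \<le> (1 + \<bar>c\<bar>) * (1 + \<bar>t\<bar>)" for t
    using cmod_le[of "z t"] by (simp add: algebra_simps) (smt (verit) mult_nonneg_nonneg)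
  have dist: "norm (of_nat j - w) \<ge> min 1 (-c) / 2 * (1 + \<bar>Im w\<bar>)" if "Re w \<le> c" for j w
    by (rule norm_nat_diff_ge_Re) (use c that in auto)
  have mm: "min 1 (-c) / 2 > 0" using c by auto
  obtain C N where C: "C > 0" "\<And>s' w. Re (s' + w) \<ge> Re s + c \<Longrightarrow> Re w \<le> c \<Longrightarrow> (\<And>j::nat. norm (of_nat j - w) \<ge> min 1 (-c) / 2 * (1 + \<bar>Im w\<bar>)) \<Longrightarrow>
      norm (Beta (s' + w) (- w)) * (1 + \<bar>Im w\<bar>) ^ 2 \<le> C * (1 + norm s') ^ N * decay (Im w)"
    using MB_kernel_bound[OF c(2) mm, of c 2] by metis
  define C1 where "C1 = C * (1 + norm s) ^ N"
  have C1: "C1 \<ge> 0" using C by (simp add: C1_def)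
  have b2: "norm (b t) * (1 + \<bar>t\<bar>) ^ 2 \<le> C1 * decay t" for t
    using C(2)[of s "z t"] dist[of "z t"] by (simp add: b_def C1_def)
  have bp: "norm (b t) * (1 + \<bar>t\<bar>) ^ n \<le> C1 * decay t" if "n \<le> 2" for t n
    by (rule order_trans[OF mult_left_mono b2]) (use that in \<open>auto intro!: power_increasing\<close>)
  define \<Phi> where "\<Phi> u = (LINT t|lborel. b t * exp (z t * of_real u))" for u
  define \<Phi>1 where "\<Phi>1 u = (LINT t|lborel. z t * b t * exp (z t * of_real u))" for u
  have ne: "norm (exp (z t * of_real u)) = exp (c * u)" for t u by simp
  have i0: "integrable lborel (\<lambda>t. b t * exp (z t * of_real u))" for u
  proof (rule integrable_if_le_decay)
    show "(\<lambda>t. b t * exp (z t * of_real u)) \<in> borel_measurable lborel"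
      using contb contz by (intro continuous_on_imp_lborel_measurable) (auto intro!: continuous_intros)
    show "norm (b t * exp (z t * of_real u)) \<le> (C1 * exp (c * u)) * decay t" for t
      using mult_right_mono[OF bp[of 0 t], of "exp (c * u)"] by (simp add: norm_mult ne mult_ac)
  qed
  have i1: "integrable lborel (\<lambda>t. z t * b t * exp (z t * of_real u))" for u
  proof (rule integrable_if_le_decay)
    show "(\<lambda>t. z t * b t * exp (z t * of_real u)) \<in> borel_measurable lborel"
      using contb contz by (intro continuous_on_imp_lborel_measurable) (auto intro!: continuous_intros)
    fix t
    have "norm (z t) * norm (b t) \<le> ((1 + \<bar>c\<bar>) * (1 + \<bar>t\<bar>)) * norm (b t)"
      by (intro mult_right_mono zlin) auto
    also have "\<dots> = (1 + \<bar>c\<bar>) * (norm (b t) * (1 + \<bar>t\<bar>) ^ 1)" by simp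
    also have "\<dots> \<le> (1 + \<bar>c\<bar>) * (C1 * decay t)"
      by (intro mult_left_mono bp) auto
    finally show "norm (z t * b t * exp (z t * of_real u)) \<le> ((1 + \<bar>c\<bar>) * C1 * exp (c * u)) * decay t"
      using mult_right_mono[of "norm (z t) * norm (b t)" _ "exp (c * u)"] by (simp add: norm_mult ne mult_ac)
  qed
  \<comment> \<open>The Taylor remainder of \<open>exp\<close> costs a factor
    \<open>(1 + \<bar>t\<bar>)\<^sup>2\<close>, which \<open>b2\<close> holds in reserve; the
    integrated error is then quadratic in \<open>h\<close>.\<close>
  have der: "(\<Phi> has_vector_derivative \<Phi>1 u) (at u)" for u
  proof (rule has_vector_derivative_quadratic)
    fix h :: real assume h: "\<bar>h\<bar> \<le> 1"
    have eq: "\<Phi> (u + h) - \<Phi> u - h *\<^sub>R \<Phi>1 u = (LINT t|lborel. b t * exp (z t * of_real u) * (exp (z t * of_real h) - 1 - z t * of_real h))"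
    proof -
      have "\<Phi> (u + h) - \<Phi> u - of_real h * \<Phi>1 u = (LINT t|lborel. b t * exp (z t * of_real (u + h)) - b t * exp (z t * of_real u)
          - of_real h * (z t * b t * exp (z t * of_real u)))"
        unfolding \<Phi>_def \<Phi>1_def using i0[of "u + h"] i0[of u] i1[of u]
        by (simp add: Bochner_Integration.integral_diff)
      also have "\<dots> = (LINT t|lborel. b t * exp (z t * of_real u) * (exp (z t * of_real h) - 1 - z t * of_real h))"
        by (intro Bochner_Integration.integral_cong refl) (simp add: algebra_simps exp_add)
      finally show ?thesis by (simp add: scaleR_conv_of_real)
    qed
    show "norm (\<Phi> (u + h) - \<Phi> u - h *\<^sub>R \<Phi>1 u) \<le>
        (C1 * exp (c * u) * exp \<bar>c\<bar> * (1 + \<bar>c\<bar>)\<^sup>2 * (LINT t|lborel. decay t)) * h\<^sup>2"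
      unfolding eq
    proof (rule order_trans[OF integrable_if_le_decay(2)[where C = "C1 * exp (c * u) * exp \<bar>c\<bar> * (1 + \<bar>c\<bar>)\<^sup>2 * h\<^sup>2"]])
      show "(\<lambda>t. b t * exp (z t * of_real u) * (exp (z t * of_real h) - 1 - z t * of_real h)) \<in> borel_measurable lborel"
        using contb contz by (intro continuous_on_imp_lborel_measurable) (auto intro!: continuous_intros)
      fix t
      have "norm (exp (z t * of_real h) - (\<Sum>i\<le>1. (z t * of_real h) ^ i / fact i)) \<le> exp \<bar>Re (z t * of_real h)\<bar> * (norm (z t * of_real h) ^ Suc 1) / fact 1"
        by (rule Taylor_exp)
      then have "norm (exp (z t * of_real h) - 1 - z t * of_real h) \<le> exp \<bar>c * h\<bar> * (norm (z t * of_real h))\<^sup>2"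
        by (simp add: power2_eq_square algebra_simps)
      also have "\<dots> \<le> exp \<bar>c\<bar> * (((1 + \<bar>c\<bar>) * (1 + \<bar>t\<bar>)) * \<bar>h\<bar>)\<^sup>2"
      proof (intro mult_mono power_mono)
        show "exp \<bar>c * h\<bar> \<le> exp \<bar>c\<bar>" using h by (simp add: abs_mult mult_left_le)
        show "norm (z t * of_real h) \<le> ((1 + \<bar>c\<bar>) * (1 + \<bar>t\<bar>)) * \<bar>h\<bar>"
          unfolding norm_mult using zlin[of t] by (intro mult_mono) auto
      qed auto
      also have "\<dots> = exp \<bar>c\<bar> * (1 + \<bar>c\<bar>)\<^sup>2 * h\<^sup>2 * (1 + \<bar>t\<bar>)\<^sup>2"
        by (simp add: power_mult_distrib)
      finally have e: "norm (exp (z t * of_real h) - 1 - z t * of_real h) \<le> exp \<bar>c\<bar> * (1 + \<bar>c\<bar>)\<^sup>2 * h\<^sup>2 * (1 + \<bar>t\<bar>)\<^sup>2" .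
      have "norm (b t * exp (z t * of_real u) * (exp (z t * of_real h) - 1 - z t * of_real h))
         \<le> norm (b t) * exp (c * u) * (exp \<bar>c\<bar> * (1 + \<bar>c\<bar>)\<^sup>2 * h\<^sup>2 * (1 + \<bar>t\<bar>)\<^sup>2)"
        unfolding norm_mult ne by (intro mult_left_mono e) auto
      also have "\<dots> = exp (c * u) * exp \<bar>c\<bar> * (1 + \<bar>c\<bar>)\<^sup>2 * h\<^sup>2 * (norm (b t) * (1 + \<bar>t\<bar>)\<^sup>2)" by simp
      also have "\<dots> \<le> exp (c * u) * exp \<bar>c\<bar> * (1 + \<bar>c\<bar>)\<^sup>2 * h\<^sup>2 * (C1 * decay t)"
        by (intro mult_left_mono b2) auto
      finally show "norm (b t * exp (z t * of_real u) * (exp (z t * of_real h) - 1 - z t * of_real h))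
         \<le> C1 * exp (c * u) * exp \<bar>c\<bar> * (1 + \<bar>c\<bar>)\<^sup>2 * h\<^sup>2 * decay t" by (simp add: mult_ac)
    qed simp
  qed
  have ode: "(1 + exp (of_real u)) * \<Phi>1 u = - s * exp (of_real u) * \<Phi> u" for u
  proof -
    \<comment> \<open>Up to the factor \<open>s\<close> this is the integrand belonging to
      \<open>s + 1\<close>. On the line it equals \<open>s + z\<close> times the original integrand,
      and one unit further left \<open>- exp (- u) * z\<close> times the original; equality of the
      two integrals is the differential equation.\<close>
    define k where "k w = s * Beta ((s + 1) + w) (- w) * exp (w * of_real u)" for w
    have k: "k w = (s + w) * Beta (s + w) (- w) * exp (w * of_real u)" if "s + w \<notin> \<int>\<^sub>\<le>\<^sub>0" for w
    proof -
      have "s * Beta ((s + 1) + w) (- w) = Gamma (s + w + 1) * Gamma (- w) * (s * rGamma (s + 1))"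
        by (simp add: Beta_altdef add_ac mult_ac)
      also have "Gamma (s + w + 1) = (s + w) * Gamma (s + w)" by (rule Gamma_plus1[OF that])
      also have "s * rGamma (s + 1) = rGamma s" by (rule rGamma_plus1)
      finally show ?thesis by (simp add: k_def Beta_altdef mult_ac)
    qed
    note npi = not_nonpos_Int_if_Re_pos
    define \<delta> where "\<delta> = min (Re s + c) (-c) / 2"
    have \<delta>: "\<delta> > 0" "c - 1 - \<delta> > - Re s - 1" "c + \<delta> < 0" using c by (auto simp: \<delta>_def min_def field_simps)
    have hol: "k holomorphic_on {w. (c - 1) - \<delta> < Re w \<and> Re w < c + \<delta>}"
      unfolding k_def
      by (intro holomorphic_intros; rule npi; use \<delta> in auto)
    \<comment> \<open>No pole lies between the two lines; the shift is applied at their regular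
      midpoint with residue \<open>0\<close>.\<close>
    have "vertical_line_integral c k - vertical_line_integral (c - 1) k = 2 * of_real pi * \<i> * 0"
    proof (rule vertical_line_shift(3)[where ?z0.0 = "of_real (c - 1/2)" and T = 0 and \<delta> = \<delta>
          and C = "norm s * (C * (1 + norm (s + 1)) ^ N) * max (exp (c * u)) (exp ((c - 1) * u))"])
      show "k holomorphic_on {z. c - 1 - \<delta> < Re z \<and> Re z < c + \<delta>} - {complex_of_real (c - 1/2)}"
        by (rule holomorphic_on_subset[OF hol]) auto
      have "isCont k (of_real (c - 1/2))"
      proof -
        have "open {w. (c - 1) - \<delta> < Re w \<and> Re w < c + \<delta>}"
          by (simp add: open_Collect_conj open_halfspace_Re_gt open_halfspace_Re_lt)
        moreover have "of_real (c - 1/2) \<in> {w. (c - 1) - \<delta> < Re w \<and> Re w < c + \<delta>}" using \<delta> by auto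
        ultimately show ?thesis using holomorphic_on_imp_continuous_on[OF hol] continuous_on_eq_continuous_at by blast
      qed
      then have "((\<lambda>z. (z - of_real (c - 1/2)) * k z) \<longlongrightarrow> (of_real (c - 1/2) - of_real (c - 1/2)) * k (of_real (c - 1/2))) (at (of_real (c - 1/2)))"
        unfolding isCont_def by (intro tendsto_intros)
      then show "((\<lambda>z. (z - of_real (c - 1/2)) * k z) \<longlongrightarrow> 0) (at (of_real (c - 1/2)))" by simp
      fix w assume w: "c - 1 \<le> Re w" "Re w \<le> c"
      have "norm (Beta ((s + 1) + w) (- w)) \<le> norm (Beta ((s + 1) + w) (- w)) * (1 + \<bar>Im w\<bar>) ^ 2"
        using mult_left_mono[of 1 "(1 + \<bar>Im w\<bar>) ^ 2" "norm (Beta ((s + 1) + w) (- w))"] by simp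
      also have "\<dots> \<le> C * (1 + norm (s + 1)) ^ N * decay (Im w)"
        by (rule C(2)) (use w dist in auto)
      finally have 1: "norm (Beta ((s + 1) + w) (- w)) \<le> C * (1 + norm (s + 1)) ^ N * decay (Im w)" .
      have 2: "exp (Re w * u) \<le> max (exp (c * u)) (exp ((c - 1) * u))"
      proof (cases "u \<ge> 0")
        case True
        then have "exp (Re w * u) \<le> exp (c * u)" using w by (simp add: mult_right_mono)
        then show ?thesis by (simp only: le_max_iff_disj simp_thms)
      next
        case False
        then have "exp (Re w * u) \<le> exp ((c - 1) * u)" using w by (simp add: mult_right_mono_neg)
        then show ?thesis by (simp only: le_max_iff_disj simp_thms)
      qed
      have "norm (k w) = norm s * norm (Beta ((s + 1) + w) (- w)) * exp (Re w * u)"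
        by (simp add: k_def norm_mult)
      also have "\<dots> \<le> norm s * (C * (1 + norm (s + 1)) ^ N * decay (Im w)) * max (exp (c * u)) (exp ((c - 1) * u))"
        using C by (intro mult_mono 1 2) (auto simp: le_max_iff_disj)
      finally show "norm (k w) \<le> norm s * (C * (1 + norm (s + 1)) ^ N) * max (exp (c * u)) (exp ((c - 1) * u)) * decay (Im w)"
        by (simp only: mult_ac)
    qed (use \<delta> in auto)
    then have sh: "(LINT t|lborel. k (Complex (c - 1) t)) = (LINT t|lborel. k (Complex c t))"
      by (simp add: vertical_line_integral_def)
    have kz1: "k (z t - 1) = - exp (- of_real u) * (z t * b t * exp (z t * of_real u))" for t
    proof -
      have "k (z t - 1) = s * Beta (s + z t) (- z t + 1) * exp (z t * of_real u - of_real u)"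
        by (simp add: k_def algebra_simps)
      also have "s * Beta (s + z t) (- z t + 1) = - z t * Beta (s + z t) (- z t)"
        using Beta_plus1_right[of "- z t" "s + z t"] npi[of "- z t"] c by simp
      also have "exp (z t * of_real u - of_real u) = exp (- of_real u) * exp (z t * of_real u)"
        by (simp add: exp_diff exp_minus field_simps)
      finally show ?thesis by (simp add: b_def)
    qed
    have kz: "k (z t) = (s * b t + z t * b t) * exp (z t * of_real u)" for t
      using k[of "z t"] npi[of "s + z t"] c by (simp add: b_def algebra_simps)
    have "Complex (c - 1) t = z t - 1" for t by (simp add: z_def complex_eq_iff)
    then have "(LINT t|lborel. k (Complex (c - 1) t)) = - exp (- of_real u) * \<Phi>1 u"
      unfolding \<Phi>1_def by (simp only: kz1 integral_mult_right_zero)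
    moreover have "(LINT t|lborel. k (Complex c t)) = s * \<Phi> u + \<Phi>1 u"
    proof -
      have "(LINT t|lborel. k (Complex c t)) = (LINT t|lborel. s * (b t * exp (z t * of_real u)) + z t * b t * exp (z t * of_real u))"
        unfolding z_def[symmetric] kz by (simp add: algebra_simps)
      also have "\<dots> = s * \<Phi> u + \<Phi>1 u" unfolding \<Phi>_def \<Phi>1_def using i0 i1 by simp
      finally show ?thesis .
    qed
    ultimately have "- exp (- of_real u) * \<Phi>1 u = s * \<Phi> u + \<Phi>1 u" using sh by simp
    then have "exp (of_real u) * (- exp (- of_real u) * \<Phi>1 u) = exp (of_real u) * (s * \<Phi> u + \<Phi>1 u)" by simp
    moreover have "exp (of_real u) * (- exp (- of_real u) * \<Phi>1 u) = - \<Phi>1 u"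
      by (simp add: exp_minus)
    ultimately show ?thesis by (simp add: algebra_simps) (metis add_eq_0_iff add.commute minus_add_cancel)
  qed
  \<comment> \<open>Multiplication by the integrating factor of the differential equation makes this
    function constant.\<close>
  define \<Psi> where "\<Psi> u = (1 + exp (of_real u)) powr s * \<Phi> u" for u :: real
  have ex: "1 + exp (complex_of_real u) = of_real (1 + exp u)" "1 + exp u > 0" for u :: real
    by (auto simp: exp_of_real intro: add_pos_pos)
  have nn: "1 + exp (complex_of_real u) \<notin> \<real>\<^sub>\<le>\<^sub>0" "1 + exp (complex_of_real u) \<noteq> 0" for u :: real
    using ex(2)[of u] unfolding ex(1) by (auto simp: complex_nonpos_Reals_iff simp del: of_real_add)
  have "(\<Psi> has_vector_derivative 0) (at u)" for u
  proof -
    have 1: "((\<lambda>u. (1 + exp (complex_of_real u)) powr s) has_vector_derivative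
        (s * (1 + exp (of_real u)) powr (s - 1) * exp (of_real u))) (at u)"
    proof (rule has_vector_derivative_real_field)
      show "((\<lambda>u. (1 + exp u) powr s) has_field_derivative s * (1 + exp (complex_of_real u)) powr (s - 1) * exp (of_real u)) (at (of_real u))"
        using nn by (auto intro!: derivative_eq_intros simp: powr_diff)
    qed
    have 2: "(\<Psi> has_vector_derivative
        ((1 + exp (of_real u)) powr s * \<Phi>1 u + s * (1 + exp (of_real u)) powr (s - 1) * exp (of_real u) * \<Phi> u)) (at u)"
      unfolding \<Psi>_def by (rule has_vector_derivative_mult[OF 1 der])
    have "(1 + exp (complex_of_real u)) powr s = (1 + exp (complex_of_real u)) powr (s - 1) * (1 + exp (complex_of_real u))"
      using nn(2) by (simp add: powr_diff)
    then have "(1 + exp (of_real u)) powr s * \<Phi>1 u + s * (1 + exp (of_real u)) powr (s - 1) * exp (of_real u) * \<Phi> u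
        = (1 + exp (of_real u)) powr (s - 1) * ((1 + exp (of_real u)) * \<Phi>1 u + s * exp (of_real u) * \<Phi> u)"
      by (simp add: algebra_simps)
    also have "\<dots> = 0" unfolding ode by simp
    finally show ?thesis using 2 by simp
  qed
  then obtain k where k: "\<Psi> u = k" for u
    using has_vector_derivative_zero_constant[of UNIV \<Psi>] by auto
  \<comment> \<open>Between the poles \<open>0\<close> and \<open>1\<close> the integral is of order
    \<open>exp (u / 2)\<close> and disappears as \<open>u\<close> tends to minus infinity. Only the
    residue at \<open>0\<close> survives there, and it fixes the constant.\<close>
  obtain B where B: "norm (vertical_line_integral (1/2) (\<lambda>z. Beta (s + z) (- z) * exp (z * of_real u))) \<le> B * exp (u / 2)" for u
  proof -
    have a: "Re s + 1/2 > 0" using c by simp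
    obtain C N where C: "C > 0" "\<And>s' w. Re (s' + w) \<ge> Re s + 1/2 \<Longrightarrow> Re w \<le> 1/2 \<Longrightarrow> (\<And>j::nat. norm (of_nat j - w) \<ge> 1 / 4 * (1 + \<bar>Im w\<bar>)) \<Longrightarrow>
      norm (Beta (s' + w) (- w)) * (1 + \<bar>Im w\<bar>) ^ 0 \<le> C * (1 + norm s') ^ N * decay (Im w)"
      using MB_kernel_bound[OF a, of "1/4" "1/2" 0] by auto
    have d: "norm (of_nat j - Complex (1/2) t) \<ge> 1 / 4 * (1 + \<bar>Im (Complex (1/2) t)\<bar>)" for j t
      using norm_nat_diff_ge_Re[of "1/2" j "Complex (1/2) t"] by (cases "j = 0") auto
    have hol: "(\<lambda>z. Beta (s + z) (- z)) holomorphic_on {z. 0 < Re z \<and> Re z < 1}"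
    proof (intro holomorphic_intros)
      fix z assume z: "z \<in> {z. 0 < Re z \<and> Re z < 1}"
      show "s + z \<notin> \<int>\<^sub>\<le>\<^sub>0" using z c by (intro not_nonpos_Int_if_Re_pos) auto
      show "- z \<notin> \<int>\<^sub>\<le>\<^sub>0"
      proof
        assume "- z \<in> \<int>\<^sub>\<le>\<^sub>0"
        then obtain n where "z = of_nat n" by (auto elim!: nonpos_Ints_cases' simp: minus_equation_iff)
        with z show False by auto
      qed
    qed
    have "norm (vertical_line_integral (1/2) (\<lambda>z. Beta (s + z) (- z) * exp (z * of_real u))) \<le> (C * (1 + norm s) ^ N * (LINT t|lborel. decay t)) * exp (u / 2)" for u
    proof -
      have "norm (LINT t|lborel. Beta (s + Complex (1/2) t) (- Complex (1/2) t) * exp (Complex (1/2) t * of_real u))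
        \<le> (C * (1 + norm s) ^ N * exp (u / 2)) * (LINT t|lborel. decay t)"
      proof (rule integrable_if_le_decay(2))
        have cz: "continuous_on UNIV (\<lambda>t. Complex (1/2) t)" by (simp add: Complex_eq continuous_intros)
        have "continuous_on UNIV (\<lambda>t. Beta (s + Complex (1/2) t) (- Complex (1/2) t))"
          by (rule continuous_on_compose2[OF holomorphic_on_imp_continuous_on[OF hol] cz]) auto
        then show "(\<lambda>t. Beta (s + Complex (1/2) t) (- Complex (1/2) t) * exp (Complex (1/2) t * of_real u)) \<in> borel_measurable lborel"
          using cz by (intro continuous_on_imp_lborel_measurable) (auto intro!: continuous_intros)
        fix t
        have "norm (Beta (s + Complex (1/2) t) (- Complex (1/2) t)) \<le> C * (1 + norm s) ^ N * decay t"
          using C(2)[of s "Complex (1/2) t"] d by simp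
        from mult_right_mono[OF this, of "exp (u/2)"]
        show "norm (Beta (s + Complex (1/2) t) (- Complex (1/2) t) * exp (Complex (1/2) t * of_real u)) \<le> C * (1 + norm s) ^ N * exp (u / 2) * decay t"
          by (simp add: norm_mult mult_ac)
      qed
      then show ?thesis by (simp add: vertical_line_integral_def norm_mult mult_ac)
    qed
    then show ?thesis using that by blast
  qed
  have shift: "\<i> * \<Phi> u = vertical_line_integral (1/2) (\<lambda>z. Beta (s + z) (- z) * exp (z * of_real u)) + 2 * of_real pi * \<i>" for u
  proof -
    have "vertical_line_integral c (\<lambda>z. Beta (s + z) (- z) * exp (z * of_real u)) =
        vertical_line_integral (1/2) (\<lambda>z. Beta (s + z) (- z) * exp (z * of_real u)) + 2 * of_real pi * \<i> * (((- s) gchoose 0) * exp (of_nat 0 * of_real u))"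
    proof (rule MB_shift(3)[where \<delta> = 1 and T = 0 and A = 0 and C = "max (exp (c * u)) (exp (1/2 * u))"])
      fix w assume w: "c \<le> Re w" "Re w \<le> 1/2"
      have "exp (Re w * u) \<le> max (exp (c * u)) (exp (1/2 * u))"
      proof (cases "u \<ge> 0")
        case True
        then have "exp (Re w * u) \<le> exp (1/2 * u)" using mult_right_mono[OF w(2) True] by simp
        then show ?thesis by (simp only: le_max_iff_disj simp_thms)
      next
        case False
        then have "exp (Re w * u) \<le> exp (c * u)" using w by (simp add: mult_right_mono_neg)
        then show ?thesis by (simp only: le_max_iff_disj simp_thms)
      qed
      then show "norm (exp (w * of_real u)) \<le> max (exp (c * u)) (exp (1/2 * u)) * (1 + \<bar>Im w\<bar>) ^ 0" by simp
    qed (use c in \<open>auto intro!: holomorphic_intros\<close>)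
    then show ?thesis by (simp add: \<Phi>_def b_def z_def vertical_line_integral_def)
  qed
  have "((\<lambda>u. \<Psi> u) \<longlongrightarrow> 1 * (2 * of_real pi)) at_bot"
    unfolding \<Psi>_def
  proof (rule tendsto_mult)
    have e0: "((\<lambda>u. exp (complex_of_real u)) \<longlongrightarrow> 0) at_bot"
      unfolding tendsto_norm_zero_iff[symmetric, of "\<lambda>u. exp (complex_of_real u)"] norm_exp_eq_Re
      using exp_at_bot by simp
    have "((\<lambda>u. (1 + exp (complex_of_real u)) powr s) \<longlongrightarrow> (1 + 0) powr s) at_bot"
      by (intro tendsto_powr_complex tendsto_add e0 tendsto_const) auto
    then show "((\<lambda>u. (1 + exp (complex_of_real u)) powr s) \<longlongrightarrow> 1) at_bot" by simp
    have "((\<lambda>u. vertical_line_integral (1/2) (\<lambda>z. Beta (s + z) (- z) * exp (z * of_real u))) \<longlongrightarrow> 0) at_bot"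
    proof (rule Lim_null_comparison)
      show "\<forall>\<^sub>F u in at_bot. norm (vertical_line_integral (1/2) (\<lambda>z. Beta (s + z) (- z) * exp (z * of_real u))) \<le> B * exp (u / 2)"
        using B by simp
      show "((\<lambda>u. B * exp (u / 2)) \<longlongrightarrow> 0) at_bot" by real_asymp
    qed
    then have "((\<lambda>u. - \<i> * (vertical_line_integral (1/2) (\<lambda>z. Beta (s + z) (- z) * exp (z * of_real u)) + 2 * of_real pi * \<i>)) \<longlongrightarrow>
        - \<i> * (0 + 2 * of_real pi * \<i>)) at_bot"
      by (intro tendsto_intros)
    then show "(\<Phi> \<longlongrightarrow> 2 * of_real pi) at_bot"
      unfolding shift[symmetric] by (simp add: algebra_simps)
  qed
  then have "k = 2 * of_real pi" unfolding k by (simp add: tendsto_const_iff)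
  then have "\<Psi> u = 2 * of_real pi" using k by simp
  then have "\<Phi> u = 2 * of_real pi * (1 + exp (of_real u)) powr (- s)"
    using nn(2)[of u] by (simp add: \<Psi>_def powr_minus field_simps)
  then show "vertical_line_integral c (\<lambda>z. Beta (s + z) (- z) * exp (z * of_real u)) =
      2 * of_real pi * \<i> * (1 + exp (of_real u)) powr (- s)"
    by (simp add: \<Phi>_def b_def z_def vertical_line_integral_def)
  show "vertical_line_integrable c (\<lambda>z. Beta (s + z) (- z) * exp (z * of_real u))"
    using i0[of u] by (simp add: vertical_line_integrable_def b_def z_def)
qed

lemma Mellin_Barnes:
  fixes s :: complex and c x :: real
  assumes c: "c < 0" "Re s + c > 0" and x: "x > 0"
  shows "vertical_line_integral c (\<lambda>z. Beta (s + z) (- z) * of_real x powr z) =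
      2 * of_real pi * \<i> * of_real (1 + x) powr (- s)"
  using Mellin_Barnes_exp(2)[OF c, of "ln x"] x
  by (simp add: powr_def Ln_of_real exp_of_real mult.commute)

text \<open>Each pole crossed removes one term of the binomial expansion, so the line between
  \<open>K - 1\<close> and \<open>K\<close> represents the Taylor remainder. Unlike the expansion,
  this needs no restriction to \<open>x < 1\<close>.\<close>

lemma Mellin_Barnes_remainder:
  fixes s :: complex and \<epsilon> x :: real and K :: nat
  assumes s: "Re s > 0" and x: "x > 0" and \<epsilon>: "0 < \<epsilon>" "\<epsilon> < 1" and K: "K \<ge> 1"
  shows "vertical_line_integral (real K - \<epsilon>) (\<lambda>z. Beta (s + z) (- z) * of_real x powr z) =
      2 * of_real pi * \<i> * (of_real (1 + x) powr (- s) - (\<Sum>k<K. ((- s) gchoose k) * of_real x ^ k))"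
  using K
proof (induction K rule: nat_induct_at_least)
  let ?h = "\<lambda>z. complex_of_real x powr z"
  let ?f = "\<lambda>z. Beta (s + z) (- z) * complex_of_real x powr z"
  have hol: "?h holomorphic_on A" for A using x by (intro holomorphic_intros) auto
  have pk: "?h (of_nat k) = of_real x ^ k" for k
    using x by (simp add: powr_nat')
  have hb: "norm (?h z) \<le> max (x powr a) (x powr b) * (1 + \<bar>Im z\<bar>) ^ 0" if "a \<le> Re z" "Re z \<le> b" for a b z
  proof (cases "x \<ge> 1")
    case True
    then have "x powr Re z \<le> x powr b" using that by (intro powr_mono) auto
    then show ?thesis using x by (simp add: norm_of_real_powr)
  next
    case False
    then have "x powr Re z \<le> x powr a" using that x by (intro powr_mono') auto
    then show ?thesis using x by (simp add: norm_of_real_powr)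
  qed
  {
    case base
    \<comment> \<open>Any abscissa between \<open>- Re s\<close> and \<open>0\<close> would serve as
      the starting line.\<close>
    define c where "c = - Re s / 2"
    have c: "c < 0" "Re s + c > 0" using s by (auto simp: c_def)
    have "vertical_line_integral c ?f = vertical_line_integral (1 - \<epsilon>) ?f + 2 * of_real pi * \<i> * (((- s) gchoose 0) * ?h (of_nat 0))"
      by (rule MB_shift(3)[where \<delta> = 1, OF _ _ _ _ _ _ hol hb]) (use c \<epsilon> in auto)
    with Mellin_Barnes[OF c x] x show ?case by (simp add: algebra_simps)
  next
    case (Suc K)
    have "vertical_line_integral (real K - \<epsilon>) ?f = vertical_line_integral (real (Suc K) - \<epsilon>) ?f + 2 * of_real pi * \<i> * (((- s) gchoose K) * ?h (of_nat K))"
      by (rule MB_shift(3)[where \<delta> = 1, OF _ _ _ _ _ _ hol hb]) (use s Suc \<epsilon> in auto)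
    with Suc.IH show ?case by (simp add: pk algebra_simps)
  }
qed

section \<open>Polynomial bounds for the Riemann zeta function\<close>

lemma infsum_eq_LINT_count_space:
  fixes f :: "'i \<Rightarrow> complex"
  assumes "(\<lambda>i. norm (f i)) summable_on A"
  shows "infsum f A = (LINT i|count_space A. f i)"
proof -
  have "Infinite_Set_Sum.abs_summable_on f A" using assms abs_summable_equivalent by blast
  from infsetsum_infsum[OF this] show ?thesis by (simp add: infsetsum_def)
qed

lemma integrable_count_space_summable_on:
  fixes g :: "'i \<Rightarrow> real"
  assumes "g summable_on A"
  shows "integrable (count_space A) g"
proof -
  have "(\<lambda>i. norm (g i)) summable_on A" using assms summable_on_iff_abs_summable_on_real by blast
  then have "Infinite_Set_Sum.abs_summable_on g A" using abs_summable_equivalent by blast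
  then show ?thesis by (simp add: Infinite_Set_Sum.abs_summable_on_def)
qed

lemma summable_on_norm_le:
  fixes f :: "'i \<Rightarrow> complex"
  assumes "g summable_on A" "\<And>i. i \<in> A \<Longrightarrow> norm (f i) \<le> g i"
  shows "(\<lambda>i. norm (f i)) summable_on A" "f summable_on A" "norm (infsum f A) \<le> infsum g A"
proof -
  show 1: "(\<lambda>i. norm (f i)) summable_on A" by (rule Infinite_Sum.abs_summable_on_comparison_test'[OF assms])
  then show "f summable_on A" by (rule abs_summable_summable)
  have "norm (infsum f A) \<le> infsum (\<lambda>i. norm (f i)) A" by (rule norm_infsum_bound) (use 1 in auto)
  also have "\<dots> \<le> infsum g A" by (rule infsum_mono[OF 1 assms])
  finally show "norm (infsum f A) \<le> infsum g A" .
qed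

lemma holomorphic_on_infsum:
  fixes f :: "complex \<Rightarrow> 'i \<Rightarrow> complex"
  assumes "open U" "\<And>i. i \<in> A \<Longrightarrow> (\<lambda>s. f s i) holomorphic_on U"
    and dom: "\<And>s0. s0 \<in> U \<Longrightarrow> \<exists>r>0. \<exists>g. g summable_on A \<and> (\<forall>s\<in>cball s0 r \<inter> U. \<forall>i\<in>A. norm (f s i) \<le> g i)"
  shows "(\<lambda>s. \<Sum>\<^sub>\<infinity>i\<in>A. f s i) holomorphic_on U"
proof -
  have "(\<lambda>s. LINT i|count_space A. f s i) holomorphic_on U"
  proof (rule holomorphic_on_LINT)
    fix s0 assume "s0 \<in> U"
    from dom[OF this] obtain r g where "r > 0" "g summable_on A" "\<forall>s\<in>cball s0 r \<inter> U. \<forall>i\<in>A. norm (f s i) \<le> g i"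
      by auto
    then show "\<exists>r>0. \<exists>g. integrable (count_space A) g \<and> (\<forall>s\<in>cball s0 r \<inter> U. \<forall>t\<in>space (count_space A). norm (f s t) \<le> g t)"
      by (intro exI[of _ r] exI[of _ g]) (auto intro: integrable_count_space_summable_on)
  qed (use assms in auto)
  moreover have "(\<Sum>\<^sub>\<infinity>i\<in>A. f s i) = (LINT i|count_space A. f s i)" if s: "s \<in> U" for s
  proof -
    from dom[OF s] obtain r g where "r > 0" "g summable_on A" "\<forall>s\<in>cball s r \<inter> U. \<forall>i\<in>A. norm (f s i) \<le> g i"
      by auto
    then show ?thesis using s by (intro infsum_eq_LINT_count_space summable_on_norm_le(1)[of g]) auto
  qed
  ultimately show ?thesis by (metis (mono_tags, lifting) holomorphic_transform)
qed

lemma continuous_on_infsum: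
  fixes f :: "'a::first_countable_topology \<Rightarrow> 'i \<Rightarrow> complex"
  assumes "\<And>i. i \<in> A \<Longrightarrow> continuous_on U (\<lambda>s. f s i)"
    and "\<And>s i. s \<in> U \<Longrightarrow> i \<in> A \<Longrightarrow> norm (f s i) \<le> g i" and g: "g summable_on A"
  shows "continuous_on U (\<lambda>s. \<Sum>\<^sub>\<infinity>i\<in>A. f s i)"
proof -
  have "continuous_on U (\<lambda>s. LINT i|count_space A. f s i)"
    by (rule continuous_on_LINT[where g = g]) (use assms integrable_count_space_summable_on[OF g] in auto)
  moreover have "(\<Sum>\<^sub>\<infinity>i\<in>A. f s i) = (LINT i|count_space A. f s i)" if "s \<in> U" for s
    using assms that by (intro infsum_eq_LINT_count_space summable_on_norm_le(1)[OF g]) auto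
  ultimately show ?thesis by (simp cong: continuous_on_cong)
qed

lemma norm_of_nat_powr: "n \<ge> 1 \<Longrightarrow> norm (of_nat n powr z :: complex) = real n powr Re z"
  using norm_of_real_powr[of "real n" z] by simp

lemma summable_on_real_powr:
  assumes "\<sigma> > 1" shows "(\<lambda>n. real n powr (- \<sigma>)) summable_on {1..}"
proof -
  have "summable (\<lambda>n. real n powr (- \<sigma>))" using assms by (simp add: summable_real_powr_iff)
  then have "(\<lambda>n. real n powr (- \<sigma>)) summable_on UNIV"
    by (subst summable_on_UNIV_nonneg_real_iff) auto
  then show ?thesis by (rule summable_on_subset_banach) auto
qed

lemma one_plus_norm_diff_1_le: "1 + norm (s - 1 :: complex) \<le> 2 * (1 + norm s)"
proof -
  have "norm (s - 1) \<le> norm s + 1" using norm_triangle_ineq4[of s 1] by simp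
  also have "\<dots> \<le> 2 * norm s + 1" by simp
  finally show ?thesis by simp
qed

lemma has_sum_finite_sum:
  fixes f :: "'j \<Rightarrow> 'i \<Rightarrow> complex"
  assumes "\<And>j. j \<in> I \<Longrightarrow> (f j has_sum g j) A"
  shows "((\<lambda>i. \<Sum>j\<in>I. f j i) has_sum (\<Sum>j\<in>I. g j)) A"
  using assms by (induction I rule: infinite_finite_induct) (auto intro: has_sum_add has_sum_0)

text \<open>Taylor's formula for \<open>(1 + w) powr (- s)\<close> on the real unit segment: the
  \<open>K\<close>-th derivative is a Pochhammer symbol, polynomial in \<open>s\<close>, times a
  power of \<open>1 + w\<close> that stays below \<open>2 powr \<bar>R\<bar>\<close> because
  \<open>1 + w\<close> lies between \<open>1\<close> and \<open>2\<close>.\<close>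

lemma binomial_remainder_bound:
  fixes R :: real and K :: nat
  assumes K: "K \<ge> 1"
  obtains C N where "C > 0" "\<And>s x. Re s \<ge> - R \<Longrightarrow> 0 \<le> x \<Longrightarrow> x \<le> 1 \<Longrightarrow>
     norm (of_real (1 + x) powr (- s) - (\<Sum>k<K. ((- s) gchoose k) * of_real x ^ k)) \<le> C * (1 + norm s) ^ N * x ^ K"
proof -
  define C where "C = (1 + real K) ^ K * 2 powr \<bar>R\<bar>"
  show ?thesis
  proof (rule that[of C K])
    show "C > 0" by (simp add: C_def)
    fix s :: complex and x :: real assume s: "Re s \<ge> - R" and x: "0 \<le> x" "x \<le> 1"
    define f where "f i w = (-1) ^ i * pochhammer s i * (1 + w) powr (- s - of_nat i)" for i w
    define S where "S = complex_of_real ` {0..1}"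
    have S: "convex S" unfolding S_def
      by (intro convex_linear_image) (auto intro: bounded_linear.linear bounded_linear_of_real)
    have npr: "1 + w \<notin> \<real>\<^sub>\<le>\<^sub>0" if "w \<in> S" for w
      using that by (auto simp: S_def complex_nonpos_Reals_iff)
    \<comment> \<open>The order in \<open>complex_Taylor\<close> is that of the last term kept,
      hence \<open>K - 1\<close> for a sum over \<open>k < K\<close>.\<close>
    have "norm (f 0 (of_real x) - (\<Sum>i\<le>K-1. f i 0 * (of_real x - 0) ^ i / fact i)) \<le> C * (1 + norm s) ^ K * norm (of_real x - 0 :: complex) ^ Suc (K-1) / fact (K-1)"
    proof (rule complex_Taylor[OF S])
      fix i w assume w: "w \<in> S"
      show "(f i has_field_derivative f (Suc i) w) (at w within S)"
      proof -
        define c where "c = - s - of_nat i"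
        have "((\<lambda>w. (1 + w) powr c) has_field_derivative c * (1 + w) powr (c - 1) * 1) (at w within S)"
          by (rule DERIV_chain2[where g = "\<lambda>w. 1 + w" and f = "\<lambda>w. w powr c", OF has_field_derivative_powr[OF npr[OF w]]])
             (auto intro!: derivative_eq_intros)
        from DERIV_cmult[OF this, of "(-1) ^ i * pochhammer s i"]
        have "(f i has_field_derivative (-1) ^ i * pochhammer s i * (c * (1 + w) powr (c - 1) * 1)) (at w within S)"
          by (simp add: f_def[abs_def] c_def)
        also have "(-1) ^ i * pochhammer s i * (c * (1 + w) powr (c - 1) * 1) = f (Suc i) w"
          by (simp add: f_def c_def pochhammer_Suc algebra_simps)
        finally show ?thesis .
      qed
    next
      fix w assume "w \<in> S"
      then obtain y where y: "w = of_real y" "0 \<le> y" "y \<le> 1" by (auto simp: S_def)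
      have "norm (f K w) = norm (pochhammer s K) * (1 + y) powr (- Re s - real K)"
        using y norm_of_real_powr[of "1 + y" "- s - of_nat K"] by (simp add: f_def norm_mult norm_power)
      also have "\<dots> \<le> (norm s + real K) ^ K * 2 powr \<bar>R\<bar>"
      proof (intro mult_mono norm_pochhammer_le)
        have "(1 + y) powr (- Re s - real K) \<le> (1 + y) powr \<bar>R\<bar>" using y s by (intro powr_mono) auto
        also have "\<dots> \<le> 2 powr \<bar>R\<bar>" using y by (intro powr_mono2) auto
        finally show "(1 + y) powr (- Re s - real K) \<le> 2 powr \<bar>R\<bar>" .
      qed auto
      also have "\<dots> \<le> ((1 + real K) * (1 + norm s)) ^ K * 2 powr \<bar>R\<bar>"
        by (intro mult_right_mono power_mono) (auto simp: algebra_simps)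
      also have "\<dots> = C * (1 + norm s) ^ K" by (simp add: C_def power_mult_distrib)
      finally show "norm (f (Suc (K-1)) w) \<le> C * (1 + norm s) ^ K" using K by simp
    qed (use x in \<open>auto simp: S_def\<close>)
    also have "(\<Sum>i\<le>K-1. f i 0 * (of_real x - 0) ^ i / fact i) = (\<Sum>k<K. ((- s) gchoose k) * of_real x ^ k)"
      using K by (intro sum.cong) (auto simp: f_def gbinomial_pochhammer)
    also have "f 0 (of_real x) = of_real (1 + x) powr (- s)" by (simp add: f_def)
    finally have "norm (of_real (1 + x) powr (- s) - (\<Sum>k<K. ((- s) gchoose k) * of_real x ^ k)) \<le> C * (1 + norm s) ^ K * x ^ K / fact (K - 1)"
      using K x by simp
    also have "\<dots> \<le> C * (1 + norm s) ^ K * x ^ K / 1"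
      using x by (intro divide_left_mono) (auto simp: C_def)
    finally show "norm (of_real (1 + x) powr (- s) - (\<Sum>k<K. ((- s) gchoose k) * of_real x ^ k)) \<le> C * (1 + norm s) ^ K * x ^ K"
      by simp
  qed
qed

definition poly_bounded_on_halfplane :: "real \<Rightarrow> (complex \<Rightarrow> complex) \<Rightarrow> bool" where
  "poly_bounded_on_halfplane a f \<longleftrightarrow> (\<exists>C N. C \<ge> 0 \<and> (\<forall>s. Re s \<ge> a \<longrightarrow> norm (f s) \<le> C * (1 + norm s) ^ N))"

lemma poly_bounded_const: "poly_bounded_on_halfplane a (\<lambda>_. c)"
  unfolding poly_bounded_on_halfplane_def by (intro exI[of _ "norm c"] exI[of _ 0]) auto

lemma poly_bounded_add:
  assumes "poly_bounded_on_halfplane a f" "poly_bounded_on_halfplane a g"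
  shows "poly_bounded_on_halfplane a (\<lambda>s. f s + g s)"
proof -
  obtain C N D M where *: "C \<ge> 0" "D \<ge> 0" "\<And>s. Re s \<ge> a \<Longrightarrow> norm (f s) \<le> C * (1 + norm s) ^ N"
     "\<And>s. Re s \<ge> a \<Longrightarrow> norm (g s) \<le> D * (1 + norm s) ^ M"
    using assms unfolding poly_bounded_on_halfplane_def by metis
  have "norm (f s + g s) \<le> (C + D) * (1 + norm s) ^ (N + M)" if "Re s \<ge> a" for s
  proof -
    have "norm (f s + g s) \<le> C * (1 + norm s) ^ N + D * (1 + norm s) ^ M"
      using *(3)[OF that] *(4)[OF that] norm_triangle_ineq[of "f s" "g s"] by linarith
    also have "\<dots> \<le> C * (1 + norm s) ^ (N + M) + D * (1 + norm s) ^ (N + M)"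
      using * by (intro add_mono mult_left_mono power_increasing) auto
    finally show ?thesis by (simp add: algebra_simps)
  qed
  then show ?thesis unfolding poly_bounded_on_halfplane_def using * by (intro exI[of _ "C + D"] exI[of _ "N + M"]) auto
qed

lemma poly_bounded_mult:
  assumes "poly_bounded_on_halfplane a f" "poly_bounded_on_halfplane a g"
  shows "poly_bounded_on_halfplane a (\<lambda>s. f s * g s)"
proof -
  obtain C N D M where *: "C \<ge> 0" "D \<ge> 0" "\<And>s. Re s \<ge> a \<Longrightarrow> norm (f s) \<le> C * (1 + norm s) ^ N"
     "\<And>s. Re s \<ge> a \<Longrightarrow> norm (g s) \<le> D * (1 + norm s) ^ M"
    using assms unfolding poly_bounded_on_halfplane_def by metis
  have "norm (f s * g s) \<le> (C * D) * (1 + norm s) ^ (N + M)" if "Re s \<ge> a" for s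
  proof -
    have "norm (f s * g s) \<le> (C * (1 + norm s) ^ N) * (D * (1 + norm s) ^ M)"
      unfolding norm_mult using *(3)[OF that] *(4)[OF that] * by (intro mult_mono) auto
    then show ?thesis by (simp add: power_add mult_ac)
  qed
  then show ?thesis unfolding poly_bounded_on_halfplane_def using * by (intro exI[of _ "C * D"] exI[of _ "N + M"]) auto
qed

lemma poly_bounded_sum:
  assumes "\<And>i. i \<in> I \<Longrightarrow> poly_bounded_on_halfplane a (f i)"
  shows "poly_bounded_on_halfplane a (\<lambda>s. \<Sum>i\<in>I. f i s)"
  using assms by (induction I rule: infinite_finite_induct) (auto intro: poly_bounded_add poly_bounded_const)

lemma poly_bounded_shift:
  assumes "poly_bounded_on_halfplane (a + real k) f"
  shows "poly_bounded_on_halfplane a (\<lambda>s. f (s + of_nat k))"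
proof -
  obtain C N where *: "C \<ge> 0" "\<And>s. Re s \<ge> a + real k \<Longrightarrow> norm (f s) \<le> C * (1 + norm s) ^ N"
    using assms unfolding poly_bounded_on_halfplane_def by metis
  have "norm (f (s + of_nat k)) \<le> (C * (1 + real k) ^ N) * (1 + norm s) ^ N" if "Re s \<ge> a" for s
  proof -
    have "norm (f (s + of_nat k)) \<le> C * (1 + norm (s + of_nat k)) ^ N" using * that by auto
    also have "\<dots> \<le> C * ((1 + real k) * (1 + norm s)) ^ N"
    proof (intro mult_left_mono power_mono)
      have "norm (s + of_nat k) \<le> norm s + real k" using norm_triangle_ineq[of s "of_nat k"] by simp
      moreover have "0 \<le> real k * norm s" by simp
      ultimately have "1 + norm (s + of_nat k) \<le> 1 + norm s + real k + real k * norm s" by linarith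
      then show "1 + norm (s + of_nat k) \<le> (1 + real k) * (1 + norm s)" by (simp add: algebra_simps)
    qed (use * in auto)
    finally show ?thesis by (simp add: power_mult_distrib)
  qed
  then show ?thesis unfolding poly_bounded_on_halfplane_def using * by (intro exI[of _ "C * (1 + real k) ^ N"] exI[of _ "N"]) auto
qed

lemma norm_gbinomial_le: "norm (z gchoose k :: complex) \<le> ((1 + real k) * (1 + norm z)) ^ k"
proof -
  have "norm (z gchoose k) = norm (pochhammer (- z) k) / fact k"
    by (simp add: gbinomial_pochhammer norm_mult norm_divide norm_power)
  also have "\<dots> \<le> norm (pochhammer (- z) k) / 1"
    by (intro divide_left_mono) auto
  also have "\<dots> \<le> (norm z + real k) ^ k" using norm_pochhammer_le[of "- z" k] by simp
  also have "\<dots> \<le> ((1 + real k) * (1 + norm z)) ^ k" by (intro power_mono) (auto simp: algebra_simps)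
  finally show ?thesis .
qed

section \<open>The Riemann zeta function and its continuation\<close>

definition zeta_series :: "complex \<Rightarrow> complex" where
  "zeta_series s = (\<Sum>\<^sub>\<infinity>n\<in>{1..}. of_nat n powr (- s))"

lemma zeta_series_summable:
  assumes "Re s > 1" shows "(\<lambda>n. of_nat n powr (- s) :: complex) summable_on {1..}"
  using summable_on_real_powr[OF assms] by (rule summable_on_norm_le(2)) (auto simp: norm_of_nat_powr)

lemma holomorphic_zeta_series: "zeta_series holomorphic_on {s. Re s > 1}"
  unfolding zeta_series_def
proof (rule holomorphic_on_infsum)
  show "open {s. Re s > 1}" by (simp add: open_halfspace_Re_gt)
  show "(\<lambda>s. of_nat i powr (- s)) holomorphic_on {s. Re s > 1}" if "i \<in> {1..}" for i :: nat
    using that by (intro holomorphic_intros) auto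
  fix s0 :: complex assume "s0 \<in> {s. Re s > 1}"
  then have s0: "Re s0 > 1" by simp
  define r where "r = (Re s0 - 1) / 2"
  have r: "r > 0" using s0 by (simp add: r_def)
  have "norm (of_nat i powr (- s) :: complex) \<le> real i powr (- (Re s0 - r))" if "s \<in> cball s0 r" "i \<in> {1..}" for s i
  proof -
    have "Re s \<ge> Re s0 - r" using that complex_Re_le_cmod[of "s0 - s"] by (auto simp: dist_norm)
    then show ?thesis using that by (auto simp: norm_of_nat_powr intro!: powr_mono)
  qed
  moreover have "(\<lambda>i. real i powr (- (Re s0 - r))) summable_on {1..}"
    using s0 by (intro summable_on_real_powr) (auto simp: r_def field_simps)
  ultimately show "\<exists>r>0. \<exists>g. g summable_on {1..} \<and> (\<forall>s\<in>cball s0 r \<inter> {s. Re s > 1}. \<forall>i\<in>{1..}. norm (of_nat i powr (- s) :: complex) \<le> g i)"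
    using r by blast
qed

lemma norm_zeta_series_le:
  assumes "Re s \<ge> a" "a > 1"
  shows "norm (zeta_series s) \<le> (\<Sum>\<^sub>\<infinity>n\<in>{1..}. real n powr (- a))"
  unfolding zeta_series_def
  using summable_on_real_powr[OF assms(2)] by (rule summable_on_norm_le(3)) (use assms in \<open>auto simp: norm_of_nat_powr intro!: powr_mono\<close>)

text \<open>Summing \<open>(n + 1) powr (1 - s) - n powr (1 - s)\<close> over \<open>n \<ge> 1\<close> telescopes to \<open>-1\<close>; expanding in powers
  of \<open>1 / n\<close> expresses \<open>(1 - s) \<zeta>(s)\<close> by the values \<open>\<zeta>(s + k)\<close> and a remainder that converges further to the left.\<close>

definition zeta_tail :: "nat \<Rightarrow> complex \<Rightarrow> complex" where
  "zeta_tail K s = (\<Sum>\<^sub>\<infinity>n\<in>{1..}. of_nat n powr (1 - s) *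
     (of_real (1 + 1 / real n) powr (1 - s) - (\<Sum>k<K. ((1 - s) gchoose k) * of_real (1 / real n) ^ k)))"

text \<open>By the binomial remainder bound the summand is at most a constant times
  \<open>n powr (1 - Re s - K)\<close>, so \<open>a + real K > 2\<close> gives absolute convergence
  on the closed half-plane, and the constant grows polynomially in \<open>s\<close>.\<close>

lemma zeta_tail_props:
  fixes K :: nat and a :: real
  assumes K: "K \<ge> 1" and a: "a + real K > 2"
  shows "zeta_tail K holomorphic_on {s. Re s > a}" "poly_bounded_on_halfplane a (zeta_tail K)"
    and "\<And>s. Re s \<ge> a \<Longrightarrow> (\<lambda>n. of_nat n powr (1 - s) *
     (of_real (1 + 1 / real n) powr (1 - s) - (\<Sum>k<K. ((1 - s) gchoose k) * of_real (1 / real n) ^ k))) summable_on {1..}"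
proof -
  define f where "f s n = of_nat n powr (1 - s) *
     (of_real (1 + 1 / real n) powr (1 - s) - (\<Sum>k<K. ((1 - s) gchoose k) * of_real (1 / real n) ^ k))" for s :: complex and n :: nat
  have zt: "zeta_tail K s = infsum (f s) {1..}" for s unfolding zeta_tail_def f_def ..
  obtain C N where C: "C > 0" "\<And>s x. Re s \<ge> - (1 - a) \<Longrightarrow> 0 \<le> x \<Longrightarrow> x \<le> 1 \<Longrightarrow>
     norm (of_real (1 + x) powr (- s) - (\<Sum>k<K. ((- s) gchoose k) * of_real x ^ k)) \<le> C * (1 + norm s) ^ N * x ^ K"
    using binomial_remainder_bound[OF K, of "1 - a"] by metis
  define D where "D = C * 2 ^ N"
  have fb: "norm (f s n) \<le> (D * (1 + norm s) ^ N) * real n powr (- (a + real K - 1))" if s: "Re s \<ge> a" and n: "n \<in> {1..}" for s n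
  proof -
    have "norm (f s n) \<le> real n powr (1 - Re s) * (C * (1 + norm (s - 1)) ^ N * (1 / real n) ^ K)"
      unfolding f_def norm_mult using C(2)[of "s - 1" "1 / real n"] s n
      by (intro mult_mono) (auto simp: norm_of_nat_powr)
    also have "\<dots> \<le> real n powr (1 - a) * (C * (2 * (1 + norm s)) ^ N * (1 / real n) ^ K)"
    proof (intro mult_mono power_mono order_refl)
      show "real n powr (1 - Re s) \<le> real n powr (1 - a)" using s n by (intro powr_mono) auto
      show "1 + norm (s - 1) \<le> 2 * (1 + norm s)"
        by (rule one_plus_norm_diff_1_le)
    qed (use C in auto)
    also have "(1 / real n) ^ K = real n powr (- real K)"
      using n by (subst powr_minus_divide) (simp add: powr_realpow power_divide)
    also have "real n powr (1 - a) * (C * (2 * (1 + norm s)) ^ N * real n powr (- real K)) =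
      (D * (1 + norm s) ^ N) * (real n powr (1 - a) * real n powr (- real K))"
      by (simp only: D_def power_mult_distrib mult_ac)
    also have "real n powr (1 - a) * real n powr (- real K) = real n powr (- (a + real K - 1))"
      by (simp add: algebra_simps flip: powr_add)
    finally show ?thesis .
  qed
  have sm: "(\<lambda>n. real n powr (- (a + real K - 1))) summable_on {1..}"
    using a by (intro summable_on_real_powr) auto
  then have sm': "(\<lambda>n. c * real n powr (- (a + real K - 1))) summable_on {1..}" for c
    by (rule summable_on_cmult_right)
  have "f s summable_on {1..}" if "Re s \<ge> a" for s
    by (rule summable_on_norm_le(2)[OF sm' fb[OF that]])
  then show "\<And>s. Re s \<ge> a \<Longrightarrow> (\<lambda>n. of_nat n powr (1 - s) *
     (of_real (1 + 1 / real n) powr (1 - s) - (\<Sum>k<K. ((1 - s) gchoose k) * of_real (1 / real n) ^ k))) summable_on {1..}"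
    unfolding f_def by blast
  show "poly_bounded_on_halfplane a (zeta_tail K)"
    unfolding poly_bounded_on_halfplane_def
  proof (intro exI conjI allI impI)
    let ?I = "\<Sum>\<^sub>\<infinity>n\<in>{1..}. real n powr (- (a + real K - 1))"
    show "D * ?I \<ge> 0" using C by (intro mult_nonneg_nonneg infsum_nonneg) (auto simp: D_def)
    fix s assume "a \<le> Re s"
    from summable_on_norm_le(3)[OF sm' fb[OF this]]
    have "norm (zeta_tail K s) \<le> (\<Sum>\<^sub>\<infinity>n\<in>{1..}. (D * (1 + norm s) ^ N) * real n powr (- (a + real K - 1)))"
      by (simp add: zt)
    also have "\<dots> = D * ?I * (1 + norm s) ^ N" by (subst infsum_cmult_right') (simp add: mult_ac)
    finally show "norm (zeta_tail K s) \<le> D * ?I * (1 + norm s) ^ N" .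
  qed
  have "(\<lambda>s. \<Sum>\<^sub>\<infinity>n\<in>{1..}. f s n) holomorphic_on {s. Re s > a}"
  proof (rule holomorphic_on_infsum)
    show "(\<lambda>s. f s i) holomorphic_on {s. Re s > a}" if "i \<in> {1..}" for i :: nat
    proof -
      have "1 + 1 / real i \<noteq> 0" by (intro less_imp_neq[symmetric] add_pos_nonneg) auto
      then have *: "complex_of_real (1 + 1 / real i) \<noteq> 0" by (simp only: of_real_eq_0_iff not_False_eq_True)
      have **: "(of_nat i :: complex) \<noteq> 0" using that by simp
      have "f s i = of_nat i powr (1 - s) *
         (of_real (1 + 1 / real i) powr (1 - s) - (\<Sum>k<K. ((-1) ^ k * pochhammer (s - 1) k / fact k) * of_real (1 / real i) ^ k))" for s
        by (simp add: f_def gbinomial_pochhammer)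
      moreover have "(\<lambda>s. of_nat i powr (1 - s) *
         (of_real (1 + 1 / real i) powr (1 - s) - (\<Sum>k<K. ((-1) ^ k * pochhammer (s - 1) k / fact k) * of_real (1 / real i) ^ k))) holomorphic_on {s. Re s > a}"
        using * ** by (intro holomorphic_intros) auto
      ultimately show ?thesis by simp
    qed
    fix s0 :: complex assume "s0 \<in> {s. Re s > a}"
    have "norm (f s i) \<le> (D * (1 + (norm s0 + 1)) ^ N) * real i powr (- (a + real K - 1))" if "s \<in> cball s0 1" "Re s > a" "i \<in> {1..}" for s i
    proof -
      have "norm s \<le> norm s0 + 1" using that norm_triangle_sub[of s s0] by (auto simp: dist_norm norm_minus_commute)
      then show ?thesis
        using that C by (intro order_trans[OF fb] mult_right_mono mult_left_mono power_mono) (auto simp: D_def)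
    qed
    then show "\<exists>r>0. \<exists>g. g summable_on {1..} \<and> (\<forall>s\<in>cball s0 r \<inter> {s. Re s > a}. \<forall>i\<in>{1..}. norm (f s i) \<le> g i)"
      using sm' by (intro exI[of _ 1] conjI exI[of _ "\<lambda>i. (D * (1 + (norm s0 + 1)) ^ N) * real i powr (- (a + real K - 1))"]) auto
  qed (simp add: open_halfspace_Re_gt)
  then show "zeta_tail K holomorphic_on {s. Re s > a}" unfolding zt[abs_def, symmetric] by (simp add: zt)
qed

text \<open>In the telescoped sum \<open>zeta_series (s + of_nat k)\<close> has the binomial
  coefficient of index \<open>k + 1\<close>, which contains the factor \<open>1 - s - k\<close>.
  Absorbing it produces \<open>(s + of_nat k - 1) * zeta_series (s + of_nat k)\<close>, so the
  recursion relates shifted values of one function in which the pole at \<open>1\<close> is already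
  cancelled.\<close>

lemma zeta_series_recursion:
  fixes K :: nat and s :: complex
  assumes s: "Re s > 1" and K: "K \<ge> 2"
  shows "(s - 1) * zeta_series s = 1 - (\<Sum>k=1..K-2. ((1 - s) gchoose k) * ((s + of_nat k - 1) * zeta_series (s + of_nat k)) / of_nat (k + 1)) + zeta_tail K s"
proof -
  define T where "T n = of_nat n powr (1 - s) *
     (of_real (1 + 1 / real n) powr (1 - s) - (\<Sum>k<K. ((1 - s) gchoose k) * of_real (1 / real n) ^ k))" for n
  have T: "T summable_on {1..}" unfolding T_def using zeta_tail_props(3)[of K 1 s] s K by auto
  have zs: "((\<lambda>n. of_nat n powr (- (s + of_nat k))) has_sum zeta_series (s + of_nat k)) {1..}" for k
    unfolding zeta_series_def by (rule has_sum_infsum[OF zeta_series_summable]) (use s in simp)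
  have A: "((\<lambda>n. (\<Sum>k=1..<K. ((1 - s) gchoose k) * of_nat n powr (- (s + of_nat (k - 1)))) + T n) has_sum
      ((\<Sum>k=1..<K. ((1 - s) gchoose k) * zeta_series (s + of_nat (k - 1))) + zeta_tail K s)) {1..}"
    unfolding zeta_tail_def T_def[symmetric]
    by (intro has_sum_add has_sum_infsum T has_sum_finite_sum has_sum_cmult_right zs)
  have eq: "(\<Sum>k=1..<K. ((1 - s) gchoose k) * of_nat n powr (- (s + of_nat (k - 1)))) + T n
      = of_nat (Suc n) powr (1 - s) - of_nat n powr (1 - s)" if n: "n \<in> {1..}" for n
  proof -
    have n0: "(of_nat n :: complex) \<noteq> 0" "real n > 0" using n by auto
    have 1: "of_nat n powr (1 - s) * of_real (1 + 1 / real n) powr (1 - s) = (of_nat (Suc n) powr (1 - s) :: complex)"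
    proof -
      have "of_nat n powr (1 - s) * of_real (1 + 1 / real n) powr (1 - s) = (of_real (real n) * of_real (1 + 1 / real n) :: complex) powr (1 - s)"
        using n0 by (subst powr_times_real) auto
      also have "of_real (real n) * of_real (1 + 1 / real n) = (of_nat (Suc n) :: complex)"
        using n0 by (simp add: field_simps)
      finally show ?thesis .
    qed
    have 2: "of_nat n powr (1 - s) * of_real (1 / real n) ^ k = (of_nat n powr (- (s + of_nat (k - 1))) :: complex)" if "k \<ge> 1" for k
    proof -
      have "(of_real (1 / real n) :: complex) ^ k = of_nat n powr (- of_nat k)"
        using n0 by (simp add: powr_minus powr_nat' power_inverse divide_inverse)
      then have "of_nat n powr (1 - s) * of_real (1 / real n) ^ k = (of_nat n powr (1 - s + (- of_nat k)) :: complex)"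
        by (simp only: powr_add)
      also have "1 - s + (- of_nat k) = - (s + of_nat (k - 1))" using that by (simp add: of_nat_diff)
      finally show ?thesis .
    qed
    have "(\<Sum>k<K. ((1 - s) gchoose k) * of_real (1 / real n) ^ k) = 1 + (\<Sum>k=1..<K. ((1 - s) gchoose k) * of_real (1 / real n) ^ k)"
      using K by (simp add: lessThan_atLeast0 sum.atLeast_Suc_lessThan)
    then have "T n = of_nat (Suc n) powr (1 - s) - of_nat n powr (1 - s) - (\<Sum>k=1..<K. ((1 - s) gchoose k) * (of_nat n powr (1 - s) * of_real (1 / real n) ^ k))"
      unfolding T_def 1[symmetric] by (simp add: algebra_simps sum_distrib_left)
    also have "(\<Sum>k=1..<K. ((1 - s) gchoose k) * (of_nat n powr (1 - s) * of_real (1 / real n) ^ k)) =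
        (\<Sum>k=1..<K. ((1 - s) gchoose k) * of_nat n powr (- (s + of_nat (k - 1))))"
      by (intro sum.cong refl) (subst 2, auto)
    finally show ?thesis by simp
  qed
  have "((\<lambda>n. of_nat (Suc n) powr (1 - s) - of_nat n powr (1 - s)) has_sum
      ((\<Sum>k=1..<K. ((1 - s) gchoose k) * zeta_series (s + of_nat (k - 1))) + zeta_tail K s)) {1..}"
    using A by (subst (asm) has_sum_cong[OF eq]) auto
  also have "{1..} = Suc ` UNIV" by (auto simp: image_iff Suc_le_eq gr0_conv_Suc)
  finally have "((\<lambda>n. of_nat (Suc (Suc n)) powr (1 - s) - of_nat (Suc n) powr (1 - s)) has_sum
      ((\<Sum>k=1..<K. ((1 - s) gchoose k) * zeta_series (s + of_nat (k - 1))) + zeta_tail K s)) UNIV"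
    by (subst (asm) has_sum_reindex) (auto simp: o_def)
  from has_sum_imp_sums[OF this] have 1: "(\<lambda>n. of_nat (Suc (Suc n)) powr (1 - s) - of_nat (Suc n) powr (1 - s)) sums
      ((\<Sum>k=1..<K. ((1 - s) gchoose k) * zeta_series (s + of_nat (k - 1))) + zeta_tail K s)" .
  have lim: "(\<lambda>n. of_nat (Suc n) powr (1 - s) :: complex) \<longlonglongrightarrow> 0"
  proof -
    have "(\<lambda>n. real (Suc n) powr (1 - Re s)) \<longlonglongrightarrow> 0"
      using s by real_asymp
    moreover have "norm (of_nat (Suc n) powr (1 - s) :: complex) = real (Suc n) powr (1 - Re s)" for n
      by (subst norm_of_nat_powr) auto
    ultimately show ?thesis by (subst tendsto_norm_zero_iff[symmetric]) (simp only:)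
  qed
  have "(\<lambda>n. of_nat (Suc (Suc n)) powr (1 - s) - of_nat (Suc n) powr (1 - s) :: complex) sums (0 - of_nat (Suc 0) powr (1 - s))"
    by (rule telescope_sums[OF lim])
  then have "(\<Sum>k=1..<K. ((1 - s) gchoose k) * zeta_series (s + of_nat (k - 1))) + zeta_tail K s = - 1"
    using sums_unique2[OF 1] by simp
  moreover have "(\<Sum>k=1..<K. ((1 - s) gchoose k) * zeta_series (s + of_nat (k - 1))) =
     (1 - s) * zeta_series s + (\<Sum>k=2..<K. ((1 - s) gchoose k) * zeta_series (s + of_nat (k - 1)))"
    using K by (subst sum.atLeast_Suc_lessThan) (auto simp: numeral_2_eq_2)
  moreover have "(\<Sum>k=2..<K. ((1 - s) gchoose k) * zeta_series (s + of_nat (k - 1))) =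
      (\<Sum>k=1..K-2. ((1 - s) gchoose (k + 1)) * zeta_series (s + of_nat k))"
    using K by (intro sum.reindex_bij_witness[of _ "\<lambda>k. k + 1" "\<lambda>k. k - 1"]) auto
  moreover have "\<dots> = (\<Sum>k=1..K-2. - (((1 - s) gchoose k) * ((s + of_nat k - 1) * zeta_series (s + of_nat k)) / of_nat (k + 1)))"
  proof (intro sum.cong refl)
    fix k
    have eq: "((1 - s) gchoose (k + 1)) = (1 - s - of_nat k) * ((1 - s) gchoose k) / of_nat (k + 1)"
      by (simp add: gbinomial_pochhammer pochhammer_Suc field_simps del: of_nat_add)
    show "((1 - s) gchoose (k + 1)) * zeta_series (s + of_nat k) =
      - (((1 - s) gchoose k) * ((s + of_nat k - 1) * zeta_series (s + of_nat k)) / of_nat (k + 1))"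
      unfolding eq by (simp add: algebra_simps add_divide_distrib diff_divide_distrib)
  qed
  ultimately have "(1 - s) * zeta_series s - (\<Sum>k=1..K-2. ((1 - s) gchoose k) * ((s + of_nat k - 1) * zeta_series (s + of_nat k)) / of_nat (k + 1)) + zeta_tail K s = - 1"
    by (simp only: sum_negf diff_conv_add_uminus)
  moreover have "(s - 1) * z = 1 - S + t" if "(1 - s) * z - S + t = - 1" for z S t :: complex
    using that by algebra
  ultimately show ?thesis by blast
qed

text \<open>Successive continuations of \<open>(s - 1) \<zeta>(s)\<close> to \<open>Re s > 1 - N\<close>.\<close>

primrec zeta_reg_aux :: "nat \<Rightarrow> complex \<Rightarrow> complex" where
  "zeta_reg_aux 0 s = (s - 1) * zeta_series s"
| "zeta_reg_aux (Suc N) s = 1 - (\<Sum>k=1..N+1. ((1 - s) gchoose k) * zeta_reg_aux N (s + of_nat k) / of_nat (k + 1)) + zeta_tail (N + 3) s"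

text \<open>Stage \<open>Suc N\<close> evaluates stage \<open>N\<close> only at
  \<open>s + of_nat k\<close> with \<open>k \<ge> 1\<close>, which gains one unit to the left. The
  tail with \<open>N + 3\<close> terms converges already for \<open>Re s > - N - 1\<close>, further
  than needed.\<close>

lemma zeta_reg_aux_props:
  "zeta_reg_aux N holomorphic_on {s. Re s > 1 - real N}"
  "a > 1 - real N \<Longrightarrow> poly_bounded_on_halfplane a (zeta_reg_aux N)"
  "Re s > 1 \<Longrightarrow> zeta_reg_aux N s = (s - 1) * zeta_series s"
proof (induction N arbitrary: a s)
  case 0
  {
    case 1
    show ?case by (auto intro!: holomorphic_intros holomorphic_zeta_series)
  next
    case 2
    have "norm (zeta_reg_aux 0 s) \<le> (\<Sum>\<^sub>\<infinity>n\<in>{1..}. real n powr (- a)) * (1 + norm s) ^ 1" if "Re s \<ge> a" for s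
    proof -
      have "norm (s - 1) * norm (zeta_series s) \<le> (1 + norm s) * (\<Sum>\<^sub>\<infinity>n\<in>{1..}. real n powr (- a))"
        using norm_zeta_series_le[OF that] 2 norm_triangle_ineq4[of s 1] by (intro mult_mono) auto
      then show ?thesis by (simp add: norm_mult mult.commute)
    qed
    then show ?case unfolding poly_bounded_on_halfplane_def
      by (intro exI[of _ "\<Sum>\<^sub>\<infinity>n\<in>{1..}. real n powr (- a)"] exI[of _ 1]) (auto intro: infsum_nonneg)
  next
    case 3
    show ?case by simp
  }
next
  case (Suc N)
  {
    case 1
    have *: "(\<lambda>s. zeta_reg_aux N (s + of_nat k)) holomorphic_on {s. Re s > 1 - real (Suc N)}" if "k \<ge> 1" for k
      using that by (intro holomorphic_on_compose_gen[OF _ Suc(1), unfolded o_def]) (auto intro!: holomorphic_intros)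
    have g: "(1 - s) gchoose k = (-1) ^ k * pochhammer (s - 1) k / fact k" for s :: complex and k
      by (simp add: gbinomial_pochhammer)
    have "zeta_tail (N + 3) holomorphic_on {s. Re s > - real N}"
      by (rule zeta_tail_props(1)) auto
    then have "(\<lambda>s. zeta_tail (N + 3) s) holomorphic_on {s. Re s > 1 - real (Suc N)}" by simp
    then show ?case
      unfolding zeta_reg_aux.simps g by (intro holomorphic_intros *) auto
  next
    case 2
    have *: "poly_bounded_on_halfplane a (\<lambda>s. zeta_reg_aux N (s + of_nat k))" if "k \<ge> 1" for k
      using that 2 by (intro poly_bounded_shift Suc(2)) auto
    have g: "poly_bounded_on_halfplane a (\<lambda>s. (1 - s) gchoose k)" for k
      unfolding poly_bounded_on_halfplane_def
    proof (intro exI conjI allI impI)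
      fix s :: complex
      have "norm ((1 - s) gchoose k) \<le> ((1 + real k) * (1 + norm (1 - s))) ^ k" by (rule norm_gbinomial_le)
      also have "\<dots> \<le> ((1 + real k) * (2 * (1 + norm s))) ^ k"
      proof (intro power_mono mult_left_mono)
        show "1 + norm (1 - s) \<le> 2 * (1 + norm s)"
          using one_plus_norm_diff_1_le[of s] by (simp add: norm_minus_commute)
      qed auto
      finally show "norm ((1 - s) gchoose k) \<le> (2 * (1 + real k)) ^ k * (1 + norm s) ^ k"
        by (simp only: power_mult_distrib mult_ac)
    qed auto
    have eq: "zeta_reg_aux (Suc N) = (\<lambda>s. 1 + (\<Sum>k=1..N+1. (- 1 / of_nat (k + 1)) * (((1 - s) gchoose k) * zeta_reg_aux N (s + of_nat k))) + zeta_tail (N + 3) s)"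
      by (simp add: fun_eq_iff sum_negf)
    have "poly_bounded_on_halfplane a (zeta_tail (N + 3))"
      by (rule zeta_tail_props(2)) (use 2 in auto)
    then show ?case
      unfolding eq by (intro poly_bounded_add poly_bounded_sum poly_bounded_mult poly_bounded_const g *) auto
  next
    case 3
    have "zeta_reg_aux N (s + of_nat k) = (s + of_nat k - 1) * zeta_series (s + of_nat k)" for k
      using 3 by (intro Suc(3)) auto
    then show ?case
      using zeta_series_recursion[OF 3, of "N + 3"] by simp
  }
qed

text \<open>The entire function obtained from \<open>(s - 1) * zeta_series s\<close>. The stage is
  chosen pointwise so that \<open>s\<close> lies in its half-plane; by
  \<open>zeta_reg_eq_aux\<close> every admissible stage gives the same value.\<close>

definition zeta_reg :: "complex \<Rightarrow> complex" where
  "zeta_reg s = zeta_reg_aux (nat \<lceil>2 - Re s\<rceil>) s"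

lemma zeta_reg_eq_aux:
  assumes "Re s > 1 - real N" shows "zeta_reg s = zeta_reg_aux N s"
proof -
  define M where "M = nat \<lceil>2 - Re s\<rceil>"
  have M: "Re s > 1 - real M" unfolding M_def by linarith
  define a where "a = max (1 - real N) (1 - real M)"
  have "zeta_reg_aux M s = zeta_reg_aux N s"
  proof (rule analytic_continuation_open[of "{s. Re s > 1}" "{s. Re s > a}" "zeta_reg_aux M" "zeta_reg_aux N"])
    show "zeta_reg_aux M holomorphic_on {s. Re s > a}" "zeta_reg_aux N holomorphic_on {s. Re s > a}"
      by (rule holomorphic_on_subset[OF zeta_reg_aux_props(1)]; force simp: a_def)+
    show "connected {s. Re s > a}" by (intro convex_connected convex_halfspace_Re_gt)
    show "{s. Re s > 1} \<noteq> {}" by (auto intro: exI[of _ 2])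
    show "zeta_reg_aux M z = zeta_reg_aux N z" if "z \<in> {s. Re s > 1}" for z
      using that by (simp add: zeta_reg_aux_props(3))
    show "open {s. Re s > a}" by (rule open_halfspace_Re_gt)
  qed (use M assms in \<open>auto simp: open_halfspace_Re_gt a_def\<close>)
  then show ?thesis by (simp add: zeta_reg_def M_def)
qed

lemma holomorphic_zeta_reg: "zeta_reg holomorphic_on A"
proof -
  have "zeta_reg field_differentiable (at s)" for s
  proof -
    obtain N :: nat where N: "Re s > 1 - real N" using reals_Archimedean2[of "1 - Re s"] by (auto simp: algebra_simps)
    have "zeta_reg holomorphic_on {s. Re s > 1 - real N}"
      using zeta_reg_aux_props(1)[of N] by (rule holomorphic_transform) (auto simp: zeta_reg_eq_aux)
    then show ?thesis
      using N by (auto simp: holomorphic_on_open open_halfspace_Re_gt field_differentiable_def)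
  qed
  then show ?thesis by (auto simp: holomorphic_on_def intro: field_differentiable_at_within)
qed

lemma poly_bounded_zeta_reg: "poly_bounded_on_halfplane a zeta_reg"
proof -
  obtain N :: nat where N: "a > 1 - real N" using reals_Archimedean2[of "1 - a"] by (auto simp: algebra_simps)
  have "zeta_reg s = zeta_reg_aux N s" if "Re s \<ge> a" for s
    using that N by (intro zeta_reg_eq_aux) auto
  with zeta_reg_aux_props(2)[OF N] show ?thesis
    unfolding poly_bounded_on_halfplane_def by auto
qed

lemma zeta_reg_series: "Re s > 1 \<Longrightarrow> zeta_reg s = (s - 1) * zeta_series s"
  using zeta_reg_eq_aux[of 0 s] by simp

text \<open>At \<open>s = 1\<close> the binomial coefficients with \<open>k \<ge> 1\<close> and all
  summands of the tail vanish, which leaves the constant \<open>1\<close>: the residue of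
  zeta.\<close>

lemma zeta_reg_1: "zeta_reg 1 = 1"
proof -
  have "zeta_reg 1 = zeta_reg_aux 1 1" by (rule zeta_reg_eq_aux) simp
  moreover have "zeta_tail 3 1 = 0"
    unfolding zeta_tail_def
  proof (rule infsum_0)
    fix n :: nat assume "n \<in> {1..}"
    have "1 + 1 / real n \<noteq> 0" by (intro less_imp_neq[symmetric] add_pos_nonneg) auto
    then have "complex_of_real (1 + 1 / real n) \<noteq> 0" by (simp only: of_real_eq_0_iff not_False_eq_True)
    then show "of_nat n powr (1 - 1) * (of_real (1 + 1 / real n) powr (1 - 1) -
        (\<Sum>k<3. ((1 - 1) gchoose k) * of_real (1 / real n) ^ k)) = (0 :: complex)"
      by (simp add: numeral_3_eq_3)
  qed
  ultimately show ?thesis by simp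
qed

text \<open>Riemann's zeta function; at the pole \<open>s = 1\<close> division by zero supplies the
  default value \<open>0\<close>.\<close>

definition zeta1 :: "complex \<Rightarrow> complex" where
  "zeta1 s = zeta_reg s / (s - 1)"

lemma zeta1_series: "Re s > 1 \<Longrightarrow> zeta1 s = zeta_series s"
  by (auto simp: zeta1_def zeta_reg_series)

lemma field_differentiable_zeta1: "s \<noteq> 1 \<Longrightarrow> zeta1 field_differentiable (at s)"
proof -
  have "zeta_reg field_differentiable (at s)" for s
    using holomorphic_zeta_reg[of UNIV] by (auto simp: holomorphic_on_def)
  then show "s \<noteq> 1 \<Longrightarrow> zeta1 field_differentiable (at s)"
    unfolding zeta1_def[abs_def] by (intro field_differentiable_divide field_differentiable_diff) auto
qed

lemma holomorphic_zeta1 [holomorphic_intros]: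
  assumes "f holomorphic_on A" "\<And>z. z \<in> A \<Longrightarrow> f z \<noteq> 1"
  shows "(\<lambda>z. zeta1 (f z)) holomorphic_on A"
  unfolding zeta1_def using assms
  by (intro holomorphic_intros holomorphic_on_compose_gen[OF _ holomorphic_zeta_reg[of UNIV], unfolded o_def]) auto

lemma zeta1_residue: "((\<lambda>s. (s - 1) * zeta1 s) \<longlongrightarrow> 1) (at 1)"
proof -
  have "isCont zeta_reg 1"
    using holomorphic_zeta_reg[of UNIV] holomorphic_on_imp_continuous_on continuous_on_eq_continuous_at[of UNIV] by blast
  then have "(zeta_reg \<longlongrightarrow> 1) (at 1)" by (simp add: isCont_def zeta_reg_1)
  moreover have "\<forall>\<^sub>F s in at 1. (s - 1) * zeta1 s = zeta_reg s"
    by (auto simp: eventually_at_filter zeta1_def)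
  ultimately show ?thesis by (simp add: tendsto_cong)
qed

section \<open>The Mordell--Tornheim series\<close>

lemma summable_on_pairs:
  assumes "a > 1" "b > 1"
  shows "(\<lambda>(m, n). real m powr (- a) * real n powr (- b)) summable_on {1..} \<times> {1..}"
proof -
  have "((\<lambda>n. real m powr (- a) * real n powr (- b)) has_sum (real m powr (- a) * (\<Sum>\<^sub>\<infinity>n\<in>{1..}. real n powr (- b)))) {1..}" for m
    by (intro has_sum_cmult_right has_sum_infsum summable_on_real_powr assms)
  then show ?thesis
    by (intro summable_on_SigmaI[where g = "\<lambda>m. real m powr (- a) * (\<Sum>\<^sub>\<infinity>n\<in>{1..}. real n powr (- b))"]
        summable_on_cmult_left summable_on_real_powr assms) auto
qed

lemma infsum_pairs_product:
  fixes f g :: "nat \<Rightarrow> complex"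
  assumes "(\<lambda>(m, n). f m * g n) summable_on A \<times> B" "g summable_on B"
  shows "(\<Sum>\<^sub>\<infinity>(m, n)\<in>A \<times> B. f m * g n) = infsum f A * infsum g B"
proof -
  have "((\<lambda>(m, n). f m * g n) has_sum (\<Sum>\<^sub>\<infinity>(m, n)\<in>A \<times> B. f m * g n)) (A \<times> B)"
    by (rule has_sum_infsum[OF assms(1)])
  then have "((\<lambda>m. f m * infsum g B) has_sum (\<Sum>\<^sub>\<infinity>(m, n)\<in>A \<times> B. f m * g n)) A"
    by (rule has_sum_SigmaD) (auto intro: has_sum_cmult_right has_sum_infsum assms)
  then show ?thesis using infsumI by (metis infsum_cmult_left')
qed

lemma countable_infinite_pairs: "countable ({1..} \<times> {1..} :: (nat \<times> nat) set)" "infinite ({1..} \<times> {1..} :: (nat \<times> nat) set)"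
  by (auto simp: infinite_Ici finite_cartesian_product_iff)

lemma norm_mt_term:
  assumes "m \<ge> 1" "n \<ge> 1"
  shows "norm (mt_term s1 s2 s3 (m, n)) = real m powr (- Re s1) * real n powr (- Re s2) * real (m + n) powr (- Re s3)"
  using assms norm_of_nat_powr[of m "- s1"] norm_of_nat_powr[of n "- s2"] norm_of_nat_powr[of "m + n" "- s3"]
  by (simp only: mt_term_def prod.case norm_mult) (simp del: of_nat_add)

text \<open>The exponent of \<open>m + n\<close> is shared out, \<open>\<alpha>\<close> of it to
  \<open>m\<close> and \<open>\<beta>\<close> to \<open>n\<close>, since \<open>m + n\<close>
  exceeds both.\<close>

lemma norm_mt_term_le:
  assumes mn: "m \<ge> 1" "n \<ge> 1" and ab: "\<alpha> \<ge> 0" "\<beta> \<ge> 0" "Re s3 \<ge> \<alpha> + \<beta>" "Re s1 + \<alpha> \<ge> a" "Re s2 + \<beta> \<ge> b"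
  shows "norm (mt_term s1 s2 s3 (m, n)) \<le> real m powr (- a) * real n powr (- b)"
proof -
  have "real (m + n) powr (- Re s3) \<le> real (m + n) powr (- \<alpha> - \<beta>)"
    using mn ab by (intro powr_mono) auto
  also have "\<dots> = real (m + n) powr (- \<alpha>) * real (m + n) powr (- \<beta>)"
    by (simp only: diff_conv_add_uminus powr_add)
  also have "\<dots> \<le> real m powr (- \<alpha>) * real n powr (- \<beta>)"
    using mn ab by (intro mult_mono powr_mono2') auto
  finally have 1: "real (m + n) powr (- Re s3) \<le> real m powr (- \<alpha>) * real n powr (- \<beta>)" .
  have "norm (mt_term s1 s2 s3 (m, n)) \<le> real m powr (- Re s1) * real n powr (- Re s2) * (real m powr (- \<alpha>) * real n powr (- \<beta>))"
    unfolding norm_mt_term[OF mn] by (intro mult_left_mono 1) auto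
  also have "\<dots> = real m powr (- Re s1 - \<alpha>) * real n powr (- Re s2 - \<beta>)"
    by (simp only: diff_conv_add_uminus powr_add mult_ac)
  also have "\<dots> \<le> real m powr (- a) * real n powr (- b)"
    using mn ab by (intro mult_mono powr_mono) auto
  finally show ?thesis .
qed

lemma mt_term_summable:
  assumes "\<alpha> \<ge> 0" "\<beta> \<ge> 0" "Re s3 \<ge> \<alpha> + \<beta>" "Re s1 + \<alpha> > 1" "Re s2 + \<beta> > 1"
  shows "mt_term s1 s2 s3 summable_on {1..} \<times> {1..}"
proof (rule summable_on_norm_le(2)[OF summable_on_pairs])
  show "norm (mt_term s1 s2 s3 p) \<le> (case p of (m, n) \<Rightarrow> real m powr (- (Re s1 + \<alpha>)) * real n powr (- (Re s2 + \<beta>)))"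
    if "p \<in> {1..} \<times> {1..}" for p
    using that by (cases p) (simp only: prod.case, rule norm_mt_term_le[where \<alpha> = \<alpha> and \<beta> = \<beta>], use assms in auto)
qed (use assms in auto)

lemma real_div_powr:
  assumes "m \<ge> 1" "n \<ge> 1"
  shows "complex_of_real (real n / real m) powr z = of_nat n powr z * of_nat m powr (- z)"
proof -
  have "complex_of_real (real n / real m) powr z = exp (z * of_real (ln (real n / real m)))"
    using assms by (simp add: powr_def Ln_of_real del: of_real_divide)
  also have "ln (real n / real m) = ln (real n) - ln (real m)" using assms by (simp add: ln_div)
  also have "exp (z * of_real (ln (real n) - ln (real m))) = exp (z * of_real (ln (real n))) * exp (- z * of_real (ln (real m)))"
    by (simp add: algebra_simps flip: exp_add)
  also have "\<dots> = of_nat n powr z * of_nat m powr (- z)"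
    using assms Ln_of_real[of "real n"] Ln_of_real[of "real m"] by (simp add: powr_def)
  finally show ?thesis .
qed

lemma continuous_MB_kernel:
  assumes "Re s + c > 0" "\<And>j::nat. c \<noteq> real j"
  shows "continuous_on UNIV (\<lambda>t. Beta (s + Complex c t) (- Complex c t))"
proof -
  define U where "U = {z. Re (s + z) > 0} - (of_nat ` UNIV :: complex set)"
  have "(\<lambda>z. Beta (s + z) (- z)) holomorphic_on U"
  proof (intro holomorphic_intros)
    fix z assume z: "z \<in> U"
    show "s + z \<notin> \<int>\<^sub>\<le>\<^sub>0" using z by (intro not_nonpos_Int_if_Re_pos) (auto simp: U_def)
    show "- z \<notin> \<int>\<^sub>\<le>\<^sub>0" using z by (auto elim!: nonpos_Ints_cases' simp: minus_equation_iff U_def)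
  qed
  moreover have "Complex c t \<in> U" for t using assms by (auto simp: U_def complex_eq_iff)
  ultimately show ?thesis
    by (intro continuous_on_compose2[OF holomorphic_on_imp_continuous_on, where g = "\<lambda>z. Beta (s + z) (- z)" and f = "Complex c"])
       (auto simp: Complex_eq intro!: continuous_intros)
qed

lemma integrable_MB_kernel:
  assumes "Re s + c > 0" "\<And>j::nat. c \<noteq> real j"
  shows "integrable lborel (\<lambda>t. Beta (s + Complex c t) (- Complex c t))"
proof -
  obtain C N where C: "C > 0" "\<And>s' z. Re (s' + z) \<ge> Re s + c \<Longrightarrow> Re z \<le> c \<Longrightarrow> (\<And>j::nat. norm (of_nat j - z) \<ge> 1/2 * (1 + \<bar>Im z\<bar>)) \<Longrightarrow>
      norm (Beta (s' + z) (- z)) * (1 + \<bar>Im z\<bar>) ^ 0 \<le> C * (1 + norm s') ^ N * decay (Im z)"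
    using MB_kernel_bound[of "Re s + c" "1/2" c 0] assms by auto
  show ?thesis
  proof (rule integrable_decay_bound[OF continuous_MB_kernel[OF assms]])
    fix t :: real assume "\<bar>t\<bar> \<ge> 1"
    then show "norm (Beta (s + Complex c t) (- Complex c t)) \<le> (C * (1 + norm s) ^ N) * decay t"
      using C(2)[of s "Complex c t"] norm_nat_diff_ge_Im[of "Complex c t"] by simp
  qed
qed

text \<open>Expanding \<open>(m + n) powr (- s3)\<close> in powers of \<open>n / m\<close> by the Mellin--Barnes integral decouples the double series.\<close>

lemma mt_sum_eq_MB:
  assumes c: "c < 0" "Re s3 + c > 0" "Re (s1 + s3) + c > 1" "Re s2 - c > 1"
  shows "vertical_line_integral c (\<lambda>z. Beta (s3 + z) (- z) * (zeta1 (s1 + s3 + z) * zeta1 (s2 - z))) =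
     2 * of_real pi * \<i> * (\<Sum>\<^sub>\<infinity>p\<in>{1..} \<times> {1..}. mt_term s1 s2 s3 p)"
proof -
  define z where "z t = Complex c t" for t
  define b where "b t = Beta (s3 + z t) (- z t)" for t
  define f where "f = (\<lambda>(m, n) t. b t * (of_nat m powr (- (s1 + s3 + z t)) * of_nat n powr (- (s2 - z t))))"
  have cj: "c \<noteq> real j" for j using c by auto
  have bi: "integrable lborel b" unfolding b_def z_def by (rule integrable_MB_kernel[OF c(2) cj])
  have contz: "continuous_on UNIV z" unfolding z_def by (simp add: Complex_eq continuous_intros)
  have contb: "continuous_on UNIV b" unfolding b_def z_def by (rule continuous_MB_kernel[OF c(2) cj])
  define a where "a = (\<lambda>(m, n). real m powr (- (Re (s1 + s3) + c)) * real n powr (- (Re s2 - c)))"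
  have a: "a summable_on {1..} \<times> {1..}" unfolding a_def by (rule summable_on_pairs) (use c in auto)
  have fb: "norm (f p t) \<le> a p * norm (b t)" if "p \<in> {1..} \<times> {1..}" for p t
  proof -
    obtain m n where p: "p = (m, n)" "m \<ge> 1" "n \<ge> 1" using \<open>p \<in> {1..} \<times> {1..}\<close> by (cases p) auto
    have "Re (- (s1 + s3 + z t)) = - (Re (s1 + s3) + c)" "Re (- (s2 - z t)) = - (Re s2 - c)"
      by (simp_all add: z_def)
    then show ?thesis
      unfolding p f_def a_def prod.case norm_mult norm_of_nat_powr[OF p(2)] norm_of_nat_powr[OF p(3)]
      by (simp only: mult_ac)
  qed
  have fm: "f p \<in> borel_measurable lborel" if "p \<in> {1..} \<times> {1..}" for p
  proof -
    obtain m n where p: "p = (m, n)" "m \<ge> 1" "n \<ge> 1" using \<open>p \<in> {1..} \<times> {1..}\<close> by (cases p) auto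
    then have "of_nat m \<noteq> (0::complex)" "of_nat n \<noteq> (0::complex)" by auto
    then show ?thesis unfolding p f_def prod.case powr_def
      using contb contz by (intro continuous_on_imp_lborel_measurable) (auto intro!: continuous_intros)
  qed
  have hs: "((\<lambda>p. LINT t|lborel. f p t) has_sum (LINT t|lborel. (\<Sum>\<^sub>\<infinity>p\<in>{1..} \<times> {1..}. f p t))) ({1..} \<times> {1..})"
    by (rule has_sum_LINT(2)[OF countable_infinite_pairs a integrable_norm[OF bi] fm fb])
  have eq: "(LINT t|lborel. f p t) = 2 * of_real pi * mt_term s1 s2 s3 p" if "p \<in> {1..} \<times> {1..}" for p
  proof -
    obtain m n where p: "p = (m, n)" "m \<ge> 1" "n \<ge> 1" using \<open>p \<in> {1..} \<times> {1..}\<close> by (cases p) auto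
    have mn: "real n / real m > 0" using p by simp
    have "f p t = of_nat m powr (- s1 - s3) * of_nat n powr (- s2) * (Beta (s3 + Complex c t) (- Complex c t) * of_real (real n / real m) powr (Complex c t))" for t
    proof -
      have "of_nat m powr (- (s1 + s3 + z t)) = (of_nat m powr (- s1 - s3) * of_nat m powr (- z t) :: complex)"
        "of_nat n powr (- (s2 - z t)) = (of_nat n powr (- s2) * of_nat n powr (z t) :: complex)"
        by (simp_all flip: powr_add)
      then show ?thesis using p by (simp add: f_def b_def z_def real_div_powr del: of_real_divide)
    qed
    then have "(LINT t|lborel. f p t) = of_nat m powr (- s1 - s3) * of_nat n powr (- s2) *
      (LINT t|lborel. Beta (s3 + Complex c t) (- Complex c t) * of_real (real n / real m) powr (Complex c t))"
      by (simp only: integral_mult_right_zero)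
    also have "(LINT t|lborel. Beta (s3 + Complex c t) (- Complex c t) * of_real (real n / real m) powr (Complex c t)) =
       2 * of_real pi * of_real (1 + real n / real m) powr (- s3)"
      using Mellin_Barnes[OF c(1,2) mn] by (simp add: vertical_line_integral_def mult_ac del: of_real_add of_real_divide)
    also have "1 + real n / real m = real (m + n) / real m" using p by (simp add: field_simps)
    also have "complex_of_real (real (m + n) / real m) powr (- s3) = of_nat (m + n) powr (- s3) * of_nat m powr s3"
      using p by (subst real_div_powr) auto
    also have "of_nat m powr (- s1 - s3) * of_nat n powr (- s2) * (2 * of_real pi * (of_nat (m + n) powr (- s3) * of_nat m powr s3)) =
      2 * of_real pi * ((of_nat m powr (- s1 - s3) * of_nat m powr s3) * of_nat n powr (- s2) * of_nat (m + n) powr (- s3) :: complex)"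
      by (simp only: mult_ac)
    also have "of_nat m powr (- s1 - s3) * of_nat m powr s3 = (of_nat m powr (- s1) :: complex)"
      by (simp flip: powr_add)
    finally show ?thesis by (simp add: p mt_term_def)
  qed
  have "((\<lambda>p. 2 * of_real pi * mt_term s1 s2 s3 p) has_sum (LINT t|lborel. (\<Sum>\<^sub>\<infinity>p\<in>{1..} \<times> {1..}. f p t))) ({1..} \<times> {1..})"
    using hs has_sum_cong[of "{1..} \<times> {1..}" "\<lambda>p. LINT t|lborel. f p t", OF eq] by simp
  then have "2 * of_real pi * (\<Sum>\<^sub>\<infinity>p\<in>{1..} \<times> {1..}. mt_term s1 s2 s3 p) = (LINT t|lborel. (\<Sum>\<^sub>\<infinity>p\<in>{1..} \<times> {1..}. f p t))"
    by (metis infsumI infsum_cmult_right')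
  also have "(\<lambda>t. \<Sum>\<^sub>\<infinity>p\<in>{1..} \<times> {1..}. f p t) = (\<lambda>t. b t * (zeta1 (s1 + s3 + z t) * zeta1 (s2 - z t)))"
  proof
    fix t
    have r: "Re (s1 + s3 + z t) > 1" "Re (s2 - z t) > 1" using c by (auto simp: z_def)
    have sm: "(\<lambda>(m, n). of_nat m powr (- (s1 + s3 + z t)) * of_nat n powr (- (s2 - z t)) :: complex) summable_on {1..} \<times> {1..}"
    proof (rule summable_on_norm_le(2)[OF a])
      fix p :: "nat \<times> nat" assume "p \<in> {1..} \<times> {1..}"
      then obtain m n where p: "p = (m, n)" "m \<ge> 1" "n \<ge> 1" by (cases p) auto
      have "Re (- (s1 + s3 + z t)) = - (Re (s1 + s3) + c)" "Re (- (s2 - z t)) = - (Re s2 - c)"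
        by (simp_all add: z_def)
      then show "norm ((case p of (m, n) \<Rightarrow> of_nat m powr (- (s1 + s3 + z t)) * of_nat n powr (- (s2 - z t))) :: complex) \<le> a p"
        unfolding p a_def prod.case norm_mult norm_of_nat_powr[OF p(2)] norm_of_nat_powr[OF p(3)]
        by simp
    qed
    have "(\<Sum>\<^sub>\<infinity>p\<in>{1..} \<times> {1..}. f p t) = b t * (\<Sum>\<^sub>\<infinity>(m, n)\<in>{1..} \<times> {1..}. of_nat m powr (- (s1 + s3 + z t)) * of_nat n powr (- (s2 - z t)))"
      by (subst infsum_cmult_right'[symmetric]) (simp add: f_def case_prod_unfold)
    also have "(\<Sum>\<^sub>\<infinity>(m, n)\<in>{1..} \<times> {1..}. of_nat m powr (- (s1 + s3 + z t)) * of_nat n powr (- (s2 - z t))) =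
        zeta1 (s1 + s3 + z t) * zeta1 (s2 - z t)"
      unfolding zeta1_series[OF r(1)] zeta1_series[OF r(2)] zeta_series_def
      by (rule infsum_pairs_product[OF sm zeta_series_summable[OF r(2)]])
    finally show "(\<Sum>\<^sub>\<infinity>p\<in>{1..} \<times> {1..}. f p t) = b t * (zeta1 (s1 + s3 + z t) * zeta1 (s2 - z t))" .
  qed
  finally have F: "2 * of_real pi * (\<Sum>\<^sub>\<infinity>p\<in>{1..} \<times> {1..}. mt_term s1 s2 s3 p) =
    (LINT t|lborel. b t * (zeta1 (s1 + s3 + z t) * zeta1 (s2 - z t)))" .
  show ?thesis
    unfolding vertical_line_integral_def F[unfolded b_def z_def, symmetric] by (simp only: mult_ac)
qed

lemma one_plus_norm_add_le: "1 + norm (a + b :: 'a::real_normed_vector) \<le> (1 + norm a) * (1 + norm b)"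
proof -
  have "1 + norm (a + b) \<le> 1 + norm a + norm b" using norm_triangle_ineq[of a b] by simp
  also have "\<dots> \<le> (1 + norm a) * (1 + norm b)" by (simp add: algebra_simps)
  finally show ?thesis .
qed

lemma zeta1_bound:
  obtains C N where "C \<ge> 0" "\<And>w \<delta>. Re w \<ge> a \<Longrightarrow> \<delta> > 0 \<Longrightarrow> norm (w - 1) \<ge> \<delta> \<Longrightarrow> norm (zeta1 w) \<le> C * (1 + norm w) ^ N / \<delta>"
proof -
  obtain C N where C: "C \<ge> 0" "\<And>s. Re s \<ge> a \<Longrightarrow> norm (zeta_reg s) \<le> C * (1 + norm s) ^ N"
    using poly_bounded_zeta_reg[of a] unfolding poly_bounded_on_halfplane_def by auto
  have "norm (zeta1 w) \<le> C * (1 + norm w) ^ N / \<delta>" if "Re w \<ge> a" "\<delta> > 0" "norm (w - 1) \<ge> \<delta>" for w \<delta>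
    unfolding zeta1_def norm_divide using C that by (intro frac_le) auto
  with C(1) that show ?thesis by blast
qed

lemma one_plus_norm_strip:
  assumes "\<bar>Re z\<bar> \<le> R" shows "1 + norm z \<le> (1 + R) * (1 + \<bar>Im z\<bar>)"
proof -
  have "0 \<le> R * \<bar>Im z\<bar>" using assms by auto
  moreover have "(1 + R) * (1 + \<bar>Im z\<bar>) = 1 + R + \<bar>Im z\<bar> + R * \<bar>Im z\<bar>" by (simp add: algebra_simps)
  ultimately show ?thesis using cmod_le[of z] assms by linarith
qed

text \<open>The two signs of \<open>u\<close> serve the factors \<open>zeta1 (s1 + s3 + z)\<close>
  and \<open>zeta1 (s2 - z)\<close>. At heights from \<open>\<bar>Im w\<bar> + 1\<close> on, the
  argument keeps distance \<open>1\<close> from the pole.\<close>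

lemma zeta1_strip_bound:
  fixes u w :: complex
  assumes u: "norm u = 1" "u = 1 \<or> u = - 1"
  obtains C N where "C \<ge> 0" "\<And>z. a \<le> Re z \<Longrightarrow> Re z \<le> b \<Longrightarrow> \<bar>Im z\<bar> \<ge> \<bar>Im w\<bar> + 1 \<Longrightarrow>
     norm (zeta1 (w + u * z)) \<le> C * (1 + \<bar>Im z\<bar>) ^ N"
proof -
  define R where "R = \<bar>a\<bar> + \<bar>b\<bar>"
  obtain C N where C: "C \<ge> 0" "\<And>v \<delta>. Re v \<ge> Re w - R \<Longrightarrow> \<delta> > 0 \<Longrightarrow> norm (v - 1) \<ge> \<delta> \<Longrightarrow> norm (zeta1 v) \<le> C * (1 + norm v) ^ N / \<delta>"
    using zeta1_bound[of "Re w - R"] by metis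
  show ?thesis
  proof (rule that[of "C * ((1 + norm w) * (1 + R)) ^ N" N])
    show "C * ((1 + norm w) * (1 + R)) ^ N \<ge> 0" using C by (simp add: R_def)
    fix z assume z: "a \<le> Re z" "Re z \<le> b" "\<bar>Im z\<bar> \<ge> \<bar>Im w\<bar> + 1"
    have R: "\<bar>Re z\<bar> \<le> R" using z by (auto simp: R_def)
    have "\<bar>Im (w + u * z - 1)\<bar> \<ge> 1" using u z by auto
    then have "norm (w + u * z - 1) \<ge> 1" using abs_Im_le_cmod order_trans by blast
    moreover have "Re (w + u * z) \<ge> Re w - R" using u R by auto
    ultimately have "norm (zeta1 (w + u * z)) \<le> C * (1 + norm (w + u * z)) ^ N / 1"
      by (intro C) auto
    also have "\<dots> \<le> C * ((1 + norm w) * (1 + R) * (1 + \<bar>Im z\<bar>)) ^ N"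
    proof -
      have "1 + norm (w + u * z) \<le> (1 + norm w) * (1 + norm z)"
        using one_plus_norm_add_le[of w "u * z"] u by (simp add: norm_mult)
      also have "\<dots> \<le> (1 + norm w) * ((1 + R) * (1 + \<bar>Im z\<bar>))"
        by (intro mult_left_mono one_plus_norm_strip R) auto
      finally show ?thesis using C by (auto intro!: mult_left_mono power_mono simp: mult_ac)
    qed
    finally show "norm (zeta1 (w + u * z)) \<le> C * ((1 + norm w) * (1 + R)) ^ N * (1 + \<bar>Im z\<bar>) ^ N"
      by (simp add: power_mult_distrib mult_ac)
  qed
qed

section \<open>The Mordell--Tornheim function as a Barnes integral on a line further right\<close>

definition mt_integrand :: "complex \<Rightarrow> complex \<Rightarrow> complex \<Rightarrow> complex \<Rightarrow> complex" where
  "mt_integrand s1 s2 s3 z = Beta (s3 + z) (- z) * (zeta1 (s1 + s3 + z) * zeta1 (s2 - z))"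

definition mt_integral :: "nat \<Rightarrow> complex \<Rightarrow> complex \<Rightarrow> complex \<Rightarrow> complex" where
  "mt_integral J s1 s2 s3 = (LINT t|lborel. mt_integrand s1 s2 s3 (Complex (real J - 1/2) t))"

text \<open>The Beta term is the residue of \<open>zeta1 (s2 - z)\<close> at
  \<open>z = s2 - 1\<close>; the sum collects the poles of \<open>Gamma (- z)\<close> at
  \<open>0, ..., J - 1\<close>. The divisor lacks a factor \<open>i\<close> because
  \<open>mt_integral\<close> integrates over the real parameter \<open>t\<close>.\<close>

definition mt_formula :: "nat \<Rightarrow> complex \<Rightarrow> complex \<Rightarrow> complex \<Rightarrow> complex" where
  "mt_formula J s1 s2 s3 = Beta (s2 + s3 - 1) (1 - s2) * zeta1 (s1 + s2 + s3 - 1)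
     + (\<Sum>j<J. ((- s3) gchoose j) * (zeta1 (s1 + s3 + of_nat j) * zeta1 (s2 - of_nat j)))
     + mt_integral J s1 s2 s3 / (2 * of_real pi)"

text \<open>\<open>Re s2 < 1\<close> places the pole at \<open>s2 - 1\<close> strictly left of
  \<open>0\<close>, apart from those of \<open>Gamma (- z)\<close>, so every pole met is simple. The
  lower bound on \<open>Re s3\<close> keeps all other poles left of the starting line.\<close>

lemma mt_sum_eq_formula:
  assumes s2: "Re s2 < 1" and s3: "Re s3 > max (2 - Re s2) (3 - Re s2 - Re s1)" and J: "J \<ge> 1"
  shows "(\<Sum>\<^sub>\<infinity>p\<in>{1..} \<times> {1..}. mt_term s1 s2 s3 p) = mt_formula J s1 s2 s3"
proof -
  let ?f = "mt_integrand s1 s2 s3"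
  let ?h = "\<lambda>z. zeta1 (s1 + s3 + z) * zeta1 (s2 - z)"
  \<comment> \<open>\<open>c0\<close> lies one unit left of the pole at \<open>s2 - 1\<close>, where
    both Dirichlet series converge; \<open>c1\<close> lies halfway between that pole and
    \<open>0\<close>.\<close>
  define c0 where "c0 = Re s2 - 2"
  define c1 where "c1 = (Re s2 - 1) / 2"
  have c0: "c0 < c1" "c0 < 0" "c1 < 0" "Re s3 + c0 > 0" "Re (s1 + s3) + c0 > 1" "Re s2 - c0 > 1" "c0 < Re s2 - 1" "Re s2 - 1 < c1"
    using s2 s3 by (auto simp: c0_def c1_def)
  have zb: "\<exists>C N. C \<ge> 0 \<and> (\<forall>z. a \<le> Re z \<longrightarrow> Re z \<le> b \<longrightarrow> \<bar>Im z\<bar> \<ge> T \<longrightarrow> norm (?h z) \<le> C * (1 + \<bar>Im z\<bar>) ^ N)"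
    if T: "T = \<bar>Im (s1 + s3)\<bar> + \<bar>Im s2\<bar> + 1" for a b T
  proof -
    obtain C N where 1: "C \<ge> 0" "\<And>z. a \<le> Re z \<Longrightarrow> Re z \<le> b \<Longrightarrow> \<bar>Im z\<bar> \<ge> \<bar>Im (s1 + s3)\<bar> + 1 \<Longrightarrow>
     norm (zeta1 ((s1 + s3) + 1 * z)) \<le> C * (1 + \<bar>Im z\<bar>) ^ N"
      using zeta1_strip_bound[of 1 a b "s1 + s3"] by auto
    obtain D M where 2: "D \<ge> 0" "\<And>z. a \<le> Re z \<Longrightarrow> Re z \<le> b \<Longrightarrow> \<bar>Im z\<bar> \<ge> \<bar>Im s2\<bar> + 1 \<Longrightarrow>
     norm (zeta1 (s2 + (-1) * z)) \<le> D * (1 + \<bar>Im z\<bar>) ^ M"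
      using zeta1_strip_bound[of "-1" a b s2] by auto
    have "norm (?h z) \<le> (C * D) * (1 + \<bar>Im z\<bar>) ^ (N + M)" if z: "a \<le> Re z" "Re z \<le> b" "\<bar>Im z\<bar> \<ge> T" for z
    proof -
      have "norm (?h z) \<le> (C * (1 + \<bar>Im z\<bar>) ^ N) * (D * (1 + \<bar>Im z\<bar>) ^ M)"
        unfolding norm_mult using 1(2)[of z] 2(2)[of z] z 1(1) T by (intro mult_mono) auto
      then show ?thesis by (simp add: power_add mult_ac)
    qed
    then show ?thesis using 1(1) 2(1) by (intro exI[of _ "C * D"] exI[of _ "N + M"]) auto
  qed
  define T where "T = \<bar>Im (s1 + s3)\<bar> + \<bar>Im s2\<bar> + 1"
  have T1: "T \<ge> 1" by (simp add: T_def)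
  define \<delta> where "\<delta> = min (min (Re s3 + c0) (Re (s1 + s3) + c0 - 1)) (- c1)"
  have \<delta>: "\<delta> > 0" "\<delta> \<le> Re s3 + c0" "\<delta> \<le> Re (s1 + s3) + c0 - 1" "\<delta> \<le> - c1" using c0 by (auto simp: \<delta>_def)
  \<comment> \<open>Crosses the pole of \<open>zeta1 (s2 - z)\<close>; the residue changes sign
    because \<open>z\<close> enters with coefficient \<open>-1\<close>.\<close>
  have step0: "vertical_line_integral c1 ?f - vertical_line_integral c0 ?f =
      2 * of_real pi * \<i> * (- (Beta (s2 + s3 - 1) (1 - s2) * zeta1 (s1 + s2 + s3 - 1)))"
  proof -
    have holU: "(\<lambda>z. Beta (s3 + z) (- z) * zeta1 (s1 + s3 + z)) holomorphic_on {z. c0 - \<delta> < Re z \<and> Re z < c1 + \<delta>}"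
    proof (intro holomorphic_intros)
      fix z assume z: "z \<in> {z. c0 - \<delta> < Re z \<and> Re z < c1 + \<delta>}"
      show "s3 + z \<notin> \<int>\<^sub>\<le>\<^sub>0" "- z \<notin> \<int>\<^sub>\<le>\<^sub>0" using z \<delta> by (auto intro!: not_nonpos_Int_if_Re_pos)
      show "s1 + s3 + z \<noteq> 1" using z \<delta> by (auto simp: complex_eq_iff)
    qed
    have hol: "?f holomorphic_on ({z. c0 - \<delta> < Re z \<and> Re z < c1 + \<delta>} - {s2 - 1})"
      unfolding mt_integrand_def mult.assoc[symmetric]
      by (intro holomorphic_on_mult[OF holomorphic_on_subset[OF holU]] holomorphic_intros) (auto simp: algebra_simps)
    have lim: "((\<lambda>z. (z - (s2 - 1)) * ?f z) \<longlongrightarrow> - (Beta (s2 + s3 - 1) (1 - s2) * zeta1 (s1 + s2 + s3 - 1))) (at (s2 - 1))"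
    proof -
      have "open {z. c0 - \<delta> < Re z \<and> Re z < c1 + \<delta>}"
        by (simp add: open_Collect_conj open_halfspace_Re_gt open_halfspace_Re_lt)
      moreover have "s2 - 1 \<in> {z. c0 - \<delta> < Re z \<and> Re z < c1 + \<delta>}" using c0 \<delta> by auto
      ultimately have "isCont (\<lambda>z. Beta (s3 + z) (- z) * zeta1 (s1 + s3 + z)) (s2 - 1)"
        using holomorphic_on_imp_continuous_on[OF holU] continuous_on_eq_continuous_at by blast
      then have 1: "((\<lambda>z. Beta (s3 + z) (- z) * zeta1 (s1 + s3 + z)) \<longlongrightarrow> Beta (s2 + s3 - 1) (1 - s2) * zeta1 (s1 + s2 + s3 - 1)) (at (s2 - 1))"
        by (simp add: isCont_def algebra_simps)
      have "filterlim (\<lambda>z. s2 - z) (at 1) (at (s2 - 1))"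
        by (rule filterlim_atI) (auto intro!: tendsto_eq_intros always_eventually simp: eventually_at_filter algebra_simps)
      from filterlim_compose[OF zeta1_residue this]
      have 2: "((\<lambda>z. (s2 - z - 1) * zeta1 (s2 - z)) \<longlongrightarrow> 1) (at (s2 - 1))" .
      have "(\<lambda>z. (z - (s2 - 1)) * ?f z) = (\<lambda>z. - ((Beta (s3 + z) (- z) * zeta1 (s1 + s3 + z)) * ((s2 - z - 1) * zeta1 (s2 - z))))"
        by (auto simp: mt_integrand_def fun_eq_iff algebra_simps)
      then show ?thesis using tendsto_minus[OF tendsto_mult[OF 1 2]] by simp
    qed
    obtain C N where C: "C \<ge> 0" "\<And>z. c0 \<le> Re z \<Longrightarrow> Re z \<le> c1 \<Longrightarrow> \<bar>Im z\<bar> \<ge> T \<Longrightarrow> norm (?h z) \<le> C * (1 + \<bar>Im z\<bar>) ^ N"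
      using zb[OF T_def, of c0 c1] by auto
    obtain D M where D: "D > 0" "\<And>s' z. Re (s' + z) \<ge> Re s3 + c0 \<Longrightarrow> Re z \<le> c1 \<Longrightarrow> (\<And>j::nat. norm (of_nat j - z) \<ge> 1/2 * (1 + \<bar>Im z\<bar>)) \<Longrightarrow>
        norm (Beta (s' + z) (- z)) * (1 + \<bar>Im z\<bar>) ^ N \<le> D * (1 + norm s') ^ M * decay (Im z)"
      using MB_kernel_bound[of "Re s3 + c0" "1/2" c1 N] c0 by auto
    have bd: "norm (?f z) \<le> (C * (D * (1 + norm s3) ^ M)) * decay (Im z)"
      if "c0 \<le> Re z" "Re z \<le> c1" "\<bar>Im z\<bar> \<ge> T" for z
    proof -
      have "norm (?f z) \<le> norm (Beta (s3 + z) (- z)) * (C * (1 + \<bar>Im z\<bar>) ^ N)"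
        unfolding mt_integrand_def norm_mult[of "Beta (s3 + z) (- z)"] using C that by (intro mult_left_mono) auto
      also have "\<dots> = C * (norm (Beta (s3 + z) (- z)) * (1 + \<bar>Im z\<bar>) ^ N)" by simp
      also have "\<dots> \<le> C * (D * (1 + norm s3) ^ M * decay (Im z))"
        by (intro mult_left_mono D norm_nat_diff_ge_Im) (use that T1 C in auto)
      finally show ?thesis by (simp add: mult_ac)
    qed
    show ?thesis
      by (rule vertical_line_shift(3)[OF _ _ \<delta>(1) hol lim bd]) (use c0 in auto)
  qed
  have base: "vertical_line_integral c0 ?f = 2 * of_real pi * \<i> * (\<Sum>\<^sub>\<infinity>p\<in>{1..} \<times> {1..}. mt_term s1 s2 s3 p)"
    unfolding mt_integrand_def[abs_def] by (rule mt_sum_eq_MB) (use c0 in auto)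
  \<comment> \<open>The lower abscissa is just \<open>Re s2 - 1\<close>, that of the pole of the
    second factor, written as a margin to the left of \<open>a\<close>.\<close>
  have hol: "?h holomorphic_on {z. a - (a - Re s2 + 1) < Re z \<and> Re z < b + 1}" if "a \<ge> c1" for a b
  proof (intro holomorphic_intros)
    fix z assume z: "z \<in> {z. a - (a - Re s2 + 1) < Re z \<and> Re z < b + 1}"
    have "Re (s1 + s3) + Re z > 1" using z c0 by auto
    then show "s1 + s3 + z \<noteq> 1" by (auto simp: complex_eq_iff)
    show "s2 - z \<noteq> 1" using z by (auto simp: complex_eq_iff)
  qed
  have shift: "vertical_line_integral a ?f = vertical_line_integral b ?f + 2 * of_real pi * \<i> * (((- s3) gchoose K) * ?h (of_nat K))"
    if ab: "a \<ge> c1" "a < real K" "real K < b" "b < real K + 1" "K = 0 \<or> real K - 1 < a" for a b K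
  proof -
    obtain C N where C: "C \<ge> 0" "\<And>z. a \<le> Re z \<Longrightarrow> Re z \<le> b \<Longrightarrow> \<bar>Im z\<bar> \<ge> T \<Longrightarrow> norm (?h z) \<le> C * (1 + \<bar>Im z\<bar>) ^ N"
      using zb[OF T_def, of a b] by auto
    have h: "?h holomorphic_on {z. a - min 1 (a - Re s2 + 1) < Re z \<and> Re z < b + min 1 (a - Re s2 + 1)}"
      by (rule holomorphic_on_subset[OF hol[OF ab(1), of b]]) auto
    show ?thesis
      unfolding mt_integrand_def[abs_def]
      by (rule MB_shift(3)[OF ab(2-5) _ _ h C(2)]) (use ab c0 in auto)
  qed
  have "vertical_line_integral c1 ?f = vertical_line_integral (real J - 1/2) ?f +
      2 * of_real pi * \<i> * (\<Sum>j<J. ((- s3) gchoose j) * ?h (of_nat j))"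
    using J
  proof (induction J rule: nat_induct_at_least)
    case base
    show ?case using shift[of c1 0 "1/2"] c0 by simp
  next
    case (Suc J)
    have "vertical_line_integral (real J - 1/2) ?f = vertical_line_integral (real (Suc J) - 1/2) ?f + 2 * of_real pi * \<i> * (((- s3) gchoose J) * ?h (of_nat J))"
      by (rule shift) (use c0 Suc in auto)
    then show ?case using Suc.IH by (simp add: algebra_simps)
  qed
  moreover have "vertical_line_integral c1 ?f = 2 * of_real pi * \<i> * ((\<Sum>\<^sub>\<infinity>p\<in>{1..} \<times> {1..}. mt_term s1 s2 s3 p) - Beta (s2 + s3 - 1) (1 - s2) * zeta1 (s1 + s2 + s3 - 1))"
    using step0 base by (simp add: algebra_simps)
  moreover have "vertical_line_integral (real J - 1/2) ?f = 2 * of_real pi * \<i> * (mt_integral J s1 s2 s3 / (2 * of_real pi))"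
    by (simp add: vertical_line_integral_def mt_integral_def)
  ultimately have "2 * of_real pi * \<i> * ((\<Sum>\<^sub>\<infinity>p\<in>{1..} \<times> {1..}. mt_term s1 s2 s3 p) - Beta (s2 + s3 - 1) (1 - s2) * zeta1 (s1 + s2 + s3 - 1))
     = 2 * of_real pi * \<i> * (mt_integral J s1 s2 s3 / (2 * of_real pi) + (\<Sum>j<J. ((- s3) gchoose j) * ?h (of_nat j)))"
    by (simp only: distrib_left)
  then have "(\<Sum>\<^sub>\<infinity>p\<in>{1..} \<times> {1..}. mt_term s1 s2 s3 p) - Beta (s2 + s3 - 1) (1 - s2) * zeta1 (s1 + s2 + s3 - 1)
     = mt_integral J s1 s2 s3 / (2 * of_real pi) + (\<Sum>j<J. ((- s3) gchoose j) * ?h (of_nat j))"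
    by (simp only: mult_cancel_left) simp
  then show ?thesis by (simp add: mt_formula_def algebra_simps)
qed

definition mt_weight :: "complex \<Rightarrow> complex \<Rightarrow> complex \<Rightarrow> real" where
  "mt_weight s1 s2 s3 = (1 + norm s1) * (1 + norm s2) * (1 + norm s3)"

lemma mt_weight_ge: "1 \<le> mt_weight s1 s2 s3" "1 + norm s1 \<le> mt_weight s1 s2 s3" "1 + norm s2 \<le> mt_weight s1 s2 s3"
  "1 + norm s3 \<le> mt_weight s1 s2 s3" "(1 + norm s1) * (1 + norm s3) \<le> mt_weight s1 s2 s3"
proof -
  define a b c where "a = 1 + norm s1" "b = 1 + norm s2" "c = 1 + norm s3"
  have abc: "a \<ge> 1" "b \<ge> 1" "c \<ge> 1" by (auto simp: a_b_c_def)
  have "1 * 1 \<le> a * b" "1 * 1 \<le> a * c" "1 * 1 \<le> b * c" using abc by (intro mult_mono; simp)+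
  moreover from this have "1 * 1 \<le> (a * b) * c" using abc by (intro mult_mono) simp_all
  ultimately have "1 * 1 \<le> a * b * c" "a * 1 \<le> a * (b * c)" "b * 1 \<le> b * (a * c)" "c * 1 \<le> c * (a * b)" "(a * c) * 1 \<le> (a * c) * b"
    using abc by (simp_all add: mult_ac)
  then show "1 \<le> mt_weight s1 s2 s3" "1 + norm s1 \<le> mt_weight s1 s2 s3" "1 + norm s2 \<le> mt_weight s1 s2 s3"
    "1 + norm s3 \<le> mt_weight s1 s2 s3" "(1 + norm s1) * (1 + norm s3) \<le> mt_weight s1 s2 s3"
    unfolding mt_weight_def a_b_c_def by (simp_all add: mult_ac)
qed

text \<open>On the line \<open>Re z = J - 1/2\<close> the hypotheses give
  \<open>Re (s3 + z) \<ge> 1/2\<close>, \<open>Re (s1 + s3 + z) \<ge> 3/2\<close> and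
  \<open>Re (s2 - z) \<le> 1/2\<close>. Hence both zeta arguments keep distance \<open>1/2\<close>
  from \<open>1\<close>, and the half-integral abscissa keeps the line off the poles of
  \<open>Gamma (- z)\<close>.\<close>

lemma mt_integrand_bound:
  fixes J :: nat and M :: real
  assumes J: "J \<ge> 1"
  obtains C N where "C \<ge> 0" "\<And>s1 s2 s3 t. Re s3 \<ge> 1 - real J \<Longrightarrow> Re (s1 + s3) \<ge> 2 - real J \<Longrightarrow> - M \<le> Re s2 \<Longrightarrow> Re s2 \<le> 1 \<Longrightarrow>
     norm (mt_integrand s1 s2 s3 (Complex (real J - 1/2) t)) \<le> C * mt_weight s1 s2 s3 ^ N * decay t"
proof -
  obtain C1 N1 where C1: "C1 \<ge> 0" "\<And>w \<delta>. Re w \<ge> 1 \<Longrightarrow> \<delta> > 0 \<Longrightarrow> norm (w - 1) \<ge> \<delta> \<Longrightarrow> norm (zeta1 w) \<le> C1 * (1 + norm w) ^ N1 / \<delta>"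
    using zeta1_bound by metis
  obtain C2 N2 where C2: "C2 \<ge> 0" "\<And>w \<delta>. Re w \<ge> - M - real J \<Longrightarrow> \<delta> > 0 \<Longrightarrow> norm (w - 1) \<ge> \<delta> \<Longrightarrow> norm (zeta1 w) \<le> C2 * (1 + norm w) ^ N2 / \<delta>"
    using zeta1_bound by metis
  \<comment> \<open>The exponent \<open>N1 + N2\<close> lets the kernel absorb the growth of both
    zeta factors in \<open>t\<close>.\<close>
  obtain C3 N3 where C3: "C3 > 0" "\<And>s z. Re (s + z) \<ge> 1/2 \<Longrightarrow> Re z \<le> real J \<Longrightarrow> (\<And>j::nat. norm (of_nat j - z) \<ge> 1/4 * (1 + \<bar>Im z\<bar>)) \<Longrightarrow>
        norm (Beta (s + z) (- z)) * (1 + \<bar>Im z\<bar>) ^ (N1 + N2) \<le> C3 * (1 + norm s) ^ N3 * decay (Im z)"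
    using MB_kernel_bound[of "1/2" "1/4" "real J" "N1 + N2"] by auto
  define R where "R = 1 + real J"
  define C where "C = 4 * C1 * C2 * C3 * R ^ (N1 + N2)"
  show ?thesis
  proof (rule that[of C "N1 + N2 + N3"])
    show "C \<ge> 0" using C1 C2 C3 by (simp add: C_def R_def)
    fix s1 s2 s3 :: complex and t :: real
    assume a: "Re s3 \<ge> 1 - real J" "Re (s1 + s3) \<ge> 2 - real J" "- M \<le> Re s2" "Re s2 \<le> 1"
    define z where "z = Complex (real J - 1/2) t"
    define X where "X = mt_weight s1 s2 s3"
    note X = mt_weight_ge[where ?s1.0 = s1 and ?s2.0 = s2 and ?s3.0 = s3, folded X_def]
    have z: "1 + norm z \<le> R * (1 + \<bar>t\<bar>)"
      using one_plus_norm_strip[of z "real J"] J by (simp add: z_def R_def)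
    have 1: "norm (zeta1 (s1 + s3 + z)) \<le> C1 * (X * (R * (1 + \<bar>t\<bar>))) ^ N1 / (1/2)"
    proof -
      have "norm (s1 + s3 + z - 1) \<ge> 1/2"
        using complex_Re_le_cmod[of "s1 + s3 + z - 1"] a by (simp add: z_def)
      moreover have "Re (s1 + s3 + z) \<ge> 1" using a by (simp add: z_def)
      ultimately have "norm (zeta1 (s1 + s3 + z)) \<le> C1 * (1 + norm (s1 + s3 + z)) ^ N1 / (1/2)"
        by (intro C1) auto
      also have "\<dots> \<le> C1 * (X * (R * (1 + \<bar>t\<bar>))) ^ N1 / (1/2)"
      proof (intro divide_right_mono mult_left_mono power_mono)
        have "1 + norm (s1 + s3 + z) \<le> (1 + norm (s1 + s3)) * (1 + norm z)" by (rule one_plus_norm_add_le)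
        also have "\<dots> \<le> X * (R * (1 + \<bar>t\<bar>))"
          using order_trans[OF one_plus_norm_add_le[of s1 s3] X(5)] X(1) z by (intro mult_mono) auto
        finally show "1 + norm (s1 + s3 + z) \<le> X * (R * (1 + \<bar>t\<bar>))" .
      qed (use C1 in auto)
      finally show ?thesis .
    qed
    have 2: "norm (zeta1 (s2 - z)) \<le> C2 * (X * (R * (1 + \<bar>t\<bar>))) ^ N2 / (1/2)"
    proof -
      have "norm (s2 - z - 1) \<ge> 1/2"
        using abs_Re_le_cmod[of "s2 - z - 1"] a J by (simp add: z_def)
      moreover have "Re (s2 - z) \<ge> - M - real J" using a by (simp add: z_def)
      ultimately have "norm (zeta1 (s2 - z)) \<le> C2 * (1 + norm (s2 - z)) ^ N2 / (1/2)"
        by (intro C2) auto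
      also have "\<dots> \<le> C2 * (X * (R * (1 + \<bar>t\<bar>))) ^ N2 / (1/2)"
      proof (intro divide_right_mono mult_left_mono power_mono)
        have "1 + norm (s2 - z) \<le> (1 + norm s2) * (1 + norm z)" using one_plus_norm_add_le[of s2 "- z"] by simp
        also have "\<dots> \<le> X * (R * (1 + \<bar>t\<bar>))"
          using X z by (intro mult_mono) auto
        finally show "1 + norm (s2 - z) \<le> X * (R * (1 + \<bar>t\<bar>))" .
      qed (use C2 in auto)
      finally show ?thesis .
    qed
    have 3: "norm (Beta (s3 + z) (- z)) * (1 + \<bar>t\<bar>) ^ (N1 + N2) \<le> C3 * X ^ N3 * decay t"
    proof -
      have "norm (of_nat j - z) \<ge> 1/4 * (1 + \<bar>Im z\<bar>)" for j
      proof -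
        have "\<bar>real j - (real J - 1/2)\<bar> \<ge> 1/2" by (cases "j \<ge> J") auto
        then show ?thesis using norm_nat_diff_ge_Re[of "1/2" j z] by (simp add: z_def)
      qed
      then have "norm (Beta (s3 + z) (- z)) * (1 + \<bar>Im z\<bar>) ^ (N1 + N2) \<le> C3 * (1 + norm s3) ^ N3 * decay (Im z)"
        using a by (intro C3) (auto simp: z_def)
      also have "\<dots> \<le> C3 * X ^ N3 * decay (Im z)"
        using C3 X by (intro mult_right_mono mult_left_mono power_mono) auto
      finally show ?thesis by (simp add: z_def)
    qed
    have "norm (mt_integrand s1 s2 s3 z) \<le> norm (Beta (s3 + z) (- z)) *
        ((C1 * (X * (R * (1 + \<bar>t\<bar>))) ^ N1 / (1/2)) * (C2 * (X * (R * (1 + \<bar>t\<bar>))) ^ N2 / (1/2)))"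
      unfolding mt_integrand_def norm_mult
      by (intro mult_left_mono mult_mono 1 2 norm_ge_zero order_trans[OF norm_ge_zero 1])
    also have "\<dots> = (4 * C1 * C2 * R ^ (N1 + N2) * X ^ (N1 + N2)) * (norm (Beta (s3 + z) (- z)) * (1 + \<bar>t\<bar>) ^ (N1 + N2))"
      by (simp only: power_mult_distrib power_add) simp
    also have "\<dots> \<le> (4 * C1 * C2 * R ^ (N1 + N2) * X ^ (N1 + N2)) * (C3 * X ^ N3 * decay t)"
      using C1 C2 X by (intro mult_left_mono 3) (auto simp: R_def)
    also have "\<dots> = C * X ^ (N1 + N2 + N3) * decay t"
      by (simp only: C_def power_add mult_ac)
    finally show "norm (mt_integrand s1 s2 s3 (Complex (real J - 1/2) t)) \<le> C * mt_weight s1 s2 s3 ^ (N1 + N2 + N3) * decay t"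
      by (simp only: z_def X_def)
  qed
qed

text \<open>On this set all poles of the integrand other than those of \<open>Gamma (- z)\<close>
  lie left of the line \<open>Re z = J - 1/2\<close>. As \<open>J\<close> grows, the sets exhaust
  \<open>Re s2 < 1\<close>.\<close>

definition mt_domain :: "nat \<Rightarrow> (complex \<times> complex \<times> complex) set" where
  "mt_domain J = {(s1, s2, s3). Re s3 > 1 - real J \<and> Re (s1 + s3) > 2 - real J \<and> Re s2 < 1}"

lemma open_mt_domain: "open (mt_domain J)"
proof -
  have "mt_domain J = {p. Re (snd (snd p)) > 1 - real J} \<inter> {p. Re (fst p + snd (snd p)) > 2 - real J} \<inter> {p. Re (fst (snd p)) < 1}"
    by (auto simp: mt_domain_def)
  then show ?thesis by (auto intro!: open_Int open_Collect_less continuous_intros)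
qed

lemma mt_integrand_holomorphic:
  assumes J: "J \<ge> 1" and W: "\<And>w. w \<in> W \<Longrightarrow> (f1 w, f2 w, f3 w) \<in> mt_domain J"
    and f: "f1 holomorphic_on W" "f2 holomorphic_on W" "f3 holomorphic_on W"
  shows "(\<lambda>w. mt_integrand (f1 w) (f2 w) (f3 w) (Complex (real J - 1/2) t)) holomorphic_on W"
  unfolding mt_integrand_def
proof (intro holomorphic_intros f)
  fix w assume "w \<in> W"
  from W[OF this] have *: "Re (f3 w) > 1 - real J" "Re (f1 w + f3 w) > 2 - real J" "Re (f2 w) < 1"
    by (auto simp: mt_domain_def)
  show "f3 w + Complex (real J - 1 / 2) t \<notin> \<int>\<^sub>\<le>\<^sub>0" by (rule not_nonpos_Int_if_Re_pos) (use * in simp)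
  show "- Complex (real J - 1 / 2) t \<notin> \<int>\<^sub>\<le>\<^sub>0"
  proof
    assume "- Complex (real J - 1 / 2) t \<in> \<int>\<^sub>\<le>\<^sub>0"
    then obtain n where "- Complex (real J - 1 / 2) t = - of_nat n" by (auto elim!: nonpos_Ints_cases')
    then have "real J - 1/2 = real n" by (simp add: complex_eq_iff)
    then have "real (2 * J) = real (2 * n + 1)" by simp
    then have "2 * J = 2 * n + 1" by (simp only: of_nat_eq_iff)
    then show False by presburger
  qed
  show "f1 w + f3 w + Complex (real J - 1 / 2) t \<noteq> 1" using * by (auto simp: complex_eq_iff)
  show "f2 w - Complex (real J - 1 / 2) t \<noteq> 1" using * J by (auto simp: complex_eq_iff)
qed

lemma mt_integrand_measurable:
  assumes J: "J \<ge> 1" and p: "(s1, s2, s3) \<in> mt_domain J"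
  shows "(\<lambda>t. mt_integrand s1 s2 s3 (Complex (real J - 1/2) t)) \<in> borel_measurable lborel"
proof (rule continuous_on_imp_lborel_measurable)
  have *: "Re s3 > 1 - real J" "Re (s1 + s3) > 2 - real J" "Re s2 < 1" using p by (auto simp: mt_domain_def)
  have z: "continuous_on UNIV (\<lambda>t. Complex (real J - 1/2) t)" by (simp add: Complex_eq continuous_intros)
  have nj: "real J - 1/2 \<noteq> real j" for j
  proof
    assume "real J - 1/2 = real j"
    then have "real (2 * J) = real (2 * j + 1)" by simp
    then have "2 * J = 2 * j + 1" by (simp only: of_nat_eq_iff)
    then show False by presburger
  qed
  have "continuous_on UNIV (\<lambda>t. Beta (s3 + Complex (real J - 1/2) t) (- Complex (real J - 1/2) t))"
    by (rule continuous_MB_kernel) (use * nj in auto)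
  moreover have zc: "continuous_on (- {1}) zeta1"
    using holomorphic_on_imp_continuous_on[OF holomorphic_zeta1[of "\<lambda>z. z" "- {1}"]] by auto
  have "continuous_on UNIV (\<lambda>t. zeta1 (s1 + s3 + Complex (real J - 1/2) t))"
  proof (rule continuous_on_compose2[OF zc])
    show "continuous_on UNIV (\<lambda>t. s1 + s3 + Complex (real J - 1/2) t)" by (intro continuous_intros z)
    show "range (\<lambda>t. s1 + s3 + Complex (real J - 1/2) t) \<subseteq> - {1}" using * by (auto simp: complex_eq_iff)
  qed
  moreover have "continuous_on UNIV (\<lambda>t. zeta1 (s2 - Complex (real J - 1/2) t))"
  proof (rule continuous_on_compose2[OF zc])
    show "continuous_on UNIV (\<lambda>t. s2 - Complex (real J - 1/2) t)" by (intro continuous_intros z)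
    show "range (\<lambda>t. s2 - Complex (real J - 1/2) t) \<subseteq> - {1}" using * J by (auto simp: complex_eq_iff)
  qed
  ultimately show "continuous_on UNIV (\<lambda>t. mt_integrand s1 s2 s3 (Complex (real J - 1/2) t))"
    unfolding mt_integrand_def by (intro continuous_intros)
qed

lemma mt_integral_holomorphic:
  assumes J: "J \<ge> 1" and U: "open U" and W: "\<And>w. w \<in> U \<Longrightarrow> (f1 w, f2 w, f3 w) \<in> mt_domain J"
    and f: "f1 holomorphic_on U" "f2 holomorphic_on U" "f3 holomorphic_on U"
  shows "(\<lambda>w. mt_integral J (f1 w) (f2 w) (f3 w)) holomorphic_on U"
  unfolding mt_integral_def
proof (rule holomorphic_on_LINT[OF U mt_integrand_holomorphic[OF J W f]])
  show "(\<lambda>t. mt_integrand (f1 s) (f2 s) (f3 s) (Complex (real J - 1/2) t)) \<in> borel_measurable lborel" if "s \<in> U" for s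
    by (rule mt_integrand_measurable[OF J W[OF that]])
  fix s0 assume "s0 \<in> U"
  then obtain r where r: "r > 0" "cball s0 r \<subseteq> U" using U open_contains_cball by blast
  have bd: "\<exists>B. \<forall>w\<in>cball s0 r. norm (f w) \<le> B" if "f holomorphic_on U" for f
  proof -
    have "compact (f ` cball s0 r)"
      using holomorphic_on_imp_continuous_on[OF holomorphic_on_subset[OF that r(2)]] by (intro compact_continuous_image) auto
    then show ?thesis by (meson bounded_iff compact_imp_bounded imageI)
  qed
  obtain B1 B2 B3 where B: "\<And>w. w \<in> cball s0 r \<Longrightarrow> norm (f1 w) \<le> B1" "\<And>w. w \<in> cball s0 r \<Longrightarrow> norm (f2 w) \<le> B2"
     "\<And>w. w \<in> cball s0 r \<Longrightarrow> norm (f3 w) \<le> B3"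
    using bd[OF f(1)] bd[OF f(2)] bd[OF f(3)] by metis
  obtain C N where C: "C \<ge> 0" "\<And>s1 s2 s3 t. Re s3 \<ge> 1 - real J \<Longrightarrow> Re (s1 + s3) \<ge> 2 - real J \<Longrightarrow> - B2 \<le> Re s2 \<Longrightarrow> Re s2 \<le> 1 \<Longrightarrow>
     norm (mt_integrand s1 s2 s3 (Complex (real J - 1/2) t)) \<le> C * mt_weight s1 s2 s3 ^ N * decay t"
    using mt_integrand_bound[OF J, of B2] by metis
  have "norm (mt_integrand (f1 w) (f2 w) (f3 w) (Complex (real J - 1/2) t)) \<le> (C * ((1 + B1) * (1 + B2) * (1 + B3)) ^ N) * decay t"
    if w: "w \<in> cball s0 r" for w t
  proof -
    have "- B2 \<le> Re (f2 w)" using B(2)[OF w] abs_Re_le_cmod[of "f2 w"] by linarith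
    then have "norm (mt_integrand (f1 w) (f2 w) (f3 w) (Complex (real J - 1/2) t)) \<le> C * mt_weight (f1 w) (f2 w) (f3 w) ^ N * decay t"
      using W[of w] w r by (intro C) (auto simp: mt_domain_def)
    moreover have "mt_weight (f1 w) (f2 w) (f3 w) \<le> (1 + B1) * (1 + B2) * (1 + B3)"
    proof -
      have "0 \<le> B1" "0 \<le> B2" "0 \<le> B3" using B[OF w] norm_ge_zero order_trans by blast+
      then show ?thesis unfolding mt_weight_def using B[OF w] by (intro mult_mono mult_nonneg_nonneg) auto
    qed
    moreover have "0 \<le> mt_weight (f1 w) (f2 w) (f3 w)" by (simp add: mt_weight_def)
    ultimately show ?thesis
      using C(1) by (meson decay_nonneg mult_left_mono mult_right_mono order_trans power_mono)
  qed
  then show "\<exists>r>0. \<exists>g. integrable lborel g \<and> (\<forall>s\<in>cball s0 r \<inter> U. \<forall>t\<in>space lborel.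
       norm (mt_integrand (f1 s) (f2 s) (f3 s) (Complex (real J - 1/2) t)) \<le> g t)"
    using r integrable_const_decay[of "C * ((1 + B1) * (1 + B2) * (1 + B3)) ^ N"] by blast
qed

lemma norm_mt_integral_le:
  assumes J: "J \<ge> 1"
  obtains C N where "C \<ge> 0" "\<And>s1 s2 s3. (s1, s2, s3) \<in> mt_domain J \<Longrightarrow> - M \<le> Re s2 \<Longrightarrow>
     norm (mt_integral J s1 s2 s3) \<le> C * mt_weight s1 s2 s3 ^ N"
proof -
  obtain C N where C: "C \<ge> 0" "\<And>s1 s2 s3 t. Re s3 \<ge> 1 - real J \<Longrightarrow> Re (s1 + s3) \<ge> 2 - real J \<Longrightarrow> - M \<le> Re s2 \<Longrightarrow> Re s2 \<le> 1 \<Longrightarrow>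
     norm (mt_integrand s1 s2 s3 (Complex (real J - 1/2) t)) \<le> C * mt_weight s1 s2 s3 ^ N * decay t"
    using mt_integrand_bound[OF J] by metis
  have 0: "(LINT t|lborel. decay t) \<ge> 0" by (intro integral_nonneg_AE) auto
  show ?thesis
  proof (rule that[of "C * (LINT t|lborel. decay t)" N])
    show "C * (LINT t|lborel. decay t) \<ge> 0" using C 0 by auto
    fix s1 s2 s3 assume p: "(s1, s2, s3) \<in> mt_domain J" "- M \<le> Re s2"
    have "norm (mt_integral J s1 s2 s3) \<le> (C * mt_weight s1 s2 s3 ^ N) * (LINT t|lborel. decay t)"
      unfolding mt_integral_def
      by (rule integrable_if_le_decay(2)[OF mt_integrand_measurable[OF J p(1)] C(2)]) (use p in \<open>auto simp: mt_domain_def\<close>)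
    then show "norm (mt_integral J s1 s2 s3) \<le> C * (LINT t|lborel. decay t) * mt_weight s1 s2 s3 ^ N"
      by (simp only: mult_ac)
  qed
qed

lemma mt_integral_holomorphic3:
  assumes J: "J \<ge> 1"
  shows "holomorphic3_on (\<lambda>(s1, s2, s3). mt_integral J s1 s2 s3) (mt_domain J)"
proof (rule holomorphic3_on_separately[OF open_mt_domain])
  have *: "(\<lambda>w. mt_integral J (f1 w) (f2 w) (f3 w)) field_differentiable (at w0)"
    if "(f1 w0, f2 w0, f3 w0) \<in> mt_domain J" and f: "f1 holomorphic_on UNIV" "f2 holomorphic_on UNIV" "f3 holomorphic_on UNIV"
    for f1 f2 f3 w0
  proof -
    define U where "U = (\<lambda>w. (f1 w, f2 w, f3 w)) -` mt_domain J"
    have U: "open U" unfolding U_def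
      by (intro open_vimage open_mt_domain continuous_on_Pair) (use f holomorphic_on_imp_continuous_on in auto)
    have "(\<lambda>w. mt_integral J (f1 w) (f2 w) (f3 w)) holomorphic_on U"
      by (rule mt_integral_holomorphic[OF J U]) (use f holomorphic_on_subset in \<open>auto simp: U_def\<close>)
    moreover have "w0 \<in> U" using that by (simp add: U_def)
    ultimately show ?thesis using U holomorphic_on_imp_differentiable_at by blast
  qed
  fix a b c :: complex assume p: "(a, b, c) \<in> mt_domain J"
  show "(\<lambda>w. case (w, b, c) of (s1, s2, s3) \<Rightarrow> mt_integral J s1 s2 s3) field_differentiable (at a)"
    using *[of "\<lambda>w. w" a "\<lambda>_. b" "\<lambda>_. c"] p by simp
  show "(\<lambda>w. case (a, w, c) of (s1, s2, s3) \<Rightarrow> mt_integral J s1 s2 s3) field_differentiable (at b)"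
    using *[of "\<lambda>_. a" b "\<lambda>w. w" "\<lambda>_. c"] p by simp
  show "(\<lambda>w. case (a, b, w) of (s1, s2, s3) \<Rightarrow> mt_integral J s1 s2 s3) field_differentiable (at c)"
    using *[of "\<lambda>_. a" c "\<lambda>_. b" "\<lambda>w. w"] p by simp
next
  fix p assume p: "p \<in> mt_domain J"
  define B where "B = norm p + 1"
  obtain C N where C: "C \<ge> 0" "\<And>s1 s2 s3. (s1, s2, s3) \<in> mt_domain J \<Longrightarrow> - B \<le> Re s2 \<Longrightarrow>
     norm (mt_integral J s1 s2 s3) \<le> C * mt_weight s1 s2 s3 ^ N"
    using norm_mt_integral_le[OF J] by metis
  have "norm (case q of (s1, s2, s3) \<Rightarrow> mt_integral J s1 s2 s3) \<le> C * ((1 + B) * (1 + B) * (1 + B)) ^ N"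
    if q: "q \<in> ball p 1 \<inter> mt_domain J" for q
  proof -
    obtain s1 s2 s3 where s: "q = (s1, s2, s3)" by (cases q) auto
    have "norm q \<le> B" using q norm_triangle_sub[of q p] by (auto simp: B_def dist_norm norm_minus_commute)
    then have n: "norm s1 \<le> B" "norm s2 \<le> B" "norm s3 \<le> B"
      using norm_fst_le[of s1 "(s2, s3)"] norm_snd_le[of "(s2, s3)" s1] norm_fst_le[of s2 s3] norm_snd_le[of s3 s2]
      unfolding s by linarith+
    have "- B \<le> Re s2" using n(2) abs_Re_le_cmod[of s2] by linarith
    then have "norm (mt_integral J s1 s2 s3) \<le> C * mt_weight s1 s2 s3 ^ N" using q s by (intro C) auto
    also have "\<dots> \<le> C * ((1 + B) * (1 + B) * (1 + B)) ^ N"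
    proof (intro mult_left_mono power_mono C)
      have "0 \<le> B" by (simp add: B_def)
      then show "mt_weight s1 s2 s3 \<le> (1 + B) * (1 + B) * (1 + B)"
        unfolding mt_weight_def using n by (intro mult_mono mult_nonneg_nonneg) auto
      show "0 \<le> mt_weight s1 s2 s3" by (simp add: mt_weight_def)
    qed
    finally show ?thesis by (simp add: s)
  qed
  then show "\<exists>r>0. \<exists>B. \<forall>q\<in>ball p r \<inter> mt_domain J. norm (case q of (s1, s2, s3) \<Rightarrow> mt_integral J s1 s2 s3) \<le> B"
    using zero_less_one by blast
qed

section \<open>Continuation of the Mordell--Tornheim zeta function\<close>

lemma mt_singular_set_altdef:
  "mt_singular_set = {p. 1 - (fst p + snd (snd p)) \<in> \<nat>} \<union> {p. 1 - (fst (snd p) + snd (snd p)) \<in> \<nat>}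
      \<union> {p. fst p + fst (snd p) + snd (snd p) = 2}"
proof -
  have *: "(\<exists>l::nat. x = 1 - of_nat l) \<longleftrightarrow> 1 - x \<in> \<nat>" for x :: complex
    by (auto simp: Nats_def algebra_simps)
  show ?thesis unfolding mt_singular_set_def * by auto
qed

lemma closed_mt_singular_set: "closed mt_singular_set"
proof -
  have N: "closed (\<nat> :: complex set)" unfolding Nats_def by (rule closed_of_nat_image)
  have "closed {p :: complex \<times> complex \<times> complex. 1 - (fst p + snd (snd p)) \<in> \<nat>}"
    using closed_vimage[OF N, of "\<lambda>p :: complex \<times> complex \<times> complex. 1 - (fst p + snd (snd p))"]
    by (simp add: vimage_def continuous_intros)
  moreover have "closed {p :: complex \<times> complex \<times> complex. 1 - (fst (snd p) + snd (snd p)) \<in> \<nat>}"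
    using closed_vimage[OF N, of "\<lambda>p :: complex \<times> complex \<times> complex. 1 - (fst (snd p) + snd (snd p))"]
    by (simp add: vimage_def continuous_intros)
  moreover have "closed {p :: complex \<times> complex \<times> complex. fst p + fst (snd p) + snd (snd p) = 2}"
    by (intro closed_Collect_eq continuous_intros)
  ultimately show ?thesis unfolding mt_singular_set_altdef by (intro closed_Un)
qed

lemma not_mt_singularD:
  assumes "(s1, s2, s3) \<notin> mt_singular_set"
  shows "s1 + s3 \<noteq> 1 - of_nat l" "s2 + s3 \<noteq> 1 - of_nat l" "s1 + s2 + s3 \<noteq> 2"
  using assms by (auto simp: mt_singular_set_def)

text \<open>Each family of singular hyperplanes comes from one kind of factor:
  \<open>Gamma (s2 + s3 - 1)\<close>, \<open>zeta1 (s1 + s3 + of_nat j)\<close> and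
  \<open>zeta1 (s1 + s2 + s3 - 1)\<close>. The remaining factors are regular on
  \<open>mt_domain J\<close>.\<close>

lemma mt_formula_holomorphic3:
  assumes J: "J \<ge> 1"
  shows "holomorphic3_on (\<lambda>(s1, s2, s3). mt_formula J s1 s2 s3) (mt_domain J - mt_singular_set)"
proof -
  define V where "V = mt_domain J - mt_singular_set"
  have Vsub: "V \<subseteq> mt_domain J" by (auto simp: V_def)
  have aff: "holomorphic3_on (\<lambda>p. a * fst p + b * fst (snd p) + c * snd (snd p) + d) V" for a b c d
    using holomorphic3_on_affine[of a b c d V] by (simp add: case_prod_unfold)
  \<comment> \<open>Every factor is written as a function of one variable applied to an affine form,
    which explains the zero coefficients below.\<close>
  have comp: "holomorphic3_on (\<lambda>p. f (a * fst p + b * fst (snd p) + c * snd (snd p) + d)) V"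
    if "\<And>s1 s2 s3. (s1, s2, s3) \<in> V \<Longrightarrow> f field_differentiable (at (a * s1 + b * s2 + c * s3 + d))" for f a b c d
    by (rule holomorphic3_on_compose[OF aff]) (use that in force)
  have fdG: "Gamma field_differentiable (at z)" if "z \<notin> \<int>\<^sub>\<le>\<^sub>0" for z :: complex
    using that by (rule field_differentiable_Gamma)
  have g1: "holomorphic3_on (\<lambda>p. Gamma (0 * fst p + 1 * fst (snd p) + 1 * snd (snd p) + (-1))) V"
  proof (rule comp[OF fdG])
    fix s1 s2 s3 assume "(s1, s2, s3) \<in> V"
    then have "s2 + s3 \<noteq> 1 - of_nat l" for l using not_mt_singularD[of s1 s2 s3] by (auto simp: V_def)
    then show "0 * s1 + 1 * s2 + 1 * s3 + (-1) \<notin> \<int>\<^sub>\<le>\<^sub>0"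
      by (auto elim!: nonpos_Ints_cases' simp: algebra_simps)
  qed
  have g2: "holomorphic3_on (\<lambda>p. Gamma (0 * fst p + (-1) * fst (snd p) + 0 * snd (snd p) + 1)) V"
    by (rule comp[OF fdG], rule not_nonpos_Int_if_Re_pos) (auto simp: V_def mt_domain_def)
  have g3: "holomorphic3_on (\<lambda>p. rGamma (0 * fst p + 0 * fst (snd p) + 1 * snd (snd p) + 0)) V"
    by (rule comp) (rule field_differentiable_rGamma)
  have z1: "holomorphic3_on (\<lambda>p. zeta1 (1 * fst p + 1 * fst (snd p) + 1 * snd (snd p) + (-1))) V"
  proof (rule comp[OF field_differentiable_zeta1])
    fix s1 s2 s3 assume "(s1, s2, s3) \<in> V"
    then have "s1 + s2 + s3 \<noteq> 2" using not_mt_singularD[of s1 s2 s3] by (auto simp: V_def)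
    then show "1 * s1 + 1 * s2 + 1 * s3 + (-1) \<noteq> 1" by (auto simp: algebra_simps)
  qed
  have b: "holomorphic3_on (\<lambda>p. (- snd (snd p)) gchoose j) V" for j
  proof -
    have "holomorphic3_on (\<lambda>p. (\<lambda>w. (-1) ^ j * pochhammer w j / fact j) (0 * fst p + 0 * fst (snd p) + 1 * snd (snd p) + 0)) V"
    proof (rule comp)
      have "(\<lambda>w. (-1) ^ j * pochhammer w j / fact j) holomorphic_on (UNIV :: complex set)"
        by (intro holomorphic_intros) auto
      then show "(\<lambda>w. (-1) ^ j * pochhammer w j / fact j) field_differentiable at z" for z :: complex
        by (simp add: holomorphic_on_def)
    qed
    then show ?thesis by (simp add: gbinomial_pochhammer)
  qed
  have z2: "holomorphic3_on (\<lambda>p. zeta1 (1 * fst p + 0 * fst (snd p) + 1 * snd (snd p) + of_nat j)) V" for j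
  proof (rule comp[OF field_differentiable_zeta1])
    fix s1 s2 s3 assume "(s1, s2, s3) \<in> V"
    then have "s1 + s3 \<noteq> 1 - of_nat j" using not_mt_singularD[of s1 s2 s3] by (auto simp: V_def)
    then show "1 * s1 + 0 * s2 + 1 * s3 + of_nat j \<noteq> 1" by (auto simp: algebra_simps)
  qed
  have z3: "holomorphic3_on (\<lambda>p. zeta1 (0 * fst p + 1 * fst (snd p) + 0 * snd (snd p) + (- of_nat j))) V" for j
    by (rule comp[OF field_differentiable_zeta1]) (auto simp: V_def mt_domain_def complex_eq_iff)
  have i: "holomorphic3_on (\<lambda>p. mt_integral J (fst p) (fst (snd p)) (snd (snd p))) V"
    using holomorphic3_on_subset[OF mt_integral_holomorphic3[OF J] Vsub] by (simp add: case_prod_unfold)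
  have c: "holomorphic3_on (\<lambda>p. d) V" for d
    using aff[of 0 0 0 d] by simp
  have "holomorphic3_on (\<lambda>p. (Gamma (0 * fst p + 1 * fst (snd p) + 1 * snd (snd p) + (-1)) *
       Gamma (0 * fst p + (-1) * fst (snd p) + 0 * snd (snd p) + 1) * rGamma (0 * fst p + 0 * fst (snd p) + 1 * snd (snd p) + 0))
       * zeta1 (1 * fst p + 1 * fst (snd p) + 1 * snd (snd p) + (-1))
     + (\<Sum>j<J. ((- snd (snd p)) gchoose j) * (zeta1 (1 * fst p + 0 * fst (snd p) + 1 * snd (snd p) + of_nat j) *
         zeta1 (0 * fst p + 1 * fst (snd p) + 0 * snd (snd p) + (- of_nat j))))
     + mt_integral J (fst p) (fst (snd p)) (snd (snd p)) * (1 / (2 * of_real pi))) V"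
    by (intro holomorphic3_on_add holomorphic3_on_mult holomorphic3_on_sum g1 g2 g3 z1 z2 z3 b i c)
  then show ?thesis
    by (simp add: mt_formula_def V_def Beta_altdef case_prod_unfold)
qed

section \<open>Uniqueness and gluing of extensions\<close>

definition mt_sum :: "complex \<Rightarrow> complex \<Rightarrow> complex \<Rightarrow> complex" where
  "mt_sum s1 s2 s3 = (\<Sum>\<^sub>\<infinity>p\<in>{1..} \<times> {1..}. mt_term s1 s2 s3 p)"

text \<open>Agreement with the series is asked only for large \<open>Re s3\<close>. Every line in
  the direction of \<open>s3\<close> enters that range, and the shifted points
  \<open>(s1 - 1, s2, s3 + 1)\<close> and \<open>(s1, s2 - 1, s3 + 1)\<close> of the recursion
  inherit the inequality. Agreement at all nonsingular points of summability is recovered in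
  \<open>mt_ext_eq_sum\<close>.\<close>

definition mt_ext :: "(complex \<times> complex \<times> complex) set \<Rightarrow> (complex \<times> complex \<times> complex \<Rightarrow> complex) \<Rightarrow> bool" where
  "mt_ext D F \<longleftrightarrow> holomorphic3_on F (D - mt_singular_set) \<and>
     (\<forall>s1 s2 s3. (s1, s2, s3) \<in> D \<longrightarrow> Re s3 > 3 + \<bar>Re s1\<bar> + \<bar>Re s2\<bar> \<longrightarrow> F (s1, s2, s3) = mt_sum s1 s2 s3)"

text \<open>From each point of such a set one reaches the region of absolute convergence by moving only \<open>s3\<close>,
  so extensions over it are unique.\<close>

definition s3_closed :: "(complex \<times> complex \<times> complex) set \<Rightarrow> bool" where
  "s3_closed D \<longleftrightarrow> open D \<and> (\<forall>s1 s2 s3 w. (s1, s2, s3) \<in> D \<longrightarrow> Re w \<ge> 0 \<longrightarrow> (s1, s2, s3 + w) \<in> D)"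

lemma mt_ext_subset: "mt_ext D F \<Longrightarrow> E \<subseteq> D \<Longrightarrow> mt_ext E F"
  unfolding mt_ext_def by (meson Diff_mono holomorphic3_on_subset order_refl subsetD)

lemma s3_closed_Int: "s3_closed D \<Longrightarrow> s3_closed E \<Longrightarrow> s3_closed (D \<inter> E)"
  unfolding s3_closed_def by (auto intro: open_Int)

text \<open>Removing a countable closed set from a connected open set of \<open>w\<close> leaves it
  open and connected, and the bound on \<open>Re w\<close> leaves a right half-plane untouched. Both
  are what the identity theorem along the line needs.\<close>

lemma mt_s3_singular:
  fixes s1 s2 s3 :: complex
  defines "T \<equiv> {w. (s1, s2, s3 + w) \<in> mt_singular_set}"
  shows "countable T" "closed T"
    "\<And>w. w \<in> T \<Longrightarrow> Re w \<le> max (2 - Re s1 - Re s2 - Re s3) (max (1 - Re s1 - Re s3) (1 - Re s2 - Re s3))"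
proof -
  have "T \<subseteq> range (\<lambda>l::nat. 1 - of_nat l - s1 - s3) \<union> range (\<lambda>l::nat. 1 - of_nat l - s2 - s3) \<union> {2 - s1 - s2 - s3}"
    by (auto simp: T_def mt_singular_set_def algebra_simps image_iff)
  moreover have "countable (range (\<lambda>l::nat. 1 - of_nat l - s1 - s3) \<union> range (\<lambda>l::nat. 1 - of_nat l - s2 - s3) \<union> {2 - s1 - s2 - s3})"
    by auto
  ultimately show "countable T" by (rule countable_subset)
  have "T = (\<lambda>w. (s1, s2, s3 + w)) -` mt_singular_set" by (auto simp: T_def)
  then show "closed T" by (simp add: closed_vimage closed_mt_singular_set continuous_intros)
  fix w assume "w \<in> T"
  then consider l where "s1 + (s3 + w) = 1 - of_nat l" | l where "s2 + (s3 + w) = 1 - of_nat l" | "s1 + s2 + (s3 + w) = 2"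
    by (auto simp: T_def mt_singular_set_def)
  then show "Re w \<le> max (2 - Re s1 - Re s2 - Re s3) (max (1 - Re s1 - Re s3) (1 - Re s2 - Re s3))"
  proof cases
    case 1
    from arg_cong[OF this, of Re] show ?thesis by simp
  next
    case 2
    from arg_cong[OF this, of Re] show ?thesis by simp
  next
    case 3
    from arg_cong[OF this, of Re] show ?thesis by simp
  qed
qed

lemma holomorphic3_on_s3_line:
  assumes "holomorphic3_on F U" "\<And>w. w \<in> W \<Longrightarrow> (s1, s2, s3 + w) \<in> U"
  shows "(\<lambda>w. F (s1, s2, s3 + w)) holomorphic_on W"
  unfolding holomorphic_on_def
proof
  fix w assume "w \<in> W"
  then have "(s1 + w * 0, s2 + w * 0, s3 + w * 1) \<in> U" using assms(2) by simp
  from holomorphic3_onD_line[OF assms(1) this]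
  show "(\<lambda>w. F (s1, s2, s3 + w)) field_differentiable (at w within W)"
    by (simp add: field_differentiable_at_within)
qed

lemma mt_ext_unique:
  assumes F: "mt_ext D F" and G: "mt_ext D G" and D: "s3_closed D" and p: "(s1, s2, s3) \<in> D - mt_singular_set"
  shows "F (s1, s2, s3) = G (s1, s2, s3)"
proof -
  define T where "T = {w. (s1, s2, s3 + w) \<in> mt_singular_set}"
  note T = mt_s3_singular[where ?s1.0 = s1 and ?s2.0 = s2 and ?s3.0 = s3, folded T_def]
  have "open ((\<lambda>w. (s1, s2, s3 + w)) -` D)"
    using D unfolding s3_closed_def by (intro open_vimage continuous_intros) auto
  moreover have "0 \<in> (\<lambda>w. (s1, s2, s3 + w)) -` D" using p by simp
  ultimately obtain \<delta> where \<delta>: "\<delta> > 0" "ball 0 \<delta> \<subseteq> (\<lambda>w. (s1, s2, s3 + w)) -` D"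
    using open_contains_ball by blast
  \<comment> \<open>A disc around \<open>0\<close>, provided by openness of \<open>D\<close>, joined
    to the right half-plane, provided by closure under shifts of \<open>s3\<close>.\<close>
  define W where "W = ball 0 \<delta> \<union> {w. Re w > 0}"
  have WD: "(s1, s2, s3 + w) \<in> D" if "w \<in> W" for w
    using that \<delta> D p unfolding W_def s3_closed_def by auto
  have oW: "open W" by (auto simp: W_def open_halfspace_Re_gt)
  have "complex_of_real (\<delta> / 2) \<in> ball 0 \<delta> \<inter> {w. Re w > 0}" using \<delta> by simp
  then have cW: "connected W" unfolding W_def
    by (intro connected_Un convex_connected convex_halfspace_Re_gt convex_ball) blast
  \<comment> \<open>Right of \<open>B\<close> there are no singular points, and both functions are
    given by the series.\<close>
  define B where "B = max (max (2 - Re s1 - Re s2 - Re s3) (max (1 - Re s1 - Re s3) (1 - Re s2 - Re s3))) (max 0 (3 + \<bar>Re s1\<bar> + \<bar>Re s2\<bar> - Re s3))"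
  have "F (s1, s2, s3 + 0) = G (s1, s2, s3 + 0)"
  proof (rule analytic_continuation_open[of "{w. Re w > B}" "W - T" "\<lambda>w. F (s1, s2, s3 + w)" "\<lambda>w. G (s1, s2, s3 + w)"])
    show "open {w. Re w > B}" by (rule open_halfspace_Re_gt)
    show "open (W - T)" by (intro open_Diff oW T)
    show "connected (W - T)" by (rule connected_open_diff_countable) (use oW cW T in auto)
    have "complex_of_real (B + 1) \<in> {w. Re w > B}" by simp
    then show "{w. Re w > B} \<noteq> {}" by blast
    show "{w. Re w > B} \<subseteq> W - T"
    proof
      fix w assume w: "w \<in> {w. Re w > B}"
      then have "w \<notin> T" using T(3)[of w] by (auto simp: B_def)
      then show "w \<in> W - T" using w by (auto simp: W_def B_def)
    qed
    show "(\<lambda>w. F (s1, s2, s3 + w)) holomorphic_on W - T" "(\<lambda>w. G (s1, s2, s3 + w)) holomorphic_on W - T"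
      using F G WD by (auto simp: mt_ext_def T_def intro!: holomorphic3_on_s3_line[of _ "D - mt_singular_set"])
    show "0 \<in> W - T" using p \<delta> by (auto simp: W_def T_def)
    fix w assume w: "w \<in> {w. Re w > B}"
    then have "w \<in> W" "Re (s3 + w) > 3 + \<bar>Re s1\<bar> + \<bar>Re s2\<bar>" by (auto simp: W_def B_def)
    then show "F (s1, s2, s3 + w) = G (s1, s2, s3 + w)"
      using F G WD[of w] unfolding mt_ext_def by metis
  qed
  then show ?thesis by simp
qed

text \<open>The member is chosen pointwise. Off the singular set uniqueness on intersections makes
  the choice irrelevant, so near each point the glued function coincides with a fixed member, and
  differentiability is local.\<close>

lemma mt_ext_glue:
  assumes "\<And>i. i \<in> I \<Longrightarrow> s3_closed (D i)" "\<And>i. i \<in> I \<Longrightarrow> \<exists>F. mt_ext (D i) F"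
  shows "\<exists>F. mt_ext (\<Union>i\<in>I. D i) F"
proof -
  obtain F where F: "\<And>i. i \<in> I \<Longrightarrow> mt_ext (D i) (F i)" using assms(2) by metis
  define G where "G p = F (SOME i. i \<in> I \<and> p \<in> D i) p" for p
  have choice: "(SOME i. i \<in> I \<and> p \<in> D i) \<in> I \<and> p \<in> D (SOME i. i \<in> I \<and> p \<in> D i)" if "i \<in> I" "p \<in> D i" for i p
    by (rule someI[of "\<lambda>i. i \<in> I \<and> p \<in> D i" i]) (use that in auto)
  have eq: "G p = F i p" if i: "i \<in> I" "p \<in> D i - mt_singular_set" for p i
  proof -
    obtain s1 s2 s3 where p: "p = (s1, s2, s3)" by (cases p) auto
    define k where "k = (SOME i. i \<in> I \<and> p \<in> D i)"
    have k: "k \<in> I" "p \<in> D k" using choice[of i p] i by (auto simp: k_def)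
    have "F k (s1, s2, s3) = F i (s1, s2, s3)"
      by (rule mt_ext_unique[of "D k \<inter> D i"])
         (use F assms i k p in \<open>auto intro: mt_ext_subset s3_closed_Int\<close>)
    then show ?thesis by (simp add: G_def p k_def)
  qed
  have "mt_ext (\<Union>i\<in>I. D i) G"
    unfolding mt_ext_def
  proof (intro conjI allI impI)
    show "holomorphic3_on G ((\<Union>i\<in>I. D i) - mt_singular_set)"
      unfolding holomorphic3_on_def
    proof
      fix p assume p: "p \<in> (\<Union>i\<in>I. D i) - mt_singular_set"
      then obtain i where i: "i \<in> I" "p \<in> D i - mt_singular_set" by auto
      have "open (D i - mt_singular_set)" using assms(1)[OF i(1)] by (auto simp: s3_closed_def intro!: open_Diff closed_mt_singular_set)
      then have "holomorphic3_on G (D i - mt_singular_set) \<longleftrightarrow> holomorphic3_on (F i) (D i - mt_singular_set)"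
        by (intro holomorphic3_on_cong eq i)
      then have "holomorphic3_on G (D i - mt_singular_set)" using F[OF i(1)] by (simp add: mt_ext_def)
      then show "\<exists>a b c. (G has_derivative (\<lambda>(h1, h2, h3). a * h1 + b * h2 + c * h3)) (at p)"
        using i unfolding holomorphic3_on_def by blast
    qed
    fix s1 s2 s3 assume "(s1, s2, s3) \<in> (\<Union>i\<in>I. D i)" and r: "3 + \<bar>Re s1\<bar> + \<bar>Re s2\<bar> < Re s3"
    then obtain i where "i \<in> I" "(s1, s2, s3) \<in> D i" by auto
    note choice[OF this]
    then show "G (s1, s2, s3) = mt_sum s1 s2 s3"
      unfolding G_def using F r unfolding mt_ext_def by blast
  qed
  then show ?thesis by blast
qed

lemma mt_term_summable_large:
  assumes "Re s3 > 3 + \<bar>Re s1\<bar> + \<bar>Re s2\<bar>"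
  shows "mt_term s1 s2 s3 summable_on {1..} \<times> {1..}"
  by (rule mt_term_summable[of "\<bar>Re s1\<bar> + 5/4" "\<bar>Re s2\<bar> + 5/4"]) (use assms in auto)

lemma mt_sum_commute: "mt_sum s1 s2 s3 = mt_sum s2 s1 s3"
proof -
  have "bij_betw prod.swap ({1..} \<times> {1..} :: (nat \<times> nat) set) ({1..} \<times> {1..})"
    by (auto simp: bij_betw_def inj_on_def image_iff)
  from infsum_reindex_bij_betw[OF this, of "mt_term s1 s2 s3"] show ?thesis
    by (simp add: mt_sum_def mt_term_def case_prod_unfold add.commute mult_ac)
qed

text \<open>Multiplying the summand by \<open>(m + n) / (m + n)\<close> raises \<open>s3\<close> and
  lowers \<open>s1\<close> or \<open>s2\<close> by one. On the right \<open>Re (s1 + s2)\<close> is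
  smaller, so the identity defines a continuation for larger values of it.\<close>

lemma mt_sum_rec:
  assumes "Re s3 > 3 + \<bar>Re s1\<bar> + \<bar>Re s2\<bar>"
  shows "mt_sum s1 s2 s3 = mt_sum (s1 - 1) s2 (s3 + 1) + mt_sum s1 (s2 - 1) (s3 + 1)"
proof -
  have "mt_term (s1 - 1) s2 (s3 + 1) summable_on {1..} \<times> {1..}" "mt_term s1 (s2 - 1) (s3 + 1) summable_on {1..} \<times> {1..}"
    by (rule mt_term_summable_large; use assms in auto)+
  then have "mt_sum (s1 - 1) s2 (s3 + 1) + mt_sum s1 (s2 - 1) (s3 + 1) =
      (\<Sum>\<^sub>\<infinity>p\<in>{1..} \<times> {1..}. mt_term (s1 - 1) s2 (s3 + 1) p + mt_term s1 (s2 - 1) (s3 + 1) p)"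
    unfolding mt_sum_def by (rule infsum_add[symmetric])
  also have "\<dots> = mt_sum s1 s2 s3"
    unfolding mt_sum_def
  proof (rule infsum_cong)
    fix p :: "nat \<times> nat" assume "p \<in> {1..} \<times> {1..}"
    then obtain m n where p: "p = (m, n)" "m \<ge> 1" "n \<ge> 1" by (cases p) auto
    have 1: "(of_nat k :: complex) powr (- (s - 1)) = of_nat k powr (- s) * of_nat k" if "k \<ge> 1" for k s
    proof -
      have "(of_nat k :: complex) powr (- (s - 1)) = of_nat k powr (- s + 1)" by (simp add: algebra_simps)
      also have "\<dots> = of_nat k powr (- s) * of_nat k powr 1" by (rule powr_add)
      finally show ?thesis using that by simp
    qed
    have 2: "(of_nat k :: complex) powr (- s) = of_nat k powr (- (s + 1)) * of_nat k" if "k \<ge> 1" for k s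
      using 1[OF that, of "s + 1"] by simp
    have "mt_term (s1 - 1) s2 (s3 + 1) p + mt_term s1 (s2 - 1) (s3 + 1) p =
      of_nat m powr (- s1) * of_nat n powr (- s2) * (of_nat (m + n) powr (- (s3 + 1)) * (of_nat m + of_nat n))"
      unfolding p mt_term_def prod.case 1[OF p(2)] 1[OF p(3)] by (simp only: algebra_simps)
    also have "\<dots> = mt_term s1 s2 s3 p"
      unfolding p mt_term_def prod.case 2[of "m + n" s3] using 2[of "m + n" s3] p by (simp only: of_nat_add)
    finally show "mt_term (s1 - 1) s2 (s3 + 1) p + mt_term s1 (s2 - 1) (s3 + 1) p = mt_term s1 s2 s3 p" .
  qed
  finally show ?thesis by simp
qed

lemma holomorphic3_on_swap:
  assumes "holomorphic3_on F V" "\<And>s1 s2 s3. (s1, s2, s3) \<in> U \<Longrightarrow> (s2, s1, s3) \<in> V"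
  shows "holomorphic3_on (\<lambda>(s1, s2, s3). F (s2, s1, s3)) U"
  unfolding holomorphic3_on_def
proof
  fix p assume p: "p \<in> U"
  obtain s1 s2 s3 where s: "p = (s1, s2, s3)" by (cases p) auto
  obtain a b c where *: "(F has_derivative (\<lambda>(h1, h2, h3). a * h1 + b * h2 + c * h3)) (at (s2, s1, s3))"
    using assms p s unfolding holomorphic3_on_def by blast
  have "((\<lambda>p. (fst (snd p), fst p, snd (snd p))) has_derivative (\<lambda>p. (fst (snd p), fst p, snd (snd p)))) (at p)"
    by (auto intro!: derivative_eq_intros)
  moreover have "(F has_derivative (\<lambda>(h1, h2, h3). a * h1 + b * h2 + c * h3)) (at (fst (snd p), fst p, snd (snd p)))"
    using * by (simp add: s)
  ultimately have
    "((\<lambda>p. F (fst (snd p), fst p, snd (snd p))) has_derivative (\<lambda>h. (case (fst (snd h), fst h, snd (snd h)) of (h1, h2, h3) \<Rightarrow> a * h1 + b * h2 + c * h3))) (at p)"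
    by (rule has_derivative_compose)
  then have "((\<lambda>(s1, s2, s3). F (s2, s1, s3)) has_derivative (\<lambda>(h1, h2, h3). b * h1 + a * h2 + c * h3)) (at p)"
    by (simp add: case_prod_unfold add_ac)
  then show "\<exists>a b c. ((\<lambda>(s1, s2, s3). F (s2, s1, s3)) has_derivative (\<lambda>(h1, h2, h3). a * h1 + b * h2 + c * h3)) (at p)"
    by blast
qed

lemma holomorphic3_on_translate:
  assumes "holomorphic3_on F V" "\<And>s1 s2 s3. (s1, s2, s3) \<in> U \<Longrightarrow> (s1 + d1, s2 + d2, s3 + d3) \<in> V"
  shows "holomorphic3_on (\<lambda>(s1, s2, s3). F (s1 + d1, s2 + d2, s3 + d3)) U"
  unfolding holomorphic3_on_def
proof
  fix p assume p: "p \<in> U"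
  obtain s1 s2 s3 where s: "p = (s1, s2, s3)" by (cases p) auto
  obtain a b c where *: "(F has_derivative (\<lambda>(h1, h2, h3). a * h1 + b * h2 + c * h3)) (at (s1 + d1, s2 + d2, s3 + d3))"
    using assms p s unfolding holomorphic3_on_def by blast
  have "((\<lambda>p. (fst p + d1, fst (snd p) + d2, snd (snd p) + d3)) has_derivative (\<lambda>p. (fst p, fst (snd p), snd (snd p)))) (at p)"
    by (auto intro!: derivative_eq_intros)
  moreover have "(F has_derivative (\<lambda>(h1, h2, h3). a * h1 + b * h2 + c * h3)) (at (fst p + d1, fst (snd p) + d2, snd (snd p) + d3))"
    using * by (simp add: s)
  ultimately have
    "((\<lambda>p. F (fst p + d1, fst (snd p) + d2, snd (snd p) + d3)) has_derivative (\<lambda>h. (case (fst h, fst (snd h), snd (snd h)) of (h1, h2, h3) \<Rightarrow> a * h1 + b * h2 + c * h3))) (at p)"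
    by (rule has_derivative_compose)
  then show "\<exists>a b c. ((\<lambda>(s1, s2, s3). F (s1 + d1, s2 + d2, s3 + d3)) has_derivative (\<lambda>(h1, h2, h3). a * h1 + b * h2 + c * h3)) (at p)"
    by (simp add: case_prod_unfold) blast
qed

lemma mt_ext_formula:
  assumes "J \<ge> 1" shows "mt_ext (mt_domain J) (\<lambda>(s1, s2, s3). mt_formula J s1 s2 s3)"
  unfolding mt_ext_def
proof (intro conjI allI impI)
  show "holomorphic3_on (\<lambda>(s1, s2, s3). mt_formula J s1 s2 s3) (mt_domain J - mt_singular_set)"
    by (rule mt_formula_holomorphic3[OF assms])
  fix s1 s2 s3 assume "(s1, s2, s3) \<in> mt_domain J" "3 + \<bar>Re s1\<bar> + \<bar>Re s2\<bar> < Re s3"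
  then show "(case (s1, s2, s3) of (s1, s2, s3) \<Rightarrow> mt_formula J s1 s2 s3) = mt_sum s1 s2 s3"
    unfolding mt_sum_def prod.case by (subst mt_sum_eq_formula[OF _ _ assms]) (auto simp: mt_domain_def)
qed

lemma s3_closed_mt_domain: "s3_closed (mt_domain J)"
  unfolding s3_closed_def using open_mt_domain by (auto simp: mt_domain_def)

lemma s3_closed_Re_less: "s3_closed {(s1, s2, s3). a * Re s1 + b * Re s2 < c}"
proof -
  have "{(s1, s2, s3 :: complex). a * Re s1 + b * Re s2 < c} = {p. a * Re (fst p) + b * Re (fst (snd p)) < c}" by auto
  also have "open \<dots>" by (intro open_Collect_less continuous_intros)
  finally show ?thesis by (auto simp: s3_closed_def)
qed

text \<open>\<open>mt_formula\<close> only reaches \<open>Re s2 < 1\<close>. Symmetry of the series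
  adds \<open>Re s1 < 1\<close>; one of the two holds whenever \<open>Re s1 + Re s2 < 2\<close>, and
  the recursion widens this half-space by one unit at a time.\<close>

lemma mt_ext_ex: "\<exists>F. mt_ext UNIV F"
proof -
  have "\<exists>F. mt_ext (\<Union>J\<in>{1..}. mt_domain J) F"
    by (rule mt_ext_glue) (use s3_closed_mt_domain mt_ext_formula in auto)
  moreover have "{(s1, s2, s3). 0 * Re s1 + 1 * Re s2 < 1} \<subseteq> (\<Union>J\<in>{1..}. mt_domain J)"
  proof safe
    fix s1 s2 s3 :: complex assume "0 * Re s1 + 1 * Re s2 < 1"
    moreover obtain J :: nat where "real J > max (max 1 (1 - Re s3)) (2 - Re (s1 + s3))" using reals_Archimedean2 by blast
    ultimately have "(s1, s2, s3) \<in> mt_domain J" "J \<ge> 1" by (auto simp: mt_domain_def)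
    then show "(s1, s2, s3) \<in> (\<Union>J\<in>{1..}. mt_domain J)" by auto
  qed
  ultimately obtain F where F: "mt_ext {(s1, s2, s3). 0 * Re s1 + 1 * Re s2 < 1} F"
    using mt_ext_subset by blast
  have F': "mt_ext {(s1, s2, s3). 1 * Re s1 + 0 * Re s2 < 1} (\<lambda>(s1, s2, s3). F (s2, s1, s3))"
    unfolding mt_ext_def
  proof (intro conjI allI impI)
    show "holomorphic3_on (\<lambda>(s1, s2, s3). F (s2, s1, s3)) ({(s1, s2, s3). 1 * Re s1 + 0 * Re s2 < 1} - mt_singular_set)"
      by (rule holomorphic3_on_swap[of F "{(s1, s2, s3). 0 * Re s1 + 1 * Re s2 < 1} - mt_singular_set"])
         (use F in \<open>auto simp: mt_ext_def mt_singular_set_def add_ac\<close>)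
    fix s1 s2 s3 assume "(s1, s2, s3) \<in> {(s1, s2, s3 :: complex). 1 * Re s1 + 0 * Re s2 < 1}" "3 + \<bar>Re s1\<bar> + \<bar>Re s2\<bar> < Re s3"
    then show "(case (s1, s2, s3) of (s1, s2, s3) \<Rightarrow> F (s2, s1, s3)) = mt_sum s1 s2 s3"
      using F unfolding mt_ext_def by (auto simp: mt_sum_commute[of s1] add_ac)
  qed
  define D where "D i = (if i then {(s1, s2, s3 :: complex). 0 * Re s1 + 1 * Re s2 < 1} else {(s1, s2, s3). 1 * Re s1 + 0 * Re s2 < 1})" for i
  have "\<exists>F. mt_ext (\<Union>i\<in>UNIV. D i) F"
    by (rule mt_ext_glue) (use F F' s3_closed_Re_less[of 0 1 1] s3_closed_Re_less[of 1 0 1] in \<open>auto simp: D_def\<close>)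
  moreover have "{(s1, s2, s3). 1 * Re s1 + 1 * Re s2 < 2} \<subseteq> (\<Union>i\<in>UNIV. D i)" by (auto simp: D_def)
  ultimately have base: "\<exists>F. mt_ext {(s1, s2, s3). 1 * Re s1 + 1 * Re s2 < 2} F" using mt_ext_subset by blast
  have "\<exists>F. mt_ext {(s1, s2, s3). 1 * Re s1 + 1 * Re s2 < 2 + real N} F" for N
  proof (induction N)
    case 0
    then show ?case using base by simp
  next
    case (Suc N)
    define V where "V = {(s1, s2, s3 :: complex). 1 * Re s1 + 1 * Re s2 < 2 + real N}"
    define U where "U = {(s1, s2, s3 :: complex). 1 * Re s1 + 1 * Re s2 < 2 + real (Suc N)}"
    obtain F where F: "mt_ext V F" using Suc by (auto simp: V_def)
    \<comment> \<open>Each shift fixes \<open>s1 + s2 + s3\<close> and one of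
      \<open>s1 + s3\<close>, \<open>s2 + s3\<close>, and raises the other by one. A singular value
      of index \<open>l\<close> of the raised sum would have been one of index \<open>Suc l\<close>
      before the shift.\<close>
    have sing: "(s1 + (-1), s2 + 0, s3 + 1) \<in> V - mt_singular_set" "(s1 + 0, s2 + (-1), s3 + 1) \<in> V - mt_singular_set"
      if "(s1, s2, s3) \<in> U - mt_singular_set" for s1 s2 s3
    proof -
      have n: "(s1, s2, s3) \<notin> mt_singular_set" and u: "Re s1 + Re s2 < 3 + real N" using that by (auto simp: U_def)
      note n = not_mt_singularD[OF n]
      have "s1 + s3 + 1 \<noteq> 1 - of_nat l" "s2 + s3 + 1 \<noteq> 1 - of_nat l" for l
        using n(1)[of "Suc l"] n(2)[of "Suc l"] by (auto simp: eq_neg_iff_add_eq_0 algebra_simps)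
      then show "(s1 + (-1), s2 + 0, s3 + 1) \<in> V - mt_singular_set" "(s1 + 0, s2 + (-1), s3 + 1) \<in> V - mt_singular_set"
        using n u by (auto simp: V_def mt_singular_set_def algebra_simps)
    qed
    have "mt_ext U (\<lambda>p. (case p of (s1, s2, s3) \<Rightarrow> F (s1 + (-1), s2 + 0, s3 + 1)) + (case p of (s1, s2, s3) \<Rightarrow> F (s1 + 0, s2 + (-1), s3 + 1)))"
      unfolding mt_ext_def
    proof (intro conjI allI impI)
      have "holomorphic3_on F (V - mt_singular_set)" using F by (simp add: mt_ext_def)
      then show "holomorphic3_on (\<lambda>p. (case p of (s1, s2, s3) \<Rightarrow> F (s1 + (-1), s2 + 0, s3 + 1)) +
            (case p of (s1, s2, s3) \<Rightarrow> F (s1 + 0, s2 + (-1), s3 + 1))) (U - mt_singular_set)"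
        by (intro holomorphic3_on_add holomorphic3_on_translate[of F "V - mt_singular_set"] sing)
      fix s1 s2 s3 assume u: "(s1, s2, s3) \<in> U" and r: "3 + \<bar>Re s1\<bar> + \<bar>Re s2\<bar> < Re s3"
      have FV: "F (s1, s2, s3) = mt_sum s1 s2 s3" if "(s1, s2, s3) \<in> V" "3 + \<bar>Re s1\<bar> + \<bar>Re s2\<bar> < Re s3" for s1 s2 s3
        using F that unfolding mt_ext_def by blast
      have "F (s1 + (-1), s2 + 0, s3 + 1) = mt_sum (s1 + (-1)) (s2 + 0) (s3 + 1)"
        by (rule FV) (use u r in \<open>auto simp: U_def V_def\<close>)
      moreover have "F (s1 + 0, s2 + (-1), s3 + 1) = mt_sum (s1 + 0) (s2 + (-1)) (s3 + 1)"
        by (rule FV) (use u r in \<open>auto simp: U_def V_def\<close>)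
      ultimately show "(case (s1, s2, s3) of (s1, s2, s3) \<Rightarrow> F (s1 + (-1), s2 + 0, s3 + 1)) +
            (case (s1, s2, s3) of (s1, s2, s3) \<Rightarrow> F (s1 + 0, s2 + (-1), s3 + 1)) = mt_sum s1 s2 s3"
        using mt_sum_rec[OF r] by simp
    qed
    then show ?case unfolding U_def by blast
  qed
  then have "\<exists>F. mt_ext (\<Union>N\<in>UNIV. {(s1, s2, s3). 1 * Re s1 + 1 * Re s2 < 2 + real N}) F"
    by (intro mt_ext_glue s3_closed_Re_less) auto
  moreover have "(\<Union>N\<in>UNIV. {(s1, s2, s3 :: complex). 1 * Re s1 + 1 * Re s2 < 2 + real N}) = UNIV"
  proof safe
    fix s1 s2 s3 :: complex
    obtain N where "real N > Re s1 + Re s2" using reals_Archimedean2 by blast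
    then show "(s1, s2, s3) \<in> (\<Union>N\<in>UNIV. {(s1, s2, s3 :: complex). 1 * Re s1 + 1 * Re s2 < 2 + real N})"
      by (auto intro!: exI[of _ N])
  qed auto
  ultimately show ?thesis by simp
qed

text \<open>At a point of summability, moving \<open>s3\<close> to the right keeps the series dominated, so its value is
  the boundary value of the continuation.\<close>

lemma mt_ext_eq_sum:
  assumes F: "mt_ext UNIV F" and p: "(s1, s2, s3) \<notin> mt_singular_set"
    and sm: "mt_term s1 s2 s3 summable_on {1..} \<times> {1..}"
  shows "F (s1, s2, s3) = mt_sum s1 s2 s3"
proof -
  define T where "T = {w. (s1, s2, s3 + w) \<in> mt_singular_set}"
  note T = mt_s3_singular[where ?s1.0 = s1 and ?s2.0 = s2 and ?s3.0 = s3, folded T_def]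
  define g where "g p = norm (mt_term s1 s2 s3 p)" for p
  have g: "g summable_on {1..} \<times> {1..}" unfolding g_def using sm by (simp add: summable_on_iff_abs_summable_on_complex)
  have dom: "norm (mt_term s1 s2 (s3 + w) p) \<le> g p" if "Re w \<ge> 0" "p \<in> {1..} \<times> {1..}" for w p
  proof -
    obtain m n where p: "p = (m, n)" "m \<ge> 1" "n \<ge> 1" using \<open>p \<in> {1..} \<times> {1..}\<close> by (cases p) auto
    have "real (m + n) powr (- Re (s3 + w)) \<le> real (m + n) powr (- Re s3)"
      using that p by (intro powr_mono) auto
    then show ?thesis unfolding p g_def norm_mt_term[OF p(2,3)] by (intro mult_left_mono) auto
  qed
  have trm: "(\<lambda>w. mt_term s1 s2 (s3 + w) p) holomorphic_on A" if "p \<in> {1..} \<times> {1..}" for p A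
  proof -
    obtain m n where p: "p = (m, n)" "m \<ge> 1" "n \<ge> 1" using \<open>p \<in> {1..} \<times> {1..}\<close> by (cases p) auto
    then have "(of_nat (m + n) :: complex) \<noteq> 0" by (simp del: of_nat_add)
    then show ?thesis unfolding p mt_term_def prod.case by (intro holomorphic_intros)
  qed
  define H where "H w = mt_sum s1 s2 (s3 + w)" for w
  have holH: "H holomorphic_on {w. Re w > 0}"
    unfolding H_def mt_sum_def
  proof (rule holomorphic_on_infsum[OF open_halfspace_Re_gt trm])
    show "\<exists>r>0. \<exists>g. g summable_on {1..} \<times> {1..} \<and> (\<forall>s\<in>cball s0 r \<inter> {w. 0 < Re w}. \<forall>i\<in>{1..} \<times> {1..}. norm (mt_term s1 s2 (s3 + s) i) \<le> g i)" for s0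
      using g dom by (intro exI[of _ 1] conjI exI[of _ g]) auto
  qed
  have contH: "continuous_on {w. Re w \<ge> 0} H"
    unfolding H_def mt_sum_def
    by (rule continuous_on_infsum[OF holomorphic_on_imp_continuous_on[OF trm] dom g]) auto
  have eq: "F (s1, s2, s3 + w) = H w" if "w \<in> {w. Re w > 0} - T" for w
  proof -
    define B where "B = max (max (2 - Re s1 - Re s2 - Re s3) (max (1 - Re s1 - Re s3) (1 - Re s2 - Re s3))) (max 0 (3 + \<bar>Re s1\<bar> + \<bar>Re s2\<bar> - Re s3))"
    show ?thesis
    proof (rule analytic_continuation_open[of "{w. Re w > B}" "{w. Re w > 0} - T" "\<lambda>w. F (s1, s2, s3 + w)" H, OF _ _ _ _ _ _ _ _ that])
      show "open {w. Re w > B}" by (rule open_halfspace_Re_gt)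
      show "open ({w. Re w > 0} - T)" by (intro open_Diff open_halfspace_Re_gt T)
      show "connected ({w. Re w > 0} - T)"
        by (rule connected_open_diff_countable) (use T in \<open>auto simp: open_halfspace_Re_gt intro!: convex_connected convex_halfspace_Re_gt\<close>)
      have "complex_of_real (B + 1) \<in> {w. Re w > B}" by simp
      then show "{w. Re w > B} \<noteq> {}" by blast
      show "{w. Re w > B} \<subseteq> {w. Re w > 0} - T"
      proof
        fix w assume w: "w \<in> {w. Re w > B}"
        then have "w \<notin> T" using T(3)[of w] by (auto simp: B_def)
        then show "w \<in> {w. Re w > 0} - T" using w by (auto simp: B_def)
      qed
      show "(\<lambda>w. F (s1, s2, s3 + w)) holomorphic_on {w. Re w > 0} - T"
        using F by (intro holomorphic3_on_s3_line[of _ "UNIV - mt_singular_set"]) (auto simp: mt_ext_def T_def)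
      show "H holomorphic_on {w. Re w > 0} - T" using holH by (rule holomorphic_on_subset) auto
      fix w assume w: "w \<in> {w. Re w > B}"
      then have "Re (s3 + w) > 3 + \<bar>Re s1\<bar> + \<bar>Re s2\<bar>" by (auto simp: B_def)
      then show "F (s1, s2, s3 + w) = H w" using F unfolding mt_ext_def H_def by blast
    qed
  qed
  \<comment> \<open>Points approaching \<open>0\<close> from the right, eventually nonsingular, at
    which \<open>F\<close> and \<open>H\<close> agree; both sides have limits at
    \<open>0\<close>.\<close>
  define X where "X n = complex_of_real (1 / (real n + 1))" for n
  have X: "X \<longlonglongrightarrow> 0"
  proof -
    have "(\<lambda>n. 1 / (real n + 1)) \<longlonglongrightarrow> 0" by real_asymp
    from tendsto_of_real[OF this, where 'a = complex] show ?thesis unfolding X_def[abs_def] by (simp only: of_real_0)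
  qed
  have Xp: "Re (X n) > 0" for n by (simp add: X_def)
  have "open (- T)" "0 \<in> - T" using T p by (auto simp: T_def)
  then have ev: "\<forall>\<^sub>F n in sequentially. X n \<in> - T" using X topological_tendstoD by blast
  have "(\<lambda>w. F (s1, s2, s3 + w)) holomorphic_on - T"
    using F by (intro holomorphic3_on_s3_line[of _ "UNIV - mt_singular_set"]) (auto simp: mt_ext_def T_def)
  then have "isCont (\<lambda>w. F (s1, s2, s3 + w)) 0"
    using \<open>open (- T)\<close> \<open>0 \<in> - T\<close> holomorphic_on_imp_continuous_on continuous_on_eq_continuous_at by blast
  then have A: "(\<lambda>n. F (s1, s2, s3 + X n)) \<longlonglongrightarrow> F (s1, s2, s3 + 0)"
    by (rule isCont_tendsto_compose[OF _ X])
  have B: "\<forall>\<^sub>F n in sequentially. H (X n) = F (s1, s2, s3 + X n)"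
    using ev
  proof eventually_elim
    case (elim n)
    then show ?case using Xp[of n] eq[of "X n"] by simp
  qed
  have C: "(\<lambda>n. H (X n)) \<longlonglongrightarrow> H 0"
    by (rule continuous_on_tendsto_compose[OF contH X])
       (use Xp less_imp_le in \<open>auto intro!: always_eventually\<close>)
  have "F (s1, s2, s3 + 0) = H 0"
    by (rule LIMSEQ_unique[OF A Lim_transform_eventually[OF C B]])
  then show ?thesis by (simp add: H_def)
qed

text \<open>The defining property also prescribes the value at any point of summability inside the
  singular set. \<open>G\<close> takes the sum wherever it exists, which avoids deciding whether
  there are such points and changes nothing off the singular set.\<close>

lemma mt_continuation_ex: "\<exists>F. mt_continuation F"
proof -
  obtain F where F: "mt_ext UNIV F" using mt_ext_ex by blast
  define G where "G = (\<lambda>(s1, s2, s3). if mt_term s1 s2 s3 summable_on {1..} \<times> {1..} then mt_sum s1 s2 s3 else F (s1, s2, s3))"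
  have "holomorphic3_on G (- mt_singular_set) \<longleftrightarrow> holomorphic3_on F (- mt_singular_set)"
    by (rule holomorphic3_on_cong) (use mt_ext_eq_sum[OF F] closed_mt_singular_set in \<open>auto simp: G_def\<close>)
  then have "mt_continuation G"
    using F by (auto simp: mt_continuation_def mt_ext_def G_def mt_sum_def Compl_eq_Diff_UNIV)
  then show ?thesis by blast
qed

lemma mt_zeta_continuation: "mt_continuation (\<lambda>(s1, s2, s3). mt_zeta s1 s2 s3)"
  using someI_ex[OF mt_continuation_ex] unfolding mt_zeta_def by (simp add: case_prod_unfold)

lemma mt_zeta_holomorphic3: "holomorphic3_on (\<lambda>(s1, s2, s3). mt_zeta s1 s2 s3) (- mt_singular_set)"
  using mt_zeta_continuation by (simp add: mt_continuation_def)

lemma mt_zeta_eq_sum: "mt_term s1 s2 s3 summable_on {1..} \<times> {1..} \<Longrightarrow> mt_zeta s1 s2 s3 = mt_sum s1 s2 s3"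
  using mt_zeta_continuation by (simp add: mt_continuation_def mt_sum_def)

lemma mt_zeta_eq_formula:
  assumes J: "J \<ge> 1" and p: "(s1, s2, s3) \<in> mt_domain J" "(s1, s2, s3) \<notin> mt_singular_set"
  shows "mt_zeta s1 s2 s3 = mt_formula J s1 s2 s3"
proof -
  have "mt_ext UNIV (\<lambda>(s1, s2, s3). mt_zeta s1 s2 s3)"
    using mt_zeta_holomorphic3 by (auto simp: mt_ext_def Compl_eq_Diff_UNIV intro!: mt_zeta_eq_sum mt_term_summable_large)
  then have "mt_ext (mt_domain J) (\<lambda>(s1, s2, s3). mt_zeta s1 s2 s3)" by (rule mt_ext_subset) auto
  from mt_ext_unique[OF this mt_ext_formula[OF J] s3_closed_mt_domain] p show ?thesis by auto
qed

section \<open>Polynomial bounds for the Mordell--Tornheim function\<close>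

definition poly_bounded3 :: "(complex \<times> complex \<times> complex) set \<Rightarrow> (complex \<Rightarrow> complex \<Rightarrow> complex \<Rightarrow> complex) \<Rightarrow> bool" where
  "poly_bounded3 S f \<longleftrightarrow> (\<exists>C N. C \<ge> 0 \<and> (\<forall>s1 s2 s3. (s1, s2, s3) \<in> S \<longrightarrow> norm (f s1 s2 s3) \<le> C * mt_weight s1 s2 s3 ^ N))"

lemma poly_bounded3_add:
  assumes "poly_bounded3 S f" "poly_bounded3 S g"
  shows "poly_bounded3 S (\<lambda>s1 s2 s3. f s1 s2 s3 + g s1 s2 s3)"
proof -
  obtain C N D M where *: "C \<ge> 0" "D \<ge> 0" "\<And>s1 s2 s3. (s1, s2, s3) \<in> S \<Longrightarrow> norm (f s1 s2 s3) \<le> C * mt_weight s1 s2 s3 ^ N"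
     "\<And>s1 s2 s3. (s1, s2, s3) \<in> S \<Longrightarrow> norm (g s1 s2 s3) \<le> D * mt_weight s1 s2 s3 ^ M"
    using assms unfolding poly_bounded3_def by metis
  have "norm (f s1 s2 s3 + g s1 s2 s3) \<le> (C + D) * mt_weight s1 s2 s3 ^ (N + M)" if s: "(s1, s2, s3) \<in> S" for s1 s2 s3
  proof -
    have "norm (f s1 s2 s3 + g s1 s2 s3) \<le> C * mt_weight s1 s2 s3 ^ N + D * mt_weight s1 s2 s3 ^ M"
      using *(3)[OF s] *(4)[OF s] norm_triangle_ineq[of "f s1 s2 s3" "g s1 s2 s3"] by linarith
    also have "\<dots> \<le> C * mt_weight s1 s2 s3 ^ (N + M) + D * mt_weight s1 s2 s3 ^ (N + M)"
      using * mt_weight_ge(1) by (intro add_mono mult_left_mono power_increasing) auto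
    finally show ?thesis by (simp add: algebra_simps)
  qed
  then show ?thesis unfolding poly_bounded3_def using * by (intro exI[of _ "C + D"] exI[of _ "N + M"]) auto
qed

lemma poly_bounded3_mult:
  assumes "poly_bounded3 S f" "poly_bounded3 S g"
  shows "poly_bounded3 S (\<lambda>s1 s2 s3. f s1 s2 s3 * g s1 s2 s3)"
proof -
  obtain C N D M where *: "C \<ge> 0" "D \<ge> 0" "\<And>s1 s2 s3. (s1, s2, s3) \<in> S \<Longrightarrow> norm (f s1 s2 s3) \<le> C * mt_weight s1 s2 s3 ^ N"
     "\<And>s1 s2 s3. (s1, s2, s3) \<in> S \<Longrightarrow> norm (g s1 s2 s3) \<le> D * mt_weight s1 s2 s3 ^ M"
    using assms unfolding poly_bounded3_def by metis
  have "norm (f s1 s2 s3 * g s1 s2 s3) \<le> (C * D) * mt_weight s1 s2 s3 ^ (N + M)" if s: "(s1, s2, s3) \<in> S" for s1 s2 s3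
  proof -
    have "norm (f s1 s2 s3 * g s1 s2 s3) \<le> (C * mt_weight s1 s2 s3 ^ N) * (D * mt_weight s1 s2 s3 ^ M)"
      unfolding norm_mult using *(3)[OF s] *(4)[OF s] * by (intro mult_mono) (auto simp: mt_weight_def)
    then show ?thesis by (simp add: power_add mult_ac)
  qed
  then show ?thesis unfolding poly_bounded3_def using * by (intro exI[of _ "C * D"] exI[of _ "N + M"]) auto
qed

lemma poly_bounded3_const: "poly_bounded3 S (\<lambda>_ _ _. c)"
  unfolding poly_bounded3_def by (intro exI[of _ "norm c"] exI[of _ 0]) auto

lemma poly_bounded3_sum:
  assumes "\<And>i. i \<in> I \<Longrightarrow> poly_bounded3 S (f i)"
  shows "poly_bounded3 S (\<lambda>s1 s2 s3. \<Sum>i\<in>I. f i s1 s2 s3)"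
  using assms by (induction I rule: infinite_finite_induct) (auto intro: poly_bounded3_add poly_bounded3_const)

lemma poly_bounded3_zeta1:
  assumes w: "\<And>s1 s2 s3. (s1, s2, s3) \<in> S \<Longrightarrow> Re (w s1 s2 s3) \<ge> a \<and> norm (w s1 s2 s3 - 1) \<ge> \<delta>"
    and n: "\<And>s1 s2 s3. 1 + norm (w s1 s2 s3) \<le> k * mt_weight s1 s2 s3" and \<delta>: "\<delta> > 0"
  shows "poly_bounded3 S (\<lambda>s1 s2 s3. zeta1 (w s1 s2 s3))"
proof -
  obtain C N where C: "C \<ge> 0" "\<And>w \<delta>. Re w \<ge> a \<Longrightarrow> \<delta> > 0 \<Longrightarrow> norm (w - 1) \<ge> \<delta> \<Longrightarrow> norm (zeta1 w) \<le> C * (1 + norm w) ^ N / \<delta>"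
    using zeta1_bound by metis
  have "norm (zeta1 (w s1 s2 s3)) \<le> (C * \<bar>k\<bar> ^ N / \<delta>) * mt_weight s1 s2 s3 ^ N" if s: "(s1, s2, s3) \<in> S" for s1 s2 s3
  proof -
    have "norm (zeta1 (w s1 s2 s3)) \<le> C * (1 + norm (w s1 s2 s3)) ^ N / \<delta>" using w[OF s] \<delta> by (intro C) auto
    also have "\<dots> \<le> C * (\<bar>k\<bar> * mt_weight s1 s2 s3) ^ N / \<delta>"
    proof (intro divide_right_mono mult_left_mono power_mono)
      have "k * mt_weight s1 s2 s3 \<le> \<bar>k\<bar> * mt_weight s1 s2 s3" by (intro mult_right_mono) (auto simp: mt_weight_def)
      with n[of s1 s2 s3] show "1 + norm (w s1 s2 s3) \<le> \<bar>k\<bar> * mt_weight s1 s2 s3" by linarith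
    qed (use C \<delta> in auto)
    finally show ?thesis by (simp add: power_mult_distrib)
  qed
  then show ?thesis unfolding poly_bounded3_def using C \<delta> by (intro exI[of _ "C * \<bar>k\<bar> ^ N / \<delta>"] exI[of _ N]) auto
qed

text \<open>Distances to the hyperplanes are measured by the affine forms that occur as arguments in
  \<open>mt_formula\<close>. \<open>Re s2 \<le> 1 - \<delta>\<close> bounds the second argument of
  Beta from below and keeps \<open>zeta1 (s2 - of_nat j)\<close> off its pole.\<close>

definition mt_bound_region :: "real \<Rightarrow> real \<Rightarrow> (complex \<times> complex \<times> complex) set" where
  "mt_bound_region M \<delta> = {(s1, s2, s3). \<bar>Re s1\<bar> \<le> M \<and> \<bar>Re s2\<bar> \<le> M \<and> \<bar>Re s3\<bar> \<le> M \<and> Re s2 \<le> 1 - \<delta> \<and>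
     (\<forall>l::nat. norm (s1 + s3 - 1 + of_nat l) \<ge> \<delta>) \<and> (\<forall>l::nat. norm (s2 + s3 - 1 + of_nat l) \<ge> \<delta>) \<and> norm (s1 + s2 + s3 - 2) \<ge> \<delta>}"

text \<open>For bounded real parts a single \<open>J\<close> places the region inside
  \<open>mt_domain J\<close>, so the finitely many terms of one formula can be bounded
  separately.\<close>

lemma mt_zeta_poly_bounded:
  assumes \<delta>: "\<delta> > 0"
  shows "poly_bounded3 (mt_bound_region M \<delta>) mt_zeta"
proof -
  let ?S = "mt_bound_region M \<delta>"
  \<comment> \<open>Large enough for membership in \<open>mt_domain J\<close> and for
    \<open>Re (s2 + s3 - 1 + of_nat J) \<ge> 1\<close> below.\<close>
  obtain J :: nat where J0: "real J > max 1 (3 * \<bar>M\<bar> + 3)" using reals_Archimedean2 by blast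
  then have J: "J \<ge> 1" "real J > 3 * \<bar>M\<bar> + 3" by auto
  have dom: "(s1, s2, s3) \<in> mt_domain J" if "(s1, s2, s3) \<in> ?S" for s1 s2 s3
    using that J \<delta> by (auto simp: mt_bound_region_def mt_domain_def)
  have sing: "(s1, s2, s3) \<notin> mt_singular_set" if "(s1, s2, s3) \<in> ?S" for s1 s2 s3
  proof
    assume "(s1, s2, s3) \<in> mt_singular_set"
    then consider l where "s1 + s3 = 1 - of_nat l" | l where "s2 + s3 = 1 - of_nat l" | "s1 + s2 + s3 = 2"
      by (auto simp: mt_singular_set_def)
    then obtain x :: complex where "x = 0" "norm x \<ge> \<delta>"
    proof cases
      case (1 l)
      moreover have "norm (s1 + s3 - 1 + of_nat l) \<ge> \<delta>"
        using \<open>(s1, s2, s3) \<in> ?S\<close> by (simp add: mt_bound_region_def)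
      ultimately show ?thesis by (intro that[of "s1 + s3 - 1 + of_nat l"]) simp_all
    next
      case (2 l)
      moreover have "norm (s2 + s3 - 1 + of_nat l) \<ge> \<delta>"
        using \<open>(s1, s2, s3) \<in> ?S\<close> by (simp add: mt_bound_region_def)
      ultimately show ?thesis by (intro that[of "s2 + s3 - 1 + of_nat l"]) simp_all
    next
      case 3
      then show ?thesis using \<open>(s1, s2, s3) \<in> ?S\<close> by (intro that[of "s1 + s2 + s3 - 2"]) (auto simp: mt_bound_region_def)
    qed
    then show False using \<delta> by simp
  qed
  have eq: "mt_zeta s1 s2 s3 = mt_formula J s1 s2 s3" if "(s1, s2, s3) \<in> ?S" for s1 s2 s3
    by (rule mt_zeta_eq_formula[OF J(1) dom[OF that] sing[OF that]])
  \<comment> \<open>The first argument may lie far to the left, between poles. The recursion of Beta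
    moves it right by \<open>J\<close>; the Pochhammer symbol divided by is at least
    \<open>\<delta> ^ J\<close>, and the one gained is that of \<open>s3\<close>, the sum of the
    arguments.\<close>
  have T1: "poly_bounded3 ?S (\<lambda>s1 s2 s3. Beta (s2 + s3 - 1) (1 - s2))"
  proof -
    have B0: "Beta 1 \<delta> \<ge> (0::real)" using \<delta> by (simp add: Beta_def Gamma_real_pos less_imp_le)
    have "norm (Beta (s2 + s3 - 1) (1 - s2)) \<le> (Beta 1 \<delta> * (1 + real J) ^ J / \<delta> ^ J) * mt_weight s1 s2 s3 ^ J"
      if s: "(s1, s2, s3) \<in> ?S" for s1 s2 s3
    proof -
      define a where "a = s2 + s3 - 1"
      have d: "norm (of_nat l - (- a)) \<ge> \<delta>" for l
      proof -
        have "norm (s2 + s3 - 1 + of_nat l) \<ge> \<delta>" using s by (simp add: mt_bound_region_def)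
        moreover have "of_nat l - (- a) = s2 + s3 - 1 + of_nat l" by (simp add: a_def)
        ultimately show ?thesis by (simp only:)
      qed
      have a0: "a \<notin> \<int>\<^sub>\<le>\<^sub>0"
      proof
        assume "a \<in> \<int>\<^sub>\<le>\<^sub>0"
        then obtain n where "a = - of_nat n" by (auto elim!: nonpos_Ints_cases')
        with d[of n] \<delta> show False by simp
      qed
      have p: "norm (pochhammer a J) \<ge> \<delta> ^ J"
        using norm_pochhammer_ge[of J \<delta> "- a"] d \<delta> by simp
      have "norm (Beta a (1 - s2)) * \<delta> ^ J \<le> norm (Beta a (1 - s2)) * norm (pochhammer a J)"
        using p by (intro mult_left_mono) auto
      also have "\<dots> = norm (Beta (1 - s2) (a + of_nat J)) * norm (pochhammer s3 J)"
      proof -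
        have "Beta a (1 - s2) * pochhammer a J = Beta (1 - s2) (a + of_nat J) * pochhammer s3 J"
          unfolding Beta_commute[of a "1 - s2"] using Beta_pochhammer_right[OF a0, of "1 - s2" J] by (simp add: a_def)
        then show ?thesis by (simp only: norm_mult[symmetric])
      qed
      also have "\<dots> \<le> Beta \<delta> 1 * (norm s3 + real J) ^ J"
      proof (intro mult_mono norm_pochhammer_le norm_Beta_le)
        show "1 \<le> Re (a + of_nat J)" using s J by (auto simp: a_def mt_bound_region_def)
      qed (use s \<delta> B0 in \<open>auto simp: mt_bound_region_def Beta_commute[of \<delta>]\<close>)
      also have "\<dots> \<le> Beta \<delta> 1 * ((1 + real J) * mt_weight s1 s2 s3) ^ J"
      proof (intro mult_left_mono power_mono)
        have "norm s3 + real J \<le> (1 + real J) * (1 + norm s3)" by (simp add: algebra_simps)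
        also have "\<dots> \<le> (1 + real J) * mt_weight s1 s2 s3"
          using mt_weight_ge(4)[where ?s1.0 = s1 and ?s2.0 = s2 and ?s3.0 = s3] by (intro mult_left_mono) auto
        finally show "norm s3 + real J \<le> (1 + real J) * mt_weight s1 s2 s3" .
      qed (use B0 in \<open>auto simp: Beta_commute[of \<delta>]\<close>)
      also have "\<dots> = (Beta 1 \<delta> * (1 + real J) ^ J) * mt_weight s1 s2 s3 ^ J"
        by (simp only: power_mult_distrib Beta_commute[of \<delta>] mult.assoc)
      finally have "norm (Beta a (1 - s2)) \<le> (Beta 1 \<delta> * (1 + real J) ^ J) * mt_weight s1 s2 s3 ^ J / \<delta> ^ J"
        using \<delta> by (subst pos_le_divide_eq) auto
      then show ?thesis by (simp add: a_def)
    qed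
    then show ?thesis unfolding poly_bounded3_def using B0 \<delta>
      by (intro exI[of _ "Beta 1 \<delta> * (1 + real J) ^ J / \<delta> ^ J"] exI[of _ J]) auto
  qed
  have w: "1 + norm (s1 + s2 + s3 + c) \<le> (1 + norm c) * mt_weight s1 s2 s3" for s1 s2 s3 c
  proof -
    have "1 + norm (s1 + s2 + s3 + c) \<le> (1 + norm (s1 + s2 + s3)) * (1 + norm c)" by (rule one_plus_norm_add_le)
    also have "\<dots> \<le> ((1 + norm (s1 + s2)) * (1 + norm s3)) * (1 + norm c)"
      by (intro mult_right_mono one_plus_norm_add_le) auto
    also have "\<dots> \<le> (((1 + norm s1) * (1 + norm s2)) * (1 + norm s3)) * (1 + norm c)"
      by (intro mult_right_mono one_plus_norm_add_le) auto
    finally show ?thesis by (simp add: mt_weight_def mult_ac)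
  qed
  have T2: "poly_bounded3 ?S (\<lambda>s1 s2 s3. zeta1 (s1 + s2 + s3 - 1))"
  proof (rule poly_bounded3_zeta1[where a = "- 3 * M - 1" and \<delta> = \<delta> and k = 2])
    show "1 + norm (s1 + s2 + s3 - 1) \<le> 2 * mt_weight s1 s2 s3" for s1 s2 s3 using w[of s1 s2 s3 "-1"] by simp
    show "Re (s1 + s2 + s3 - 1) \<ge> - 3 * M - 1 \<and> norm (s1 + s2 + s3 - 1 - 1) \<ge> \<delta>" if "(s1, s2, s3) \<in> ?S" for s1 s2 s3
    proof -
      have "s1 + s2 + s3 - 1 - 1 = s1 + s2 + s3 - 2" by simp
      then show ?thesis using that unfolding mt_bound_region_def by (simp only: mem_Collect_eq prod.case) auto
    qed
  qed (use \<delta> in auto)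
  have T3: "poly_bounded3 ?S (\<lambda>s1 s2 s3. zeta1 (s1 + s3 + of_nat j))" for j
  proof (rule poly_bounded3_zeta1[where a = "- 2 * M" and \<delta> = \<delta> and k = "1 + real j"])
    show "1 + norm (s1 + s3 + of_nat j) \<le> (1 + real j) * mt_weight s1 s2 s3" for s1 s2 s3
    proof -
      have "1 + norm (s1 + s3 + of_nat j) \<le> (1 + real j) * mt_weight s1 0 s3" using w[of s1 0 s3 "of_nat j"] by simp
      also have "\<dots> \<le> (1 + real j) * mt_weight s1 s2 s3"
        using mt_weight_ge(5)[where ?s1.0 = s1 and ?s2.0 = s2 and ?s3.0 = s3] by (intro mult_left_mono) (auto simp: mt_weight_def)
      finally show ?thesis .
    qed
    show "Re (s1 + s3 + of_nat j) \<ge> - 2 * M \<and> norm (s1 + s3 + of_nat j - 1) \<ge> \<delta>" if "(s1, s2, s3) \<in> ?S" for s1 s2 s3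
    proof -
      have "s1 + s3 + of_nat j - 1 = s1 + s3 - 1 + of_nat j" by simp
      then show ?thesis using that unfolding mt_bound_region_def by (simp only: mem_Collect_eq prod.case) auto
    qed
  qed (use \<delta> in auto)
  have T4: "poly_bounded3 ?S (\<lambda>s1 s2 s3. zeta1 (s2 - of_nat j))" for j
  proof (rule poly_bounded3_zeta1[where a = "- M - real j" and \<delta> = \<delta> and k = "1 + real j"])
    show "1 + norm (s2 - of_nat j) \<le> (1 + real j) * mt_weight s1 s2 s3" for s1 s2 s3
    proof -
      have "1 + norm (s2 - of_nat j) \<le> (1 + real j) * mt_weight 0 s2 0" using w[of 0 s2 0 "- of_nat j"] by simp
      also have "\<dots> \<le> (1 + real j) * mt_weight s1 s2 s3"
        using mt_weight_ge(3)[where ?s1.0 = s1 and ?s2.0 = s2 and ?s3.0 = s3] by (intro mult_left_mono) (auto simp: mt_weight_def)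
      finally show ?thesis .
    qed
    show "Re (s2 - of_nat j) \<ge> - M - real j \<and> norm (s2 - of_nat j - 1) \<ge> \<delta>" if "(s1, s2, s3) \<in> ?S" for s1 s2 s3
      using that abs_Re_le_cmod[of "s2 - of_nat j - 1"] by (auto simp: mt_bound_region_def)
  qed (use \<delta> in auto)
  have T5: "poly_bounded3 ?S (\<lambda>s1 s2 s3. (- s3) gchoose j)" for j
  proof -
    have "norm ((- s3) gchoose j) \<le> (1 + real j) ^ j * mt_weight s1 s2 s3 ^ j" for s1 s2 s3 :: complex
    proof -
      have "norm ((- s3) gchoose j) \<le> ((1 + real j) * (1 + norm s3)) ^ j" using norm_gbinomial_le[of "- s3" j] by simp
      also have "\<dots> \<le> ((1 + real j) * mt_weight s1 s2 s3) ^ j"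
        using mt_weight_ge(4)[where ?s1.0 = s1 and ?s2.0 = s2 and ?s3.0 = s3] by (intro power_mono mult_left_mono) auto
      finally show ?thesis by (simp add: power_mult_distrib)
    qed
    then show ?thesis unfolding poly_bounded3_def by (intro exI[of _ "(1 + real j) ^ j"] exI[of _ j]) auto
  qed
  have T6: "poly_bounded3 ?S (mt_integral J)"
  proof -
    obtain C N where C: "C \<ge> 0" "\<And>s1 s2 s3. (s1, s2, s3) \<in> mt_domain J \<Longrightarrow> - M \<le> Re s2 \<Longrightarrow> norm (mt_integral J s1 s2 s3) \<le> C * mt_weight s1 s2 s3 ^ N"
      using norm_mt_integral_le[OF J(1)] by metis
    have "norm (mt_integral J s1 s2 s3) \<le> C * mt_weight s1 s2 s3 ^ N" if "(s1, s2, s3) \<in> ?S" for s1 s2 s3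
      using that by (intro C dom) (auto simp: mt_bound_region_def)
    then show ?thesis unfolding poly_bounded3_def using C(1) by blast
  qed
  have "poly_bounded3 ?S (\<lambda>s1 s2 s3. Beta (s2 + s3 - 1) (1 - s2) * zeta1 (s1 + s2 + s3 - 1)
     + (\<Sum>j<J. ((- s3) gchoose j) * (zeta1 (s1 + s3 + of_nat j) * zeta1 (s2 - of_nat j)))
     + mt_integral J s1 s2 s3 * (1 / (2 * of_real pi)))"
    by (intro poly_bounded3_add poly_bounded3_mult poly_bounded3_sum poly_bounded3_const T1 T2 T3 T4 T5 T6)
  then have "poly_bounded3 ?S (mt_formula J)" by (simp add: mt_formula_def[abs_def])
  then show ?thesis using eq unfolding poly_bounded3_def by metis
qed

section \<open>The Mellin--Barnes formula for so(5)\<close>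

lemma nat_minus_frac_neq:
  assumes "0 < \<epsilon>" "\<epsilon> < 1" shows "real K - \<epsilon> \<noteq> real j"
proof
  assume "real K - \<epsilon> = real j"
  then have "real j < real K" "real K < real (Suc j)" using assms by auto
  then show False by (simp only: of_nat_less_iff)
qed

text \<open>At \<open>(s, s - z, 2 * s + z)\<close> the sums \<open>s2 + s3\<close> and
  \<open>s1 + s2 + s3\<close> are \<open>3 * s\<close> and \<open>4 * s\<close>, whose singular
  values give these points. The sum \<open>s1 + s3 = 3 * s + z\<close> adds none when
  \<open>z\<close> is a natural number.\<close>

definition so5_exceptional :: "complex set" where
  "so5_exceptional = {1/2} \<union> third_points"

definition mt_diag :: "complex \<Rightarrow> complex \<Rightarrow> complex" where
  "mt_diag s z = mt_zeta s (s - z) (2 * s + z)"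

definition so5_integrand :: "complex \<Rightarrow> complex \<Rightarrow> complex" where
  "so5_integrand s z = Beta (s + z) (- z) * mt_diag s z"

text \<open>Quotients of Gamma values appear as binomial coefficients and Beta, so nothing is
  divided by \<open>Gamma s\<close>; the form with Gamma is recovered in
  \<open>so5_formula_Gamma_form\<close>.\<close>

definition so5_formula :: "nat \<Rightarrow> real \<Rightarrow> complex \<Rightarrow> complex" where
  "so5_formula K \<epsilon> s = 6 powr s * ((\<Sum>k<K. ((- s) gchoose k) * mt_diag s (of_nat k)) +
      (LINT t|lborel. so5_integrand s (Complex (real K - \<epsilon>) t)) / (2 * of_real pi))"

lemma mem_so5_exceptional: "s \<in> so5_exceptional \<longleftrightarrow> 4 * s = 2 \<or> 1 - 3 * s \<in> \<nat>"
proof -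
  have 1: "s = 1/2 \<longleftrightarrow> 4 * s = 2" by (auto simp: field_simps)
  have 2: "s \<in> third_points \<longleftrightarrow> 1 - 3 * s \<in> \<nat>"
  proof
    assume "s \<in> third_points"
    then obtain l :: nat where "s = (1 - of_nat l) / 3" by (auto simp: third_points_def)
    then have "3 * s = 1 - of_nat l" by (simp only:) simp
    then have "1 - 3 * s = of_nat l" by (simp only:) simp
    then show "1 - 3 * s \<in> \<nat>" by simp
  next
    assume "1 - 3 * s \<in> \<nat>"
    then obtain l :: nat where "1 - 3 * s = of_nat l" by (auto elim: Nats_cases)
    then have "3 * s = 1 - of_nat l" by (simp add: algebra_simps)
    then have "s = (1 - of_nat l) / 3" by (simp add: field_simps)
    then show "s \<in> third_points" by (auto simp: third_points_def)
  qed
  show ?thesis unfolding so5_exceptional_def using 1 2 by auto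
qed

lemma closed_so5_exceptional: "closed so5_exceptional"
proof -
  have eq: "so5_exceptional = {s. 4 * s = 2} \<union> (\<lambda>s. 1 - 3 * s) -` \<nat>" using mem_so5_exceptional by auto
  show ?thesis unfolding eq by (intro closed_Un closed_vimage closed_Collect_eq closed_Nats continuous_intros)
qed

lemma countable_so5_exceptional: "countable so5_exceptional"
proof -
  have eq: "third_points = range (\<lambda>l::nat. (1 - of_nat l) / 3)" by (auto simp: third_points_def)
  have "countable third_points" unfolding eq by simp
  then show ?thesis by (simp add: so5_exceptional_def)
qed

text \<open>Of the three critical sums only \<open>s1 + s3 = 3 * s + z\<close> depends on
  \<open>z\<close>. Right of \<open>1\<close> it is harmless, and for natural \<open>z\<close> a
  singular value of it would make \<open>1 - 3 * s\<close> natural.\<close>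

lemma mt_diag_nonsingular:
  assumes s: "s \<notin> so5_exceptional" and z: "z \<in> \<nat> \<or> Re (3 * s + z) > 1"
  shows "(s, s - z, 2 * s + z) \<notin> mt_singular_set"
proof
  assume "(s, s - z, 2 * s + z) \<in> mt_singular_set"
  then consider l :: nat where "s + (2 * s + z) = 1 - of_nat l" | l :: nat where "s - z + (2 * s + z) = 1 - of_nat l"
    | "s + (s - z) + (2 * s + z) = 2"
    by (auto simp: mt_singular_set_def)
  then show False
  proof cases
    case (1 l)
    then have eq: "3 * s + z = 1 - of_nat l" by (simp add: algebra_simps)
    then have "\<not> Re (3 * s + z) > 1" by simp
    then obtain k :: nat where "z = of_nat k" using z by (auto elim: Nats_cases)
    then have "1 - 3 * s = of_nat (l + k)" using eq by (simp add: algebra_simps)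
    then show False using s unfolding mem_so5_exceptional by (metis of_nat_in_Nats)
  next
    case (2 l)
    then have "1 - 3 * s = of_nat l" by (simp add: algebra_simps)
    then show False using s unfolding mem_so5_exceptional by (metis of_nat_in_Nats)
  next
    case 3
    then have "4 * s = 2" by (simp add: algebra_simps)
    then show False using s unfolding mem_so5_exceptional by blast
  qed
qed

lemma mt_diag_holomorphic:
  assumes "\<And>s. s \<in> U \<Longrightarrow> (s, s - z, 2 * s + z) \<notin> mt_singular_set"
  shows "(\<lambda>s. mt_diag s z) holomorphic_on U"
  unfolding holomorphic_on_def
proof
  fix s assume "s \<in> U"
  then have "(0 + s * 1, - z + s * 1, z + s * 2) \<in> - mt_singular_set" using assms by (simp add: algebra_simps)
  from holomorphic3_onD_line[OF mt_zeta_holomorphic3 this]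
  have "(\<lambda>s. mt_diag s z) field_differentiable (at s)"
    unfolding mt_diag_def by (simp add: algebra_simps)
  then show "(\<lambda>s. mt_diag s z) field_differentiable (at s within U)"
    by (rule field_differentiable_at_within)
qed

lemma mt_diag_continuous_line:
  assumes s: "s \<notin> so5_exceptional" "Re (3 * s) + c > 1"
  shows "continuous_on UNIV (\<lambda>t. mt_diag s (Complex c t))"
proof -
  have "isCont (\<lambda>z. mt_diag s z) (Complex c t)" for t
  proof -
    have "(s, s - Complex c t, 2 * s + Complex c t) \<notin> mt_singular_set"
      by (rule mt_diag_nonsingular) (use s in auto)
    then have "(s + Complex c t * 0, s + Complex c t * (-1), 2 * s + Complex c t * 1) \<in> - mt_singular_set"
      by simp
    from field_differentiable_imp_continuous_at[OF holomorphic3_onD_line[OF mt_zeta_holomorphic3 this]]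
    show ?thesis unfolding mt_diag_def by simp
  qed
  then have "continuous_on (range (Complex c)) (mt_diag s)"
    by (auto intro!: continuous_at_imp_continuous_on)
  then show ?thesis
    by (rule continuous_on_compose2) (auto simp: Complex_eq intro!: continuous_intros)
qed

lemma so5_integrand_measurable:
  assumes s: "s \<notin> so5_exceptional" "Re s > (1 - real K + \<epsilon>) / 3" and K: "K \<ge> 1" and \<epsilon>: "0 < \<epsilon>" "\<epsilon> < 1"
  shows "(\<lambda>t. so5_integrand s (Complex (real K - \<epsilon>) t)) \<in> borel_measurable lborel"
proof (rule continuous_on_imp_lborel_measurable)
  have 1: "Re s + (real K - \<epsilon>) > 0" using s K \<epsilon> by (simp add: field_simps)
  note 2 = nat_minus_frac_neq[OF \<epsilon>]
  have 3: "Re (3 * s) + (real K - \<epsilon>) > 1" using s by (simp add: field_simps)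
  show "continuous_on UNIV (\<lambda>t. so5_integrand s (Complex (real K - \<epsilon>) t))"
    unfolding so5_integrand_def
    by (intro continuous_on_mult continuous_MB_kernel mt_diag_continuous_line 1 2 3 s)
qed

lemma not_exceptional_large: "Re s > 1/2 \<Longrightarrow> s \<notin> so5_exceptional"
proof
  assume s: "Re s > 1/2" "s \<in> so5_exceptional"
  then consider "4 * s = 2" | l :: nat where "1 - 3 * s = of_nat l"
    unfolding mem_so5_exceptional by (auto elim: Nats_cases)
  then show False
  proof cases
    case 1
    from arg_cong[OF this, of Re] s show False by simp
  next
    case 2
    from arg_cong[OF this, of Re] s show False by simp
  qed
qed

text \<open>Of the exponent \<open>2 * s + z\<close> of \<open>m + n\<close> the share
  \<open>Re s\<close> goes to \<open>m\<close>; \<open>n\<close> receives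
  \<open>Re s + Re z\<close>, which compensates for its own exponent \<open>s - z\<close>.\<close>

lemma mt_diag_term_bound:
  assumes "Re s \<ge> 0" "Re z \<ge> 0" "m \<ge> 1" "n \<ge> 1"
  shows "norm (mt_term s (s - z) (2 * s + z) (m, n)) \<le> real m powr (- (2 * Re s)) * real n powr (- (2 * Re s))"
  by (rule norm_mt_term_le[where \<alpha> = "Re s" and \<beta> = "Re s + Re z"]) (use assms in auto)

lemma mt_diag_summable:
  assumes "Re s > 1/2" "Re z \<ge> 0"
  shows "mt_term s (s - z) (2 * s + z) summable_on {1..} \<times> {1..}"
  by (rule mt_term_summable[where \<alpha> = "Re s" and \<beta> = "Re s + Re z"]) (use assms in auto)

text \<open>\<open>m + n \<ge> m\<close> and \<open>m + 2 * n \<ge> n\<close> distribute the four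
  factors evenly, two for each variable, whence convergence for \<open>Re s > 1/2\<close>.\<close>

lemma so5_term_norm_le:
  assumes "Re s \<ge> \<sigma>" "\<sigma> \<ge> 0" "m \<ge> 1" "n \<ge> 1"
  shows "norm (so5_term s (m, n)) \<le> real m powr (- (2 * \<sigma>)) * real n powr (- (2 * \<sigma>))"
proof -
  have "norm (so5_term s (m, n)) = real m powr (- Re s) * real n powr (- Re s) * real (m + n) powr (- Re s) * real (m + 2 * n) powr (- Re s)"
    using assms norm_of_nat_powr[of m "- s"] norm_of_nat_powr[of n "- s"] norm_of_nat_powr[of "m + n" "- s"] norm_of_nat_powr[of "m + 2 * n" "- s"]
    by (simp only: so5_term_def prod.case norm_mult) (simp del: of_nat_add of_nat_mult)
  also have "\<dots> \<le> real m powr (- Re s) * real n powr (- Re s) * real m powr (- Re s) * real n powr (- Re s)"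
    using assms by (intro mult_mono powr_mono2') auto
  also have "\<dots> \<le> real m powr (- \<sigma>) * real n powr (- \<sigma>) * real m powr (- \<sigma>) * real n powr (- \<sigma>)"
    using assms by (intro mult_mono powr_mono) auto
  also have "\<dots> = (real m powr (- \<sigma>) * real m powr (- \<sigma>)) * (real n powr (- \<sigma>) * real n powr (- \<sigma>))"
    by (simp only: mult_ac)
  also have "\<dots> = real m powr (- (2 * \<sigma>)) * real n powr (- (2 * \<sigma>))"
    by (simp flip: powr_add)
  finally show ?thesis .
qed

lemma so5_term_summable:
  assumes "Re s > 1/2" shows "so5_term s summable_on {1..} \<times> {1..}"
proof (rule summable_on_norm_le(2)[OF summable_on_pairs])
  fix p :: "nat \<times> nat" assume "p \<in> {1..} \<times> {1..}"
  then obtain m n where p: "p = (m, n)" "m \<ge> 1" "n \<ge> 1" by (cases p) auto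
  then show "norm (so5_term s p) \<le> (case p of (m, n) \<Rightarrow> real m powr (- (2 * Re s)) * real n powr (- (2 * Re s)))"
    using so5_term_norm_le[of "Re s" s m n] assms by simp
qed (use assms in auto)

text \<open>With \<open>m + 2 n = (m + n) (1 + n / (m + n))\<close>, the Mellin--Barnes formula turns the series into
  an integral of Mordell--Tornheim values.\<close>

lemma so5_series_eq_formula:
  assumes s: "Re s > 1/2" and K: "K \<ge> 1" and \<epsilon>: "0 < \<epsilon>" "\<epsilon> < 1"
  shows "integrable lborel (\<lambda>t. so5_integrand s (Complex (real K - \<epsilon>) t))"
    and "so5_series s = so5_formula K \<epsilon> s"
proof -
  define c where "c = real K - \<epsilon>"
  have c: "c > 0" using K \<epsilon> by (simp add: c_def)
  have cj: "c \<noteq> real j" for j unfolding c_def by (rule nat_minus_frac_neq[OF \<epsilon>])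
  have sc: "Re s + c > 0" using s c by simp
  define z where "z t = Complex c t" for t
  define b where "b t = Beta (s + z t) (- z t)" for t
  define f where "f p t = b t * mt_term s (s - z t) (2 * s + z t) p" for p t
  have bi: "integrable lborel b" unfolding b_def z_def by (rule integrable_MB_kernel[OF sc cj])
  have contz: "continuous_on UNIV z" unfolding z_def by (simp add: Complex_eq continuous_intros)
  have contb: "continuous_on UNIV b" unfolding b_def z_def by (rule continuous_MB_kernel[OF sc cj])
  define a where "a = (\<lambda>(m, n). real m powr (- (2 * Re s)) * real n powr (- (2 * Re s)))"
  have a: "a summable_on {1..} \<times> {1..}" unfolding a_def by (rule summable_on_pairs) (use s in auto)
  have fb: "norm (f p t) \<le> a p * norm (b t)" if "p \<in> {1..} \<times> {1..}" for p t
  proof -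
    obtain m n where p: "p = (m, n)" "m \<ge> 1" "n \<ge> 1" using \<open>p \<in> {1..} \<times> {1..}\<close> by (cases p) auto
    have "norm (mt_term s (s - z t) (2 * s + z t) p) \<le> a p"
      unfolding p a_def prod.case by (rule mt_diag_term_bound) (use s c p in \<open>auto simp: z_def\<close>)
    from mult_left_mono[OF this, of "norm (b t)"] show ?thesis by (simp add: f_def norm_mult mult.commute)
  qed
  have fm: "f p \<in> borel_measurable lborel" if "p \<in> {1..} \<times> {1..}" for p
  proof -
    obtain m n where p: "p = (m, n)" "m \<ge> 1" "n \<ge> 1" using \<open>p \<in> {1..} \<times> {1..}\<close> by (cases p) auto
    then have "of_nat m \<noteq> (0::complex)" "of_nat n \<noteq> (0::complex)" "of_nat (m + n) \<noteq> (0::complex)" by (auto simp del: of_nat_add)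
    then show ?thesis unfolding p f_def mt_term_def prod.case powr_def
      using contb contz by (intro continuous_on_imp_lborel_measurable) (auto simp del: of_nat_add intro!: continuous_intros)
  qed
  note LS = has_sum_LINT[OF countable_infinite_pairs a integrable_norm[OF bi] fm fb]
  have sum_f: "(\<Sum>\<^sub>\<infinity>p\<in>{1..} \<times> {1..}. f p t) = so5_integrand s (z t)" for t
  proof -
    have "(\<Sum>\<^sub>\<infinity>p\<in>{1..} \<times> {1..}. f p t) = b t * mt_sum s (s - z t) (2 * s + z t)"
      unfolding f_def mt_sum_def by (rule infsum_cmult_right')
    also have "mt_sum s (s - z t) (2 * s + z t) = mt_diag s (z t)"
      unfolding mt_diag_def by (rule mt_zeta_eq_sum[OF mt_diag_summable, symmetric]) (use s c in \<open>auto simp: z_def\<close>)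
    finally show ?thesis by (simp add: so5_integrand_def b_def)
  qed
  show "integrable lborel (\<lambda>t. so5_integrand s (Complex (real K - \<epsilon>) t))"
    using LS(1) unfolding sum_f z_def c_def .
  have hs: "((\<lambda>p. LINT t|lborel. f p t) has_sum (LINT t|lborel. so5_integrand s (z t))) ({1..} \<times> {1..})"
    using LS(2) unfolding sum_f .
  have eq: "so5_term s p = (LINT t|lborel. f p t) / (2 * of_real pi) + (\<Sum>k<K. ((- s) gchoose k) * mt_term s (s - of_nat k) (2 * s + of_nat k) p)"
    if "p \<in> {1..} \<times> {1..}" for p
  proof -
    obtain m n where p: "p = (m, n)" "m \<ge> 1" "n \<ge> 1" using \<open>p \<in> {1..} \<times> {1..}\<close> by (cases p) auto
    define x where "x = real n / real (m + n)"
    have x: "x > 0" using p by (simp add: x_def)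
    define A where "A = (of_nat m powr (- s) * of_nat n powr (- s) * of_nat (m + n) powr (- (2 * s)) :: complex)"
    have mt: "mt_term s (s - w) (2 * s + w) p = A * of_real x powr w" for w
    proof -
      have "of_nat n powr (- (s - w)) = (of_nat n powr (- s) * of_nat n powr w :: complex)"
        "of_nat (m + n) powr (- (2 * s + w)) = (of_nat (m + n) powr (- (2 * s)) * of_nat (m + n) powr (- w) :: complex)"
        by (simp_all del: of_nat_add flip: powr_add)
      then show ?thesis using real_div_powr[of "m + n" n w] p
        by (simp only: p(1) mt_term_def prod.case A_def x_def) (simp del: of_nat_add of_real_divide)
    qed
    have so: "so5_term s p = A * of_real (1 + x) powr (- s)"
    proof -
      have "1 + x = real (m + 2 * n) / real (m + n)" using p by (simp add: x_def field_simps)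
      then have "complex_of_real (1 + x) powr (- s) = of_nat (m + 2 * n) powr (- s) * of_nat (m + n) powr s"
        using real_div_powr[of "m + n" "m + 2 * n" "- s"] p by (simp only: minus_minus)
      moreover have "of_nat (m + n) powr (- s) = (of_nat (m + n) powr (- (2 * s)) * of_nat (m + n) powr s :: complex)"
        by (simp del: of_nat_add flip: powr_add)
      ultimately show ?thesis by (simp add: p(1) so5_term_def A_def del: of_nat_add of_nat_mult of_real_add)
    qed
    have "(LINT t|lborel. f p t) = A * (LINT t|lborel. Beta (s + z t) (- z t) * of_real x powr (z t))"
      unfolding f_def mt b_def by (subst integral_mult_right_zero[symmetric]) (simp only: mult_ac)
    also have "(LINT t|lborel. Beta (s + z t) (- z t) * of_real x powr (z t)) = 2 * of_real pi * (of_real (1 + x) powr (- s) - (\<Sum>k<K. ((- s) gchoose k) * of_real x ^ k))"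
      using Mellin_Barnes_remainder[OF _ x \<epsilon> K, of s] s
      by (simp add: vertical_line_integral_def z_def c_def mult_ac del: of_real_add)
    finally have "(LINT t|lborel. f p t) = A * (2 * of_real pi * (of_real (1 + x) powr (- s) - (\<Sum>k<K. ((- s) gchoose k) * of_real x ^ k)))" .
    then have "(LINT t|lborel. f p t) / (2 * of_real pi) = A * (of_real (1 + x) powr (- s) - (\<Sum>k<K. ((- s) gchoose k) * of_real x ^ k))"
      by (simp del: of_real_add)
    then have 1: "(LINT t|lborel. f p t) / (2 * of_real pi) = A * of_real (1 + x) powr (- s) - (\<Sum>k<K. ((- s) gchoose k) * (A * of_real x ^ k))"
      by (simp only: right_diff_distrib sum_distrib_left mult.left_commute)
    have "of_real x powr (of_nat k) = complex_of_real x ^ k" for k using x by (simp add: powr_nat')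
    then show ?thesis unfolding 1 so mt by simp
  qed
  have hk: "((\<lambda>p. mt_term s (s - of_nat k) (2 * s + of_nat k) p) has_sum mt_diag s (of_nat k)) ({1..} \<times> {1..})" for k
  proof -
    have sm: "mt_term s (s - of_nat k) (2 * s + of_nat k) summable_on {1..} \<times> {1..}"
      by (rule mt_diag_summable) (use s in auto)
    from has_sum_infsum[OF sm] show ?thesis
      using mt_zeta_eq_sum[OF sm] by (simp add: mt_diag_def mt_sum_def)
  qed
  have "((\<lambda>p. (LINT t|lborel. f p t) / (2 * of_real pi) + (\<Sum>k<K. ((- s) gchoose k) * mt_term s (s - of_nat k) (2 * s + of_nat k) p)) has_sum
     ((LINT t|lborel. so5_integrand s (z t)) / (2 * of_real pi) + (\<Sum>k<K. ((- s) gchoose k) * mt_diag s (of_nat k)))) ({1..} \<times> {1..})"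
    unfolding divide_inverse by (intro has_sum_add has_sum_finite_sum has_sum_cmult_right has_sum_cmult_left hs hk)
  then have "(so5_term s has_sum ((LINT t|lborel. so5_integrand s (z t)) / (2 * of_real pi) + (\<Sum>k<K. ((- s) gchoose k) * mt_diag s (of_nat k)))) ({1..} \<times> {1..})"
    using has_sum_cong[of "{1..} \<times> {1..}" "so5_term s", OF eq] by simp
  from infsumI[OF this] show "so5_series s = so5_formula K \<epsilon> s"
    by (simp add: so5_series_def so5_formula_def z_def c_def add.commute)
qed

section \<open>Bounds along the diagonal (s, s - z, 2 s + z)\<close>

text \<open>\<open>Re s \<le> 9/10\<close> keeps the second argument \<open>s - z\<close> at real
  part below \<open>1\<close> for \<open>Re z \<ge> 0\<close>, as \<open>mt_bound_region\<close>
  demands. Any cap strictly between \<open>1/2\<close> and \<open>1\<close> would do, because the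
  series takes over right of \<open>1/2\<close>.\<close>

definition so5_region :: "real \<Rightarrow> real \<Rightarrow> complex set" where
  "so5_region a \<delta> = {s. a \<le> Re s \<and> Re s \<le> 9/10 \<and> (\<forall>l::nat. norm (3 * s - 1 + of_nat l) \<ge> \<delta>) \<and> norm (4 * s - 2) \<ge> \<delta>}"

lemma mt_diag_weight_le: "mt_weight s (s - z) (2 * s + z) \<le> 2 * (1 + norm s) ^ 3 * (1 + norm z) ^ 2"
proof -
  have 1: "1 + norm (s - z) \<le> (1 + norm s) * (1 + norm z)" using one_plus_norm_add_le[of s "- z"] by simp
  have "1 + norm (2 * s + z) \<le> (1 + norm (2 * s)) * (1 + norm z)" by (rule one_plus_norm_add_le)
  also have "\<dots> \<le> (2 * (1 + norm s)) * (1 + norm z)" by (intro mult_right_mono) (auto simp: norm_mult)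
  finally have 2: "1 + norm (2 * s + z) \<le> (2 * (1 + norm s)) * (1 + norm z)" .
  have "mt_weight s (s - z) (2 * s + z) \<le> (1 + norm s) * ((1 + norm s) * (1 + norm z)) * ((2 * (1 + norm s)) * (1 + norm z))"
    unfolding mt_weight_def by (intro mult_mono 1 2) auto
  also have "\<dots> = 2 * (1 + norm s) ^ 3 * (1 + norm z) ^ 2"
    by (simp only: power2_eq_square power3_eq_cube mult_ac)
  finally show ?thesis .
qed

lemma mt_diag_bound:
  assumes \<delta>: "\<delta> > 0" and R: "R \<ge> 0"
  obtains C N where "C \<ge> 0"
    "\<And>s z. s \<in> so5_region a \<delta> \<Longrightarrow> 0 \<le> Re z \<Longrightarrow> Re z \<le> R \<Longrightarrow> (\<And>l::nat. norm (3 * s + z - 1 + of_nat l) \<ge> \<delta>) \<Longrightarrow>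
      norm (mt_diag s z) \<le> C * (1 + norm s) ^ N * (1 + \<bar>Im z\<bar>) ^ N"
proof -
  define M where "M = 2 * (\<bar>a\<bar> + 1) + R"
  \<comment> \<open>The margin \<open>1/10\<close> is what \<open>Re (s - z) \<le> 9/10\<close>
    leaves below \<open>1\<close>.\<close>
  define \<delta>' where "\<delta>' = min \<delta> (1/10)"
  have \<delta>': "\<delta>' > 0" "\<delta>' \<le> \<delta>" "\<delta>' \<le> 1/10" using \<delta> by (auto simp: \<delta>'_def)
  obtain C N where C: "C \<ge> 0" "\<And>s1 s2 s3. (s1, s2, s3) \<in> mt_bound_region M \<delta>' \<Longrightarrow> norm (mt_zeta s1 s2 s3) \<le> C * mt_weight s1 s2 s3 ^ N"
    using mt_zeta_poly_bounded[OF \<delta>'(1), of M] unfolding poly_bounded3_def by auto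
  define D where "D = C * (2 * (1 + R) ^ 2) ^ N"
  show ?thesis
  proof (rule that[of D "3 * N"])
    show "D \<ge> 0" using C R by (simp add: D_def)
    fix s z assume s: "s \<in> so5_region a \<delta>" and z: "0 \<le> Re z" "Re z \<le> R" and l: "\<And>l::nat. norm (3 * s + z - 1 + of_nat l) \<ge> \<delta>"
    have eqs: "s + (2 * s + z) = 3 * s + z" "s - z + (2 * s + z) = 3 * s" "s + (s - z) + (2 * s + z) = 4 * s"
      by (simp_all add: algebra_simps)
    have s': "a \<le> Re s" "Re s \<le> 9/10" "\<And>l::nat. norm (3 * s - 1 + of_nat l) \<ge> \<delta>" "norm (4 * s - 2) \<ge> \<delta>"
      using s by (auto simp: so5_region_def)
    have "(s, s - z, 2 * s + z) \<in> mt_bound_region M \<delta>'"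
      unfolding mt_bound_region_def mem_Collect_eq prod.case eqs
      using s' z l \<delta>' order_trans[OF \<delta>'(2)] by (auto simp: M_def)
    then have "norm (mt_diag s z) \<le> C * mt_weight s (s - z) (2 * s + z) ^ N" unfolding mt_diag_def by (rule C)
    also have "\<dots> \<le> C * (2 * (1 + norm s) ^ 3 * ((1 + R) * (1 + \<bar>Im z\<bar>)) ^ 2) ^ N"
    proof (intro mult_left_mono power_mono C order_trans[OF mt_diag_weight_le])
      show "1 + norm z \<le> (1 + R) * (1 + \<bar>Im z\<bar>)" by (rule one_plus_norm_strip) (use z in auto)
    qed (auto simp: mt_weight_def)
    also have "\<dots> = D * (1 + norm s) ^ (3 * N) * (1 + \<bar>Im z\<bar>) ^ (2 * N)"
      unfolding D_def power_mult by (simp only: power_mult_distrib mult_ac)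
    also have "\<dots> \<le> D * (1 + norm s) ^ (3 * N) * (1 + \<bar>Im z\<bar>) ^ (3 * N)"
      using C R by (intro mult_left_mono power_increasing) (auto simp: D_def)
    finally show "norm (mt_diag s z) \<le> D * (1 + norm s) ^ (3 * N) * (1 + \<bar>Im z\<bar>) ^ (3 * N)" .
  qed
qed

lemma mt_diag_bound_nat:
  assumes \<delta>: "\<delta> > 0"
  obtains C N where "C \<ge> 0" "\<And>s. s \<in> so5_region a \<delta> \<Longrightarrow> norm (mt_diag s (of_nat k)) \<le> C * (1 + norm s) ^ N"
proof -
  obtain C N where C: "C \<ge> 0"
    "\<And>s z. s \<in> so5_region a \<delta> \<Longrightarrow> 0 \<le> Re z \<Longrightarrow> Re z \<le> real k \<Longrightarrow> (\<And>l::nat. norm (3 * s + z - 1 + of_nat l) \<ge> \<delta>) \<Longrightarrow>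
      norm (mt_diag s z) \<le> C * (1 + norm s) ^ N * (1 + \<bar>Im z\<bar>) ^ N"
    using mt_diag_bound[OF \<delta>, of "real k" a] by auto
  have "norm (mt_diag s (of_nat k)) \<le> C * (1 + norm s) ^ N" if "s \<in> so5_region a \<delta>" for s
  proof -
    have "norm (3 * s + of_nat k - 1 + of_nat l) \<ge> \<delta>" for l
    proof -
      have "norm (3 * s - 1 + of_nat (l + k)) \<ge> \<delta>" using that unfolding so5_region_def by blast
      then show ?thesis by (simp add: algebra_simps)
    qed
    then show ?thesis using C(2)[OF that, of "of_nat k"] by simp
  qed
  with C(1) that show ?thesis by blast
qed

text \<open>On the line \<open>Re z = c\<close> the sum \<open>3 * s + z\<close> stays right of
  \<open>1\<close> by at least \<open>3 * a + c - 1\<close>, so the singular hyperplanes that depend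
  on \<open>z\<close> keep their distance. With \<open>c = K - \<epsilon>\<close> the condition on
  \<open>a\<close> describes the half-plane of the formula.\<close>

lemma mt_diag_bound_line:
  assumes \<delta>: "\<delta> > 0" and a: "a > (1 - c) / 3" and c: "c \<ge> 0"
  obtains C N where "C \<ge> 0" "\<And>s t. s \<in> so5_region a \<delta> \<Longrightarrow> norm (mt_diag s (Complex c t)) \<le> C * (1 + norm s) ^ N * (1 + \<bar>t\<bar>) ^ N"
proof -
  define \<delta>' where "\<delta>' = min \<delta> (3 * a + c - 1)"
  have \<delta>': "\<delta>' > 0" "\<delta>' \<le> \<delta>" "\<delta>' \<le> 3 * a + c - 1" using \<delta> a by (auto simp: \<delta>'_def field_simps)
  obtain C N where C: "C \<ge> 0"
    "\<And>s z. s \<in> so5_region a \<delta>' \<Longrightarrow> 0 \<le> Re z \<Longrightarrow> Re z \<le> c \<Longrightarrow> (\<And>l::nat. norm (3 * s + z - 1 + of_nat l) \<ge> \<delta>') \<Longrightarrow>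
      norm (mt_diag s z) \<le> C * (1 + norm s) ^ N * (1 + \<bar>Im z\<bar>) ^ N"
    using mt_diag_bound[OF \<delta>'(1) c, of a] by metis
  have "norm (mt_diag s (Complex c t)) \<le> C * (1 + norm s) ^ N * (1 + \<bar>t\<bar>) ^ N" if s: "s \<in> so5_region a \<delta>" for s t
  proof -
    have "s \<in> so5_region a \<delta>'" using s \<delta>'(2) unfolding so5_region_def by (auto intro: order_trans)
    moreover have "norm (3 * s + Complex c t - 1 + of_nat l) \<ge> \<delta>'" for l
    proof -
      have "\<delta>' \<le> Re (3 * s + Complex c t - 1 + of_nat l)" using s \<delta>'(3) by (simp add: so5_region_def)
      also have "\<dots> \<le> norm (3 * s + Complex c t - 1 + of_nat l)" by (rule complex_Re_le_cmod)
      finally show ?thesis .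
    qed
    ultimately show ?thesis using C(2)[of s "Complex c t"] c by simp
  qed
  with C(1) that show ?thesis by blast
qed

lemma so5_integrand_bound:
  assumes \<delta>: "\<delta> > 0" and a: "a > (1 - real K + \<epsilon>) / 3" and K: "K \<ge> 1" and \<epsilon>: "0 < \<epsilon>" "\<epsilon> < 1"
  obtains C N where "C \<ge> 0" "\<And>s t. s \<in> so5_region a \<delta> \<Longrightarrow> norm (so5_integrand s (Complex (real K - \<epsilon>) t)) \<le> C * (1 + norm s) ^ N * decay t"
proof -
  define c where "c = real K - \<epsilon>"
  have c: "c \<ge> 0" "a > (1 - c) / 3" using a K \<epsilon> by (auto simp: c_def)
  obtain C N where C: "C \<ge> 0" "\<And>s t. s \<in> so5_region a \<delta> \<Longrightarrow> norm (mt_diag s (Complex c t)) \<le> C * (1 + norm s) ^ N * (1 + \<bar>t\<bar>) ^ N"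
    using mt_diag_bound_line[OF \<delta> c(2,1)] by metis
  \<comment> \<open>The distance from \<open>K - \<epsilon>\<close> to the nearest integer.\<close>
  define \<eta> where "\<eta> = min \<epsilon> (1 - \<epsilon>)"
  have \<eta>: "\<eta> > 0" "\<eta> \<le> \<epsilon>" "\<eta> \<le> 1 - \<epsilon>" using \<epsilon> by (auto simp: \<eta>_def)
  have ac: "a + c > 0" using a K \<epsilon> by (simp add: c_def field_simps)
  obtain D M where D: "D > 0" "\<And>s z. Re (s + z) \<ge> a + c \<Longrightarrow> Re z \<le> c \<Longrightarrow> (\<And>j::nat. norm (of_nat j - z) \<ge> \<eta> / 2 * (1 + \<bar>Im z\<bar>)) \<Longrightarrow>
      norm (Beta (s + z) (- z)) * (1 + \<bar>Im z\<bar>) ^ N \<le> D * (1 + norm s) ^ M * decay (Im z)"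
    using MB_kernel_bound[OF ac, of "\<eta> / 2" c N] \<eta> by auto
  have "norm (so5_integrand s (Complex c t)) \<le> (C * D) * (1 + norm s) ^ (N + M) * decay t" if s: "s \<in> so5_region a \<delta>" for s t
  proof -
    define z where "z = Complex c t"
    have "norm (of_nat j - z) \<ge> \<eta> / 2 * (1 + \<bar>Im z\<bar>)" for j
    proof (rule norm_nat_diff_ge_Re)
      show "\<bar>real j - Re z\<bar> \<ge> \<eta>"
      proof (cases "j < K")
        case True
        then have "real j \<le> real K - 1" by linarith
        then show ?thesis using \<eta> by (simp add: z_def c_def)
      qed (use \<eta> in \<open>auto simp: z_def c_def\<close>)
    qed (use \<eta> \<epsilon> in auto)
    then have "norm (Beta (s + z) (- z)) * (1 + \<bar>Im z\<bar>) ^ N \<le> D * (1 + norm s) ^ M * decay (Im z)"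
      using s by (intro D) (auto simp: z_def so5_region_def)
    then have B: "norm (Beta (s + z) (- z)) * (1 + \<bar>t\<bar>) ^ N \<le> D * (1 + norm s) ^ M * decay t" by (simp add: z_def)
    have "norm (so5_integrand s z) \<le> norm (Beta (s + z) (- z)) * (C * (1 + norm s) ^ N * (1 + \<bar>t\<bar>) ^ N)"
      unfolding so5_integrand_def norm_mult using C(2)[OF s, of t] by (intro mult_left_mono) (auto simp: z_def)
    also have "\<dots> = (C * (1 + norm s) ^ N) * (norm (Beta (s + z) (- z)) * (1 + \<bar>t\<bar>) ^ N)" by (simp only: mult_ac)
    also have "\<dots> \<le> (C * (1 + norm s) ^ N) * (D * (1 + norm s) ^ M * decay t)"
      using C by (intro mult_left_mono B) auto
    finally show ?thesis by (simp add: z_def power_add mult_ac)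
  qed
  then show ?thesis using C(1) D(1) that[of "C * D" "N + M"] by (simp add: c_def)
qed

text \<open>\<open>3 * s - 1 + of_nat l\<close> is three times
  \<open>s - (1 - of_nat l) / 3\<close>, and \<open>4 * s - 2\<close> is four times
  \<open>s - 1/2\<close>; the smaller factor determines the constant.\<close>

lemma so5_region_nhd:
  assumes "r > 0" "\<And>e. e \<in> so5_exceptional \<Longrightarrow> norm (s - e) \<ge> r" "a \<le> Re s" "Re s \<le> 9/10"
  shows "s \<in> so5_region a (3 * r)"
proof -
  have "norm (3 * s - 1 + of_nat l) \<ge> 3 * r" for l
  proof -
    have "(1 - of_nat l) / 3 \<in> so5_exceptional" by (auto simp: so5_exceptional_def third_points_def)
    from assms(2)[OF this] have "3 * norm (s - (1 - of_nat l) / 3) \<ge> 3 * r" by simp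
    also have "3 * norm (s - (1 - of_nat l) / 3) = norm (3 * (s - (1 - of_nat l) / 3))" by (simp only: norm_mult) simp
    also have "3 * (s - (1 - of_nat l) / 3) = 3 * s - 1 + of_nat l"
    proof -
      have "3 * (s - q / 3) = 3 * s - q" for q :: complex by (simp add: field_simps)
      from this[of "1 - of_nat l"] show ?thesis by simp
    qed
    finally show ?thesis .
  qed
  moreover have "norm (4 * s - 2) \<ge> 3 * r"
  proof -
    have "1/2 \<in> so5_exceptional" by (auto simp: so5_exceptional_def)
    from assms(2)[OF this] have "4 * norm (s - 1/2) \<ge> 3 * r" using assms(1) by linarith
    also have "4 * norm (s - 1/2) = norm (4 * (s - 1/2))" by (simp only: norm_mult) simp
    also have "4 * (s - 1/2) = 4 * s - 2" by (simp add: algebra_simps)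
    finally show ?thesis .
  qed
  ultimately show ?thesis using assms by (auto simp: so5_region_def)
qed

text \<open>Holomorphy is claimed only left of \<open>9/10\<close>, where the bounds on
  \<open>mt_diag\<close> hold. Integrability needs no cap, since absolute convergence of the series
  provides it for \<open>Re s > 1/2\<close>.\<close>

lemma so5_formula_props:
  fixes K :: nat and \<epsilon> :: real
  assumes K: "K \<ge> 1" and \<epsilon>: "0 < \<epsilon>" "\<epsilon> < 1"
  defines "U \<equiv> {s. Re s > (1 - real K + \<epsilon>) / 3} - so5_exceptional"
  shows "\<And>s. s \<in> U \<Longrightarrow> integrable lborel (\<lambda>t. so5_integrand s (Complex (real K - \<epsilon>) t))"
    and "so5_formula K \<epsilon> holomorphic_on (U \<inter> {s. Re s < 9/10})"
proof -
  define V where "V = U \<inter> {s. Re s < 9/10}"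
  have oV: "open V" unfolding V_def U_def
    by (intro open_Int open_Diff open_halfspace_Re_gt open_halfspace_Re_lt closed_so5_exceptional)
  have meas: "(\<lambda>t. so5_integrand s (Complex (real K - \<epsilon>) t)) \<in> borel_measurable lborel" if "s \<in> U" for s
    by (rule so5_integrand_measurable[OF _ _ K \<epsilon>]) (use that in \<open>auto simp: U_def\<close>)
  have dom: "\<exists>r>0. cball s0 r \<subseteq> V \<and> (\<exists>B. \<forall>s\<in>cball s0 r. \<forall>t. norm (so5_integrand s (Complex (real K - \<epsilon>) t)) \<le> B * decay t)"
    if s0: "s0 \<in> V" for s0
  proof -
    obtain r' where r': "r' > 0" "cball s0 r' \<subseteq> V" using oV s0 open_contains_cball by blast
    define r where "r = min (r' / 2) ((Re s0 - (1 - real K + \<epsilon>) / 3) / 2)"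
    have r: "r > 0" "r \<le> r' / 2" "r \<le> (Re s0 - (1 - real K + \<epsilon>) / 3) / 2"
    proof -
      show "r > 0" using r' s0 by (auto simp: r_def V_def U_def)
      show "r \<le> r' / 2" "r \<le> (Re s0 - (1 - real K + \<epsilon>) / 3) / 2"
        unfolding r_def by (rule min.cobounded1, rule min.cobounded2)
    qed
    define a where "a = Re s0 - r"
    have a: "a > (1 - real K + \<epsilon>) / 3" using r s0 by (simp add: a_def V_def U_def field_simps)
    have reg: "s \<in> so5_region a (3 * r)" if s: "s \<in> cball s0 r" for s
    proof (rule so5_region_nhd[OF r(1)])
      fix e assume e: "e \<in> so5_exceptional"
      show "norm (s - e) \<ge> r"
      proof (rule ccontr)
        assume "\<not> r \<le> norm (s - e)"
        then have "dist s0 e \<le> r'" using s r dist_triangle[of s0 e s] by (simp add: dist_norm)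
        then have "e \<in> V" using r' by auto
        then show False using e by (auto simp: V_def U_def)
      qed
    next
      have "s \<in> V" using s r r' by (auto simp: subset_iff)
      then show "Re s \<le> 9/10" by (auto simp: V_def)
      show "a \<le> Re s" using s abs_Re_le_cmod[of "s0 - s"] by (auto simp: a_def dist_norm)
    qed
    obtain C N where C: "C \<ge> 0" "\<And>s t. s \<in> so5_region a (3 * r) \<Longrightarrow> norm (so5_integrand s (Complex (real K - \<epsilon>) t)) \<le> C * (1 + norm s) ^ N * decay t"
      using so5_integrand_bound[OF _ a K \<epsilon>, of "3 * r"] r by auto
    have "norm (so5_integrand s (Complex (real K - \<epsilon>) t)) \<le> (C * (1 + (norm s0 + r)) ^ N) * decay t" if s: "s \<in> cball s0 r" for s t
    proof -
      have "norm s \<le> norm s0 + r" using s norm_triangle_sub[of s s0] by (simp add: dist_norm norm_minus_commute)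
      then have "C * (1 + norm s) ^ N * decay t \<le> (C * (1 + (norm s0 + r)) ^ N) * decay t"
        using C(1) by (intro mult_right_mono mult_left_mono power_mono) auto
      with C(2)[OF reg[OF s], of t] show ?thesis by linarith
    qed
    moreover have "cball s0 r \<subseteq> V" using r r' by (auto simp: subset_iff)
    ultimately show ?thesis using r(1) by blast
  qed
  show "integrable lborel (\<lambda>t. so5_integrand s (Complex (real K - \<epsilon>) t))" if s: "s \<in> U" for s
  proof (cases "Re s > 1/2")
    case True
    then show ?thesis by (rule so5_series_eq_formula(1)[OF _ K \<epsilon>])
  next
    case False
    then have "s \<in> V" using s by (auto simp: V_def)
    from dom[OF this] obtain r B where rB: "r > 0" "\<forall>s\<in>cball s r. \<forall>t. norm (so5_integrand s (Complex (real K - \<epsilon>) t)) \<le> B * decay t" by blast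
    then have "norm (so5_integrand s (Complex (real K - \<epsilon>) t)) \<le> B * decay t" for t by auto
    then show ?thesis by (rule integrable_if_le_decay(1)[OF meas[OF s]])
  qed
  have int: "(\<lambda>s. LINT t|lborel. so5_integrand s (Complex (real K - \<epsilon>) t)) holomorphic_on V"
  proof (rule holomorphic_on_LINT[OF oV])
    show "(\<lambda>s. so5_integrand s (Complex (real K - \<epsilon>) t)) holomorphic_on V" for t
      unfolding so5_integrand_def
    proof (intro holomorphic_on_mult holomorphic_Beta mt_diag_holomorphic mt_diag_nonsingular)
      show "s + Complex (real K - \<epsilon>) t \<notin> \<int>\<^sub>\<le>\<^sub>0" if "s \<in> V" for s
        by (rule not_nonpos_Int_if_Re_pos) (use that K \<epsilon> in \<open>auto simp: V_def U_def field_simps\<close>)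
      show "- Complex (real K - \<epsilon>) t \<notin> \<int>\<^sub>\<le>\<^sub>0"
      proof
        assume "- Complex (real K - \<epsilon>) t \<in> \<int>\<^sub>\<le>\<^sub>0"
        then obtain n where "- Complex (real K - \<epsilon>) t = - of_nat n" by (auto elim!: nonpos_Ints_cases')
        then have "real K - \<epsilon> = real n" by (simp add: complex_eq_iff)
        then show False using nat_minus_frac_neq[OF \<epsilon>] by blast
      qed
      show "s \<notin> so5_exceptional" if "s \<in> V" for s using that by (auto simp: V_def U_def)
      show "Complex (real K - \<epsilon>) t \<in> \<nat> \<or> 1 < Re (3 * s + Complex (real K - \<epsilon>) t)" if "s \<in> V" for s
        using that by (auto simp: V_def U_def field_simps)
    qed (auto intro!: holomorphic_intros)
    show "(\<lambda>t. so5_integrand s (Complex (real K - \<epsilon>) t)) \<in> borel_measurable lborel" if "s \<in> V" for s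
      using that by (intro meas) (auto simp: V_def)
    fix s0 assume "s0 \<in> V"
    from dom[OF this] obtain r B where rB: "r > 0" "\<forall>s\<in>cball s0 r. \<forall>t. norm (so5_integrand s (Complex (real K - \<epsilon>) t)) \<le> B * decay t" by blast
    then show "\<exists>r>0. \<exists>g. integrable lborel g \<and> (\<forall>s\<in>cball s0 r \<inter> V. \<forall>t\<in>space lborel. norm (so5_integrand s (Complex (real K - \<epsilon>) t)) \<le> g t)"
      using integrable_const_decay[of B] by (intro exI[of _ r] conjI exI[of _ "\<lambda>t. B * decay t"]) auto
  qed
  have d: "(\<lambda>s. mt_diag s (of_nat k)) holomorphic_on V" for k
    by (intro mt_diag_holomorphic mt_diag_nonsingular) (auto simp: V_def U_def)
  have "so5_formula K \<epsilon> = (\<lambda>s. 6 powr s * ((\<Sum>k<K. ((-1) ^ k * pochhammer s k / fact k) * mt_diag s (of_nat k)) +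
      (LINT t|lborel. so5_integrand s (Complex (real K - \<epsilon>) t)) / (2 * of_real pi)))"
    by (simp add: so5_formula_def gbinomial_pochhammer fun_eq_iff)
  moreover have "(\<lambda>s. 6 powr s * ((\<Sum>k<K. ((-1) ^ k * pochhammer s k / fact k) * mt_diag s (of_nat k)) +
      (LINT t|lborel. so5_integrand s (Complex (real K - \<epsilon>) t)) / (2 * of_real pi))) holomorphic_on V"
    by (intro holomorphic_intros int d) auto
  ultimately show "so5_formula K \<epsilon> holomorphic_on (U \<inter> {s. Re s < 9/10})" by (simp only: V_def)
qed

text \<open>Both sides equal the series for \<open>Re s > 1/2\<close>. The strip
  \<open>1/2 < Re s < 9/10\<close> lies in the common domain of holomorphy, which stays connected
  after removal of the countable exceptional set.\<close>

lemma so5_formula_unique: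
  assumes K: "K \<ge> 1" "0 < \<epsilon>" "\<epsilon> < 1" "K' \<ge> 1" "0 < \<epsilon>'" "\<epsilon>' < 1"
    and s: "s \<notin> so5_exceptional" "Re s > (1 - real K + \<epsilon>) / 3" "Re s > (1 - real K' + \<epsilon>') / 3"
  shows "so5_formula K \<epsilon> s = so5_formula K' \<epsilon>' s"
proof (cases "Re s > 1/2")
  case True
  then show ?thesis using so5_series_eq_formula(2)[OF True] K by metis
next
  case False
  define a where "a = max ((1 - real K + \<epsilon>) / 3) ((1 - real K' + \<epsilon>') / 3)"
  define W where "W = {s. Re s > a} \<inter> {s. Re s < 9/10}"
  have W: "open W" "connected W" unfolding W_def
    by (intro open_Int open_halfspace_Re_gt open_halfspace_Re_lt convex_connected convex_Int convex_halfspace_Re_gt convex_halfspace_Re_lt)+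
  show ?thesis
  proof (rule analytic_continuation_open[of "{s. Re s > 1/2} \<inter> {s. Re s < 9/10}" "W - so5_exceptional" "so5_formula K \<epsilon>" "so5_formula K' \<epsilon>'"])
    show "open ({s. Re s > 1/2} \<inter> {s. Re s < 9/10})" by (intro open_Int open_halfspace_Re_gt open_halfspace_Re_lt)
    show "open (W - so5_exceptional)" by (intro open_Diff W closed_so5_exceptional)
    show "connected (W - so5_exceptional)"
      by (rule connected_open_diff_countable) (use W countable_so5_exceptional in auto)
    have "complex_of_real (3/4) \<in> {s. Re s > 1/2} \<inter> {s. Re s < 9/10}" by simp
    then show "{s. Re s > 1/2} \<inter> {s. Re s < 9/10} \<noteq> {}" by blast
    show "{s. Re s > 1/2} \<inter> {s. Re s < 9/10} \<subseteq> W - so5_exceptional"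
      using not_exceptional_large K by (auto simp: W_def a_def field_simps)
    show "so5_formula K \<epsilon> holomorphic_on W - so5_exceptional"
      by (rule holomorphic_on_subset[OF so5_formula_props(2)[of K \<epsilon>]]) (use K in \<open>auto simp: W_def a_def\<close>)
    show "so5_formula K' \<epsilon>' holomorphic_on W - so5_exceptional"
      by (rule holomorphic_on_subset[OF so5_formula_props(2)[of K' \<epsilon>']]) (use K in \<open>auto simp: W_def a_def\<close>)
    show "s \<in> W - so5_exceptional" using s False by (auto simp: W_def a_def)
    fix z assume "z \<in> {s. Re s > 1/2} \<inter> {s. Re s < 9/10}"
    then have z: "Re z > 1/2" by simp
    show "so5_formula K \<epsilon> z = so5_formula K' \<epsilon>' z" using so5_series_eq_formula(2)[OF z] K by metis
  qed
qed

text \<open>A nonpositive integer \<open>- n\<close> is exceptional, because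
  \<open>1 - 3 * s = 1 + 3 * n\<close> is natural there. So \<open>s\<close> is no pole of Gamma,
  \<open>Gamma s\<close> is not the default value \<open>0\<close>, and division by it is
  legitimate.\<close>

lemma so5_formula_Gamma_form:
  assumes s: "s \<notin> so5_exceptional" "Re s > (1 - real K + \<epsilon>) / 3" and K: "K \<ge> 1" and \<epsilon>: "0 < \<epsilon>" "\<epsilon> < 1"
  defines "f \<equiv> \<lambda>z. Gamma (s + z) * Gamma (- z) * mt_zeta s (s - z) (2 * s + z)"
  shows "vertical_line_integrable (real K - \<epsilon>) f"
    and "so5_formula K \<epsilon> s = 6 powr s / Gamma s *
           (\<Sum>k<K. (-1) ^ k * Gamma (s + of_nat k) / fact k * mt_zeta s (s - of_nat k) (2 * s + of_nat k))
         + 6 powr s / (2 * of_real pi * \<i> * Gamma s) * vertical_line_integral (real K - \<epsilon>) f"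
proof -
  have nz: "s \<notin> \<int>\<^sub>\<le>\<^sub>0"
  proof
    assume "s \<in> \<int>\<^sub>\<le>\<^sub>0"
    then obtain n where "s = - of_nat n" by (auto elim!: nonpos_Ints_cases')
    then have "1 - 3 * s = of_nat (1 + 3 * n)" by simp
    then show False using s(1) unfolding mem_so5_exceptional by (metis of_nat_in_Nats)
  qed
  then have G: "Gamma s \<noteq> 0" by (simp add: Gamma_eq_zero_iff)
  have f: "f z = Gamma s * so5_integrand s z" for z
    using G by (simp add: f_def so5_integrand_def Beta_altdef mt_diag_def rGamma_inverse_Gamma field_simps)
  have "integrable lborel (\<lambda>t. so5_integrand s (Complex (real K - \<epsilon>) t))"
    using so5_formula_props(1)[OF K \<epsilon>] s by auto
  then show "vertical_line_integrable (real K - \<epsilon>) f"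
    unfolding vertical_line_integrable_def f by simp
  have "vertical_line_integral (real K - \<epsilon>) f = \<i> * (Gamma s * (LINT t|lborel. so5_integrand s (Complex (real K - \<epsilon>) t)))"
    unfolding vertical_line_integral_def f by simp
  then have 1: "6 powr s / (2 * of_real pi * \<i> * Gamma s) * vertical_line_integral (real K - \<epsilon>) f =
     6 powr s * ((LINT t|lborel. so5_integrand s (Complex (real K - \<epsilon>) t)) / (2 * of_real pi))"
    using G by (simp add: field_simps)
  have "(-1) ^ k * Gamma (s + of_nat k) / fact k = Gamma s * ((- s) gchoose k)" for k
    using G pochhammer_Gamma[OF nz, of k] by (simp add: gbinomial_pochhammer field_simps)
  then have 2: "6 powr s / Gamma s * (\<Sum>k<K. (-1) ^ k * Gamma (s + of_nat k) / fact k * mt_zeta s (s - of_nat k) (2 * s + of_nat k)) =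
    6 powr s * (\<Sum>k<K. ((- s) gchoose k) * mt_diag s (of_nat k))"
    using G by (simp add: mt_diag_def mult.assoc flip: sum_distrib_left)
  show "so5_formula K \<epsilon> s = 6 powr s / Gamma s *
           (\<Sum>k<K. (-1) ^ k * Gamma (s + of_nat k) / fact k * mt_zeta s (s - of_nat k) (2 * s + of_nat k))
         + 6 powr s / (2 * of_real pi * \<i> * Gamma s) * vertical_line_integral (real K - \<epsilon>) f"
    unfolding 1 2 so5_formula_def by (simp add: algebra_simps)
qed

section \<open>Poles and growth for so(5)\<close>

text \<open>Six times an exceptional point is an integer.\<close>

lemma so5_exceptional_isolated:
  assumes "p \<in> so5_exceptional" "e \<in> so5_exceptional" "p \<noteq> e"
  shows "norm (p - e) \<ge> 1/6"
proof -
  have *: "\<exists>j::int. 6 * s = of_int j" if "s \<in> so5_exceptional" for s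
  proof -
    from that consider "4 * s = 2" | l :: nat where "1 - 3 * s = of_nat l"
      unfolding mem_so5_exceptional by (auto elim: Nats_cases)
    then show ?thesis
    proof cases
      case 1
      have "2 * (6 * s) = 3 * (4 * s)" by simp
      also have "\<dots> = 2 * of_int 3" unfolding 1 by simp
      finally have "6 * s = of_int 3" by simp
      then show ?thesis by blast
    next
      case (2 l)
      then have "3 * s = 1 - of_nat l" by (simp add: algebra_simps)
      then have "2 * (3 * s) = 2 * (1 - of_nat l)" by (simp only:)
      then have "6 * s = of_int (2 - 2 * int l)" by (simp add: algebra_simps)
      then show ?thesis by blast
    qed
  qed
  obtain i j :: int where ij: "6 * p = of_int i" "6 * e = of_int j" using * assms by metis
  have "i \<noteq> j"
  proof
    assume "i = j"
    then have "6 * p = 6 * e" using ij by simp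
    then show False using assms(3) by simp
  qed
  then have "\<bar>i - j\<bar> \<ge> 1" by simp
  then have "real_of_int \<bar>i - j\<bar> \<ge> 1" by linarith
  also have "real_of_int \<bar>i - j\<bar> = norm (of_int (i - j) :: complex)" by (simp only: norm_of_int of_int_abs)
  also have "of_int (i - j) = 6 * (p - e)" using ij by (simp add: algebra_simps)
  also have "norm (6 * (p - e)) = 6 * norm (p - e)" by (simp only: norm_mult) simp
  finally show ?thesis by simp
qed

lemma so5_exceptional_Re_le: "p \<in> so5_exceptional \<Longrightarrow> Re p \<le> 1/2"
  using not_exceptional_large by force

section \<open>Residues along the diagonal\<close>

lemma tendsto_linear_residue:
  fixes f :: "complex \<Rightarrow> complex" and a p w q :: complex
  assumes res: "((\<lambda>s. (s - q) * f s) \<longlongrightarrow> r) (at q)" and a: "a \<noteq> 0" and eq: "a * p + w = q"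
  shows "((\<lambda>s. (s - p) * f (a * s + w)) \<longlongrightarrow> r / a) (at p)"
proof -
  have "filterlim (\<lambda>s. a * s + w) (at q) (at p)"
  proof (rule filterlim_atI)
    show "((\<lambda>s. a * s + w) \<longlongrightarrow> q) (at p)" unfolding eq[symmetric] by (intro tendsto_intros)
    show "\<forall>\<^sub>F s in at p. a * s + w \<noteq> q"
      using a by (auto simp: eventually_at_filter eq[symmetric])
  qed
  from filterlim_compose[OF res this] have "((\<lambda>s. (a * s + w - q) * f (a * s + w) * inverse a) \<longlongrightarrow> r * inverse a) (at p)"
    by (intro tendsto_intros)
  moreover have "(a * s + w - q) * f (a * s + w) * inverse a = (s - p) * f (a * s + w)" for s
  proof -
    have "a * s + w - q = a * (s - p)" by (simp add: eq[symmetric] algebra_simps)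
    then have "(a * s + w - q) * f (a * s + w) * inverse a = (a * inverse a) * ((s - p) * f (a * s + w))"
      by (simp only: mult_ac)
    then show ?thesis using a by simp
  qed
  ultimately show ?thesis by (simp add: divide_inverse)
qed

lemma tendsto_linear_cont:
  fixes f :: "complex \<Rightarrow> complex"
  assumes "isCont f (a * p + w)"
  shows "((\<lambda>s. f (a * s + w)) \<longlongrightarrow> f (a * p + w)) (at p)"
proof -
  have "isCont (\<lambda>s. a * s + w) p" by (intro continuous_intros)
  from isCont_o2[OF this assms] show ?thesis by (simp add: isCont_def)
qed

lemma isCont_zeta1: "s \<noteq> 1 \<Longrightarrow> isCont zeta1 s"
  using field_differentiable_imp_continuous_at[OF field_differentiable_zeta1] by blast

lemma zeta1_linear_residue:
  assumes a: "a \<noteq> 0"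
  obtains b where "((\<lambda>s. (s - p) * zeta1 (a * s + w)) \<longlongrightarrow> b) (at p)" "a * p + w \<noteq> 1 \<Longrightarrow> b = 0"
proof (cases "a * p + w = 1")
  case True
  show ?thesis by (rule that[OF tendsto_linear_residue[OF zeta1_residue a True]]) (use True in simp)
next
  case False
  have "((\<lambda>s. (s - p) * zeta1 (a * s + w)) \<longlongrightarrow> (p - p) * zeta1 (a * p + w)) (at p)"
    by (intro tendsto_mult tendsto_diff tendsto_ident_at tendsto_const tendsto_linear_cont isCont_zeta1 False)
  then show ?thesis by (intro that[of 0]) auto
qed

text \<open>\<open>zeta1 (4 * s - 1)\<close> is singular only at \<open>1/2\<close>, where
  \<open>3 * s - 1 = 1/2\<close> is no pole of Gamma; the two kinds of simple poles never
  coincide.\<close>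

lemma Gamma_zeta1_residue:
  obtains q where "((\<lambda>s. (s - p) * (Gamma (3 * s - 1) * zeta1 (4 * s - 1))) \<longlongrightarrow> q) (at p)"
proof (cases "p = 1/2")
  case True
  obtain b where b: "((\<lambda>s. (s - p) * zeta1 (4 * s + (-1))) \<longlongrightarrow> b) (at p)" using zeta1_linear_residue[of 4 p "-1"] by auto
  have "isCont Gamma (3 * p + (-1))"
    by (intro continuous_intros not_nonpos_Int_if_Re_pos) (simp add: True)
  from tendsto_mult[OF tendsto_linear_cont[OF this] b]
  show ?thesis by (intro that) (simp add: mult_ac)
next
  case False
  have "4 * p + (-1) \<noteq> 1"
  proof
    assume "4 * p + (-1) = 1"
    then have "4 * p = 2" by (simp add: algebra_simps)
    then show False using False by (simp add: field_simps)
  qed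
  then have z: "((\<lambda>s. zeta1 (4 * s + (-1))) \<longlongrightarrow> zeta1 (4 * p + (-1))) (at p)"
    by (intro tendsto_linear_cont isCont_zeta1)
  obtain g where g: "((\<lambda>s. (s - p) * Gamma (3 * s + (-1))) \<longlongrightarrow> g) (at p)"
  proof (cases "3 * p + (-1) \<in> \<int>\<^sub>\<le>\<^sub>0")
    case True
    then obtain l where l: "3 * p + (-1) = - of_nat l" by (auto elim!: nonpos_Ints_cases')
    have "((\<lambda>z. (z - (- of_nat l)) * Gamma z) \<longlongrightarrow> (-1) ^ l / fact l) (at (- of_nat l :: complex))"
      using Gamma_residues[of l, where 'a = complex] by (simp add: mult.commute)
    from tendsto_linear_residue[OF this _ l] show ?thesis by (intro that) auto
  next
    case False
    then have "isCont Gamma (3 * p + (-1))" by (intro continuous_intros)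
    then have "((\<lambda>s. (s - p) * Gamma (3 * s + (-1))) \<longlongrightarrow> (p - p) * Gamma (3 * p + (-1))) (at p)"
      by (intro tendsto_mult tendsto_diff tendsto_ident_at tendsto_const tendsto_linear_cont)
    then show ?thesis by (rule that)
  qed
  from tendsto_mult[OF g z] show ?thesis by (intro that) (simp add: mult_ac)
qed

text \<open>All singularities of \<open>s \<mapsto> mt_zeta s (s - z) (2 s + z)\<close> are simple, because the factors of
  \<open>mt_formula\<close> that can blow up never do so in the same summand.\<close>

lemma mt_diag_residue:
  assumes p: "p \<in> so5_exceptional" and z: "z \<in> \<nat> \<or> Re (3 * p + z) > 1" and z0: "Re z \<ge> 0"
  obtains L where "((\<lambda>s. (s - p) * mt_diag s z) \<longlongrightarrow> L) (at p)"
    "rGamma (2 * p + z) = 0 \<Longrightarrow> (\<And>j::nat. 3 * p + z + of_nat j = 1 \<Longrightarrow> ((- (2 * p + z)) gchoose j) = 0) \<Longrightarrow> L = 0"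
proof -
  have pr: "Re p \<le> 1/2" by (rule so5_exceptional_Re_le[OF p])
  \<comment> \<open>Chosen so that \<open>mt_formula J\<close> is available at \<open>p\<close>,
    hence in a neighbourhood of \<open>p\<close>.\<close>
  obtain J :: nat where J0: "real J > max 1 (max (1 - Re (2 * p + z)) (2 - Re (3 * p + z)))" using reals_Archimedean2 by blast
  then have J: "J \<ge> 1" by simp
  define U where "U = (\<lambda>s. (s, s - z, 2 * s + z)) -` mt_domain J"
  have U: "open U" unfolding U_def by (intro open_vimage open_mt_domain continuous_intros)
  have "s + (2 * s + z) = 3 * s + z" for s by simp
  then have pU: "p \<in> U" using J0 pr z0 by (simp add: U_def mt_domain_def)
  have "\<forall>\<^sub>F s in at p. s \<in> U" using eventually_at_in_open'[OF U pU] .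
  moreover have "\<forall>\<^sub>F s in at p. s \<notin> so5_exceptional"
  proof -
    have "\<forall>\<^sub>F s in at p. s \<in> ball p (1/6) - {p}" by (intro eventually_at_in_open) auto
    then show ?thesis
    proof eventually_elim
      case (elim s)
      then show ?case using so5_exceptional_isolated[OF p, of s] by (auto simp: dist_norm)
    qed
  qed
  moreover have "\<forall>\<^sub>F s in at p. z \<in> \<nat> \<or> Re (3 * s + z) > 1"
  proof (cases "z \<in> \<nat>")
    case False
    then have "Re (3 * p + z) > 1" using z by simp
    moreover have "((\<lambda>s. Re (3 * s + z)) \<longlongrightarrow> Re (3 * p + z)) (at p)" by (intro tendsto_intros)
    ultimately have "\<forall>\<^sub>F s in at p. Re (3 * s + z) > 1" by (rule order_tendstoD(1)[rotated])
    then show ?thesis by eventually_elim simp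
  qed simp
  ultimately have ev: "\<forall>\<^sub>F s in at p. mt_diag s z = mt_formula J s (s - z) (2 * s + z)"
  proof eventually_elim
    case (elim s)
    then show ?case unfolding mt_diag_def
      by (intro mt_zeta_eq_formula[OF J] mt_diag_nonsingular) (auto simp: U_def)
  qed
  obtain q where q: "((\<lambda>s. (s - p) * (Gamma (3 * s - 1) * zeta1 (4 * s - 1))) \<longlongrightarrow> q) (at p)"
    by (rule Gamma_zeta1_residue)
  \<comment> \<open>The limits are the residues of the factors
    \<open>zeta1 (3 * s + z + of_nat j)\<close> at \<open>p\<close>; only the \<open>j\<close> with
    \<open>3 * p + z + of_nat j = 1\<close> can give a nonzero one.\<close>
  have "\<forall>j::nat. \<exists>b. ((\<lambda>s. (s - p) * zeta1 (3 * s + (z + of_nat j))) \<longlongrightarrow> b) (at p) \<and> (3 * p + (z + of_nat j) \<noteq> 1 \<longrightarrow> b = 0)"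
    using zeta1_linear_residue[of 3 p] by (metis zero_neq_numeral)
  then obtain b where b: "\<And>j::nat. ((\<lambda>s. (s - p) * zeta1 (3 * s + (z + of_nat j))) \<longlongrightarrow> b j) (at p)"
     "\<And>j. 3 * p + (z + of_nat j) \<noteq> 1 \<Longrightarrow> b j = 0" by metis
  have g: "((\<lambda>s. Gamma (1 - (s - z)) * rGamma (2 * s + z)) \<longlongrightarrow> Gamma (1 - (p - z)) * rGamma (2 * p + z)) (at p)"
  proof (intro tendsto_mult)
    show "((\<lambda>s. Gamma (1 - (s - z))) \<longlongrightarrow> Gamma (1 - (p - z))) (at p)"
      by (intro tendsto_intros not_nonpos_Int_if_Re_pos) (use pr z0 in simp)
    have "isCont rGamma (2 * p + z)"
      using holomorphic_on_imp_continuous_on[OF holomorphic_rGamma[of UNIV]] continuous_on_eq_continuous_at[of UNIV rGamma] by blast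
    then show "((\<lambda>s. rGamma (2 * s + z)) \<longlongrightarrow> rGamma (2 * p + z)) (at p)" by (rule tendsto_linear_cont)
  qed
  have ch: "((\<lambda>s. (- (2 * s + z)) gchoose j) \<longlongrightarrow> ((- (2 * p + z)) gchoose j)) (at p)" for j
  proof -
    have "(\<lambda>s. (-1) ^ j * pochhammer (2 * s + z) j / fact j) holomorphic_on UNIV"
      by (intro holomorphic_intros) auto
    then have "isCont (\<lambda>s. (-1) ^ j * pochhammer (2 * s + z) j / fact j) p"
      using holomorphic_on_imp_continuous_on continuous_on_eq_continuous_at[of UNIV] by blast
    then show ?thesis by (simp only: isCont_def gbinomial_pochhammer minus_minus)
  qed
  have z2: "((\<lambda>s. zeta1 (s - z - of_nat j)) \<longlongrightarrow> zeta1 (p - z - of_nat j)) (at p)" for j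
  proof -
    have "1 * p + (- z - of_nat j) \<noteq> 1" using pr z0 by (auto simp: complex_eq_iff)
    from tendsto_linear_cont[OF isCont_zeta1[OF this]] show ?thesis by (simp add: algebra_simps)
  qed
  have i: "((\<lambda>s. mt_integral J s (s - z) (2 * s + z)) \<longlongrightarrow> mt_integral J p (p - z) (2 * p + z)) (at p)"
  proof -
    have "(\<lambda>s. mt_integral J s (s - z) (2 * s + z)) holomorphic_on U"
      by (rule mt_integral_holomorphic[OF J U]) (auto simp: U_def intro!: holomorphic_intros)
    then have "isCont (\<lambda>s. mt_integral J s (s - z) (2 * s + z)) p"
      using holomorphic_on_imp_continuous_on continuous_on_eq_continuous_at[OF U] pU by blast
    then show ?thesis by (simp add: isCont_def)
  qed
  \<comment> \<open>The limit of \<open>s - p\<close> times \<open>mt_formula\<close>, term by term.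
    The first term carries \<open>rGamma (2 * p + z)\<close> and the summands a binomial coefficient
    times \<open>b j\<close>, whence the vanishing criterion; the integral is regular at
    \<open>p\<close> and contributes \<open>0\<close>.\<close>
  define L where "L = q * (Gamma (1 - (p - z)) * rGamma (2 * p + z)) + (\<Sum>j<J. ((- (2 * p + z)) gchoose j) * (b j * zeta1 (p - z - of_nat j)))
      + (p - p) * mt_integral J p (p - z) (2 * p + z) / (2 * of_real pi)"
  have lim: "((\<lambda>s. (s - p) * (Gamma (3 * s - 1) * zeta1 (4 * s - 1)) * (Gamma (1 - (s - z)) * rGamma (2 * s + z))
      + (\<Sum>j<J. ((- (2 * s + z)) gchoose j) * (((s - p) * zeta1 (3 * s + (z + of_nat j))) * zeta1 (s - z - of_nat j)))
      + (s - p) * mt_integral J s (s - z) (2 * s + z) / (2 * of_real pi)) \<longlongrightarrow> L) (at p)"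
    unfolding L_def by (intro tendsto_add tendsto_mult tendsto_sum tendsto_divide q g ch b z2 i tendsto_diff tendsto_ident_at tendsto_const) simp
  have "((\<lambda>s. (s - p) * mt_diag s z) \<longlongrightarrow> L) (at p)"
  proof (rule Lim_transform_eventually[OF lim])
    show "\<forall>\<^sub>F s in at p. (s - p) * (Gamma (3 * s - 1) * zeta1 (4 * s - 1)) * (Gamma (1 - (s - z)) * rGamma (2 * s + z))
      + (\<Sum>j<J. ((- (2 * s + z)) gchoose j) * (((s - p) * zeta1 (3 * s + (z + of_nat j))) * zeta1 (s - z - of_nat j)))
      + (s - p) * mt_integral J s (s - z) (2 * s + z) / (2 * of_real pi) = (s - p) * mt_diag s z"
      using ev
    proof eventually_elim
      case (elim s)
      have e: "s - z + (2 * s + z) - 1 = 3 * s - 1" "3 * s - 1 + (1 - (s - z)) = 2 * s + z"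
        "s + (s - z) + (2 * s + z) - 1 = 4 * s - 1" "s + (2 * s + z) + of_nat j = 3 * s + (z + of_nat j)" for j
        by (simp_all add: algebra_simps)
      show ?case
        unfolding elim mt_formula_def Beta_altdef e distrib_left sum_distrib_left
        by (simp add: mult_ac)
    qed
  qed
  moreover have "L = 0" if r: "rGamma (2 * p + z) = 0" and c: "\<And>j::nat. 3 * p + z + of_nat j = 1 \<Longrightarrow> ((- (2 * p + z)) gchoose j) = 0"
  proof -
    have "((- (2 * p + z)) gchoose j) * (b j * zeta1 (p - z - of_nat j)) = 0" for j
      using c[of j] b(2)[of j] by (cases "3 * p + z + of_nat j = 1") (auto simp: add.assoc)
    then show ?thesis unfolding L_def r by (subst sum.neutral) auto
  qed
  ultimately show ?thesis using that by blast
qed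

section \<open>The continued function and its poles\<close>

text \<open>The number of terms is taken so large that \<open>s\<close> lies in the half-plane of
  the formula with \<open>\<epsilon> = 1/2\<close>. The values at exceptional points are meaningless
  and are repaired in \<open>so5_zeta\<close>.\<close>

definition so5_zeta0 :: "complex \<Rightarrow> complex" where
  "so5_zeta0 s = so5_formula (nat \<lceil>3 - 3 * Re s\<rceil> + 1) (1/2) s"

lemma so5_zeta0_eq:
  assumes "s \<notin> so5_exceptional" "K \<ge> 1" "0 < \<epsilon>" "\<epsilon> < 1" "Re s > (1 - real K + \<epsilon>) / 3"
  shows "so5_zeta0 s = so5_formula K \<epsilon> s"
  unfolding so5_zeta0_def
proof (rule so5_formula_unique)
  have "real (nat \<lceil>3 - 3 * Re s\<rceil> + 1) \<ge> 4 - 3 * Re s" by linarith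
  then show "(1 - real (nat \<lceil>3 - 3 * Re s\<rceil> + 1) + 1/2) / 3 < Re s" by (simp add: field_simps)
qed (use assms in auto)

lemma so5_zeta0_series: "Re s > 1/2 \<Longrightarrow> so5_zeta0 s = so5_series s"
  unfolding so5_zeta0_def by (rule so5_series_eq_formula(2)[symmetric]) auto

lemma so5_series_holomorphic: "so5_series holomorphic_on {s. Re s > 1/2}"
  unfolding so5_series_def
proof (intro holomorphic_intros holomorphic_on_infsum open_halfspace_Re_gt)
  fix p :: "nat \<times> nat" assume "p \<in> {1..} \<times> {1..}"
  then obtain m n where p: "p = (m, n)" "m \<ge> 1" "n \<ge> 1" by (cases p) auto
  then have "(of_nat (m + n) :: complex) \<noteq> 0" "(of_nat (m + 2 * n) :: complex) \<noteq> 0" "(of_nat m :: complex) \<noteq> 0" "(of_nat n :: complex) \<noteq> 0"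
    by (simp_all del: of_nat_add of_nat_mult)
  then show "(\<lambda>s. so5_term s p) holomorphic_on {s. Re s > 1/2}"
    unfolding p so5_term_def prod.case by (intro holomorphic_intros)
next
  fix s0 :: complex assume "s0 \<in> {s. Re s > 1/2}"
  then have s0: "Re s0 > 1/2" by simp
  define r where "r = (Re s0 - 1/2) / 2"
  have r: "r > 0" "Re s0 - r > 1/2" using s0 by (auto simp: r_def field_simps)
  define g where "g = (\<lambda>(m, n). real m powr (- (2 * (Re s0 - r))) * real n powr (- (2 * (Re s0 - r))))"
  have "g summable_on {1..} \<times> {1..}" unfolding g_def by (rule summable_on_pairs) (use r in auto)
  moreover have "norm (so5_term s p) \<le> g p" if s: "s \<in> cball s0 r" and p: "p \<in> {1..} \<times> {1..}" for s p
  proof -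
    obtain m n where p: "p = (m, n)" "m \<ge> 1" "n \<ge> 1" using p by (cases p) auto
    have "Re s \<ge> Re s0 - r" using s abs_Re_le_cmod[of "s0 - s"] by (auto simp: dist_norm)
    then show ?thesis unfolding p g_def prod.case by (rule so5_term_norm_le) (use r p in auto)
  qed
  ultimately show "\<exists>r>0. \<exists>g. g summable_on {1..} \<times> {1..} \<and> (\<forall>s\<in>cball s0 r \<inter> {s. 1/2 < Re s}. \<forall>i\<in>{1..} \<times> {1..}. norm (so5_term s i) \<le> g i)"
    using r(1) by blast
qed

lemma so5_zeta0_analytic:
  assumes s: "s \<notin> so5_exceptional" shows "so5_zeta0 analytic_on {s}"
proof (cases "Re s > 1/2")
  case True
  have "so5_zeta0 holomorphic_on {s. Re s > 1/2}"
    using so5_series_holomorphic by (rule holomorphic_transform) (simp add: so5_zeta0_series)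
  moreover have "open {s. Re s > 1/2}" by (rule open_halfspace_Re_gt)
  moreover have "s \<in> {s. Re s > 1/2}" using True by simp
  ultimately show ?thesis unfolding analytic_at by blast
next
  case False
  obtain K :: nat where K0: "real K > max 1 (3/2 - 3 * Re s)" using reals_Archimedean2 by blast
  then have K: "K \<ge> 1" "Re s > (1 - real K + 1/2) / 3" by (auto simp: field_simps)
  define V where "V = ({s. Re s > (1 - real K + 1/2) / 3} - so5_exceptional) \<inter> {s. Re s < 9/10}"
  have "open V" unfolding V_def
    by (intro open_Int open_Diff open_halfspace_Re_gt open_halfspace_Re_lt closed_so5_exceptional)
  moreover have "so5_zeta0 holomorphic_on V"
  proof (rule holomorphic_transform)
    show "so5_formula K (1/2) holomorphic_on V" unfolding V_def by (rule so5_formula_props(2)[OF K(1)]) auto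
  qed (use K in \<open>auto simp: V_def intro!: so5_zeta0_eq[symmetric]\<close>)
  moreover have "s \<in> V" using s K False by (auto simp: V_def)
  ultimately show ?thesis using analytic_at by blast
qed

text \<open>\<open>G\<close> is the formula with every \<open>mt_diag s z\<close> replaced by
  \<open>(s - p) * mt_diag s z\<close>, continued to \<open>s = p\<close>. This continuation is made
  for each \<open>z\<close> separately, so measurability along the line and bounds uniform in
  \<open>z\<close> have to be established at \<open>p\<close> as well.\<close>

lemma so5_pole_structure:
  assumes p: "p \<in> so5_exceptional"
  obtains G where "G holomorphic_on ball p (1/10)" "\<And>s. s \<in> ball p (1/10) - {p} \<Longrightarrow> so5_zeta0 s = G s / (s - p)"
    "p \<in> \<int> \<Longrightarrow> G p = 0"
proof -
  have pr: "Re p \<le> 1/2" by (rule so5_exceptional_Re_le[OF p])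
  define a where "a = Re p - 1/9"
  obtain K :: nat where K0: "real K > max 1 (3/2 - 3 * a)" using reals_Archimedean2 by blast
  then have K: "K \<ge> 1" "a > (1 - real K + 1/2) / 3" by (auto simp: field_simps)
  define c where "c = real K - 1/2"
  have c: "c \<ge> 0" "c > 0" "a > (1 - c) / 3" "a + c > 0" using K by (auto simp: c_def field_simps)
  \<comment> \<open>The values of \<open>z\<close> that occur: the naturals in the finite sum, and
    the line of integration.\<close>
  define Z where "Z = of_nat ` UNIV \<union> range (Complex c)"
  \<comment> \<open>The disc of radius \<open>1/9\<close> contains no other exceptional point, as
    these are \<open>1/6\<close> apart; the smaller radius \<open>1/10\<close> carries the
    estimates. Both discs stay left of \<open>9/10\<close> because
    \<open>Re p \<le> 1/2\<close>.\<close>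
  have near: "a \<le> Re s \<and> Re s \<le> 9/10 \<and> Re (3 * s) + c > 1" if "s \<in> ball p (1/9)" for s
  proof -
    have "\<bar>Re (p - s)\<bar> < 1/9" using that abs_Re_le_cmod[of "p - s"] by (simp add: dist_norm)
    then have d: "Re p - 1/9 < Re s" "Re s < Re p + 1/9" unfolding minus_complex.sel by linarith+
    have "3 * a > 1 - c" using c(3) by (simp add: field_simps)
    then have "Re (3 * s) + c > 1" using d a_def by simp
    then show ?thesis using d pr by (simp add: a_def)
  qed
  have nonex: "s \<notin> so5_exceptional" if "s \<in> ball p (1/9)" "s \<noteq> p" for s
    using so5_exceptional_isolated[OF p, of s] that by (auto simp: dist_norm)
  have Zz: "Re z \<ge> 0" "z \<in> \<nat> \<or> Re (3 * s + z) > 1" if "z \<in> Z" "s \<in> ball p (1/9)" for z s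
    using that near[OF that(2)] c by (auto simp: Z_def)
  have pb: "p \<in> ball p (1/9)" by simp
  have "\<forall>z\<in>Z. \<exists>L. ((\<lambda>s. (s - p) * mt_diag s z) \<longlongrightarrow> L) (at p) \<and>
    (rGamma (2 * p + z) = 0 \<longrightarrow> (\<forall>j::nat. 3 * p + z + of_nat j = 1 \<longrightarrow> ((- (2 * p + z)) gchoose j) = 0) \<longrightarrow> L = 0)"
    (is "\<forall>z\<in>Z. \<exists>L. ?R z L")
  proof
    fix z assume z: "z \<in> Z"
    show "\<exists>L. ?R z L" by (rule mt_diag_residue[OF p Zz(2)[OF z pb] Zz(1)[OF z pb]]) blast
  qed
  from bchoice[OF this] obtain L where L: "\<And>z. z \<in> Z \<Longrightarrow> ((\<lambda>s. (s - p) * mt_diag s z) \<longlongrightarrow> L z) (at p)"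
    "\<And>z. z \<in> Z \<Longrightarrow> rGamma (2 * p + z) = 0 \<Longrightarrow> (\<And>j::nat. 3 * p + z + of_nat j = 1 \<Longrightarrow> ((- (2 * p + z)) gchoose j) = 0) \<Longrightarrow> L z = 0"
    by blast
  \<comment> \<open>The limit \<open>L z\<close> removes the singularity without any claim about
    \<open>mt_zeta\<close> at \<open>s = p\<close>, where the point may be singular.\<close>
  define \<psi> where "\<psi> z s = (if s = p then L z else (s - p) * mt_diag s z)" for z s
  have \<psi>_hol: "\<psi> z holomorphic_on ball p (1/9)" if z: "z \<in> Z" for z
    unfolding \<psi>_def
  proof (rule removable_singularity[OF _ _ L(1)[OF z]])
    have "(\<lambda>s. mt_diag s z) holomorphic_on ball p (1/9) - {p}"
      by (intro mt_diag_holomorphic mt_diag_nonsingular nonex Zz z) auto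
    then show "(\<lambda>s. (s - p) * mt_diag s z) holomorphic_on ball p (1/9) - {p}" by (intro holomorphic_intros)
  qed auto
  \<comment> \<open>On the circle of radius \<open>1/10\<close> the distance to the other
    exceptional points is at least \<open>1/6 - 1/10\<close>, which exceeds
    \<open>1/18\<close>.\<close>
  have sphere: "s \<in> so5_region a (3 * (1/18))" if s: "norm (s - p) = 1/10" for s
  proof (rule so5_region_nhd)
    fix e assume e: "e \<in> so5_exceptional"
    show "norm (s - e) \<ge> 1/18"
    proof (cases "e = p")
      case False
      then have "norm (p - e) \<ge> 1/6" using so5_exceptional_isolated[OF p e] by auto
      moreover have "norm (p - e) \<le> norm (s - p) + norm (s - e)"
        using norm_triangle_ineq4[of "s - e" "s - p"] by (simp add: norm_minus_commute)
      ultimately show ?thesis using s by simp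
    qed (use s in simp)
  qed (use near[of s] s in \<open>auto simp: dist_norm norm_minus_commute\<close>)
  obtain C N where C: "C \<ge> 0" "\<And>s t. s \<in> so5_region a (3 * (1/18)) \<Longrightarrow> norm (mt_diag s (Complex c t)) \<le> C * (1 + norm s) ^ N * (1 + \<bar>t\<bar>) ^ N"
    using mt_diag_bound_line[of "3 * (1/18)" c a] c by (metis divide_pos_pos mult_pos_pos zero_less_numeral zero_less_one)
  define B where "B = 1/10 * (C * (2 + norm p) ^ N)"
  have B0: "B \<ge> 0" using C by (simp add: B_def)
  have \<psi>_bound: "norm (\<psi> (Complex c t) s) \<le> B * (1 + \<bar>t\<bar>) ^ N" if s: "s \<in> cball p (1/10)" for s t
  proof (rule maximum_modulus_frontier[of "\<psi> (Complex c t)" "cball p (1/10)"])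
    have h: "\<psi> (Complex c t) holomorphic_on ball p (1/9)" by (rule \<psi>_hol) (simp add: Z_def)
    show "\<psi> (Complex c t) holomorphic_on interior (cball p (1/10))"
      by (rule holomorphic_on_subset[OF h]) auto
    show "continuous_on (closure (cball p (1/10))) (\<psi> (Complex c t))"
      by (rule continuous_on_subset[OF holomorphic_on_imp_continuous_on[OF h]]) auto
    fix w assume "w \<in> frontier (cball p (1/10))"
    then have w: "norm (w - p) = 1/10" by (simp add: frontier_cball dist_norm norm_minus_commute)
    then have "w \<noteq> p" by auto
    then have "norm (\<psi> (Complex c t) w) = 1/10 * norm (mt_diag w (Complex c t))" by (simp add: \<psi>_def norm_mult w)
    also have "\<dots> \<le> 1/10 * (C * (1 + norm w) ^ N * (1 + \<bar>t\<bar>) ^ N)"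
      by (intro mult_left_mono C sphere w) auto
    also have "\<dots> \<le> 1/10 * (C * (2 + norm p) ^ N * (1 + \<bar>t\<bar>) ^ N)"
    proof (intro mult_left_mono mult_right_mono power_mono C)
      show "1 + norm w \<le> 2 + norm p" using norm_triangle_sub[of w p] w by simp
    qed auto
    finally show "norm (\<psi> (Complex c t) w) \<le> B * (1 + \<bar>t\<bar>) ^ N" by (simp add: B_def mult_ac)
  qed (use s in auto)
  obtain D M where D: "D > 0" "\<And>s z. Re (s + z) \<ge> a + c \<Longrightarrow> Re z \<le> c \<Longrightarrow> (\<And>j::nat. norm (of_nat j - z) \<ge> 1/4 * (1 + \<bar>Im z\<bar>)) \<Longrightarrow>
      norm (Beta (s + z) (- z)) * (1 + \<bar>Im z\<bar>) ^ N \<le> D * (1 + norm s) ^ M * decay (Im z)"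
    using MB_kernel_bound[OF c(4), of "1/4" c N] by auto
  have cj: "c \<noteq> real j" for j unfolding c_def by (rule nat_minus_frac_neq) auto
  have dist: "norm (of_nat j - Complex c t) \<ge> 1/4 * (1 + \<bar>Im (Complex c t)\<bar>)" for j t
  proof -
    have "\<bar>real j - c\<bar> \<ge> 1/2" unfolding c_def by (cases "j \<ge> K") auto
    then show ?thesis using norm_nat_diff_ge_Re[of "1/2" j "Complex c t"] by simp
  qed
  define f where "f s t = Beta (s + Complex c t) (- Complex c t) * \<psi> (Complex c t) s" for s t
  have f_bound: "norm (f s t) \<le> (B * (D * (2 + norm p) ^ M)) * decay t" if s: "s \<in> ball p (1/10)" for s t
  proof -
    have s9: "s \<in> ball p (1/9)" using s by auto
    have "norm (f s t) \<le> norm (Beta (s + Complex c t) (- Complex c t)) * (B * (1 + \<bar>t\<bar>) ^ N)"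
      unfolding f_def norm_mult using s by (intro mult_left_mono \<psi>_bound) auto
    also have "\<dots> = B * (norm (Beta (s + Complex c t) (- Complex c t)) * (1 + \<bar>Im (Complex c t)\<bar>) ^ N)" by simp
    also have "\<dots> \<le> B * (D * (1 + norm s) ^ M * decay (Im (Complex c t)))"
      by (intro mult_left_mono D dist B0) (use near[OF s9] in auto)
    also have "\<dots> \<le> B * (D * (2 + norm p) ^ M * decay (Im (Complex c t)))"
    proof (intro mult_left_mono mult_right_mono power_mono B0)
      show "1 + norm s \<le> 2 + norm p" using norm_triangle_sub[of s p] s by (simp add: dist_norm norm_minus_commute)
    qed (use D in auto)
    finally show ?thesis by (simp add: mult_ac)
  qed
  have diag_meas: "(\<lambda>t. mt_diag s (Complex c t)) \<in> borel_measurable lborel" if "s \<in> ball p (1/9)" "s \<noteq> p" for s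
    by (intro continuous_on_imp_lborel_measurable mt_diag_continuous_line nonex that) (use near[OF that(1)] in auto)
  have \<psi>_meas: "(\<lambda>t. \<psi> (Complex c t) s) \<in> borel_measurable lborel" if s: "s \<in> ball p (1/9)" for s
  proof (cases "s = p")
    case False
    then show ?thesis unfolding \<psi>_def using diag_meas[OF s False] by simp
  next
    case True
    \<comment> \<open>\<open>L\<close> was picked pointwise, so its measurability along the line
      comes from a limit of measurable functions at points tending to \<open>p\<close>; the summand
      \<open>10\<close> keeps these points inside the disc.\<close>
    define X where "X n = p + complex_of_real (1 / (real n + 10))" for n :: nat
    have X: "filterlim X (at p) sequentially"
    proof (rule filterlim_atI)
      have "(\<lambda>n. 1 / (real n + 10)) \<longlonglongrightarrow> 0" by real_asymp
      from tendsto_add[OF tendsto_const[of p] tendsto_of_real[OF this, where 'a = complex]]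
      show "X \<longlonglongrightarrow> p" unfolding X_def[abs_def] by simp
      show "\<forall>\<^sub>F n in sequentially. X n \<noteq> p"
      proof (rule always_eventually, rule allI)
        fix n :: nat
        have "1 / (real n + 10) \<noteq> 0" by (simp add: add_eq_0_iff)
        then have "complex_of_real (1 / (real n + 10)) \<noteq> 0" by (simp only: of_real_eq_0_iff not_False_eq_True)
        then show "X n \<noteq> p" unfolding X_def by (simp only: add_cancel_left_right not_False_eq_True)
      qed
    qed
    have Xb: "X n \<in> ball p (1/9)" "X n \<noteq> p" for n
    proof -
      have pos: "1 / (real n + 10) > 0" by simp
      have le: "1 / (real n + 10) \<le> 1/10" by (intro divide_left_mono) auto
      have "dist p (X n) = 1 / (real n + 10)"
        unfolding X_def dist_norm using pos by (simp only: norm_minus_commute[of p] add_diff_cancel_left' norm_of_real abs_of_pos)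
      then show "X n \<in> ball p (1/9)" "X n \<noteq> p" using pos le by auto
    qed
    show ?thesis
    proof (rule borel_measurable_LIMSEQ_metric)
      show "(\<lambda>t. (X n - p) * mt_diag (X n) (Complex c t)) \<in> borel_measurable lborel" for n
        using diag_meas[OF Xb] by simp
      show "(\<lambda>n. (X n - p) * mt_diag (X n) (Complex c t)) \<longlonglongrightarrow> \<psi> (Complex c t) s" for t
        using filterlim_compose[OF L(1)[of "Complex c t"] X] True by (simp add: \<psi>_def Z_def)
    qed
  qed
  have ker_meas: "(\<lambda>t. Beta (s + Complex c t) (- Complex c t)) \<in> borel_measurable lborel" if s: "s \<in> ball p (1/9)" for s
    by (intro continuous_on_imp_lborel_measurable continuous_MB_kernel cj) (use near[OF s] c in auto)
  have int_hol: "(\<lambda>s. LINT t|lborel. f s t) holomorphic_on ball p (1/10)"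
  proof (rule holomorphic_on_LINT)
    show "(\<lambda>s. f s t) holomorphic_on ball p (1/10)" for t
      unfolding f_def
    proof (intro holomorphic_on_mult holomorphic_Beta)
      show "(\<lambda>s. \<psi> (Complex c t) s) holomorphic_on ball p (1/10)"
        by (rule holomorphic_on_subset[OF \<psi>_hol]) (auto simp: Z_def)
      show "s + Complex c t \<notin> \<int>\<^sub>\<le>\<^sub>0" if "s \<in> ball p (1/10)" for s
        by (rule not_nonpos_Int_if_Re_pos) (use near[of s] that c in auto)
      show "- Complex c t \<notin> \<int>\<^sub>\<le>\<^sub>0"
      proof
        assume "- Complex c t \<in> \<int>\<^sub>\<le>\<^sub>0"
        then obtain n where "- Complex c t = - of_nat n" by (auto elim!: nonpos_Ints_cases')
        then have "c = real n" by (simp add: complex_eq_iff)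
        then show False using cj by blast
      qed
    qed (auto intro!: holomorphic_intros)
    show "f s \<in> borel_measurable lborel" if "s \<in> ball p (1/10)" for s
      unfolding f_def[abs_def] using ker_meas[of s] \<psi>_meas[of s] that by auto
    show "\<exists>r>0. \<exists>g. integrable lborel g \<and> (\<forall>s\<in>cball s0 r \<inter> ball p (1/10). \<forall>t\<in>space lborel. norm (f s t) \<le> g t)" for s0
      using f_bound integrable_const_decay[of "B * (D * (2 + norm p) ^ M)"]
      by (intro exI[of _ 1] conjI exI[of _ "\<lambda>t. (B * (D * (2 + norm p) ^ M)) * decay t"]) auto
  qed auto
  define G where "G s = 6 powr s * ((\<Sum>k<K. ((- s) gchoose k) * \<psi> (of_nat k) s) + (LINT t|lborel. f s t) / (2 * of_real pi))" for s
  show ?thesis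
  proof (rule that[of G])
    have k: "(\<lambda>s. \<psi> (of_nat k) s) holomorphic_on ball p (1/10)" for k
      by (rule holomorphic_on_subset[OF \<psi>_hol]) (auto simp: Z_def)
    have "G = (\<lambda>s. 6 powr s * ((\<Sum>k<K. ((-1) ^ k * pochhammer s k / fact k) * \<psi> (of_nat k) s) + (LINT t|lborel. f s t) / (2 * of_real pi)))"
      by (simp add: G_def gbinomial_pochhammer fun_eq_iff)
    moreover have "(\<lambda>s. 6 powr s * ((\<Sum>k<K. ((-1) ^ k * pochhammer s k / fact k) * \<psi> (of_nat k) s) + (LINT t|lborel. f s t) / (2 * of_real pi))) holomorphic_on ball p (1/10)"
      by (intro holomorphic_intros k int_hol) auto
    ultimately show "G holomorphic_on ball p (1/10)" by simp
  next
    fix s assume s: "s \<in> ball p (1/10) - {p}"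
    then have s9: "s \<in> ball p (1/9)" "s \<noteq> p" by auto
    have "so5_zeta0 s = so5_formula K (1/2) s"
      by (rule so5_zeta0_eq[OF nonex[OF s9] K(1)]) (use near[OF s9(1)] K in auto)
    moreover have "f s t = (s - p) * so5_integrand s (Complex c t)" for t
      using s9 by (simp add: f_def \<psi>_def so5_integrand_def)
    then have I: "(LINT t|lborel. f s t) = (s - p) * (LINT t|lborel. so5_integrand s (Complex c t))"
      by (simp only: integral_mult_right_zero)
    have S: "(\<Sum>k<K. ((- s) gchoose k) * \<psi> (of_nat k) s) = (s - p) * (\<Sum>k<K. ((- s) gchoose k) * mt_diag s (of_nat k))"
      unfolding sum_distrib_left using s9 by (intro sum.cong) (auto simp: \<psi>_def)
    have "x * (d * S + d * I / q) = d * (x * (S + I / q))" for x d S I q :: complex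
      by (simp add: divide_inverse algebra_simps)
    then have "G s = (s - p) * so5_formula K (1/2) s"
      unfolding G_def so5_formula_def S I c_def[symmetric] .
    ultimately show "so5_zeta0 s = G s / (s - p)" using s9 by simp
  next
    assume pZ: "p \<in> \<int>"
    then obtain i where i: "p = of_int i" by (auto elim: Ints_cases)
    with pr have "real_of_int i \<le> 1/2" by simp
    then have "i \<le> 0" by linarith
    then have p_n: "p = - of_nat (nat (- i))" by (simp add: i)
    then obtain n where n: "p = - of_nat n" by blast
    \<comment> \<open>The arguments of Beta add up to \<open>p = - n\<close>, a zero of
      \<open>rGamma\<close>, so the kernel vanishes on the whole line.\<close>
    have "f p = (\<lambda>_. 0)" unfolding f_def by (simp add: Beta_zero n)
    \<comment> \<open>For \<open>k > n\<close> the binomial coefficient vanishes. For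
      \<open>k \<le> n\<close> the residue does: \<open>2 * p + k = - (2 * n - k)\<close> is a zero
      of \<open>rGamma\<close>, and the only critical index \<open>j = 1 + 3 * n - k\<close> exceeds
      \<open>2 * n - k\<close>, so its binomial coefficient is \<open>0\<close>.\<close>
    moreover have "((- p) gchoose k) * \<psi> (of_nat k) p = 0" for k
    proof (cases "k \<le> n")
      case False
      then have "((- p) gchoose k) = 0" unfolding n minus_minus by (simp flip: binomial_gbinomial)
      then show ?thesis by simp
    next
      case True
      have e: "2 * p + of_nat k = - of_nat (2 * n - k)" using True by (simp add: n of_nat_diff)
      have "L (of_nat k) = 0"
      proof (rule L(2))
        show "rGamma (2 * p + of_nat k) = 0" unfolding e by (simp add: rGamma_eq_zero_iff)
        fix j :: nat assume "3 * p + of_nat k + of_nat j = 1"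
        then have "of_nat k + of_nat j = (1 + 3 * of_nat n :: complex)" by (simp add: n algebra_simps)
        then have "of_nat (k + j) = (of_nat (1 + 3 * n) :: complex)" by simp
        then have "k + j = 1 + 3 * n" by (simp only: of_nat_eq_iff)
        with True have "2 * n - k < j" by linarith
        then show "((- (2 * p + of_nat k)) gchoose j) = 0" unfolding e minus_minus by (simp flip: binomial_gbinomial)
      qed (auto simp: Z_def)
      then show ?thesis by (simp add: \<psi>_def)
    qed
    ultimately show "G p = 0" unfolding G_def by (subst sum.neutral) auto
  qed
qed

lemma so5_zeta0_meromorphic: "so5_zeta0 meromorphic_on UNIV"
  unfolding meromorphic_on_meromorphic_at[of _ UNIV]
proof
  fix p :: complex
  show "so5_zeta0 meromorphic_on {p}"
  proof (cases "p \<in> so5_exceptional")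
    case False
    then show ?thesis by (intro analytic_on_imp_meromorphic_on so5_zeta0_analytic)
  next
    case True
    obtain G where G: "G holomorphic_on ball p (1/10)" "\<And>s. s \<in> ball p (1/10) - {p} \<Longrightarrow> so5_zeta0 s = G s / (s - p)"
      using so5_pole_structure[OF True] by metis
    have "\<forall>\<^sub>F s in at p. so5_zeta0 s = G s / (s - p)"
    proof -
      have "\<forall>\<^sub>F s in at p. s \<in> ball p (1/10) - {p}" by (intro eventually_at_in_open) auto
      then show ?thesis by eventually_elim (rule G(2))
    qed
    then have "so5_zeta0 meromorphic_on {p} \<longleftrightarrow> (\<lambda>s. G s / (s - p)) meromorphic_on {p}"
      by (intro meromorphic_on_cong) auto
    moreover have "G analytic_on {p}" using G(1) by (intro holomorphic_on_imp_analytic_at[where A = "ball p (1/10)"]) auto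
    then have "(\<lambda>s. G s / (s - p)) meromorphic_on {p}"
      by (intro meromorphic_intros analytic_on_imp_meromorphic_on) (auto intro!: analytic_intros)
    ultimately show ?thesis by simp
  qed
qed

text \<open>\<open>remove_sings\<close> puts the limit in place of the value at a removable
  singularity and \<open>0\<close> at a pole, which discards the meaningless values of
  \<open>so5_zeta0\<close> at exceptional points.\<close>

definition so5_zeta :: "complex \<Rightarrow> complex" where
  "so5_zeta = remove_sings so5_zeta0"

lemma so5_zeta_eq: "s \<notin> so5_exceptional \<Longrightarrow> so5_zeta s = so5_zeta0 s"
  unfolding so5_zeta_def by (rule remove_sings_at_analytic[OF so5_zeta0_analytic])

lemma so5_zeta_analytic: "s \<notin> so5_exceptional \<Longrightarrow> so5_zeta analytic_on {s}"
  unfolding so5_zeta_def by (rule remove_sings_analytic_on[OF so5_zeta0_analytic])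

text \<open>With \<open>G p = 0\<close> the quotient \<open>G s / (s - p)\<close> is a difference
  quotient and tends to the derivative of \<open>G\<close> at \<open>p\<close>, so the singularity
  is removable.\<close>

lemma so5_zeta_analytic_if_zero:
  assumes G: "G holomorphic_on ball p (1/10)" "\<And>s. s \<in> ball p (1/10) - {p} \<Longrightarrow> so5_zeta0 s = G s / (s - p)" "G p = 0"
  shows "so5_zeta analytic_on {p}"
  unfolding so5_zeta_def
proof (rule remove_sings_analytic_at)
  show "isolated_singularity_at so5_zeta0 p"
    using so5_zeta0_meromorphic meromorphic_on_altdef by blast
  have "(G has_field_derivative deriv G p) (at p)"
    by (rule holomorphic_derivI[OF G(1)]) auto
  then have "((\<lambda>s. (G s - G p) / (s - p)) \<longlongrightarrow> deriv G p) (at p)" by (simp add: has_field_derivative_iff)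
  moreover have "\<forall>\<^sub>F s in at p. (G s - G p) / (s - p) = so5_zeta0 s"
  proof -
    have "\<forall>\<^sub>F s in at p. s \<in> ball p (1/10) - {p}" by (intro eventually_at_in_open) auto
    then show ?thesis by eventually_elim (simp add: G)
  qed
  ultimately show "(so5_zeta0 \<longlongrightarrow> deriv G p) (at p)" by (rule Lim_transform_eventually)
qed

lemma so5_zeta_analytic_int:
  assumes "p \<in> \<int>" shows "so5_zeta analytic_on {p}"
proof (cases "p \<in> so5_exceptional")
  case True
  obtain G where "G holomorphic_on ball p (1/10)" "\<And>s. s \<in> ball p (1/10) - {p} \<Longrightarrow> so5_zeta0 s = G s / (s - p)" "G p = 0"
    using so5_pole_structure[OF True] assms by metis
  then show ?thesis by (rule so5_zeta_analytic_if_zero)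
qed (rule so5_zeta_analytic)

text \<open>At a pole the numerator cannot vanish, since otherwise the singularity would be
  removable; hence the order is exactly \<open>-1\<close>. Integers drop out because the function is
  analytic at all of them.\<close>

lemma so5_zeta_pole:
  assumes pole: "is_pole so5_zeta p"
  shows "zorder so5_zeta p = -1" "p \<in> {1/2} \<union> (third_points - \<int>)"
proof -
  have na: "\<not> so5_zeta analytic_on {p}"
    using pole analytic_at_imp_no_pole by blast
  then have p: "p \<in> so5_exceptional" "p \<notin> \<int>" using so5_zeta_analytic so5_zeta_analytic_int by blast+
  then show "p \<in> {1/2} \<union> (third_points - \<int>)" by (auto simp: so5_exceptional_def)
  obtain G where G: "G holomorphic_on ball p (1/10)" "\<And>s. s \<in> ball p (1/10) - {p} \<Longrightarrow> so5_zeta0 s = G s / (s - p)"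
    using so5_pole_structure[OF p(1)] by metis
  have "G p \<noteq> 0" using so5_zeta_analytic_if_zero[OF G] na by blast
  show "zorder so5_zeta p = -1"
  proof (rule zorder_eqI[OF open_ball _ G(1) \<open>G p \<noteq> 0\<close>])
    fix w assume w: "w \<in> ball p (1/10)" "w \<noteq> p"
    then have "w \<notin> so5_exceptional" using so5_exceptional_isolated[OF p(1), of w] by (auto simp: dist_norm)
    then show "so5_zeta w = G w * (w - p) powi (-1)"
      using G(2)[of w] w by (simp add: so5_zeta_eq power_int_minus field_simps)
  qed simp
qed

lemma norm_6_powr: "norm ((6::complex) powr s) = 6 powr Re s"
  using norm_of_real_powr[of 6 s] by simp

section \<open>Growth in vertical strips\<close>

lemma so5_formula_growth:
  assumes K: "K \<ge> 1" and a: "a > (1 - real K + 1/2) / 3"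
  obtains C N where "C \<ge> 0" "\<And>s. s \<in> so5_region a 1 \<Longrightarrow> norm (so5_formula K (1/2) s) \<le> C * (1 + norm s) ^ N"
proof -
  have "\<forall>k. \<exists>C N. C \<ge> 0 \<and> (\<forall>s. s \<in> so5_region a 1 \<longrightarrow> norm (mt_diag s (of_nat k)) \<le> C * (1 + norm s) ^ N)"
    using mt_diag_bound_nat[of 1 a] by (metis zero_less_one)
  then obtain c n where cn: "\<And>k. c k \<ge> 0" "\<And>k s. s \<in> so5_region a 1 \<Longrightarrow> norm (mt_diag s (of_nat k)) \<le> c k * (1 + norm s) ^ n k"
    by metis
  obtain D M where D: "D \<ge> 0" "\<And>s t. s \<in> so5_region a 1 \<Longrightarrow> norm (so5_integrand s (Complex (real K - 1/2) t)) \<le> D * (1 + norm s) ^ M * decay t"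
    using so5_integrand_bound[of 1 K "1/2" a] K a by auto
  define I where "I = (LINT t|lborel. decay t)"
  have I: "I \<ge> 0" unfolding I_def by (intro integral_nonneg_AE) auto
  define N where "N = M + (\<Sum>k<K. n k + k)"
  define C where "C = 6 powr 1 * ((\<Sum>k<K. (1 + real k) ^ k * c k) + D * I)"
  show ?thesis
  proof (rule that[of C N])
    show "C \<ge> 0" unfolding C_def using cn(1) D I by (intro mult_nonneg_nonneg add_nonneg_nonneg sum_nonneg) auto
    fix s assume s: "s \<in> so5_region a 1"
    let ?Y = "1 + norm s"
    have 1: "norm (((- s) gchoose k) * mt_diag s (of_nat k)) \<le> ((1 + real k) ^ k * c k) * ?Y ^ N" if k: "k < K" for k
    proof -
      have "norm (((- s) gchoose k) * mt_diag s (of_nat k)) \<le> ((1 + real k) * ?Y) ^ k * (c k * ?Y ^ n k)"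
        unfolding norm_mult using norm_gbinomial_le[of "- s" k] cn s by (intro mult_mono) auto
      also have "\<dots> = ((1 + real k) ^ k * c k) * ?Y ^ (n k + k)" by (simp only: power_mult_distrib power_add mult_ac)
      also have "\<dots> \<le> ((1 + real k) ^ k * c k) * ?Y ^ N"
      proof (intro mult_left_mono power_increasing)
        have "n k + k \<le> (\<Sum>k<K. n k + k)" using k by (intro member_le_sum) auto
        then show "n k + k \<le> N" by (simp add: N_def)
      qed (use cn in auto)
      finally show ?thesis .
    qed
    have ex: "s \<notin> so5_exceptional"
    proof
      assume "s \<in> so5_exceptional"
      then consider "4 * s = 2" | l :: nat where "1 - 3 * s = of_nat l"
        unfolding mem_so5_exceptional by (auto elim: Nats_cases)
      then show False
      proof cases
        case 1
        have "norm (4 * s - 2) \<ge> 1" using s unfolding so5_region_def by blast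
        then show False unfolding 1 by simp
      next
        case (2 l)
        have "norm (3 * s - 1 + of_nat l) \<ge> 1" using s unfolding so5_region_def by blast
        then show False unfolding 2[symmetric] by simp
      qed
    qed
    have "norm (LINT t|lborel. so5_integrand s (Complex (real K - 1/2) t)) \<le> (D * ?Y ^ M) * I"
      unfolding I_def
      by (rule integrable_if_le_decay(2)[OF so5_integrand_measurable[OF ex _ K] D(2)[OF s]])
         (use s a in \<open>auto simp: so5_region_def\<close>)
    also have "\<dots> \<le> (D * ?Y ^ N) * I" using D I by (intro mult_right_mono mult_left_mono power_increasing) (auto simp: N_def)
    finally have 2: "norm (LINT t|lborel. so5_integrand s (Complex (real K - 1/2) t)) \<le> (D * I) * ?Y ^ N" by (simp only: mult_ac)
    have 3: "norm ((LINT t|lborel. so5_integrand s (Complex (real K - 1/2) t)) / (2 * of_real pi)) \<le> (D * I) * ?Y ^ N"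
    proof -
      have "norm ((LINT t|lborel. so5_integrand s (Complex (real K - 1/2) t)) / (2 * of_real pi)) =
          norm (LINT t|lborel. so5_integrand s (Complex (real K - 1/2) t)) / (2 * pi)" by (simp add: norm_divide norm_mult)
      also have "\<dots> \<le> norm (LINT t|lborel. so5_integrand s (Complex (real K - 1/2) t)) / 1"
        using pi_gt3 by (intro divide_left_mono) auto
      finally show ?thesis using 2 by simp
    qed
    have "norm (so5_formula K (1/2) s) \<le> 6 powr 1 * ((\<Sum>k<K. ((1 + real k) ^ k * c k) * ?Y ^ N) + (D * I) * ?Y ^ N)"
      unfolding so5_formula_def norm_mult
    proof (intro mult_mono)
      show "norm ((6::complex) powr s) \<le> 6 powr 1" unfolding norm_6_powr using s by (intro powr_mono) (auto simp: so5_region_def)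
      show "norm ((\<Sum>k<K. ((- s) gchoose k) * mt_diag s (of_nat k)) + (LINT t|lborel. so5_integrand s (Complex (real K - 1/2) t)) / (2 * of_real pi))
        \<le> (\<Sum>k<K. ((1 + real k) ^ k * c k) * ?Y ^ N) + (D * I) * ?Y ^ N"
        by (rule order_trans[OF norm_triangle_ineq], rule add_mono[OF sum_norm_le 3]) (use 1 in auto)
    qed auto
    also have "\<dots> = C * ?Y ^ N" by (simp only: C_def sum_distrib_right distrib_right distrib_left mult.assoc)
    finally show "norm (so5_formula K (1/2) s) \<le> C * ?Y ^ N" .
  qed
qed

text \<open>For \<open>\<bar>Im s\<bar> \<ge> 1\<close> the affine forms in
  \<open>so5_region\<close> have norm at least \<open>1\<close>, so the region with
  \<open>\<delta> = 1\<close> contains the part of the strip left of \<open>3/4\<close>; further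
  right the series is bounded. The abscissa \<open>3/4\<close> only has to lie between
  \<open>1/2\<close> and \<open>9/10\<close>.\<close>

lemma so5_zeta_growth:
  assumes "\<sigma>0 \<le> \<sigma>1"
  shows "\<exists>P :: real poly. \<exists>T::real. \<forall>s. \<sigma>0 \<le> Re s \<longrightarrow> Re s \<le> \<sigma>1 \<longrightarrow> \<bar>Im s\<bar> \<ge> T \<longrightarrow> norm (so5_zeta s) \<le> poly P \<bar>Im s\<bar>"
proof -
  obtain K :: nat where K0: "real K > max 1 (3/2 - 3 * \<sigma>0)" using reals_Archimedean2 by blast
  then have K: "K \<ge> 1" "\<sigma>0 > (1 - real K + 1/2) / 3" by (auto simp: field_simps)
  obtain C N where C: "C \<ge> 0" "\<And>s. s \<in> so5_region \<sigma>0 1 \<Longrightarrow> norm (so5_formula K (1/2) s) \<le> C * (1 + norm s) ^ N"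
    using so5_formula_growth[OF K] by metis
  define R where "R = \<bar>\<sigma>0\<bar> + \<bar>\<sigma>1\<bar>"
  define S where "S = (\<Sum>\<^sub>\<infinity>(m, n)\<in>{1..} \<times> {1..}. real m powr (- (2 * (3/4))) * real n powr (- (2 * (3/4))))"
  have S0: "S \<ge> 0" unfolding S_def by (intro infsum_nonneg) auto
  \<comment> \<open>The constant serves the part of the strip from \<open>3/4\<close> on, the power
    the rest, where \<open>R\<close> bounds \<open>\<bar>Re s\<bar>\<close>.\<close>
  define P where "P = [:6 powr \<sigma>1 * S:] + smult C ([:1 + R, 1:] ^ N)"
  have P: "poly P x = 6 powr \<sigma>1 * S + C * (1 + R + x) ^ N" for x by (simp add: P_def)
  have "norm (so5_zeta s) \<le> poly P \<bar>Im s\<bar>" if s: "\<sigma>0 \<le> Re s" "Re s \<le> \<sigma>1" "\<bar>Im s\<bar> \<ge> 1" for s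
  proof (cases "Re s \<ge> 3/4")
    case True
    then have "so5_zeta s = so5_series s" using not_exceptional_large[of s] by (simp add: so5_zeta_eq so5_zeta0_series)
    also have "norm \<dots> \<le> 6 powr \<sigma>1 * S"
      unfolding so5_series_def norm_mult norm_6_powr
    proof (intro mult_mono)
      show "6 powr Re s \<le> 6 powr \<sigma>1" using s by (intro powr_mono) auto
      show "norm (\<Sum>\<^sub>\<infinity>p\<in>{1..} \<times> {1..}. so5_term s p) \<le> S"
        unfolding S_def
      proof (rule summable_on_norm_le(3)[OF summable_on_pairs])
        fix p :: "nat \<times> nat" assume "p \<in> {1..} \<times> {1..}"
        then obtain m n where p: "p = (m, n)" "m \<ge> 1" "n \<ge> 1" by (cases p) auto
        then show "norm (so5_term s p) \<le> (case p of (m, n) \<Rightarrow> real m powr (- (2 * (3/4))) * real n powr (- (2 * (3/4))))"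
          using so5_term_norm_le[of "3/4" s m n] True by simp
      qed auto
    qed auto
    also have "\<dots> \<le> poly P \<bar>Im s\<bar>" unfolding P using C by (simp add: R_def)
    finally show ?thesis .
  next
    case False
    have reg: "s \<in> so5_region \<sigma>0 1"
    proof -
      have "norm (3 * s - 1 + of_nat l) \<ge> 1" for l
        using abs_Im_le_cmod[of "3 * s - 1 + of_nat l"] s by simp
      moreover have "norm (4 * s - 2) \<ge> 1" using abs_Im_le_cmod[of "4 * s - 2"] s by simp
      ultimately show ?thesis using s False by (auto simp: so5_region_def)
    qed
    have ex: "s \<notin> so5_exceptional"
    proof
      assume "s \<in> so5_exceptional"
      then consider "4 * s = 2" | l :: nat where "1 - 3 * s = of_nat l"
        unfolding mem_so5_exceptional by (auto elim: Nats_cases)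
      then have "Im s = 0"
      proof cases
        case 1
        from arg_cong[OF this, of Im] show ?thesis by simp
      next
        case 2
        from arg_cong[OF this, of Im] show ?thesis by simp
      qed
      then show False using s by simp
    qed
    have "so5_zeta s = so5_formula K (1/2) s"
      unfolding so5_zeta_eq[OF ex] by (rule so5_zeta0_eq[OF ex K(1)]) (use s K in auto)
    then have "norm (so5_zeta s) \<le> C * (1 + norm s) ^ N" using C(2)[OF reg] by simp
    also have "\<dots> \<le> C * (1 + R + \<bar>Im s\<bar>) ^ N"
    proof (intro mult_left_mono power_mono C)
      show "1 + norm s \<le> 1 + R + \<bar>Im s\<bar>" using cmod_le[of s] s by (simp add: R_def)
    qed auto
    also have "\<dots> \<le> poly P \<bar>Im s\<bar>" unfolding P using S0 by simp
    finally show ?thesis .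
  qed
  then show ?thesis by blast
qed

theorem theorem5p14:
  shows "\<exists>Z :: complex \<Rightarrow> complex.
    Z nicely_meromorphic_on UNIV \<and>
    (\<exists>\<sigma>::real. \<forall>s. Re s > \<sigma> \<longrightarrow>
       so5_term s summable_on {1..} \<times> {1..} \<and> Z s = so5_series s) \<and>
    (\<forall>n::nat. Z analytic_on {of_nat n}) \<and>
    (\<forall>(K::nat) (\<epsilon>::real) s. K \<ge> 1 \<longrightarrow> 0 < \<epsilon> \<longrightarrow> \<epsilon> < 1 \<longrightarrow>
       Re s > (1 - real K + \<epsilon>) / 3 \<longrightarrow> s \<notin> {1/2} \<union> third_points \<longrightarrow>
       vertical_line_integrable (real K - \<epsilon>)
         (\<lambda>z. Gamma (s + z) * Gamma (- z) * mt_zeta s (s - z) (2 * s + z)) \<and>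
       Z s = 6 powr s / Gamma s *
           (\<Sum>k<K. (-1) ^ k * Gamma (s + of_nat k) / fact k *
              mt_zeta s (s - of_nat k) (2 * s + of_nat k))
         + 6 powr s / (2 * of_real pi * \<i> * Gamma s) *
           vertical_line_integral (real K - \<epsilon>)
             (\<lambda>z. Gamma (s + z) * Gamma (- z) * mt_zeta s (s - z) (2 * s + z))) \<and>
    (\<forall>p. is_pole Z p \<longrightarrow> zorder Z p = -1 \<and> p \<in> {1/2} \<union> (third_points - \<int>)) \<and>
    (\<forall>\<sigma>0 \<sigma>1 :: real. \<sigma>0 \<le> \<sigma>1 \<longrightarrow>
       (\<exists>P :: real poly. \<exists>T::real. \<forall>s. \<sigma>0 \<le> Re s \<longrightarrow> Re s \<le> \<sigma>1 \<longrightarrow> \<bar>Im s\<bar> \<ge> T \<longrightarrow>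
          cmod (Z s) \<le> poly P \<bar>Im s\<bar>))"
proof (intro exI[of _ so5_zeta] conjI)
  show "so5_zeta nicely_meromorphic_on UNIV"
    unfolding so5_zeta_def by (rule remove_sings_nicely_meromorphic[OF so5_zeta0_meromorphic])
  show "\<exists>\<sigma>::real. \<forall>s. Re s > \<sigma> \<longrightarrow> so5_term s summable_on {1..} \<times> {1..} \<and> so5_zeta s = so5_series s"
    using so5_term_summable not_exceptional_large
    by (intro exI[of _ "1/2"]) (auto simp: so5_zeta_eq so5_zeta0_series)
  show "\<forall>n::nat. so5_zeta analytic_on {of_nat n}" by (auto intro: so5_zeta_analytic_int)
  show "\<forall>(K::nat) (\<epsilon>::real) s. K \<ge> 1 \<longrightarrow> 0 < \<epsilon> \<longrightarrow> \<epsilon> < 1 \<longrightarrow>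
       Re s > (1 - real K + \<epsilon>) / 3 \<longrightarrow> s \<notin> {1/2} \<union> third_points \<longrightarrow>
       vertical_line_integrable (real K - \<epsilon>)
         (\<lambda>z. Gamma (s + z) * Gamma (- z) * mt_zeta s (s - z) (2 * s + z)) \<and>
       so5_zeta s = 6 powr s / Gamma s *
           (\<Sum>k<K. (-1) ^ k * Gamma (s + of_nat k) / fact k *
              mt_zeta s (s - of_nat k) (2 * s + of_nat k))
         + 6 powr s / (2 * of_real pi * \<i> * Gamma s) *
           vertical_line_integral (real K - \<epsilon>)
             (\<lambda>z. Gamma (s + z) * Gamma (- z) * mt_zeta s (s - z) (2 * s + z))"
  proof (intro allI impI)
    fix K :: nat and \<epsilon> :: real and s
    assume K: "K \<ge> 1" and \<epsilon>: "0 < \<epsilon>" "\<epsilon> < 1" and r: "Re s > (1 - real K + \<epsilon>) / 3" and "s \<notin> {1/2} \<union> third_points"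
    then have ex: "s \<notin> so5_exceptional" by (simp add: so5_exceptional_def)
    have "so5_zeta s = so5_formula K \<epsilon> s" unfolding so5_zeta_eq[OF ex] by (rule so5_zeta0_eq[OF ex K \<epsilon> r])
    with so5_formula_Gamma_form[OF ex r K \<epsilon>] show
      "vertical_line_integrable (real K - \<epsilon>)
         (\<lambda>z. Gamma (s + z) * Gamma (- z) * mt_zeta s (s - z) (2 * s + z)) \<and>
       so5_zeta s = 6 powr s / Gamma s *
           (\<Sum>k<K. (-1) ^ k * Gamma (s + of_nat k) / fact k *
              mt_zeta s (s - of_nat k) (2 * s + of_nat k))
         + 6 powr s / (2 * of_real pi * \<i> * Gamma s) *
           vertical_line_integral (real K - \<epsilon>)
             (\<lambda>z. Gamma (s + z) * Gamma (- z) * mt_zeta s (s - z) (2 * s + z))" by simp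
  qed
  show "\<forall>p. is_pole so5_zeta p \<longrightarrow> zorder so5_zeta p = -1 \<and> p \<in> {1/2} \<union> (third_points - \<int>)"
    using so5_zeta_pole by blast
  show "\<forall>\<sigma>0 \<sigma>1 :: real. \<sigma>0 \<le> \<sigma>1 \<longrightarrow>
       (\<exists>P :: real poly. \<exists>T::real. \<forall>s. \<sigma>0 \<le> Re s \<longrightarrow> Re s \<le> \<sigma>1 \<longrightarrow> \<bar>Im s\<bar> \<ge> T \<longrightarrow>
          cmod (so5_zeta s) \<le> poly P \<bar>Im s\<bar>)"
    using so5_zeta_growth by blast
qed

end
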